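(* Let $\kappa>0$. (i) Let $K=\kappa^2$ and let $\sigma\in\{+,-\}$. A space $(\mathcal X,\rho)\in\mathfrak M_G$ (respectively $(\mathcal X,\rho)\in\mathfrak M_S$) lies in the global $\mathcal K^{\sigma}(\kappa^2)$-curvature class if and only if $(\mathcal X,\rho)$ is an $\Re_K$ domain (respectively a complete $\Re_K$ domain) of diameter at most $\pi/(2\kappa)$. (ii) Let $K=-\kappa^2$ and $\sigma\in\{+,-\}$. A space $(\mathcal X,\rho)\in\mathfrak M_G$ (respectively $\in\mathfrak M_S$) lies in the global $\mathcal K^{\sigma}(-\kappa^2)$-curvature class if and only if $(\mathcal X,\rho)$ is an $\Re_K$ domain (respectively a complete $\Re_K$ domain).
   Context: Let $M_4$ be the set of symmetric $4\times4$ real matrices with zero diagonal and nonnegative entries. For a set $\mathcal X$ with a symmetric nonnegative function $\rho$ vanishing exactly on the diagonal, $K_4(\mathcal X)\subseteq M_4$ is the set of all matrices $(\rho(P_i,P_j))_{i,j=1}^4$ for $P_1,\dots,P_4\in\mathcal X$ (repetitions allowed). For $\mathcal K\subseteq M_4$, $(\mathcal X,\rho)$ lies in the global $\mathcal K$-curvature class if $K_4(\mathcal X)\subseteq\mathcal K$. $\mathcal K^+(\kappa^2)$ is the set of $(a_{ij})\in M_4$ with all $a_{ij}\le\pi/(2\kappa)$ and $$(\cos\kappa a_{23}+\cos\kappa a_{12}\cos\kappa a_{34})(1+\cos\kappa a_{14})-(\cos\kappa a_{12}+\cos\kappa a_{24})(\cos\kappa a_{34}+\cos\kappa a_{13})\le\sin\kappa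 a_{12}\sin\kappa a_{34}(1+\cos\kappa a_{14});$$ $\mathcal K^-(\kappa^2)$ is defined identically except the left-hand side is multiplied by $-1$. $\mathcal K^+(-\kappa^2)$ is the set of $(a_{ij})\in M_4$ with $$(\cosh\kappa a_{12}+\cosh\kappa a_{24})(\cosh\kappa a_{34}+\cosh\kappa a_{13})-(\cosh\kappa a_{23}+\cosh\kappa a_{12}\cosh\kappa a_{34})(1+\cosh\kappa a_{14})\le\sinh\kappa a_{12}\sinh\kappa a_{34}(1+\cosh\kappa a_{14}),$$ and $\mathcal K^-(-\kappa^2)$ is defined identically except the left-hand side is multiplied by $-1$. $\mathfrak M_G$ is the class of geodesically connected metric spaces (any two points joined by a curve of length equal to their distance). $\mathfrak M_S$ is the class of semimetric spaces (symmetric, nonnegative distance vanishing exactly on the diagonal, no triangle inequality) that are weakly convex — for all $A,B$ there is $\lambda\in(0,1)$ such that for every $\varepsilon>0$ some $C_\varepsilon$ has $|\rho(A,C_\varepsilon)-\lambda\rho(A,B)|<\varepsilon$, $|\rho(B,C_\varepsilon)-(1-\lambda)\rho(A,B)|<\varepsilon$ — and in which every Cauchy sequence has a limit. $\Re_K$ domain: a geodesically connected metric space in which (if $K>0$) every geodesic triangle has perimeter $<2\pi/\sqrt K$, and every geodesic triangle $ABC$ has sum of upper angles between its sides at its vertices at most $\angle_KBAC+\angle_KABC+\angle_KACB$, where $\angle_K$ denotes the corresponding angle of a triangle with the same side lengths in the model plane $\mathbb S_K$ (open hemisphere of radius $1/\sqrt K$ for $K>0$, hyperbolic plane of curvature $K$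 for $K<0$, Euclidean plane for $K=0$), and the upper angle between shortests $\mathcal L,\mathcal N$ from $O$ is $\limsup\angle_0XOY$ as $X\to O$ in $\mathcal L\setminus\{O\}$, $Y\to O$ in $\mathcal N\setminus\{O\}$. Complete means complete as a metric space. *)

theory Defs
  imports Complex_Main "HOL-Library.Extended_Real"
begin

definition semimetric_on :: "'a set \<Rightarrow> ('a \<Rightarrow> 'a \<Rightarrow> real) \<Rightarrow> bool" where
  "semimetric_on X rho \<longleftrightarrow>
     (\<forall>x\<in>X. \<forall>y\<in>X. rho x y = rho y x \<and> rho x y \<ge> 0 \<and> (rho x y = 0 \<longleftrightarrow> x = y))"

definition metric_on :: "'a set \<Rightarrow> ('a \<Rightarrow> 'a \<Rightarrow> real) \<Rightarrow> bool" where
  "metric_on X rho \<longleftrightarrow> semimetric_on X rho \<and>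
     (\<forall>x\<in>X. \<forall>y\<in>X. \<forall>z\<in>X. rho x z \<le> rho x y + rho y z)"

definition cauchy_complete :: "'a set \<Rightarrow> ('a \<Rightarrow> 'a \<Rightarrow> real) \<Rightarrow> bool" where
  "cauchy_complete X rho \<longleftrightarrow>
     (\<forall>s :: nat \<Rightarrow> 'a. (\<forall>n. s n \<in> X) \<longrightarrow>
        (\<forall>e>0. \<exists>N. \<forall>m\<ge>N. \<forall>n\<ge>N. rho (s m) (s n) < e) \<longrightarrow>
        (\<exists>x\<in>X. (\<lambda>n. rho (s n) x) \<longlonglongrightarrow> 0))"

definition weakly_convex :: "'a set \<Rightarrow> ('a \<Rightarrow> 'a \<Rightarrow> real) \<Rightarrow> bool" where
  "weakly_convex X rho \<longleftrightarrow>
     (\<forall>A\<in>X. \<forall>B\<in>X. \<exists>l::real. 0 < l \<and> l < 1 \<and>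
        (\<forall>e>0. \<exists>C\<in>X. \<bar>rho A C - l * rho A B\<bar> < e \<and> \<bar>rho B C - (1 - l) * rho A B\<bar> < e))"

definition curve_in :: "'a set \<Rightarrow> ('a \<Rightarrow> 'a \<Rightarrow> real) \<Rightarrow> (real \<Rightarrow> 'a) \<Rightarrow> real \<Rightarrow> real \<Rightarrow> bool" where
  "curve_in X rho \<gamma> a b \<longleftrightarrow> a \<le> b \<and> \<gamma> ` {a..b} \<subseteq> X \<and>
     (\<forall>t\<in>{a..b}. \<forall>e>0. \<exists>d>0. \<forall>s\<in>{a..b}. \<bar>s - t\<bar> < d \<longrightarrow> rho (\<gamma> s) (\<gamma> t) < e)"

definition curve_length :: "('a \<Rightarrow> 'a \<Rightarrow> real) \<Rightarrow> (real \<Rightarrow> 'a) \<Rightarrow> real \<Rightarrow> real \<Rightarrow> ereal" where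
  "curve_length rho \<gamma> a b =
     (SUP p \<in> {(t, n). t 0 = a \<and> t n = b \<and> (\<forall>i<n. t i \<le> t (Suc i))}.
        ereal (\<Sum>i<snd p. rho (\<gamma> (fst p i)) (\<gamma> (fst p (Suc i)))))"

definition shortest :: "'a set \<Rightarrow> ('a \<Rightarrow> 'a \<Rightarrow> real) \<Rightarrow> 'a set \<Rightarrow> 'a \<Rightarrow> 'a \<Rightarrow> bool" where
  "shortest X rho L A B \<longleftrightarrow>
     (\<exists>\<gamma> a b. curve_in X rho \<gamma> a b \<and> \<gamma> a = A \<and> \<gamma> b = B \<and>
        curve_length rho \<gamma> a b = ereal (rho A B) \<and> L = \<gamma> ` {a..b})"

definition geodesically_connected :: "'a set \<Rightarrow> ('a \<Rightarrow> 'a \<Rightarrow> real) \<Rightarrow> bool" where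
  "geodesically_connected X rho \<longleftrightarrow> metric_on X rho \<and>
     (\<forall>A\<in>X. \<forall>B\<in>X. \<exists>L. shortest X rho L A B)"

definition in_MG :: "'a set \<Rightarrow> ('a \<Rightarrow> 'a \<Rightarrow> real) \<Rightarrow> bool" where
  "in_MG X rho \<longleftrightarrow> geodesically_connected X rho"

definition in_MS :: "'a set \<Rightarrow> ('a \<Rightarrow> 'a \<Rightarrow> real) \<Rightarrow> bool" where
  "in_MS X rho \<longleftrightarrow> semimetric_on X rho \<and> weakly_convex X rho \<and> cauchy_complete X rho"

definition diam_le :: "'a set \<Rightarrow> ('a \<Rightarrow> 'a \<Rightarrow> real) \<Rightarrow> real \<Rightarrow> bool" where
  "diam_le X rho D \<longleftrightarrow> (\<forall>A\<in>X. \<forall>B\<in>X. rho A B \<le> D)"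

definition angle0 :: "('a \<Rightarrow> 'a \<Rightarrow> real) \<Rightarrow> 'a \<Rightarrow> 'a \<Rightarrow> 'a \<Rightarrow> real" where
  "angle0 rho P0 x y =
     arccos ((rho P0 x ^ 2 + rho P0 y ^ 2 - rho x y ^ 2) / (2 * rho P0 x * rho P0 y))"

text \<open>Angle between sides of lengths a and b (opposite side c) of a triangle in the
  model plane S_K.\<close>
definition model_angle :: "real \<Rightarrow> real \<Rightarrow> real \<Rightarrow> real \<Rightarrow> real" where
  "model_angle K a b c =
     (if K > 0 then
        (let k = sqrt K in arccos ((cos (k * c) - cos (k * a) * cos (k * b)) / (sin (k * a) * sin (k * b))))
      else if K < 0 then
        (let k = sqrt (- K) in arccos ((cosh (k * a) * cosh (k * b) - cosh (k * c)) / (sinh (k * a) * sinh (k * b))))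
      else arccos ((a ^ 2 + b ^ 2 - c ^ 2) / (2 * a * b)))"

definition upper_angle :: "('a \<Rightarrow> 'a \<Rightarrow> real) \<Rightarrow> 'a \<Rightarrow> 'a set \<Rightarrow> 'a set \<Rightarrow> real" where
  "upper_angle rho P0 L N =
     (INF e \<in> {e::real. e > 0}.
        Sup {angle0 rho P0 x y | x y. x \<in> L - {P0} \<and> y \<in> N - {P0} \<and> rho P0 x < e \<and> rho P0 y < e})"

definition ReK_domain :: "'a set \<Rightarrow> ('a \<Rightarrow> 'a \<Rightarrow> real) \<Rightarrow> real \<Rightarrow> bool" where
  "ReK_domain X rho K \<longleftrightarrow> geodesically_connected X rho \<and>
     (K > 0 \<longrightarrow> (\<forall>A\<in>X. \<forall>B\<in>X. \<forall>C\<in>X. \<forall>Sab Sbc Sca.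
        shortest X rho Sab A B \<and> shortest X rho Sbc B C \<and> shortest X rho Sca C A \<longrightarrow>
        rho A B + rho B C + rho C A < 2 * pi / sqrt K)) \<and>
     (\<forall>A\<in>X. \<forall>B\<in>X. \<forall>C\<in>X. \<forall>Sab Sbc Sca.
        A \<noteq> B \<and> B \<noteq> C \<and> C \<noteq> A \<and>
        shortest X rho Sab A B \<and> shortest X rho Sbc B C \<and> shortest X rho Sca C A \<longrightarrow>
        upper_angle rho A Sab Sca + upper_angle rho B Sab Sbc + upper_angle rho C Sca Sbc
          \<le> model_angle K (rho A B) (rho A C) (rho B C)
           + model_angle K (rho A B) (rho B C) (rho A C)
           + model_angle K (rho A C) (rho B C) (rho A B))"

type_synonym mat4 = "nat \<Rightarrow> nat \<Rightarrow> real"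

definition M4 :: "mat4 set" where
  "M4 = {a. \<forall>i\<in>{1..4}. \<forall>j\<in>{1..4}. a i j = a j i \<and> a i j \<ge> 0 \<and> a i i = 0}"

text \<open>The matrix (rho(P_i,P_j)), i,j = 1..4 (entries outside 1..4 are irrelevant).\<close>
definition pt4 :: "'a \<Rightarrow> 'a \<Rightarrow> 'a \<Rightarrow> 'a \<Rightarrow> nat \<Rightarrow> 'a" where
  "pt4 P1 P2 P3 P4 i = (if i = 1 then P1 else if i = 2 then P2 else if i = 3 then P3 else P4)"

definition dist_mat4 :: "('a \<Rightarrow> 'a \<Rightarrow> real) \<Rightarrow> 'a \<Rightarrow> 'a \<Rightarrow> 'a \<Rightarrow> 'a \<Rightarrow> mat4" where
  "dist_mat4 rho P1 P2 P3 P4 = (\<lambda>i j. rho (pt4 P1 P2 P3 P4 i) (pt4 P1 P2 P3 P4 j))"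

definition K4 :: "'a set \<Rightarrow> ('a \<Rightarrow> 'a \<Rightarrow> real) \<Rightarrow> mat4 set" where
  "K4 X rho = {dist_mat4 rho P1 P2 P3 P4 | P1 P2 P3 P4. P1 \<in> X \<and> P2 \<in> X \<and> P3 \<in> X \<and> P4 \<in> X}"

definition global_class :: "'a set \<Rightarrow> ('a \<Rightarrow> 'a \<Rightarrow> real) \<Rightarrow> mat4 set \<Rightarrow> bool" where
  "global_class X rho K \<longleftrightarrow> K4 X rho \<subseteq> K"

definition Ksph :: "bool \<Rightarrow> real \<Rightarrow> mat4 set" where
  "Ksph \<sigma> \<kappa> = {a \<in> M4. (\<forall>i\<in>{1..4}. \<forall>j\<in>{1..4}. a i j \<le> pi / (2 * \<kappa>)) \<and>
     (if \<sigma> then 1 else -1) *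
       ((cos (\<kappa> * a 2 3) + cos (\<kappa> * a 1 2) * cos (\<kappa> * a 3 4)) * (1 + cos (\<kappa> * a 1 4))
        - (cos (\<kappa> * a 1 2) + cos (\<kappa> * a 2 4)) * (cos (\<kappa> * a 3 4) + cos (\<kappa> * a 1 3)))
     \<le> sin (\<kappa> * a 1 2) * sin (\<kappa> * a 3 4) * (1 + cos (\<kappa> * a 1 4))}"

definition Khyp :: "bool \<Rightarrow> real \<Rightarrow> mat4 set" where
  "Khyp \<sigma> \<kappa> = {a \<in> M4.
     (if \<sigma> then 1 else -1) *
       ((cosh (\<kappa> * a 1 2) + cosh (\<kappa> * a 2 4)) * (cosh (\<kappa> * a 3 4) + cosh (\<kappa> * a 1 3))
        - (cosh (\<kappa> * a 2 3) + cosh (\<kappa> * a 1 2) * cosh (\<kappa> * a 3 4)) * (1 + cosh (\<kappa> * a 1 4)))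
     \<le> sinh (\<kappa> * a 1 2) * sinh (\<kappa> * a 3 4) * (1 + cosh (\<kappa> * a 1 4))}"

end

theory Submission
  imports Defs "HOL-Analysis.Analysis"
begin

text \<open>
  Rescale so that \<open>K = k\<close> is \<open>1\<close> or \<open>-1\<close> and write \<open>C\<close>, \<open>S\<close> for cosine and sine, respectively their
  hyperbolic analogues. Both conditions are compared with the concavity inequality \<open>CAT\<close> for the
  cosine of the distance from a point to the points of a geodesic.

  From the four-point inequality: applied to small rectangles between two geodesics with common
  start it yields, in the limit, that the cosine \<open>J\<close> of the comparison angle is almost decreasing
  along the geodesics; the error is quadratic, so \<open>CAT\<close> holds infinitesimally, and a maximum
  principle makes it global. Angle comparison, and with it the bound for angle sums, is immediate.

  From the bound for angle sums: if an upper angle exceeded its comparison angle by \<open>c\<close>, minimise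
  the comparison angle minus a small multiple of \<open>ln (x * y)\<close> over subtriangles with sides \<open>x\<close>, \<open>y\<close>.
  At the minimum one of the other two angles is too small by \<open>c / 2\<close>, and the first variation
  inequality along its side contradicts minimality. Adjacent angles then sum to at least \<open>pi\<close>,
  which gives \<open>CAT\<close>.

  From \<open>CAT\<close> to the four-point inequality: glue two comparison triangles along a diagonal of the
  quadrilateral, \<open>P1 P4\<close> for one sign and \<open>P2 P4\<close> for the other; in the model plane both
  inequalities are Cauchy--Schwarz for parallel transport along \<open>P1 P4\<close>.

  In a semimetric space, \<open>P4 = P1\<close> turns the four-point inequality into the triangle inequality.
  It also forces approximate intermediate points to form Cauchy sequences, so intermediate points
  exist and Menger's theorem provides geodesics.
\<close>

text \<open>The distance between two geodesics need not be differentiable, so the four-point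
  inequality cannot just be expanded at a point. The mixed second difference of \<open>J\<close>,
  however, is additive over rectangles: if it exceeds \<open>B\<close> times the area once, it does
  so on arbitrarily small rectangles of prescribed aspect ratio, along which compactness provides
  the limits that derivatives would. The aspect ratio is the one for which all terms without the
  variation of \<open>J\<close> cancel, as in the model plane; what is left bounds \<open>B\<close>
  by a quadratic form in the slopes of \<open>J\<close>. For \<open>k = 1\<close> this form is
  semidefinite and the error disappears. For \<open>k = -1\<close> it is indefinite, and the bound
  is fed back into itself to make the error small near the common start. A second obstacle is the
  distance \<open>pi / 2\<close>, where \<open>C\<close> vanishes and these limits break down; a
  separate argument shows that a zero of the cosine inside a geodesic spreads over all of it. For
  angle sums, the logarithm keeps the minimum away from subtriangles with a vanishing side, where
  nothing controls the comparison angle; its derivative costs only a small multiple of the bounded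
  quotient \<open>S x / x\<close>.\<close>

definition cs :: "real \<Rightarrow> real \<Rightarrow> real" where
  "cs k x = (if k = 1 then cos x else cosh x)"

definition sn :: "real \<Rightarrow> real \<Rightarrow> real" where
  "sn k x = (if k = 1 then sin x else sinh x)"

section \<open>Trigonometry of the model planes, uniformly in the sign of the curvature\<close>

locale curv =
  fixes k :: real
  assumes k: "k = 1 \<or> k = -1"
begin

abbreviation C :: "real \<Rightarrow> real" where "C \<equiv> cs k"
abbreviation S :: "real \<Rightarrow> real" where "S \<equiv> sn k"

lemma kk [simp]: "k * k = 1" using k by auto
lemma kk2 [simp]: "k * (k * x) = x" using k by auto

lemma C_0 [simp]: "C 0 = 1" by (simp add: cs_def)
lemma S_0 [simp]: "S 0 = 0" by (simp add: sn_def)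
lemma C_minus [simp]: "C (-x) = C x" by (simp add: cs_def)
lemma S_minus [simp]: "S (-x) = - S x" by (simp add: sn_def)

lemma C_add: "C (x + y) = C x * C y - k * S x * S y"
  using k by (auto simp: cs_def sn_def cos_add cosh_add)
lemma S_add: "S (x + y) = S x * C y + C x * S y"
  using k by (auto simp: cs_def sn_def sin_add sinh_add)
lemma C_diff: "C (x - y) = C x * C y + k * S x * S y"
  using C_add[of x "-y"] by simp
lemma S_diff: "S (x - y) = S x * C y - C x * S y"
  using S_add[of x "-y"] by simp
lemma C_commute: "C (x - y) = C (y - x)" by (metis C_minus minus_diff_eq)
lemma C_abs [simp]: "C \<bar>x\<bar> = C x" by (simp add: abs_if)

lemma S_sq: "(S x)\<^sup>2 = k * (1 - (C x)\<^sup>2)"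
  using k by (auto simp: cs_def sn_def sin_squared_eq sinh_square_eq)
lemma C_sq: "(C x)\<^sup>2 = 1 - k * (S x)\<^sup>2"
  using k by (auto simp: cs_def sn_def cos_squared_eq cosh_square_eq)

lemma C_double: "C x = 1 - 2 * k * (S (x/2))\<^sup>2"
  using C_add[of "x/2" "x/2"] C_sq[of "x/2"] by (simp add: power2_eq_square)
lemma one_minus_C: "k * (1 - C x) = 2 * (S (x/2))\<^sup>2"
  using k by (auto simp: C_double)
lemma C_double': "1 + C x = 2 * (C (x/2))\<^sup>2"
  using C_double[of x] by (simp add: C_sq)
lemma S_double: "S x = 2 * S (x/2) * C (x/2)"
  using S_add[of "x/2" "x/2"] by simp
lemma one_minus_C_nonneg: "0 \<le> k * (1 - C x)"
  by (simp add: one_minus_C)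
lemma S_diff_sq: "(S x)\<^sup>2 - (S y)\<^sup>2 = S (x + y) * S (x - y)"
proof -
  have "S (x + y) * S (x - y) = (S x)\<^sup>2 * (C y)\<^sup>2 - (C x)\<^sup>2 * (S y)\<^sup>2"
    by (simp add: S_add S_diff power2_eq_square algebra_simps)
  then show ?thesis by (simp add: C_sq algebra_simps)
qed

lemma DERIV_C [derivative_intros]:
  "(f has_real_derivative f') (at x within A) \<Longrightarrow> ((\<lambda>x. C (f x)) has_real_derivative - k * S (f x) * f') (at x within A)"
  using k unfolding cs_def sn_def by (auto intro!: derivative_eq_intros)
lemma DERIV_S [derivative_intros]:
  "(f has_real_derivative f') (at x within A) \<Longrightarrow> ((\<lambda>x. S (f x)) has_real_derivative C (f x) * f') (at x within A)"
  using k unfolding cs_def sn_def by (auto intro!: derivative_eq_intros)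

lemma tendsto_C [tendsto_intros]: "(f \<longlongrightarrow> a) F \<Longrightarrow> ((\<lambda>x. C (f x)) \<longlongrightarrow> C a) F"
  by (rule isCont_tendsto_compose[OF DERIV_isCont[OF DERIV_C[OF DERIV_ident]]])
lemma tendsto_S [tendsto_intros]: "(f \<longlongrightarrow> a) F \<Longrightarrow> ((\<lambda>x. S (f x)) \<longlongrightarrow> S a) F"
  by (rule isCont_tendsto_compose[OF DERIV_isCont[OF DERIV_S[OF DERIV_ident]]])
lemma continuous_on_C [continuous_intros]: "continuous_on A f \<Longrightarrow> continuous_on A (\<lambda>x. C (f x))"
  unfolding continuous_on_def by (auto intro: tendsto_C)
lemma continuous_on_S [continuous_intros]: "continuous_on A f \<Longrightarrow> continuous_on A (\<lambda>x. S (f x))"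
  unfolding continuous_on_def by (auto intro: tendsto_S)

lemma S_pos: "0 < x \<Longrightarrow> (k = 1 \<Longrightarrow> x < pi) \<Longrightarrow> 0 < S x"
  using k by (auto simp: sn_def sin_gt_zero)
lemma S_nonneg: "0 \<le> x \<Longrightarrow> (k = 1 \<Longrightarrow> x \<le> pi) \<Longrightarrow> 0 \<le> S x"
  using k by (auto simp: sn_def sin_ge_zero)
lemma C_pos: "(k = 1 \<Longrightarrow> \<bar>x\<bar> < pi/2) \<Longrightarrow> 0 < C x"
  using k by (auto simp: cs_def abs_if intro!: cos_gt_zero_pi split: if_splits)
lemma C_nonneg: "(k = 1 \<Longrightarrow> \<bar>x\<bar> \<le> pi/2) \<Longrightarrow> 0 \<le> C x"
  using k by (auto simp: cs_def abs_if intro!: cos_ge_zero split: if_splits)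

text \<open>Multiplication by \<open>k\<close> turns both \<open>cos\<close> on
  \<open>[0, pi]\<close> and \<open>cosh\<close> into decreasing functions of the distance. This is
  why inequalities between cosines carry a factor \<open>k\<close> throughout: a larger
  \<open>k * C\<close> means a smaller distance for either sign.\<close>

lemma kC_mono: "0 \<le> x \<Longrightarrow> x \<le> y \<Longrightarrow> (k = 1 \<Longrightarrow> y \<le> pi) \<Longrightarrow> k * C y \<le> k * C x"
  using k by (auto simp: cs_def cos_monotone_0_pi_le cosh_real_nonneg_le_iff)
lemma kC_strict: "0 \<le> x \<Longrightarrow> x < y \<Longrightarrow> (k = 1 \<Longrightarrow> y \<le> pi) \<Longrightarrow> k * C y < k * C x"
  using k by (auto simp: cs_def cos_monotone_0_pi cosh_real_nonneg_less_iff)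
lemma kC_le_D: "k * C y \<le> k * C x \<Longrightarrow> 0 \<le> y \<Longrightarrow> (k = 1 \<Longrightarrow> x \<le> pi) \<Longrightarrow> x \<le> y"
  using kC_strict[of y x] by force

lemma LIM_C: "((\<lambda>t. k * (1 - C t) / t\<^sup>2) \<longlongrightarrow> 1/2) (at 0)"
proof -
  have "((\<lambda>t. S t / t) \<longlongrightarrow> 1) (at 0)"
    using DERIV_S[OF DERIV_ident, of 0 UNIV] by (simp add: DERIV_def)
  then have "((\<lambda>t. S (t/2) / (t/2)) \<longlongrightarrow> 1) (at 0)"
    by (rule filterlim_compose) (auto simp: filterlim_at intro!: tendsto_eq_intros eventually_neq_at_within)
  then have "((\<lambda>t. (S (t/2) / (t/2))\<^sup>2 / 2) \<longlongrightarrow> 1\<^sup>2/2) (at 0)"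
    by (intro tendsto_intros) auto
  then show ?thesis
    by (simp add: one_minus_C power_divide field_simps)
qed

text \<open>The base point \<open>t n\<close> moves with \<open>n\<close>, so the derivative at
  \<open>x\<close> does not apply directly. The addition theorems reduce the quotients to their
  limits at 0 and to the continuity of \<open>C\<close> and \<open>S\<close>.\<close>

lemma LIM_diff:
  assumes "t \<longlonglongrightarrow> x" "\<tau> \<longlonglongrightarrow> 0" "\<And>n. 0 < \<tau> n"
  shows "(\<lambda>n. (C (t n + \<tau> n) - C (t n)) / \<tau> n) \<longlonglongrightarrow> - k * S x"
    and "(\<lambda>n. (S (t n + \<tau> n) - S (t n)) / \<tau> n) \<longlonglongrightarrow> C x"
    and "(\<lambda>n. k * (1 - C (\<tau> n)) / (\<tau> n)\<^sup>2) \<longlonglongrightarrow> 1/2"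
    and "(\<lambda>n. (1 - C (\<tau> n)) / \<tau> n) \<longlonglongrightarrow> 0"
    and "(\<lambda>n. S (\<tau> n) / \<tau> n) \<longlonglongrightarrow> 1"
proof -
  have f: "filterlim \<tau> (at 0) sequentially"
    using assms(2,3) by (auto simp: filterlim_at less_imp_neq[symmetric])
  have 1: "(\<lambda>n. (C (\<tau> n) - 1) / \<tau> n) \<longlonglongrightarrow> 0"
    using DERIV_C[OF DERIV_ident, of 0 UNIV] filterlim_compose[OF _ f, of "\<lambda>t. (C t - 1)/t"] by (simp add: DERIV_def)
  show 2: "(\<lambda>n. S (\<tau> n) / \<tau> n) \<longlonglongrightarrow> 1"
    using DERIV_S[OF DERIV_ident, of 0 UNIV] filterlim_compose[OF _ f, of "\<lambda>t. S t/t"] by (simp add: DERIV_def)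
  have "(C (t n + \<tau> n) - C (t n)) / \<tau> n = C (t n) * ((C (\<tau> n) - 1) / \<tau> n) - k * S (t n) * (S (\<tau> n) / \<tau> n)" for n
    using assms(3)[of n] by (simp add: C_add field_simps)
  moreover have "(\<lambda>n. C (t n) * ((C (\<tau> n) - 1) / \<tau> n) - k * S (t n) * (S (\<tau> n) / \<tau> n)) \<longlonglongrightarrow> C x * 0 - k * S x * 1"
    by (intro tendsto_intros 1 2 assms)
  ultimately show "(\<lambda>n. (C (t n + \<tau> n) - C (t n)) / \<tau> n) \<longlonglongrightarrow> - k * S x" by simp
  have "(S (t n + \<tau> n) - S (t n)) / \<tau> n = S (t n) * ((C (\<tau> n) - 1) / \<tau> n) + C (t n) * (S (\<tau> n) / \<tau> n)" for n
    using assms(3)[of n] by (simp add: S_add field_simps)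
  moreover have "(\<lambda>n. S (t n) * ((C (\<tau> n) - 1) / \<tau> n) + C (t n) * (S (\<tau> n) / \<tau> n)) \<longlonglongrightarrow> S x * 0 + C x * 1"
    by (intro tendsto_intros 1 2 assms)
  ultimately show "(\<lambda>n. (S (t n + \<tau> n) - S (t n)) / \<tau> n) \<longlonglongrightarrow> C x" by simp
  show "(\<lambda>n. k * (1 - C (\<tau> n)) / (\<tau> n)\<^sup>2) \<longlonglongrightarrow> 1/2"
    using filterlim_compose[OF LIM_C f] by simp
  show "(\<lambda>n. (1 - C (\<tau> n)) / \<tau> n) \<longlonglongrightarrow> 0"
    using tendsto_minus[OF 1] by (simp add: minus_divide_left)
qed

end

section \<open>Second-order limits of the four-point inequality on shrinking rectangles\<close>

context curv
begin

text \<open>Here \<open>c\<close>, \<open>s\<close> and \<open>c'\<close>, \<open>s'\<close> stand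
  for \<open>C\<close>, \<open>S\<close> at two parameters and \<open>h\<close> for the cosine of
  the distance, expressed through the angle cosine \<open>J\<close>. If \<open>x / s\<close>,
  \<open>y / s'\<close> and \<open>B\<close> are the partial derivatives and the mixed derivative of
  \<open>J\<close>, then \<open>E\<close>, \<open>E'\<close> are the partial derivatives of
  \<open>h\<close> and \<open>K\<close> is \<open>k\<close> times its mixed derivative. For constant
  \<open>J\<close>, as in the model plane, both sides vanish.\<close>

lemma model_identity:
  fixes c s c' s' J x y B h E E' K :: real
  assumes c: "c\<^sup>2 = 1 - k * s\<^sup>2" and c': "c'\<^sup>2 = 1 - k * s'\<^sup>2"
    and h: "h = c * c' + k * s * s' * J"
    and E: "E = - k * s * c' + k * c * s' * J + k * s' * x"
    and E': "E' = - k * c * s' + k * s * c' * J + k * s * y"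
    and K: "K = k * s * s' + J * c * c' + x * c' + y * c + B * s * s'"
  shows "2 * (1 - h\<^sup>2) * (k * K) * (s * s') + 2 * h * E * E' * (s * s') + E\<^sup>2 * s\<^sup>2 + E'\<^sup>2 * s'\<^sup>2
     - k * (1 - h\<^sup>2) * (s\<^sup>2 + s'\<^sup>2)
    = (s * s')\<^sup>2 * (2 * k * (1 - h\<^sup>2) * B + x\<^sup>2 + y\<^sup>2 + 2 * h * x * y)"
proof -
  define q where "q = s * s'"
  have ks: "k * s\<^sup>2 = 1 - c\<^sup>2" "k * s'\<^sup>2 = 1 - c'\<^sup>2" using c c' by auto
  have q2: "q\<^sup>2 = (1 - c\<^sup>2) * (1 - c'\<^sup>2)"
    unfolding q_def ks[symmetric] using k by (auto simp: power_mult_distrib)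
  \<comment> \<open>Eliminating \<open>J\<close> in favour of \<open>h\<close> makes
    \<open>s * E\<close>, \<open>s' * E'\<close> and \<open>K * q\<close> polynomials in
    \<open>c\<close>, \<open>c'\<close>, \<open>h\<close> and the perturbations
    \<open>q * x\<close>, \<open>q * y\<close>, \<open>B\<close>; the claim becomes a ring
    identity.\<close>
  have kqJ: "k * q * J = h - c * c'" using h by (simp add: q_def)
  have sE: "s * E = c * h - c' + k * q * x"
  proof -
    have "s * E = - (k * s\<^sup>2) * c' + c * (k * q * J) + k * q * x"
      unfolding E q_def by (simp add: algebra_simps power2_eq_square)
    then show ?thesis unfolding ks kqJ by (simp add: algebra_simps power2_eq_square)
  qed
  have sE': "s' * E' = c' * h - c + k * q * y"
  proof -
    have "s' * E' = - (k * s'\<^sup>2) * c + c' * (k * q * J) + k * q * y"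
      unfolding E' q_def by (simp add: algebra_simps power2_eq_square)
    then show ?thesis unfolding ks kqJ by (simp add: algebra_simps power2_eq_square)
  qed
  have qK: "k * K * q = 1 - c\<^sup>2 - c'\<^sup>2 + c * c' * h + k * q * (x * c' + y * c) + k * B * q\<^sup>2"
  proof -
    have "k * K * q = q\<^sup>2 + (k * q * J) * (c * c') + k * q * (x * c' + y * c) + k * B * q\<^sup>2"
      unfolding K by (simp add: algebra_simps power2_eq_square q_def)
    also have "q\<^sup>2 + (k * q * J) * (c * c') = 1 - c\<^sup>2 - c'\<^sup>2 + c * c' * h"
      unfolding q2 kqJ by (simp add: algebra_simps power2_eq_square)
    finally show ?thesis by simp
  qed
  have "2 * (1 - h\<^sup>2) * (k * K) * (s * s') + 2 * h * E * E' * (s * s') + E\<^sup>2 * s\<^sup>2 + E'\<^sup>2 * s'\<^sup>2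
     - k * (1 - h\<^sup>2) * (s\<^sup>2 + s'\<^sup>2)
    = 2 * (1 - h\<^sup>2) * (k * K * q) + 2 * h * (s * E) * (s' * E') + (s * E)\<^sup>2 + (s' * E')\<^sup>2
      - (1 - h\<^sup>2) * (k * s\<^sup>2 + k * s'\<^sup>2)"
    unfolding q_def by (simp add: algebra_simps power2_eq_square)
  also have "\<dots> = 2 * (1 - h\<^sup>2) * k * B * q\<^sup>2 + (k * q * x)\<^sup>2 + (k * q * y)\<^sup>2 + 2 * h * (k * q * x) * (k * q * y)"
    unfolding qK sE sE' ks by (simp add: algebra_simps power2_eq_square)
  also have "\<dots> = q\<^sup>2 * (2 * k * (1 - h\<^sup>2) * B + x\<^sup>2 + y\<^sup>2 + 2 * h * x * y)"
    by (simp add: algebra_simps power2_eq_square)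
  finally show ?thesis by (simp add: q_def)
qed

lemma ratio_cancel:
  fixes a b x e f :: real
  assumes "0 < a" "0 < b"
  shows "x / a\<^sup>2 / (b / a) * (a * b) = x" and "x / b\<^sup>2 * (b / a) * (a * b) = x"
    and "e / a * (f / b) * (a * b) = e * f"
    and "(e / a)\<^sup>2 / (b / a) * (a * b) = e\<^sup>2" and "(f / b)\<^sup>2 * (b / a) * (a * b) = f\<^sup>2"
    and "e / a + f / b * (b / a) = (e + f) / a"
  using assms by (simp_all add: field_simps power2_eq_square)

text \<open>\<open>ineq\<close> is the four-point inequality for the corners of a rectangle with
  sides \<open>\<tau> n\<close> and \<open>\<upsilon> n\<close>, freed of \<open>S\<close>. Apart
  from a square that may be dropped, the second difference of \<open>h\<close> enters linearly, with
  a coefficient \<open>A n\<close> of positive limit; division by the area gives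
  \<open>K n * A n \<le> R n\<close>. The sum \<open>1 / \<rho> + \<rho>\<close> stems from
  \<open>1 - C (\<tau> n)\<close> and \<open>1 - C (\<upsilon> n)\<close>, which up to the factor
  \<open>k\<close> are half a square to leading order.\<close>

lemma rect_limit_minus:
  fixes \<tau> \<upsilon> h00 h10 h01 h11 K :: "nat \<Rightarrow> real"
  assumes \<tau>: "\<tau> \<longlonglongrightarrow> 0" "\<And>n. 0 < \<tau> n" and \<upsilon>: "\<upsilon> \<longlonglongrightarrow> 0" "\<And>n. 0 < \<upsilon> n"
    and \<rho>: "(\<lambda>n. \<upsilon> n / \<tau> n) \<longlonglongrightarrow> \<rho>" "0 < \<rho>"
    and h: "h00 \<longlonglongrightarrow> h" "h10 \<longlonglongrightarrow> h" "h01 \<longlonglongrightarrow> h" "h11 \<longlonglongrightarrow> h"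
    and hk: "0 < k * (1 - h)" "0 < h"
    and E: "(\<lambda>n. (h10 n - h00 n) / \<tau> n) \<longlonglongrightarrow> E" and E': "(\<lambda>n. (h01 n - h00 n) / \<upsilon> n) \<longlonglongrightarrow> E'"
    and K: "K \<longlonglongrightarrow> K0" "\<And>n. K n * (\<tau> n * \<upsilon> n) \<le> k * (h11 n - h10 n - h01 n + h00 n)"
    and ineq: "\<And>n. k * (h00 n + C (\<upsilon> n)) * (h11 n + C (\<tau> n))
       \<le> k * (1 + h10 n) * (1 + h01 n) - k * (h11 n - h00 n)\<^sup>2 / (2 * (1 - h00 n * h11 n)) * (1 + h01 n)"
  shows "2 * (1 - h\<^sup>2) * (k * K0) + 2 * h * E * E' + E\<^sup>2 / \<rho> + E'\<^sup>2 * \<rho> \<le> k * (1 - h\<^sup>2) * (1 / \<rho> + \<rho>)"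
proof -
  define r where "r n = k * (1 + h01 n) / (2 * (1 - h00 n * h11 n))" for n
  define e where "e n = h10 n - h00 n" for n
  define f where "f n = h01 n - h00 n" for n
  define m where "m n = h11 n - h10 n - h01 n + h00 n" for n
  define A where "A n = (1 + h00 n) - (1 - C (\<upsilon> n)) + 2 * r n * k * (e n + f n)" for n
  define R where "R n = (1 + h00 n) * ((k * (1 - C (\<tau> n)) / (\<tau> n)\<^sup>2) / (\<upsilon> n / \<tau> n) + (k * (1 - C (\<upsilon> n)) / (\<upsilon> n)\<^sup>2) * (\<upsilon> n / \<tau> n))
     + ((1 - C (\<upsilon> n)) / \<upsilon> n) * k * (e n / \<tau> n + f n / \<upsilon> n * (\<upsilon> n / \<tau> n) - (1 - C (\<tau> n)) / \<tau> n)
     + k * (e n / \<tau> n) * (f n / \<upsilon> n)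
     - r n * ((e n / \<tau> n)\<^sup>2 / (\<upsilon> n / \<tau> n) + 2 * (e n / \<tau> n) * (f n / \<upsilon> n) + (f n / \<upsilon> n)\<^sup>2 * (\<upsilon> n / \<tau> n))" for n
  define r0 where "r0 = k * (1 + h) / (2 * (1 - h * h))"
  have hne: "1 - h * h \<noteq> 0"
  proof
    assume "1 - h * h = 0"
    then have "(1 - h) * (1 + h) = 0" by (simp add: algebra_simps)
    then show False using hk by auto
  qed
  have lr: "r \<longlonglongrightarrow> r0" unfolding r_def r0_def using hne by (intro tendsto_intros h) auto
  have le: "e \<longlonglongrightarrow> 0" "f \<longlonglongrightarrow> 0"
    unfolding e_def f_def using tendsto_diff[OF h(2,1)] tendsto_diff[OF h(3,1)] by auto
  have ltu: "(\<lambda>n. C (\<tau> n)) \<longlonglongrightarrow> 1" "(\<lambda>n. C (\<upsilon> n)) \<longlonglongrightarrow> 1"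
    using tendsto_C[OF \<tau>(1)] tendsto_C[OF \<upsilon>(1)] by auto
  have lA: "A \<longlonglongrightarrow> (1 + h) - (1 - 1) + 2 * r0 * k * (0 + 0)"
    unfolding A_def by (intro tendsto_intros h lr le ltu)
  have lR: "R \<longlonglongrightarrow> (1 + h) * ((1/2) / \<rho> + (1/2) * \<rho>)
     + 0 * k * (E + E' * \<rho> - 0) + k * E * E' - r0 * (E\<^sup>2 / \<rho> + 2 * E * E' + E'\<^sup>2 * \<rho>)"
    unfolding R_def using \<rho>(2)
    by (intro tendsto_intros h lr \<rho> LIM_diff(3,4)[OF tendsto_const] \<tau> \<upsilon> E[folded e_def] E'[folded f_def]) auto
  have rpos: "0 < r0"
  proof -
    define w where "w = 1 - h * h"
    have w: "0 < k * w"
      using mult_pos_pos[OF hk(1), of "1 + h"] hk(2) unfolding w_def by (simp add: algebra_simps)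
    then have wn: "0 < 2 * w\<^sup>2" by auto
    have "r0 = (1 + h) * (k * w) / (2 * w\<^sup>2)"
      unfolding r0_def w_def[symmetric] using wn by (simp add: power2_eq_square)
    moreover have "0 < (1 + h) * (k * w)" using hk(2) by (intro mult_pos_pos[OF _ w]) auto
    ultimately show ?thesis using divide_pos_pos[OF _ wn] by (simp only:)
  qed
  have ev1: "\<forall>\<^sub>F n in sequentially. 0 < r n" using order_tendstoD(1)[OF lr rpos] .
  have ev2: "\<forall>\<^sub>F n in sequentially. 0 < A n" using order_tendstoD(1)[OF lA, of 0] hk by simp
  have key: "K n * A n \<le> R n" if "0 < r n" "0 < A n" for n
  proof -
    have 1: "k * m n * (1 + h00 n - (1 - C (\<upsilon> n))) - k * (1 + h00 n) * ((1 - C (\<tau> n)) + (1 - C (\<upsilon> n)))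
        - k * (1 - C (\<upsilon> n)) * (e n + f n - (1 - C (\<tau> n))) - k * e n * f n + r n * (h11 n - h00 n)\<^sup>2 \<le> 0"
      using ineq[of n] unfolding r_def m_def e_def f_def by (simp add: algebra_simps)
    have h11: "h11 n - h00 n = (e n + f n) + m n" by (simp add: m_def e_def f_def)
    \<comment> \<open>The square of the second difference \<open>m n\<close> is dropped; its mixed
      term with \<open>e n + f n\<close> stays and becomes part of \<open>A n\<close>.\<close>
    have "r n * (h11 n - h00 n)\<^sup>2 \<ge> r n * ((e n + f n)\<^sup>2 + 2 * m n * (e n + f n))"
      unfolding h11 using that by (intro mult_left_mono) (auto simp: power2_eq_square algebra_simps)
    moreover have "r n * (2 * m n * (e n + f n)) = k * m n * (2 * r n * k * (e n + f n))"
      by (simp add: algebra_simps)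
    ultimately have 2: "k * m n * A n \<le> k * (1 + h00 n) * ((1 - C (\<tau> n)) + (1 - C (\<upsilon> n)))
        + k * (1 - C (\<upsilon> n)) * (e n + f n - (1 - C (\<tau> n))) + k * e n * f n - r n * (e n + f n)\<^sup>2"
      using 1 unfolding A_def by (simp add: algebra_simps)
    also have "\<dots> = R n * (\<tau> n * \<upsilon> n)"
    proof -
      note rc = ratio_cancel[OF \<tau>(2)[of n] \<upsilon>(2)[of n]]
      have d: "(P * (Q1 + Q2) + Z1 * k * (Q3 - Q4) + k * Q5 * Q6 - r n * (Q7 + 2 * Q5 * Q6 + Q8)) * (a * b)
         = P * (Q1 * (a * b) + Q2 * (a * b)) + k * (Z1 * (Q3 - Q4) * (a * b)) + k * (Q5 * Q6 * (a * b))
           - r n * (Q7 * (a * b) + 2 * (Q5 * Q6 * (a * b)) + Q8 * (a * b))" for P Q1 Q2 Z1 Q3 Q4 Q5 Q6 Q7 Q8 a b :: real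
        by (simp add: algebra_simps)
      have 3: "(1 - C (\<upsilon> n)) / \<upsilon> n * ((e n + f n) / \<tau> n - (1 - C (\<tau> n)) / \<tau> n) * (\<tau> n * \<upsilon> n)
         = (1 - C (\<upsilon> n)) * (e n + f n - (1 - C (\<tau> n)))"
        using \<tau>(2)[of n] \<upsilon>(2)[of n] by (simp add: diff_divide_distrib[symmetric])
      have q: "(e n + f n)\<^sup>2 = (e n)\<^sup>2 + 2 * (e n * f n) + (f n)\<^sup>2" by (simp add: power2_eq_square algebra_simps)
      have q': "k * (1 + h00 n) * ((1 - C (\<tau> n)) + (1 - C (\<upsilon> n))) = (1 + h00 n) * (k * (1 - C (\<tau> n)) + k * (1 - C (\<upsilon> n)))"
        by (simp add: algebra_simps)
      show ?thesis unfolding R_def d rc 3 q q' by (simp add: mult.assoc)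
    qed
    finally have "k * m n * A n \<le> R n * (\<tau> n * \<upsilon> n)" .
    moreover have "K n * (\<tau> n * \<upsilon> n) * A n \<le> k * m n * A n"
      using K(2)[of n] that unfolding m_def by (intro mult_right_mono) auto
    ultimately have "(K n * A n) * (\<tau> n * \<upsilon> n) \<le> R n * (\<tau> n * \<upsilon> n)" by (simp add: algebra_simps)
    then show ?thesis using \<tau>(2)[of n] \<upsilon>(2)[of n] by (simp add: mult_le_cancel_right)
  qed
  have "K0 * ((1 + h) - (1 - 1) + 2 * r0 * k * (0 + 0)) \<le> (1 + h) * ((1/2) / \<rho> + (1/2) * \<rho>)
     + 0 * k * (E + E' * \<rho> - 0) + k * E * E' - r0 * (E\<^sup>2 / \<rho> + 2 * E * E' + E'\<^sup>2 * \<rho>)"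
    by (rule tendsto_le[OF sequentially_bot lR tendsto_mult[OF K(1) lA]])
       (use ev1 ev2 in eventually_elim, rule key)
  then have fin: "K0 * (1 + h) \<le> (1 + h) * ((1/2) / \<rho> + (1/2) * \<rho>) + k * E * E' - r0 * (E\<^sup>2 / \<rho> + 2 * E * E' + E'\<^sup>2 * \<rho>)"
    by simp
  define p where "p = E\<^sup>2 / \<rho>"
  define q where "q = E'\<^sup>2 * \<rho>"
  define d where "d = 1 / \<rho>"
  have fin': "K0 * (1 + h) \<le> (1 + h) * (d / 2 + \<rho> / 2) + k * E * E' - r0 * (p + 2 * E * E' + q)"
    using fin by (simp add: p_def q_def d_def mult.commute[of \<rho> 2])
  \<comment> \<open>The multiplier is the reciprocal of \<open>r0\<close>; it removes the last
    denominator.\<close>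
  have "2 * (k * (1 - h)) * (K0 * (1 + h)) \<le> 2 * (k * (1 - h)) * ((1 + h) * (d / 2 + \<rho> / 2) + k * E * E' - r0 * (p + 2 * E * E' + q))"
    using hk by (intro mult_left_mono fin') auto
  also have "\<dots> = k * (1 - h * h) * (d + \<rho>) + 2 * (k * k) * (1 - h) * E * E' - (2 * (k * (1 - h)) * r0) * (p + 2 * E * E' + q)"
    by (simp only: algebra_simps) simp
  also have "2 * (k * (1 - h)) * r0 = 1"
    unfolding r0_def using hne by (simp add: field_simps)
  finally have "2 * (k * (1 - h)) * (K0 * (1 + h)) \<le> k * (1 - h * h) * (d + \<rho>) - 2 * h * E * E' - (p + q)"
    by (simp add: algebra_simps)
  moreover have "2 * (k * (1 - h)) * (K0 * (1 + h)) = 2 * (1 - h * h) * (k * K0)" by (simp add: algebra_simps)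
  ultimately show ?thesis unfolding p_def q_def d_def by (simp add: power2_eq_square)
qed

text \<open>For this sign \<open>1 - C (\<upsilon> n)\<close> enters with the weight 2 and
  \<open>1 - C (\<tau> n)\<close> with a weight tending to \<open>2 * h\<^sup>2\<close>. The aspect
  ratio \<open>h * \<rho>\<close> balances the two terms: both acquire a common factor
  \<open>h\<close>, and after division by it the conclusion is the same as for the other
  sign.\<close>

lemma rect_limit_plus:
  fixes \<tau> \<upsilon> h00 h10 h01 h11 K :: "nat \<Rightarrow> real"
  assumes \<tau>: "\<tau> \<longlonglongrightarrow> 0" "\<And>n. 0 < \<tau> n" and \<upsilon>: "\<upsilon> \<longlonglongrightarrow> 0" "\<And>n. 0 < \<upsilon> n"
    and \<rho>: "(\<lambda>n. \<upsilon> n / \<tau> n) \<longlonglongrightarrow> h * \<rho>" "0 < \<rho>"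
    and h: "h00 \<longlonglongrightarrow> h" "h10 \<longlonglongrightarrow> h" "h01 \<longlonglongrightarrow> h" "h11 \<longlonglongrightarrow> h"
    and hk: "0 < k * (1 - h)" "0 < h"
    and E: "(\<lambda>n. (h10 n - h00 n) / \<tau> n) \<longlonglongrightarrow> E" and E': "(\<lambda>n. (h01 n - h00 n) / \<upsilon> n) \<longlonglongrightarrow> E'"
    and K: "K \<longlonglongrightarrow> K0" "\<And>n. K n * (\<tau> n * \<upsilon> n) \<le> k * (h11 n - h10 n - h01 n + h00 n)"
    and ineq: "\<And>n. k * ((C (\<upsilon> n) + 2 * h00 n * h11 n - 1 + (h11 n - h00 n)\<^sup>2 / (2 * (1 - h00 n * h11 n))) * (1 + C (\<tau> n))
       - (h00 n + h10 n) * (h11 n + h01 n)) \<le> 0"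
  shows "2 * (1 - h\<^sup>2) * (k * K0) + 2 * h * E * E' + E\<^sup>2 / \<rho> + E'\<^sup>2 * \<rho> \<le> k * (1 - h\<^sup>2) * (1 / \<rho> + \<rho>)"
proof -
  define r where "r n = k * (1 + C (\<tau> n)) / (2 * (1 - h00 n * h11 n))" for n
  define e where "e n = h10 n - h00 n" for n
  define f where "f n = h01 n - h00 n" for n
  define m where "m n = h11 n - h10 n - h01 n + h00 n" for n
  define A where "A n = 2 * h00 n - k * k * e n + 2 * r n * k * (e n + f n)" for n
  define R where "R n = 2 * (k * (1 - C (\<upsilon> n)) / (\<upsilon> n)\<^sup>2) * (\<upsilon> n / \<tau> n)
     + (k * (1 - C (\<tau> n)) / (\<tau> n)\<^sup>2) / (\<upsilon> n / \<tau> n) * (2 * h00 n * h11 n - (1 - C (\<upsilon> n)))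
     + k * ((e n / \<tau> n)\<^sup>2 / (\<upsilon> n / \<tau> n) + 2 * (e n / \<tau> n) * (f n / \<upsilon> n))
     - r n * ((e n / \<tau> n)\<^sup>2 / (\<upsilon> n / \<tau> n) + 2 * (e n / \<tau> n) * (f n / \<upsilon> n) + (f n / \<upsilon> n)\<^sup>2 * (\<upsilon> n / \<tau> n))" for n
  define w where "w = 1 - h * h"
  have w: "0 < k * w"
    using mult_pos_pos[OF hk(1), of "1 + h"] hk(2) unfolding w_def by (simp add: algebra_simps)
  define r0 where "r0 = k * (1 + 1) / (2 * w)"
  have hne: "1 - h * h \<noteq> 0" using w by (auto simp: w_def)
  have ltu: "(\<lambda>n. C (\<tau> n)) \<longlonglongrightarrow> 1" "(\<lambda>n. C (\<upsilon> n)) \<longlonglongrightarrow> 1"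
    using tendsto_C[OF \<tau>(1)] tendsto_C[OF \<upsilon>(1)] by auto
  have lr: "r \<longlonglongrightarrow> r0" unfolding r_def r0_def w_def using hne by (intro tendsto_intros h ltu) auto
  have le: "e \<longlonglongrightarrow> 0" "f \<longlonglongrightarrow> 0"
    unfolding e_def f_def using tendsto_diff[OF h(2,1)] tendsto_diff[OF h(3,1)] by auto
  have lA: "A \<longlonglongrightarrow> 2 * h - k * k * 0 + 2 * r0 * k * (0 + 0)"
    unfolding A_def by (intro tendsto_intros h lr le ltu)
  have lR: "R \<longlonglongrightarrow> 2 * (1/2) * (h * \<rho>) + (1/2) / (h * \<rho>) * (2 * h * h - (1 - 1))
     + k * (E\<^sup>2 / (h * \<rho>) + 2 * E * E') - r0 * (E\<^sup>2 / (h * \<rho>) + 2 * E * E' + E'\<^sup>2 * (h * \<rho>))"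
    unfolding R_def using \<rho>(2) hk(2)
    by (intro tendsto_intros h lr \<rho> ltu LIM_diff(3,4)[OF tendsto_const] \<tau> \<upsilon> E[folded e_def] E'[folded f_def]) auto
  have rpos: "0 < r0"
  proof -
    have "r0 = k * w / w\<^sup>2" unfolding r0_def by (simp add: power2_eq_square)
    moreover have "0 < w\<^sup>2" using w by auto
    ultimately show ?thesis using divide_pos_pos[OF w] by (simp only:)
  qed
  have ev1: "\<forall>\<^sub>F n in sequentially. 0 < r n" using order_tendstoD(1)[OF lr rpos] .
  have ev2: "\<forall>\<^sub>F n in sequentially. 0 < A n" using order_tendstoD(1)[OF lA, of 0] hk by simp
  have key: "K n * A n \<le> R n" if "0 < r n" "0 < A n" for n
  proof -
    have r: "k * ((h11 n - h00 n)\<^sup>2 / (2 * (1 - h00 n * h11 n))) * (1 + C (\<tau> n)) = r n * (h11 n - h00 n)\<^sup>2"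
      unfolding r_def by simp
    have h11: "h11 n = h00 n + e n + f n + m n" and h10: "h10 n = h00 n + e n" and h01: "h01 n = h00 n + f n"
      by (simp_all add: m_def e_def f_def)
    have "k * (C (\<upsilon> n) + 2 * h00 n * h11 n - 1) * (1 + C (\<tau> n)) + r n * (h11 n - h00 n)\<^sup>2 - k * ((h00 n + h10 n) * (h11 n + h01 n)) \<le> 0"
    proof -
      have d: "k * ((a + b) * u - P) = k * a * u + k * b * u - k * P" for a b u P by (simp add: algebra_simps)
      show ?thesis using ineq[of n] unfolding d r .
    qed
    moreover have "k * (C (\<upsilon> n) + 2 * h00 n * h11 n - 1) * (1 + C (\<tau> n)) - k * ((h00 n + h10 n) * (h11 n + h01 n))
      = k * m n * (2 * h00 n - e n) - 2 * k * (1 - C (\<upsilon> n))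
        - k * (1 - C (\<tau> n)) * (2 * h00 n * h11 n - (1 - C (\<upsilon> n))) - k * e n * (e n + 2 * f n)"
    proof -
      have "k * (u + 2 * a * (a + b + c + d) - 1) * (1 + v) - k * ((a + (a + b)) * ((a + b + c + d) + (a + c)))
       = k * d * (2 * a - b) - 2 * k * (1 - u) - k * (1 - v) * (2 * a * (a + b + c + d) - (1 - u)) - k * b * (b + 2 * c)"
        for a b c d u v :: real by (simp add: algebra_simps)
      then show ?thesis unfolding h11 h10 h01 .
    qed
    ultimately have 1: "k * m n * (2 * h00 n - e n) - 2 * k * (1 - C (\<upsilon> n))
        - k * (1 - C (\<tau> n)) * (2 * h00 n * h11 n - (1 - C (\<upsilon> n))) - k * e n * (e n + 2 * f n) + r n * (h11 n - h00 n)\<^sup>2 \<le> 0"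
      by simp
    have h11: "h11 n - h00 n = (e n + f n) + m n" by (simp add: m_def e_def f_def)
    have "r n * (h11 n - h00 n)\<^sup>2 \<ge> r n * ((e n + f n)\<^sup>2 + 2 * m n * (e n + f n))"
      unfolding h11 using that by (intro mult_left_mono) (auto simp: power2_eq_square algebra_simps)
    moreover have "r n * (2 * m n * (e n + f n)) = k * m n * (2 * r n * k * (e n + f n))"
      by (simp add: algebra_simps)
    ultimately have 2: "k * m n * A n \<le> 2 * k * (1 - C (\<upsilon> n))
        + k * (1 - C (\<tau> n)) * (2 * h00 n * h11 n - (1 - C (\<upsilon> n))) + k * e n * (e n + 2 * f n) - r n * (e n + f n)\<^sup>2"
      using 1 unfolding A_def by (simp add: algebra_simps)
    also have "\<dots> = R n * (\<tau> n * \<upsilon> n)"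
    proof -
      note rc = ratio_cancel[OF \<tau>(2)[of n] \<upsilon>(2)[of n]]
      have d: "(2 * Q1 * w + Q2 * P + k * (Q3 + 2 * Q5 * Q6) - r n * (Q3 + 2 * Q5 * Q6 + Q8)) * (a * b)
         = 2 * (Q1 * w * (a * b)) + Q2 * (a * b) * P + k * (Q3 * (a * b) + 2 * (Q5 * Q6 * (a * b)))
           - r n * (Q3 * (a * b) + 2 * (Q5 * Q6 * (a * b)) + Q8 * (a * b))" for P Q1 Q2 Q3 Q5 Q6 Q8 w a b :: real
        by (simp add: algebra_simps)
      have q: "(e n + f n)\<^sup>2 = (e n)\<^sup>2 + 2 * (e n * f n) + (f n)\<^sup>2" by (simp add: power2_eq_square algebra_simps)
      have q': "k * e n * (e n + 2 * f n) = k * ((e n)\<^sup>2 + 2 * (e n * f n))" by (simp add: power2_eq_square algebra_simps)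
      show ?thesis unfolding R_def d rc q q' by (simp add: mult.assoc)
    qed
    finally have "k * m n * A n \<le> R n * (\<tau> n * \<upsilon> n)" .
    moreover have "K n * (\<tau> n * \<upsilon> n) * A n \<le> k * m n * A n"
      using K(2)[of n] that unfolding m_def by (intro mult_right_mono) auto
    ultimately have "(K n * A n) * (\<tau> n * \<upsilon> n) \<le> R n * (\<tau> n * \<upsilon> n)" by (simp add: algebra_simps)
    then show ?thesis using \<tau>(2)[of n] \<upsilon>(2)[of n] by (simp add: mult_le_cancel_right)
  qed
  have "K0 * (2 * h - k * k * 0 + 2 * r0 * k * (0 + 0)) \<le> 2 * (1/2) * (h * \<rho>) + (1/2) / (h * \<rho>) * (2 * h * h - (1 - 1))
     + k * (E\<^sup>2 / (h * \<rho>) + 2 * E * E') - r0 * (E\<^sup>2 / (h * \<rho>) + 2 * E * E' + E'\<^sup>2 * (h * \<rho>))"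
    by (rule tendsto_le[OF sequentially_bot lR tendsto_mult[OF K(1) lA]])
       (use ev1 ev2 in eventually_elim, rule key)
  moreover define p where "p = E\<^sup>2 / \<rho>"
  moreover define q where "q = E'\<^sup>2 * \<rho>"
  moreover define d where "d = 1 / \<rho>"
  moreover have "E\<^sup>2 / (h * \<rho>) = p / h" "E'\<^sup>2 * (h * \<rho>) = h * q" "(1/2) / (h * \<rho>) * (2 * h * h - (1 - 1)) = h * d"
    using hk(2) by (simp_all add: p_def q_def d_def)
  ultimately have fin: "K0 * (2 * h) \<le> h * \<rho> + h * d + k * (p / h + 2 * E * E') - r0 * (p / h + 2 * E * E' + h * q)"
    by simp
  have kr: "k * w * r0 = 1" unfolding r0_def using w by (auto simp: field_simps)
  have "k * w * (K0 * (2 * h)) \<le> k * w * (h * \<rho> + h * d + k * (p / h + 2 * E * E') - r0 * (p / h + 2 * E * E' + h * q))"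
    using w by (intro mult_left_mono fin) auto
  also have "\<dots> = k * w * h * (\<rho> + d) + (k * k) * w * (p / h + 2 * E * E') - (k * w * r0) * (p / h + 2 * E * E' + h * q)"
    by (simp only: distrib_left right_diff_distrib mult.assoc mult.left_commute)
  also have "\<dots> = k * w * h * (\<rho> + d) - (1 - w) * (p / h + 2 * E * E') - h * q"
    unfolding kr kk by (simp add: left_diff_distrib)
  also have "\<dots> = h * (k * w * (\<rho> + d) - p - h * 2 * E * E' - q)"
    using hk(2) by (simp add: w_def distrib_left right_diff_distrib)
  finally have "h * (2 * w * (k * K0)) \<le> h * (k * w * (\<rho> + d) - p - h * 2 * E * E' - q)"
    by (simp add: ac_simps)
  then have "2 * w * (k * K0) \<le> k * w * (\<rho> + d) - p - h * 2 * E * E' - q"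
    using hk(2) by (rule mult_left_le_imp_le)
  then show ?thesis unfolding p_def q_def d_def w_def by (simp add: power2_eq_square ac_simps)
qed

end

context curv
begin

text \<open>With \<open>v = k * (1 - C a * C b)\<close> the square of \<open>S a * S b\<close> is
  \<open>v\<^sup>2 - (C b - C a)\<^sup>2\<close>, and the square root lies below its tangent at
  \<open>v\<^sup>2\<close>. The estimate rids the four-point inequality of \<open>S\<close> without
  losing second-order accuracy for nearby \<open>a\<close> and \<open>b\<close>.\<close>

lemma mult_S_le:
  assumes "0 < k * (1 - C a * C b)"
  shows "S a * S b \<le> k * (1 - C a * C b) - k * (C b - C a)\<^sup>2 / (2 * (1 - C a * C b))"
proof -
  define v where "v = k * (1 - C a * C b)"
  have "(S a * S b)\<^sup>2 = (1 - (C a)\<^sup>2) * (1 - (C b)\<^sup>2)"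
    using k by (auto simp: power_mult_distrib S_sq algebra_simps)
  also have "\<dots> = v\<^sup>2 - (C b - C a)\<^sup>2"
    unfolding v_def using k by (auto simp: power2_eq_square algebra_simps)
  finally have 1: "(S a * S b)\<^sup>2 = v\<^sup>2 - (C b - C a)\<^sup>2" .
  have "2 * v * (S a * S b) \<le> v\<^sup>2 + (S a * S b)\<^sup>2"
    using zero_le_power2[of "v - S a * S b"] by (simp add: power2_eq_square algebra_simps)
  then have "2 * v * (S a * S b) \<le> 2 * v * v - (C b - C a)\<^sup>2"
    unfolding 1 by (simp add: power2_eq_square)
  moreover have v: "0 < v" using assms by (simp add: v_def)
  ultimately have "S a * S b \<le> v - (C b - C a)\<^sup>2 / (2 * v)"
    by (simp add: field_simps)
  moreover have "1 - C a * C b = k * v" by (simp add: v_def)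
  then have "k * (C b - C a)\<^sup>2 / (2 * (1 - C a * C b)) = (C b - C a)\<^sup>2 / (2 * v)"
    using k by (elim disjE) auto
  ultimately show ?thesis by (simp add: v_def)
qed

text \<open>Only the quotients of \<open>h\<close> are assumed to converge; those of
  \<open>J\<close> follow, because \<open>J\<close> is an explicit function of \<open>h\<close> and
  the parameters. The numbers \<open>x\<close> and \<open>y\<close> are found by solving the
  formulas for \<open>E\<close> and \<open>E'\<close>. The rectangle limit makes the left-hand side
  of \<open>model_identity\<close> nonpositive, and the factor \<open>(S a * S b)\<^sup>2\<close> on
  its right cancels.\<close>

lemma corner_limit:
  fixes t u \<tau> \<upsilon> h00 h10 h01 h11 J00 J10 J01 J11 :: "nat \<Rightarrow> real"
  assumes t: "t \<longlonglongrightarrow> a" and u: "u \<longlonglongrightarrow> b" and ab: "0 < S a" "0 < S b"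
    and \<tau>: "\<tau> \<longlonglongrightarrow> 0" "\<And>n. 0 < \<tau> n" and \<upsilon>: "\<upsilon> \<longlonglongrightarrow> 0" "\<And>n. 0 < \<upsilon> n"
    and pos: "\<And>n. 0 < S (t n)" "\<And>n. 0 < S (u n)" "\<And>n. 0 < S (t n + \<tau> n)" "\<And>n. 0 < S (u n + \<upsilon> n)"
    and h: "h00 \<longlonglongrightarrow> h" "h10 \<longlonglongrightarrow> h" "h01 \<longlonglongrightarrow> h" "h11 \<longlonglongrightarrow> h"
    and hk: "0 < k * (1 - h)" "0 < h"
    and E: "(\<lambda>n. (h10 n - h00 n) / \<tau> n) \<longlonglongrightarrow> E" and E': "(\<lambda>n. (h01 n - h00 n) / \<upsilon> n) \<longlonglongrightarrow> E'"
    and h00: "\<And>n. h00 n = C (t n) * C (u n) + k * S (t n) * S (u n) * J00 n"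
    and h10: "\<And>n. h10 n = C (t n + \<tau> n) * C (u n) + k * S (t n + \<tau> n) * S (u n) * J10 n"
    and h01: "\<And>n. h01 n = C (t n) * C (u n + \<upsilon> n) + k * S (t n) * S (u n + \<upsilon> n) * J01 n"
    and h11: "\<And>n. h11 n = C (t n + \<tau> n) * C (u n + \<upsilon> n) + k * S (t n + \<tau> n) * S (u n + \<upsilon> n) * J11 n"
    and bad: "\<And>n. B * (\<tau> n * \<upsilon> n) \<le> J11 n - J10 n - J01 n + J00 n"
    and ineq: "(\<lambda>n. \<upsilon> n / \<tau> n) \<longlonglongrightarrow> S b / S a \<and> (\<forall>n. k * (h00 n + C (\<upsilon> n)) * (h11 n + C (\<tau> n))
       \<le> k * (1 + h10 n) * (1 + h01 n) - k * (h11 n - h00 n)\<^sup>2 / (2 * (1 - h00 n * h11 n)) * (1 + h01 n)) \<or>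
     (\<lambda>n. \<upsilon> n / \<tau> n) \<longlonglongrightarrow> h * (S b / S a) \<and> (\<forall>n. k * ((C (\<upsilon> n) + 2 * h00 n * h11 n - 1 + (h11 n - h00 n)\<^sup>2 / (2 * (1 - h00 n * h11 n))) * (1 + C (\<tau> n))
       - (h00 n + h10 n) * (h11 n + h01 n)) \<le> 0)"
    and J: "h = C a * C b + k * S a * S b * J"
  shows "\<exists>x y. E = - k * S a * C b + k * C a * S b * J + k * S b * x \<and>
     E' = - k * C a * S b + k * S a * C b * J + k * S a * y \<and>
     (\<lambda>n. (J10 n - J00 n) / \<tau> n) \<longlonglongrightarrow> x / S a \<and> (\<lambda>n. (J01 n - J00 n) / \<upsilon> n) \<longlonglongrightarrow> y / S b \<and>
     2 * k * (1 - h\<^sup>2) * B \<le> - (x\<^sup>2 + y\<^sup>2 + 2 * h * x * y)"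
proof -
  define x where "x = k * (E + k * S a * C b) / S b - C a * J"
  define y where "y = k * (E' + k * C a * S b) / S a - C b * J"
  have Ex: "E = - k * S a * C b + k * C a * S b * J + k * S b * x"
  proof -
    have "k * S b * (k * Z / S b) = Z" for Z using ab by (simp add: mult.assoc)
    then show ?thesis unfolding x_def by (simp add: right_diff_distrib)
  qed
  have Ey: "E' = - k * C a * S b + k * S a * C b * J + k * S a * y"
  proof -
    have "k * S a * (k * Z / S a) = Z" for Z using ab by (simp add: mult.assoc)
    then show ?thesis unfolding y_def by (simp add: right_diff_distrib)
  qed
  define dC where "dC n = (C (t n + \<tau> n) - C (t n)) / \<tau> n" for n
  define dS where "dS n = (S (t n + \<tau> n) - S (t n)) / \<tau> n" for n
  define dC' where "dC' n = (C (u n + \<upsilon> n) - C (u n)) / \<upsilon> n" for n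
  define dS' where "dS' n = (S (u n + \<upsilon> n) - S (u n)) / \<upsilon> n" for n
  have lim: "dC \<longlonglongrightarrow> - k * S a" "dS \<longlonglongrightarrow> C a" "dC' \<longlonglongrightarrow> - k * S b" "dS' \<longlonglongrightarrow> C b"
    unfolding dC_def dS_def dC'_def dS'_def by (intro LIM_diff t u \<tau> \<upsilon>)+
  have St: "(\<lambda>n. S (t n + \<tau> n)) \<longlonglongrightarrow> S a" "(\<lambda>n. S (u n + \<upsilon> n)) \<longlonglongrightarrow> S b"
    using tendsto_S[OF tendsto_add[OF t \<tau>(1)]] tendsto_S[OF tendsto_add[OF u \<upsilon>(1)]] by simp_all
  have JJ: "J = k * (h - C a * C b) / (S a * S b)" unfolding J using ab by simp
  have J00: "J00 n = k * (h00 n - C (t n) * C (u n)) / (S (t n) * S (u n))" for n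
    unfolding h00 using pos(1,2)[of n] by simp
  have J00l: "J00 \<longlonglongrightarrow> J"
    unfolding JJ J00 using ab by (intro tendsto_intros h t u) auto
  have xn: "(J10 n - J00 n) / \<tau> n = (k * ((h10 n - h00 n) / \<tau> n - dC n * C (u n)) / S (u n) - dS n * J00 n) / S (t n + \<tau> n)" for n
  proof -
    have "h10 n - h00 n - (C (t n + \<tau> n) - C (t n)) * C (u n)
      = k * S (u n) * (S (t n + \<tau> n) * (J10 n - J00 n) + (S (t n + \<tau> n) - S (t n)) * J00 n)"
      unfolding h10 h00 by (simp add: algebra_simps)
    then have "k * (h10 n - h00 n - (C (t n + \<tau> n) - C (t n)) * C (u n)) / S (u n)
      = S (t n + \<tau> n) * (J10 n - J00 n) + (S (t n + \<tau> n) - S (t n)) * J00 n"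
      using pos(2)[of n] by simp
    then have "(k * (h10 n - h00 n - (C (t n + \<tau> n) - C (t n)) * C (u n)) / S (u n) - (S (t n + \<tau> n) - S (t n)) * J00 n) / S (t n + \<tau> n)
      = J10 n - J00 n" using pos(3)[of n] by simp
    then have "(J10 n - J00 n) / \<tau> n = (k * (h10 n - h00 n - (C (t n + \<tau> n) - C (t n)) * C (u n)) / S (u n) - (S (t n + \<tau> n) - S (t n)) * J00 n) / S (t n + \<tau> n) / \<tau> n"
      by simp
    also have "\<dots> = (k * ((h10 n - h00 n) / \<tau> n - dC n * C (u n)) / S (u n) - dS n * J00 n) / S (t n + \<tau> n)"
      unfolding dC_def dS_def by (simp add: diff_divide_distrib right_diff_distrib mult.commute)
    finally show ?thesis .
  qed
  have yn: "(J01 n - J00 n) / \<upsilon> n = (k * ((h01 n - h00 n) / \<upsilon> n - dC' n * C (t n)) / S (t n) - dS' n * J00 n) / S (u n + \<upsilon> n)" for n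
  proof -
    have "h01 n - h00 n - (C (u n + \<upsilon> n) - C (u n)) * C (t n)
      = k * S (t n) * (S (u n + \<upsilon> n) * (J01 n - J00 n) + (S (u n + \<upsilon> n) - S (u n)) * J00 n)"
      unfolding h01 h00 by (simp add: algebra_simps)
    then have "k * (h01 n - h00 n - (C (u n + \<upsilon> n) - C (u n)) * C (t n)) / S (t n)
      = S (u n + \<upsilon> n) * (J01 n - J00 n) + (S (u n + \<upsilon> n) - S (u n)) * J00 n"
      using pos(1)[of n] by simp
    then have "(k * (h01 n - h00 n - (C (u n + \<upsilon> n) - C (u n)) * C (t n)) / S (t n) - (S (u n + \<upsilon> n) - S (u n)) * J00 n) / S (u n + \<upsilon> n)
      = J01 n - J00 n" using pos(4)[of n] by simp
    then have "(J01 n - J00 n) / \<upsilon> n = (k * (h01 n - h00 n - (C (u n + \<upsilon> n) - C (u n)) * C (t n)) / S (t n) - (S (u n + \<upsilon> n) - S (u n)) * J00 n) / S (u n + \<upsilon> n) / \<upsilon> n"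
      by simp
    also have "\<dots> = (k * ((h01 n - h00 n) / \<upsilon> n - dC' n * C (t n)) / S (t n) - dS' n * J00 n) / S (u n + \<upsilon> n)"
      unfolding dC'_def dS'_def by (simp add: diff_divide_distrib right_diff_distrib mult.commute)
    finally show ?thesis .
  qed
  have lx: "(\<lambda>n. (J10 n - J00 n) / \<tau> n) \<longlonglongrightarrow> (k * (E - (- k * S a) * C b) / S b - C a * J) / S a"
    unfolding xn using ab by (intro tendsto_intros E lim u J00l St) auto
  have ly: "(\<lambda>n. (J01 n - J00 n) / \<upsilon> n) \<longlonglongrightarrow> (k * (E' - (- k * S b) * C a) / S a - C b * J) / S b"
    unfolding yn using ab by (intro tendsto_intros E' lim t J00l St) auto
  have lx': "(\<lambda>n. (J10 n - J00 n) / \<tau> n) \<longlonglongrightarrow> x / S a"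
    using lx by (simp add: x_def)
  have ly': "(\<lambda>n. (J01 n - J00 n) / \<upsilon> n) \<longlonglongrightarrow> y / S b"
    using ly by (simp add: y_def mult.commute mult.left_commute)
  \<comment> \<open>A discrete product rule for the second difference of
    \<open>C t * C u + k * S t * S u * J\<close>, in which \<open>B\<close> replaces the second
    difference of \<open>J\<close>. Since the two \<open>S\<close> next to \<open>B\<close> are
    positive, \<open>bad\<close> makes \<open>K n\<close> a lower bound.\<close>
  define K where "K n = k * dC n * dC' n + J00 n * dS n * dS' n + (J10 n - J00 n) / \<tau> n * (S (t n + \<tau> n) * dS' n)
     + (J01 n - J00 n) / \<upsilon> n * (S (u n + \<upsilon> n) * dS n) + B * (S (t n + \<tau> n) * S (u n + \<upsilon> n))" for n
  define K0 where "K0 = k * S a * S b + J * C a * C b + x * C b + y * C a + B * S a * S b"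
  have "K \<longlonglongrightarrow> k * (- k * S a) * (- k * S b) + J * C a * C b + x / S a * (S a * C b)
     + y / S b * (S b * C a) + B * (S a * S b)"
    unfolding K_def by (intro tendsto_intros lim J00l lx' ly' St)
  moreover have "k * (- k * S a) * (- k * S b) + J * C a * C b + x / S a * (S a * C b)
     + y / S b * (S b * C a) + B * (S a * S b) = K0"
    using ab unfolding K0_def by simp
  ultimately have Kl: "K \<longlonglongrightarrow> K0" by simp
  have Kn: "K n * (\<tau> n * \<upsilon> n) \<le> k * (h11 n - h10 n - h01 n + h00 n)" for n
  proof -
    have \<tau>\<upsilon>: "0 < \<tau> n" "0 < \<upsilon> n" using \<tau> \<upsilon> by auto
    have d: "dC n * \<tau> n = C (t n + \<tau> n) - C (t n)" "dS n * \<tau> n = S (t n + \<tau> n) - S (t n)"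
      "dC' n * \<upsilon> n = C (u n + \<upsilon> n) - C (u n)" "dS' n * \<upsilon> n = S (u n + \<upsilon> n) - S (u n)"
      "(J10 n - J00 n) / \<tau> n * \<tau> n = J10 n - J00 n" "(J01 n - J00 n) / \<upsilon> n * \<upsilon> n = J01 n - J00 n"
      unfolding dC_def dS_def dC'_def dS'_def using \<tau>\<upsilon> by auto
    have "K n * (\<tau> n * \<upsilon> n) = k * (dC n * \<tau> n) * (dC' n * \<upsilon> n) + J00 n * (dS n * \<tau> n) * (dS' n * \<upsilon> n)
       + ((J10 n - J00 n) / \<tau> n * \<tau> n) * (S (t n + \<tau> n) * (dS' n * \<upsilon> n))
       + ((J01 n - J00 n) / \<upsilon> n * \<upsilon> n) * (S (u n + \<upsilon> n) * (dS n * \<tau> n)) + (B * (\<tau> n * \<upsilon> n)) * (S (t n + \<tau> n) * S (u n + \<upsilon> n))"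
      unfolding K_def by (simp only: distrib_left distrib_right mult.assoc mult.left_commute mult.commute)
    also have "\<dots> \<le> k * (dC n * \<tau> n) * (dC' n * \<upsilon> n) + J00 n * (dS n * \<tau> n) * (dS' n * \<upsilon> n)
       + ((J10 n - J00 n) / \<tau> n * \<tau> n) * (S (t n + \<tau> n) * (dS' n * \<upsilon> n))
       + ((J01 n - J00 n) / \<upsilon> n * \<upsilon> n) * (S (u n + \<upsilon> n) * (dS n * \<tau> n)) + (J11 n - J10 n - J01 n + J00 n) * (S (t n + \<tau> n) * S (u n + \<upsilon> n))"
      by (intro add_left_mono mult_right_mono bad mult_nonneg_nonneg less_imp_le[OF pos(3)] less_imp_le[OF pos(4)])
    also have "\<dots> = k * (h11 n - h10 n - h01 n + h00 n)"
      unfolding d h00 h10 h01 h11 by (simp add: algebra_simps)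
    finally show ?thesis .
  qed
  have "2 * (1 - h\<^sup>2) * (k * K0) + 2 * h * E * E' + E\<^sup>2 / (S b / S a) + E'\<^sup>2 * (S b / S a)
     \<le> k * (1 - h\<^sup>2) * (1 / (S b / S a) + S b / S a)" (is "?L \<le> ?R")
    using ineq
  proof (elim disjE conjE)
    assume 1: "(\<lambda>n. \<upsilon> n / \<tau> n) \<longlonglongrightarrow> S b / S a" and 2: "\<forall>n. k * (h00 n + C (\<upsilon> n)) * (h11 n + C (\<tau> n))
       \<le> k * (1 + h10 n) * (1 + h01 n) - k * (h11 n - h00 n)\<^sup>2 / (2 * (1 - h00 n * h11 n)) * (1 + h01 n)"
    show ?thesis
      by (rule rect_limit_minus[OF \<tau> \<upsilon> 1 _ h hk E E' Kl Kn]) (use ab 2 in auto)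
  next
    assume 1: "(\<lambda>n. \<upsilon> n / \<tau> n) \<longlonglongrightarrow> h * (S b / S a)" and 2: "\<forall>n. k * ((C (\<upsilon> n) + 2 * h00 n * h11 n - 1 + (h11 n - h00 n)\<^sup>2 / (2 * (1 - h00 n * h11 n))) * (1 + C (\<tau> n))
       - (h00 n + h10 n) * (h11 n + h01 n)) \<le> 0"
    show ?thesis
      by (rule rect_limit_plus[OF \<tau> \<upsilon> 1 _ h hk E E' Kl Kn]) (use ab 2 in auto)
  qed
  then have "?L * (S a * S b) \<le> ?R * (S a * S b)"
    using ab by (intro mult_right_mono) auto
  moreover have "?L * (S a * S b) = 2 * (1 - h\<^sup>2) * (k * K0) * (S a * S b) + 2 * h * E * E' * (S a * S b) + E\<^sup>2 * (S a)\<^sup>2 + E'\<^sup>2 * (S b)\<^sup>2"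
    using ab by (simp add: distrib_right power2_eq_square)
  moreover have "?R * (S a * S b) = k * (1 - h\<^sup>2) * ((S a)\<^sup>2 + (S b)\<^sup>2)"
  proof -
    have "(1 / (S b / S a) + S b / S a) * (S a * S b) = (S a)\<^sup>2 + (S b)\<^sup>2"
      using ab by (simp add: distrib_right power2_eq_square)
    then show ?thesis by (simp only: mult.assoc)
  qed
  ultimately have "(S a * S b)\<^sup>2 * (2 * k * (1 - h\<^sup>2) * B + x\<^sup>2 + y\<^sup>2 + 2 * h * x * y) \<le> 0"
    using model_identity[OF C_sq C_sq J Ex Ey K0_def] by linarith
  moreover have "0 < (S a * S b)\<^sup>2" using ab by simp
  ultimately have "2 * k * (1 - h\<^sup>2) * B + x\<^sup>2 + y\<^sup>2 + 2 * h * x * y \<le> 0"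
    by (simp add: mult_le_0_iff)
  then show ?thesis using Ex Ey lx' ly' by (intro exI[of _ x] exI[of _ y]) auto
qed

end

section \<open>Unit-speed geodesics and the selection of small rectangles\<close>

definition geod :: "'a set \<Rightarrow> ('a \<Rightarrow> 'a \<Rightarrow> real) \<Rightarrow> (real \<Rightarrow> 'a) \<Rightarrow> real \<Rightarrow> bool" where
  "geod X d \<alpha> l \<longleftrightarrow> 0 \<le> l \<and> (\<forall>s\<in>{0..l}. \<alpha> s \<in> X) \<and> (\<forall>s\<in>{0..l}. \<forall>t\<in>{0..l}. d (\<alpha> s) (\<alpha> t) = \<bar>s - t\<bar>)"

lemma geodD:
  assumes "geod X d \<alpha> l"
  shows "0 \<le> l" "0 \<le> s \<Longrightarrow> s \<le> l \<Longrightarrow> \<alpha> s \<in> X"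
    "0 \<le> s \<Longrightarrow> s \<le> l \<Longrightarrow> 0 \<le> t \<Longrightarrow> t \<le> l \<Longrightarrow> d (\<alpha> s) (\<alpha> t) = \<bar>s - t\<bar>"
  using assms by (auto simp: geod_def)

lemma geod_rev_sub:
  assumes "geod X d \<alpha> l" "0 \<le> m" "m \<le> s" "s \<le> l"
  shows "geod X d (\<lambda>t. \<alpha> (s - t)) m"
  using assms by (auto simp: geod_def abs_if)

lemma geod_shift:
  assumes "geod X d \<alpha> l" "0 \<le> m" "0 \<le> s" "s + m \<le> l"
  shows "geod X d (\<lambda>t. \<alpha> (s + t)) m"
  using assms by (auto simp: geod_def)

text \<open>Second differences are additive: summed over the cells of a grid they telescope in both
  directions, so some cell is at least as bad as the average.\<close>

lemma grid_bad:
  fixes f :: "real \<Rightarrow> real \<Rightarrow> real"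
  assumes m: "0 < m" "0 < l" and TU: "0 < T" "0 < U"
    and bad: "B * (T * U) < f (t + T) (u + U) - f (t + T) u - f t (u + U) + f t u"
  shows "\<exists>i<m. \<exists>j<l. B * (T / real m * (U / real l)) <
     f (t + real i * (T / m) + T / m) (u + real j * (U / l) + U / l) - f (t + real i * (T / m) + T / m) (u + real j * (U / l))
     - f (t + real i * (T / m)) (u + real j * (U / l) + U / l) + f (t + real i * (T / m)) (u + real j * (U / l))"
proof (rule ccontr)
  assume neg: "\<not> ?thesis"
  define F where "F i j = f (t + real i * (T / m)) (u + real j * (U / l))" for i j
  have F: "(F (Suc i) (Suc j) - F i (Suc j)) - (F (Suc i) j - F i j) \<le> B * (T / real m * (U / real l))" if "i < m" "j < l" for i j
  proof -
    have eq: "t + real (Suc i) * (T / m) = t + real i * (T / m) + T / m"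
      "u + real (Suc j) * (U / l) = u + real j * (U / l) + U / l"
      by (simp_all add: algebra_simps add_divide_distrib)
    show ?thesis proof -
      have "\<not> (B * (T / real m * (U / real l)) <
        f (t + real i * (T / m) + T / m) (u + real j * (U / l) + U / l) - f (t + real i * (T / m) + T / m) (u + real j * (U / l))
        - f (t + real i * (T / m)) (u + real j * (U / l) + U / l) + f (t + real i * (T / m)) (u + real j * (U / l)))"
        using neg that by blast
      then show ?thesis unfolding F_def eq by linarith
    qed
  qed
  have "(\<Sum>i<m. \<Sum>j<l. (F (Suc i) (Suc j) - F i (Suc j)) - (F (Suc i) j - F i j)) \<le> (\<Sum>i<m. \<Sum>j<l. B * (T / real m * (U / real l)))"
    by (intro sum_mono F) auto
  also have "\<dots> = B * (T * U)" using m by simp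
  also have "(\<Sum>i<m. \<Sum>j<l. (F (Suc i) (Suc j) - F i (Suc j)) - (F (Suc i) j - F i j))
     = (\<Sum>i<m. (F (Suc i) l - F i l) - (F (Suc i) 0 - F i 0))"
    by (intro sum.cong refl) (rule sum_lessThan_telescope)
  also have "\<dots> = (\<Sum>i<m. F (Suc i) l - F i l) - (\<Sum>i<m. F (Suc i) 0 - F i 0)"
    by (simp add: sum_subtractf)
  also have "\<dots> = (F m l - F 0 l) - (F m 0 - F 0 0)"
    by (simp only: sum_lessThan_telescope[of "\<lambda>i. F i l"] sum_lessThan_telescope[of "\<lambda>i. F i 0"])
  also have "\<dots> = f (t + T) (u + U) - f t (u + U) - f (t + T) u + f t u"
    using m by (simp add: F_def)
  finally show False using bad by simp
qed

text \<open>The desired aspect ratio depends on the limit point, which is known only after passing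
  to a subsequence. Hence two subdivisions: equal grids in both directions produce the limit point
  \<open>(a, b)\<close>, and another grid inside the selected cells adjusts the ratio to
  \<open>\<rho> a b\<close>.\<close>

lemma bad_rectangles:
  fixes f \<rho> :: "real \<Rightarrow> real \<Rightarrow> real"
  assumes tu: "t0 < t1" "u0 < u1"
    and bad: "B * ((t1 - t0) * (u1 - u0)) < f t1 u1 - f t1 u0 - f t0 u1 + f t0 u0"
    and \<rho>: "\<And>t u. t0 \<le> t \<Longrightarrow> t \<le> t1 \<Longrightarrow> u0 \<le> u \<Longrightarrow> u \<le> u1 \<Longrightarrow> 0 < \<rho> t u"
  obtains t \<tau> u \<upsilon> a b where "t \<longlonglongrightarrow> a" "u \<longlonglongrightarrow> b" "\<tau> \<longlonglongrightarrow> 0" "\<upsilon> \<longlonglongrightarrow> 0"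
    "(\<lambda>n. \<upsilon> n / \<tau> n) \<longlonglongrightarrow> \<rho> a b" "t0 \<le> a" "a \<le> t1" "u0 \<le> b" "b \<le> u1"
    "\<And>n::nat. t0 \<le> t n" "\<And>n. u0 \<le> u n" "\<And>n. 0 < \<tau> n" "\<And>n. 0 < \<upsilon> n" "\<And>n. t n + \<tau> n \<le> t1" "\<And>n. u n + \<upsilon> n \<le> u1"
    "\<And>n. B * (\<tau> n * \<upsilon> n) \<le> f (t n + \<tau> n) (u n + \<upsilon> n) - f (t n + \<tau> n) (u n) - f (t n) (u n + \<upsilon> n) + f (t n) (u n)"
proof -
  define T where "T = t1 - t0"
  define U where "U = u1 - u0"
  have TU: "0 < T" "0 < U" using tu by (auto simp: T_def U_def)
  define M where "M t \<tau> u \<upsilon> = f (t + \<tau>) (u + \<upsilon>) - f (t + \<tau>) u - f t (u + \<upsilon>) + f t u" for t \<tau> u \<upsilon>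
  have inside: "p0 \<le> p0 + real i * (P / real m) \<and> p0 + real i * (P / real m) + P / real m \<le> p0 + P"
    if "i < m" "0 < P" for i m :: nat and p0 P :: real
  proof -
    have "real i + 1 \<le> real m" using that by linarith
    then have "(real i + 1) * (P / real m) \<le> real m * (P / real m)"
      using that by (intro mult_right_mono) auto
    moreover have "real m * (P / real m) = P" using that by simp
    ultimately have "real i * (P / real m) + P / real m \<le> P" by (simp only: distrib_right mult_1)
    moreover have "0 \<le> real i * (P / real m)" using that by simp
    ultimately show ?thesis by simp
  qed
  have grid: "\<exists>p' q'. p \<le> p' \<and> p' + P / real m \<le> p + P \<and> q \<le> q' \<and> q' + Q / real l \<le> q + Q \<and> B * (P / real m * (Q / real l)) < M p' (P / real m) q' (Q / real l)"
    if "0 < m" "0 < l" "0 < P" "0 < Q" "B * (P * Q) < M p P q Q" for m l :: nat and p q P Q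
  proof -
    from grid_bad[of m l P Q B f p q] that obtain i j where ij: "i < m" "j < l"
      "B * (P / real m * (Q / real l)) < M (p + real i * (P / m)) (P / m) (q + real j * (Q / l)) (Q / l)"
      unfolding M_def by auto
    then show ?thesis using inside[of i m P p] inside[of j l Q q] that by blast
  qed
  have bad': "B * (T * U) < M t0 T u0 U"
    using bad by (simp add: M_def T_def U_def)
  have "\<exists>p' q'. t0 \<le> p' \<and> p' + T / real (Suc n) \<le> t0 + T \<and> u0 \<le> q' \<and> q' + U / real (Suc n) \<le> u0 + U \<and> B * (T / real (Suc n) * (U / real (Suc n))) < M p' (T / real (Suc n)) q' (U / real (Suc n))" for n
    using grid[of "Suc n" "Suc n" T U t0 u0] TU bad' by simp
  then have "\<forall>n. \<exists>p' q'. t0 \<le> p' \<and> p' + T / real (Suc n) \<le> t0 + T \<and> u0 \<le> q' \<and> q' + U / real (Suc n) \<le> u0 + U \<and> B * (T / real (Suc n) * (U / real (Suc n))) < M p' (T / real (Suc n)) q' (U / real (Suc n))"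
    by (rule allI)
  from this[unfolded choice_iff] obtain p q where pq': "\<forall>n. t0 \<le> p n \<and> p n + T / real (Suc n) \<le> t0 + T \<and> u0 \<le> q n \<and> q n + U / real (Suc n) \<le> u0 + U \<and> B * (T / real (Suc n) * (U / real (Suc n))) < M (p n) (T / real (Suc n)) (q n) (U / real (Suc n))"
    by (elim exE)
  have pq: "t0 \<le> p n" "p n + T / real (Suc n) \<le> t0 + T" "u0 \<le> q n" "q n + U / real (Suc n) \<le> u0 + U"
    "B * (T / real (Suc n) * (U / real (Suc n))) < M (p n) (T / real (Suc n)) (q n) (U / real (Suc n))" for n
    using pq' by auto
  have Tn: "0 < T / real (Suc n)" "0 < U / real (Suc n)" for n using TU by auto
  have inn: "\<forall>n. (p n, q n) \<in> {t0..t1} \<times> {u0..u1}"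
  proof
    show "(p n, q n) \<in> {t0..t1} \<times> {u0..u1}" for n
      using pq(1-4)[of n] Tn[of n] unfolding T_def U_def by (auto simp del: of_nat_Suc)
  qed
  have sc: "seq_compact ({t0..t1} \<times> {u0..u1})"
    by (intro compact_imp_seq_compact compact_Times) auto
  from seq_compactE[OF sc inn] obtain z r where z: "z \<in> {t0..t1} \<times> {u0..u1}" "strict_mono (r :: nat \<Rightarrow> nat)" "((\<lambda>n. (p n, q n)) \<circ> r) \<longlonglongrightarrow> z"
    by blast
  obtain a b where ab: "z = (a, b)" by force
  have pr: "(\<lambda>n. p (r n)) \<longlonglongrightarrow> a" "(\<lambda>n. q (r n)) \<longlonglongrightarrow> b"
    using tendsto_fst[OF z(3)] tendsto_snd[OF z(3)] ab by (auto simp: o_def)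
  \<comment> \<open>A cell of the first grid has sides in the ratio \<open>U / T\<close>. Cutting it
    into \<open>m n\<close> by \<open>Suc n\<close> pieces, with \<open>m n / Suc n\<close> tending
    to \<open>R\<close>, changes this ratio to \<open>\<rho> a b\<close> in the limit.\<close>
  define R where "R = \<rho> a b * (T / U)"
  have R: "0 < R" using \<rho>[of a b] z(1) ab TU by (simp add: R_def)
  define m where "m n = nat \<lceil>R * real (Suc n)\<rceil>" for n
  have m: "0 < m n" for n using R by (simp add: m_def)
  have m_real: "R * real (Suc n) \<le> real (m n)" "real (m n) \<le> R * real (Suc n) + 1" for n
  proof -
    have "0 < R * real (Suc n)" using R by simp
    then have "real (m n) = of_int \<lceil>R * real (Suc n)\<rceil>" unfolding m_def by (intro of_nat_nat) linarith
    then show "R * real (Suc n) \<le> real (m n)" "real (m n) \<le> R * real (Suc n) + 1" by linarith+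
  qed
  have ex: "\<exists>p' q'. p (r n) \<le> p' \<and> p' + T / real (Suc (r n)) / real (m n) \<le> p (r n) + T / real (Suc (r n)) \<and>
     q (r n) \<le> q' \<and> q' + U / real (Suc (r n)) / real (Suc n) \<le> q (r n) + U / real (Suc (r n)) \<and>
     B * (T / real (Suc (r n)) / real (m n) * (U / real (Suc (r n)) / real (Suc n))) < M p' (T / real (Suc (r n)) / real (m n)) q' (U / real (Suc (r n)) / real (Suc n))" for n
    by (rule grid[OF m _ Tn pq(5)]) simp
  then have "\<forall>n. \<exists>p' q'. p (r n) \<le> p' \<and> p' + T / real (Suc (r n)) / real (m n) \<le> p (r n) + T / real (Suc (r n)) \<and>
     q (r n) \<le> q' \<and> q' + U / real (Suc (r n)) / real (Suc n) \<le> q (r n) + U / real (Suc (r n)) \<and>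
     B * (T / real (Suc (r n)) / real (m n) * (U / real (Suc (r n)) / real (Suc n))) < M p' (T / real (Suc (r n)) / real (m n)) q' (U / real (Suc (r n)) / real (Suc n))" by (rule allI)
  from this[unfolded choice_iff] obtain t u where tu'': "\<forall>n. p (r n) \<le> t n \<and> t n + T / real (Suc (r n)) / real (m n) \<le> p (r n) + T / real (Suc (r n)) \<and>
     q (r n) \<le> u n \<and> u n + U / real (Suc (r n)) / real (Suc n) \<le> q (r n) + U / real (Suc (r n)) \<and>
     B * (T / real (Suc (r n)) / real (m n) * (U / real (Suc (r n)) / real (Suc n))) < M (t n) (T / real (Suc (r n)) / real (m n)) (u n) (U / real (Suc (r n)) / real (Suc n))"
    by (elim exE)
  have tu': "p (r n) \<le> t n" "t n + T / real (Suc (r n)) / real (m n) \<le> p (r n) + T / real (Suc (r n))"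
     "q (r n) \<le> u n" "u n + U / real (Suc (r n)) / real (Suc n) \<le> q (r n) + U / real (Suc (r n))"
     "B * (T / real (Suc (r n)) / real (m n) * (U / real (Suc (r n)) / real (Suc n))) < M (t n) (T / real (Suc (r n)) / real (m n)) (u n) (U / real (Suc (r n)) / real (Suc n))" for n
    using tu'' by auto
  define \<tau> where "\<tau> n = T / real (Suc (r n)) / real (m n)" for n
  define \<upsilon> where "\<upsilon> n = U / real (Suc (r n)) / real (Suc n)" for n
  have pos: "0 < \<tau> n" "0 < \<upsilon> n" for n unfolding \<tau>_def \<upsilon>_def using TU m[of n] by simp_all
  have lim0: "(\<lambda>n. T / real (Suc (r n))) \<longlonglongrightarrow> 0" "(\<lambda>n. U / real (Suc (r n))) \<longlonglongrightarrow> 0"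
    using LIMSEQ_subseq_LIMSEQ[OF lim_const_over_n[THEN LIMSEQ_Suc, of T] z(2)]
      LIMSEQ_subseq_LIMSEQ[OF lim_const_over_n[THEN LIMSEQ_Suc, of U] z(2)] by (simp_all add: o_def)
  have le: "t n \<le> p (r n) + T / real (Suc (r n))" "\<tau> n \<le> T / real (Suc (r n))"
    "u n \<le> q (r n) + U / real (Suc (r n))" "\<upsilon> n \<le> U / real (Suc (r n))" for n
    using tu'(1-4)[of n] pos[of n] unfolding \<tau>_def \<upsilon>_def by linarith+
  have lt: "t \<longlonglongrightarrow> a"
    by (rule tendsto_sandwich[OF _ _ pr(1)]) (use tu'(1) le(1) tendsto_add[OF pr(1) lim0(1)] in auto)
  have lu: "u \<longlonglongrightarrow> b"
    by (rule tendsto_sandwich[OF _ _ pr(2)]) (use tu'(3) le(3) tendsto_add[OF pr(2) lim0(2)] in auto)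
  have l\<tau>: "\<tau> \<longlonglongrightarrow> 0"
    by (rule tendsto_sandwich[OF _ _ tendsto_const lim0(1)]) (use less_imp_le[OF pos(1)] less_imp_le[OF pos(2)] le in auto)
  have l\<upsilon>: "\<upsilon> \<longlonglongrightarrow> 0"
    by (rule tendsto_sandwich[OF _ _ tendsto_const lim0(2)]) (use less_imp_le[OF pos(1)] less_imp_le[OF pos(2)] le in auto)
  have "(\<lambda>n. real (m n) / real (Suc n)) \<longlonglongrightarrow> R"
  proof (rule tendsto_sandwich[OF _ _ tendsto_const])
    show "\<forall>\<^sub>F n in sequentially. R \<le> real (m n) / real (Suc n)"
      using m_real(1) by (auto simp: field_simps simp del: of_nat_Suc)
    show "\<forall>\<^sub>F n in sequentially. real (m n) / real (Suc n) \<le> R + 1 / real (Suc n)"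
      using m_real(2) by (auto simp: field_simps simp del: of_nat_Suc)
    show "(\<lambda>n. R + 1 / real (Suc n)) \<longlonglongrightarrow> R"
      using tendsto_add[OF tendsto_const lim_const_over_n[THEN LIMSEQ_Suc, of 1], of R] by simp
  qed
  then have "(\<lambda>n. U / T * (real (m n) / real (Suc n))) \<longlonglongrightarrow> U / T * R"
    by (rule tendsto_mult_left)
  moreover have "\<upsilon> n / \<tau> n = U / T * (real (m n) / real (Suc n))" for n
    unfolding \<upsilon>_def \<tau>_def using TU m[of n] by (simp del: of_nat_Suc)
  moreover have "U / T * R = \<rho> a b" using TU by (simp add: R_def)
  ultimately have l\<rho>: "(\<lambda>n. \<upsilon> n / \<tau> n) \<longlonglongrightarrow> \<rho> a b" by simp
  show thesis
  proof (rule that[OF lt lu l\<tau> l\<upsilon> l\<rho>])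
    show "t0 \<le> a" "a \<le> t1" "u0 \<le> b" "b \<le> u1" using z(1) ab by auto
    show "t0 \<le> t n" "u0 \<le> u n" for n using pq(1,3)[of "r n"] tu'(1,3)[of n] by linarith+
    show "0 < \<tau> n" "0 < \<upsilon> n" for n using pos by auto
    show "t n + \<tau> n \<le> t1" "u n + \<upsilon> n \<le> u1" for n
      using pq(2,4)[of "r n"] tu'(2,4)[of n] unfolding \<tau>_def \<upsilon>_def T_def U_def by linarith+
    show "B * (\<tau> n * \<upsilon> n) \<le> f (t n + \<tau> n) (u n + \<upsilon> n) - f (t n + \<tau> n) (u n) - f (t n) (u n + \<upsilon> n) + f (t n) (u n)" for n
      using tu'(5)[of n] unfolding \<tau>_def \<upsilon>_def M_def by linarith
  qed
qed

section \<open>One-sided slope bounds\<close>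

context curv
begin

text \<open>The four-point inequality for the common start, a point of one geodesic and two
  neighbouring points of the other, divided by \<open>\<tau> n\<close>. Both signs have the same
  first-order limit. It bounds the scaled slope \<open>x\<close> in terms of \<open>J\<close> alone
  and so provides the initial estimate of the bootstrap.\<close>

lemma slope_limit:
  fixes t u \<tau> h00 h10 :: "nat \<Rightarrow> real"
  assumes t: "t \<longlonglongrightarrow> a" and u: "u \<longlonglongrightarrow> b" and ab: "0 < S a" "0 < S b" "0 < 1 + C a"
    and \<tau>: "\<tau> \<longlonglongrightarrow> 0" "\<And>n. 0 < \<tau> n"
    and h: "h00 \<longlonglongrightarrow> h" "h10 \<longlonglongrightarrow> h"
    and E: "(\<lambda>n. (h10 n - h00 n) / \<tau> n) \<longlonglongrightarrow> E"
    and ineq: "(\<forall>n. k * ((h10 n + C (u n) * C (\<tau> n)) * (1 + C (t n)) - (C (u n) + h00 n) * (C (\<tau> n) + C (t n + \<tau> n)))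
        \<le> S (u n) * S (\<tau> n) * (1 + C (t n))) \<or>
      (\<forall>n. - k * ((h00 n + C (u n) * C (\<tau> n)) * (1 + C (t n + \<tau> n)) - (C (u n) + h10 n) * (C (\<tau> n) + C (t n)))
        \<le> S (u n) * S (\<tau> n) * (1 + C (t n + \<tau> n)))"
    and J: "h = C a * C b + k * S a * S b * J"
    and x: "E = - k * S a * C b + k * C a * S b * J + k * S b * x"
  shows "x \<le> 1 - J"
proof -
  define dC where "dC n = (C (t n + \<tau> n) - C (t n)) / \<tau> n" for n
  define e where "e n = (h10 n - h00 n) / \<tau> n" for n
  define g where "g n = (1 - C (\<tau> n)) / \<tau> n" for n
  have lim: "dC \<longlonglongrightarrow> - k * S a" "g \<longlonglongrightarrow> 0" "(\<lambda>n. S (\<tau> n) / \<tau> n) \<longlonglongrightarrow> 1" "(\<lambda>n. C (\<tau> n)) \<longlonglongrightarrow> 1" "(\<lambda>n. C (t n + \<tau> n)) \<longlonglongrightarrow> C a"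
    unfolding dC_def g_def using LIM_diff[OF t \<tau>] tendsto_C[OF \<tau>(1)] tendsto_C[OF tendsto_add[OF t \<tau>(1)]] by simp_all
  note E' = E[folded e_def]
  have eq: "e n * \<tau> n = h10 n - h00 n" "g n * \<tau> n = 1 - C (\<tau> n)" "dC n * \<tau> n = C (t n + \<tau> n) - C (t n)"
     "S (\<tau> n) / \<tau> n * \<tau> n = S (\<tau> n)" for n
    unfolding e_def g_def dC_def using \<tau>(2)[of n] by auto
  have main: "k * (E * (1 + C a) + (h + C b) * (k * S a)) \<le> S b * (1 + C a)"
    using ineq
  proof
    assume *: "\<forall>n. k * ((h10 n + C (u n) * C (\<tau> n)) * (1 + C (t n)) - (C (u n) + h00 n) * (C (\<tau> n) + C (t n + \<tau> n)))
        \<le> S (u n) * S (\<tau> n) * (1 + C (t n))"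
    have key: "k * (e n * (1 + C (t n)) + (h00 n + C (u n)) * (g n - dC n) - C (u n) * g n * (1 + C (t n)))
      \<le> S (u n) * (S (\<tau> n) / \<tau> n) * (1 + C (t n))" for n
    proof (rule mult_right_le_imp_le[OF _ \<tau>(2)[of n]])
      have "k * (e n * (1 + C (t n)) + (h00 n + C (u n)) * (g n - dC n) - C (u n) * g n * (1 + C (t n))) * \<tau> n
        = k * ((e n * \<tau> n) * (1 + C (t n)) + (h00 n + C (u n)) * (g n * \<tau> n - dC n * \<tau> n) - C (u n) * (g n * \<tau> n) * (1 + C (t n)))"
        by (simp add: algebra_simps)
      also have "\<dots> = k * ((h10 n + C (u n) * C (\<tau> n)) * (1 + C (t n)) - (C (u n) + h00 n) * (C (\<tau> n) + C (t n + \<tau> n)))"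
        unfolding eq by (simp add: algebra_simps)
      also have "\<dots> \<le> S (u n) * (S (\<tau> n) / \<tau> n * \<tau> n) * (1 + C (t n))" unfolding eq using * by simp
      finally show "k * (e n * (1 + C (t n)) + (h00 n + C (u n)) * (g n - dC n) - C (u n) * g n * (1 + C (t n))) * \<tau> n
        \<le> S (u n) * (S (\<tau> n) / \<tau> n) * (1 + C (t n)) * \<tau> n" by (simp only: mult.assoc mult.commute mult.left_commute)
    qed
    have l: "(\<lambda>n. k * (e n * (1 + C (t n)) + (h00 n + C (u n)) * (g n - dC n) - C (u n) * g n * (1 + C (t n)))) \<longlonglongrightarrow> k * (E * (1 + C a) + (h + C b) * (0 - (- k * S a)) - C b * 0 * (1 + C a))"
      by (intro tendsto_intros lim E' h t u)
    have r: "(\<lambda>n. S (u n) * (S (\<tau> n) / \<tau> n) * (1 + C (t n))) \<longlonglongrightarrow> S b * 1 * (1 + C a)"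
      by (intro tendsto_intros lim E' h t u)
    have "k * (E * (1 + C a) + (h + C b) * (0 - (- k * S a)) - C b * 0 * (1 + C a)) \<le> S b * 1 * (1 + C a)"
      by (rule LIMSEQ_le[OF l r]) (use key in blast)
    then show ?thesis by simp
  next
    assume *: "\<forall>n. - k * ((h00 n + C (u n) * C (\<tau> n)) * (1 + C (t n + \<tau> n)) - (C (u n) + h10 n) * (C (\<tau> n) + C (t n)))
        \<le> S (u n) * S (\<tau> n) * (1 + C (t n + \<tau> n))"
    have key: "k * (e n * (C (\<tau> n) + C (t n)) + (h00 n + C (u n)) * (- g n - dC n) + C (u n) * g n * (1 + C (t n + \<tau> n)))
      \<le> S (u n) * (S (\<tau> n) / \<tau> n) * (1 + C (t n + \<tau> n))" for n
    proof (rule mult_right_le_imp_le[OF _ \<tau>(2)[of n]])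
      have "k * (e n * (C (\<tau> n) + C (t n)) + (h00 n + C (u n)) * (- g n - dC n) + C (u n) * g n * (1 + C (t n + \<tau> n))) * \<tau> n
        = k * ((e n * \<tau> n) * (C (\<tau> n) + C (t n)) + (h00 n + C (u n)) * (- (g n * \<tau> n) - dC n * \<tau> n) + C (u n) * (g n * \<tau> n) * (1 + C (t n + \<tau> n)))"
        by (simp add: algebra_simps)
      also have "\<dots> = - k * ((h00 n + C (u n) * C (\<tau> n)) * (1 + C (t n + \<tau> n)) - (C (u n) + h10 n) * (C (\<tau> n) + C (t n)))"
        unfolding eq by (simp add: algebra_simps)
      also have "\<dots> \<le> S (u n) * (S (\<tau> n) / \<tau> n * \<tau> n) * (1 + C (t n + \<tau> n))" unfolding eq using * by simp
      finally show "k * (e n * (C (\<tau> n) + C (t n)) + (h00 n + C (u n)) * (- g n - dC n) + C (u n) * g n * (1 + C (t n + \<tau> n))) * \<tau> n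
        \<le> S (u n) * (S (\<tau> n) / \<tau> n) * (1 + C (t n + \<tau> n)) * \<tau> n" by (simp only: mult.assoc mult.commute mult.left_commute)
    qed
    have l: "(\<lambda>n. k * (e n * (C (\<tau> n) + C (t n)) + (h00 n + C (u n)) * (- g n - dC n) + C (u n) * g n * (1 + C (t n + \<tau> n)))) \<longlonglongrightarrow> k * (E * (1 + C a) + (h + C b) * (- 0 - (- k * S a)) + C b * 0 * (1 + C a))"
      by (intro tendsto_intros lim E' h t u)
    have r: "(\<lambda>n. S (u n) * (S (\<tau> n) / \<tau> n) * (1 + C (t n + \<tau> n))) \<longlonglongrightarrow> S b * 1 * (1 + C a)"
      by (intro tendsto_intros lim E' h t u)
    have "k * (E * (1 + C a) + (h + C b) * (- 0 - (- k * S a)) + C b * 0 * (1 + C a)) \<le> S b * 1 * (1 + C a)"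
      by (rule LIMSEQ_le[OF l r]) (use key in blast)
    then show ?thesis by simp
  qed
  have kE: "k * E = - S a * C b + C a * S b * J + S b * x"
    unfolding x using k by auto
  have kS: "k * (S a * S a) = 1 - C a * C a"
    using C_sq[of a] by (simp add: power2_eq_square)
  have "k * (E * (1 + C a) + (h + C b) * (k * S a)) = (k * E) * (1 + C a) + (h + C b) * S a"
    using k by auto
  then have "(k * E) * (1 + C a) + (h + C b) * S a \<le> S b * (1 + C a)" using main by simp
  moreover have "(k * E) * (1 + C a) + (h + C b) * S a = (C a * S b * J + S b * x) * (1 + C a) + (k * (S a * S a)) * (S b * J)"
    unfolding kE J by (simp add: algebra_simps)
  moreover have "\<dots> = (J + x) * (S b * (1 + C a))" unfolding kS by (simp add: algebra_simps)
  ultimately have "(J + x) * (S b * (1 + C a)) \<le> 1 * (S b * (1 + C a))" by simp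
  moreover have "0 < S b * (1 + C a)" using ab by simp
  ultimately have "J + x \<le> 1" by (rule mult_right_le_imp_le)
  then show ?thesis by simp
qed

lemma C_lipschitz:
  assumes "0 \<le> x" "0 \<le> y" "x \<le> M" "y \<le> M"
  shows "\<bar>C x - C y\<bar> \<le> cosh M * \<bar>x - y\<bar>"
proof -
  have "norm (C x - C y) \<le> cosh M * norm (x - y)"
  proof (rule field_differentiable_bound[of "{0..M}" C "\<lambda>z. - k * S z"])
    show "norm (- k * S z) \<le> cosh M" if "z \<in> {0..M}" for z
    proof -
      have "\<bar>S z\<bar> \<le> cosh M"
      proof (cases "k = 1")
        case True
        then show ?thesis using abs_sin_le_one[of z] cosh_real_ge_1[of M] by (simp add: sn_def del: abs_sin_le_one)
      next
        case False
        then have "\<bar>S z\<bar> = sinh z" using that by (simp add: sn_def)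
        also have "\<dots> \<le> cosh z" using sinh_less_cosh_real[of z] by simp
        also have "\<dots> \<le> cosh M" using that by (simp add: cosh_real_nonneg_le_iff)
        finally show ?thesis .
      qed
      then show ?thesis using k by (auto simp: abs_mult)
    qed
    show "(C has_field_derivative - k * S z) (at z within {0..M})" for z
      using DERIV_C[OF DERIV_ident, of z "{0..M}"] by simp
  qed (use assms in auto)
  then show ?thesis by simp
qed

end

section \<open>Metric spaces, of diameter at most \<open>pi / 2\<close> if \<open>k = 1\<close>, and
  comparison angles\<close>

locale mspace = curv +
  fixes X :: "'a set" and d :: "'a \<Rightarrow> 'a \<Rightarrow> real"
  assumes met: "metric_on X d"
    and bnd: "k = 1 \<Longrightarrow> x \<in> X \<Longrightarrow> y \<in> X \<Longrightarrow> d x y \<le> pi / 2"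
begin

lemma d_comm: "x \<in> X \<Longrightarrow> y \<in> X \<Longrightarrow> d x y = d y x"
  and d_nn: "x \<in> X \<Longrightarrow> y \<in> X \<Longrightarrow> 0 \<le> d x y"
  and d_zero: "x \<in> X \<Longrightarrow> y \<in> X \<Longrightarrow> d x y = 0 \<longleftrightarrow> x = y"
  and d_tri: "x \<in> X \<Longrightarrow> y \<in> X \<Longrightarrow> z \<in> X \<Longrightarrow> d x z \<le> d x y + d y z"
  using met unfolding metric_on_def semimetric_on_def by blast+

lemma d_self [simp]: "x \<in> X \<Longrightarrow> d x x = 0" using d_zero by blast

lemma d_pos: "x \<in> X \<Longrightarrow> y \<in> X \<Longrightarrow> x \<noteq> y \<Longrightarrow> 0 < d x y"
  using d_nn[of x y] d_zero[of x y] by linarith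

lemma Cd_nn: "x \<in> X \<Longrightarrow> y \<in> X \<Longrightarrow> 0 \<le> C (d x y)"
  using bnd[of x y] d_nn[of x y] by (intro C_nonneg) auto

lemma Sd_nn: "x \<in> X \<Longrightarrow> y \<in> X \<Longrightarrow> 0 \<le> S (d x y)"
  using bnd[of x y] d_nn[of x y] by (intro S_nonneg) auto

lemma geod_bnd: "geod X d \<alpha> l \<Longrightarrow> k = 1 \<Longrightarrow> l \<le> pi / 2"
  using geodD[of X d \<alpha> l] bnd[of "\<alpha> 0" "\<alpha> l"] by force

lemma geod_S_pos: "geod X d \<alpha> l \<Longrightarrow> 0 < t \<Longrightarrow> t \<le> l \<Longrightarrow> 0 < S t"
  using geod_bnd[of \<alpha> l] by (intro S_pos) (auto intro: order_le_less_trans[of t "pi/2"])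

lemma geod_C_nn: "geod X d \<alpha> l \<Longrightarrow> 0 \<le> t \<Longrightarrow> t \<le> l \<Longrightarrow> 0 \<le> C t"
  using geod_bnd[of \<alpha> l] by (intro C_nonneg) auto

lemma dist_lip:
  assumes "geod X d \<alpha> T" "geod X d \<beta> U" "0 \<le> t" "t \<le> T" "0 \<le> t'" "t' \<le> T" "0 \<le> u" "u \<le> U" "0 \<le> u'" "u' \<le> U"
  shows "\<bar>d (\<alpha> t) (\<beta> u) - d (\<alpha> t') (\<beta> u')\<bar> \<le> \<bar>t - t'\<bar> + \<bar>u - u'\<bar>"
proof -
  have X: "\<alpha> t \<in> X" "\<alpha> t' \<in> X" "\<beta> u \<in> X" "\<beta> u' \<in> X"
    using geodD(2)[OF assms(1)] geodD(2)[OF assms(2)] assms by auto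
  have "d (\<alpha> t) (\<alpha> t') = \<bar>t - t'\<bar>" "d (\<alpha> t') (\<alpha> t) = \<bar>t - t'\<bar>" "d (\<beta> u) (\<beta> u') = \<bar>u - u'\<bar>" "d (\<beta> u') (\<beta> u) = \<bar>u - u'\<bar>"
    using geodD(3)[OF assms(1)] geodD(3)[OF assms(2)] assms by auto
  then show ?thesis
    using d_tri[of "\<alpha> t" "\<alpha> t'" "\<beta> u"] d_tri[of "\<alpha> t'" "\<beta> u'" "\<beta> u"]
      d_tri[of "\<alpha> t'" "\<alpha> t" "\<beta> u'"] d_tri[of "\<alpha> t" "\<beta> u" "\<beta> u'"] X by linarith
qed

text \<open>By the law of cosines of the model plane this is the cosine of the comparison angle,
  provided that \<open>\<alpha>\<close> and \<open>\<beta>\<close> start at the same point.\<close>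

definition J :: "(real \<Rightarrow> 'a) \<Rightarrow> (real \<Rightarrow> 'a) \<Rightarrow> real \<Rightarrow> real \<Rightarrow> real" where
  "J \<alpha> \<beta> t u = k * (C (d (\<alpha> t) (\<beta> u)) - C t * C u) / (S t * S u)"

lemma J_eq:
  assumes "S t \<noteq> 0" "S u \<noteq> 0"
  shows "C (d (\<alpha> t) (\<beta> u)) = C t * C u + k * S t * S u * J \<alpha> \<beta> t u"
  unfolding J_def using assms by (simp add: mult.assoc)

text \<open>The triangle inequalities, put through \<open>k * C\<close>: the values of
  \<open>C\<close> at the sum and at the difference of two sides are those that belong to the angle
  cosines -1 and 1.\<close>

lemma cosine_bounds:
  assumes X: "A \<in> X" "P \<in> X" "Q \<in> X" and pos: "0 < S (d A P)" "0 < S (d A Q)"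
  shows "-1 \<le> k * (C (d P Q) - C (d A P) * C (d A Q)) / (S (d A P) * S (d A Q))"
    and "k * (C (d P Q) - C (d A P) * C (d A Q)) / (S (d A P) * S (d A Q)) \<le> 1"
proof -
  have a: "d P Q \<le> d A P + d A Q" "\<bar>d A P - d A Q\<bar> \<le> d P Q"
    using d_tri[of P A Q] d_tri[of A P Q] d_tri[of A Q P] d_comm[of A P] d_comm[of P Q] X by auto
  have "k * C (d A P + d A Q) \<le> k * C (d P Q)"
    using a(1) bnd[of A P] bnd[of A Q] d_nn[of P Q] X by (intro kC_mono) auto
  moreover have "k * C (d P Q) \<le> k * C \<bar>d A P - d A Q\<bar>"
    using a(2) bnd[of P Q] X by (intro kC_mono) auto
  ultimately have "- (S (d A P) * S (d A Q)) \<le> k * (C (d P Q) - C (d A P) * C (d A Q))"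
    "k * (C (d P Q) - C (d A P) * C (d A Q)) \<le> S (d A P) * S (d A Q)"
    unfolding C_abs C_add C_diff using k by (auto simp: algebra_simps)
  moreover have "0 < S (d A P) * S (d A Q)" using pos by simp
  ultimately show "-1 \<le> k * (C (d P Q) - C (d A P) * C (d A Q)) / (S (d A P) * S (d A Q))"
    "k * (C (d P Q) - C (d A P) * C (d A Q)) / (S (d A P) * S (d A Q)) \<le> 1"
    by (simp_all add: pos_le_divide_eq pos_divide_le_eq del: zero_less_mult_iff)
qed

lemma J_bounds:
  assumes "geod X d \<alpha> T" "geod X d \<beta> U" "\<alpha> 0 = \<beta> 0" "0 < t" "t \<le> T" "0 < u" "u \<le> U"
  shows "-1 \<le> J \<alpha> \<beta> t u" "J \<alpha> \<beta> t u \<le> 1"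
proof -
  have "d (\<alpha> 0) (\<alpha> t) = t" "d (\<alpha> 0) (\<beta> u) = u" "\<alpha> 0 \<in> X" "\<alpha> t \<in> X" "\<beta> u \<in> X"
    using geodD(2)[OF assms(1)] geodD(3)[OF assms(1), of 0 t] geodD(2)[OF assms(2)] geodD(3)[OF assms(2), of 0 u] assms(4-) unfolding assms(3) by auto
  then show "-1 \<le> J \<alpha> \<beta> t u" "J \<alpha> \<beta> t u \<le> 1"
    using cosine_bounds[of "\<alpha> 0" "\<alpha> t" "\<beta> u"] geod_S_pos[OF assms(1,4,5)] geod_S_pos[OF assms(2,6,7)]
    unfolding J_def by auto
qed

end

section \<open>Local consequences of the four-point inequality\<close>

locale fourpt = mspace +
  fixes sg :: real
  assumes sg: "sg = 1 \<or> sg = -1"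
    and four: "\<And>P1 P2 P3 P4. P1 \<in> X \<Longrightarrow> P2 \<in> X \<Longrightarrow> P3 \<in> X \<Longrightarrow> P4 \<in> X \<Longrightarrow>
      sg * k * ((C (d P2 P3) + C (d P1 P2) * C (d P3 P4)) * (1 + C (d P1 P4))
        - (C (d P1 P2) + C (d P2 P4)) * (C (d P3 P4) + C (d P1 P3)))
      \<le> S (d P1 P2) * S (d P3 P4) * (1 + C (d P1 P4))"
begin

text \<open>The sign decides how the corners are numbered: for \<open>sg = -1\<close> the short
  distances \<open>\<tau>\<close> and \<open>\<upsilon>\<close> are those of \<open>P1\<close>,
  \<open>P3\<close> and of \<open>P2\<close>, \<open>P4\<close>; for \<open>sg = 1\<close> those of
  \<open>P1\<close>, \<open>P4\<close> and of \<open>P2\<close>, \<open>P3\<close>. In both cases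
  \<open>P1 P2\<close> and \<open>P3 P4\<close>, whose \<open>S\<close> stand on the right, join the
  two geodesics, and \<open>mult_S_le\<close> applies to them.\<close>

lemma corner:
  assumes g: "geod X d \<alpha> T" "geod X d \<beta> U"
    and b: "0 \<le> t" "0 < \<tau>" "t + \<tau> \<le> T" "0 \<le> u" "0 < \<upsilon>" "u + \<upsilon> \<le> U"
    and pos: "0 < d (\<alpha> t) (\<beta> u)" "0 < d (\<alpha> (t + \<tau>)) (\<beta> (u + \<upsilon>))"
    and h: "h00 = C (d (\<alpha> t) (\<beta> u))" "h10 = C (d (\<alpha> (t + \<tau>)) (\<beta> u))"
      "h01 = C (d (\<alpha> t) (\<beta> (u + \<upsilon>)))" "h11 = C (d (\<alpha> (t + \<tau>)) (\<beta> (u + \<upsilon>)))"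
  shows "sg = -1 \<Longrightarrow> k * (h00 + C \<upsilon>) * (h11 + C \<tau>)
       \<le> k * (1 + h10) * (1 + h01) - k * (h11 - h00)\<^sup>2 / (2 * (1 - h00 * h11)) * (1 + h01)"
    and "sg = 1 \<Longrightarrow> k * ((C \<upsilon> + 2 * h00 * h11 - 1 + (h11 - h00)\<^sup>2 / (2 * (1 - h00 * h11))) * (1 + C \<tau>)
       - (h00 + h10) * (h11 + h01)) \<le> 0"
proof -
  have X: "\<alpha> t \<in> X" "\<alpha> (t + \<tau>) \<in> X" "\<beta> u \<in> X" "\<beta> (u + \<upsilon>) \<in> X"
    using geodD(2)[OF g(1)] geodD(2)[OF g(2)] b by auto
  have dd: "d (\<alpha> t) (\<alpha> (t + \<tau>)) = \<tau>" "d (\<beta> u) (\<beta> (u + \<upsilon>)) = \<upsilon>"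
    "d (\<beta> u) (\<alpha> (t + \<tau>)) = d (\<alpha> (t + \<tau>)) (\<beta> u)" "d (\<beta> (u + \<upsilon>)) (\<alpha> (t + \<tau>)) = d (\<alpha> (t + \<tau>)) (\<beta> (u + \<upsilon>))"
    using geodD(3)[OF g(1)] geodD(3)[OF g(2)] b d_comm X by auto
  have \<tau>: "0 \<le> C \<tau>" using Cd_nn[OF X(1,2)] dd by simp
  have hh: "0 \<le> h00" "0 \<le> h01" "0 \<le> h10" "0 \<le> h11" using h Cd_nn X by auto
  have kd: "0 < k * (1 - C x)" if "0 < x" "k = 1 \<Longrightarrow> x \<le> pi/2" for x
  proof -
    have "k = 1 \<Longrightarrow> x \<le> pi" using that pi_gt_zero by linarith
    then show ?thesis using kC_strict[of 0 x] that by (simp add: algebra_simps)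
  qed
  have "0 < k * (1 - h00)" "0 < k * (1 - h11)"
    unfolding h using pos bnd X by (auto intro!: kd)
  then have k1: "0 < k * (1 - h00 * h11)"
    using k hh mult_strict_mono[of h00 1 h11 1] mult_strict_mono[of 1 h00 1 h11] by auto
  note SS = mult_S_le[of "d (\<alpha> t) (\<beta> u)" "d (\<alpha> (t + \<tau>)) (\<beta> (u + \<upsilon>))", folded h, OF k1]
  show "k * (h00 + C \<upsilon>) * (h11 + C \<tau>)
       \<le> k * (1 + h10) * (1 + h01) - k * (h11 - h00)\<^sup>2 / (2 * (1 - h00 * h11)) * (1 + h01)" if "sg = -1"
  proof -
    have "- k * ((h10 + h00 * h11) * (1 + h01) - (h00 + C \<upsilon>) * (h11 + C \<tau>)) \<le> S (d (\<alpha> t) (\<beta> u)) * S (d (\<alpha> (t + \<tau>)) (\<beta> (u + \<upsilon>))) * (1 + h01)"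
      using four[OF X(1,3,2,4)] unfolding dd h[symmetric] that by simp
    also have "\<dots> \<le> (k * (1 - h00 * h11) - k * (h11 - h00)\<^sup>2 / (2 * (1 - h00 * h11))) * (1 + h01)"
      using hh by (intro mult_right_mono SS) auto
    finally show ?thesis by (simp add: algebra_simps)
  qed
  show "k * ((C \<upsilon> + 2 * h00 * h11 - 1 + (h11 - h00)\<^sup>2 / (2 * (1 - h00 * h11))) * (1 + C \<tau>)
       - (h00 + h10) * (h11 + h01)) \<le> 0" if "sg = 1"
  proof -
    define q where "q = (h11 - h00)\<^sup>2 / (2 * (1 - h00 * h11))"
    have "k * ((C \<upsilon> + h00 * h11) * (1 + C \<tau>) - (h00 + h10) * (h11 + h01)) \<le> S (d (\<alpha> t) (\<beta> u)) * S (d (\<alpha> (t + \<tau>)) (\<beta> (u + \<upsilon>))) * (1 + C \<tau>)"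
      using four[OF X(1,3,4,2)] d_comm[OF X(4,2)] unfolding dd h[symmetric] that by (simp add: h dd)
    also have "\<dots> \<le> (k * (1 - h00 * h11) - k * (h11 - h00)\<^sup>2 / (2 * (1 - h00 * h11))) * (1 + C \<tau>)"
      using \<tau> by (intro mult_right_mono SS) auto
    also have "k * (h11 - h00)\<^sup>2 / (2 * (1 - h00 * h11)) = k * q" by (simp add: q_def)
    finally show ?thesis unfolding q_def[symmetric] by (simp add: algebra_simps)
  qed
qed

lemma slope:
  assumes g: "geod X d \<alpha> T" and b: "0 \<le> t" "0 < \<tau>" "t + \<tau> \<le> T" and P: "P \<in> X"
  shows "sg = 1 \<Longrightarrow> k * ((C (d (\<alpha> (t + \<tau>)) P) + C (d (\<alpha> 0) P) * C \<tau>) * (1 + C t) - (C (d (\<alpha> 0) P) + C (d (\<alpha> t) P)) * (C \<tau> + C (t + \<tau>)))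
        \<le> S (d (\<alpha> 0) P) * S \<tau> * (1 + C t)"
    and "sg = -1 \<Longrightarrow> - k * ((C (d (\<alpha> t) P) + C (d (\<alpha> 0) P) * C \<tau>) * (1 + C (t + \<tau>)) - (C (d (\<alpha> 0) P) + C (d (\<alpha> (t + \<tau>)) P)) * (C \<tau> + C t))
        \<le> S (d (\<alpha> 0) P) * S \<tau> * (1 + C (t + \<tau>))"
proof -
  have X: "\<alpha> 0 \<in> X" "\<alpha> t \<in> X" "\<alpha> (t + \<tau>) \<in> X" using geodD(1,2)[OF g] b by auto
  have dd: "d (\<alpha> 0) (\<alpha> t) = t" "d (\<alpha> 0) (\<alpha> (t + \<tau>)) = t + \<tau>" "d (\<alpha> t) (\<alpha> (t + \<tau>)) = \<tau>" "d (\<alpha> (t + \<tau>)) (\<alpha> t) = \<tau>"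
    "d P (\<alpha> t) = d (\<alpha> t) P" "d P (\<alpha> (t + \<tau>)) = d (\<alpha> (t + \<tau>)) P"
    using geodD(1,3)[OF g] b d_comm X P by auto
  show "sg = 1 \<Longrightarrow> k * ((C (d (\<alpha> (t + \<tau>)) P) + C (d (\<alpha> 0) P) * C \<tau>) * (1 + C t) - (C (d (\<alpha> 0) P) + C (d (\<alpha> t) P)) * (C \<tau> + C (t + \<tau>)))
        \<le> S (d (\<alpha> 0) P) * S \<tau> * (1 + C t)"
    using four[OF X(1) P X(3,2)] unfolding dd by simp
  show "sg = -1 \<Longrightarrow> - k * ((C (d (\<alpha> t) P) + C (d (\<alpha> 0) P) * C \<tau>) * (1 + C (t + \<tau>)) - (C (d (\<alpha> 0) P) + C (d (\<alpha> (t + \<tau>)) P)) * (C \<tau> + C t))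
        \<le> S (d (\<alpha> 0) P) * S \<tau> * (1 + C (t + \<tau>))"
    using four[OF X(1) P X(2,3)] unfolding dd by simp
qed

text \<open>Joins the corner inequality, its limit and the slope bounds in both variables along one
  sequence of rectangles for which the quotients of \<open>H\<close> already converge. The factor
  \<open>H a b\<close> in the ratio for \<open>sg = 1\<close> is the one that
  \<open>rect_limit_plus\<close> asks for.\<close>

lemma local_seq:
  fixes t \<tau> u \<upsilon> :: "nat \<Rightarrow> real"
  assumes g: "geod X d \<alpha> T" "geod X d \<beta> U" "\<alpha> 0 = \<beta> 0"
    and rect: "0 < t0" "t1 \<le> T" "0 < u0" "u1 \<le> U"
    and pos: "\<And>t u. t0 \<le> t \<Longrightarrow> t \<le> t1 \<Longrightarrow> u0 \<le> u \<Longrightarrow> u \<le> u1 \<Longrightarrow> 0 < d (\<alpha> t) (\<beta> u) \<and> 0 < C (d (\<alpha> t) (\<beta> u))"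
    and H: "\<And>t u. H t u = C (d (\<alpha> t) (\<beta> u))"
    and lim: "t \<longlonglongrightarrow> a" "u \<longlonglongrightarrow> b" "\<tau> \<longlonglongrightarrow> 0" "\<upsilon> \<longlonglongrightarrow> 0"
      "(\<lambda>n. \<upsilon> n / \<tau> n) \<longlonglongrightarrow> (if sg = 1 then H a b * (S b / S a) else S b / S a)"
    and ab: "t0 \<le> a" "a \<le> t1" "u0 \<le> b" "b \<le> u1"
    and seq: "\<And>n. t0 \<le> t n" "\<And>n. u0 \<le> u n" "\<And>n. 0 < \<tau> n" "\<And>n. 0 < \<upsilon> n" "\<And>n. t n + \<tau> n \<le> t1" "\<And>n. u n + \<upsilon> n \<le> u1"
    and bad: "\<And>n. B * (\<tau> n * \<upsilon> n) \<le> J \<alpha> \<beta> (t n + \<tau> n) (u n + \<upsilon> n) - J \<alpha> \<beta> (t n + \<tau> n) (u n) - J \<alpha> \<beta> (t n) (u n + \<upsilon> n) + J \<alpha> \<beta> (t n) (u n)"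
    and lE: "(\<lambda>n. (H (t n + \<tau> n) (u n) - H (t n) (u n)) / \<tau> n) \<longlonglongrightarrow> E" "(\<lambda>n. (H (t n) (u n + \<upsilon> n) - H (t n) (u n)) / \<upsilon> n) \<longlonglongrightarrow> E'"
    and Hlim: "\<And>p q. p \<longlonglongrightarrow> a \<Longrightarrow> q \<longlonglongrightarrow> b \<Longrightarrow> (\<And>n. t0 \<le> p n \<and> p n \<le> t1 \<and> u0 \<le> q n \<and> q n \<le> u1) \<Longrightarrow> (\<lambda>n. H (p n) (q n)) \<longlonglongrightarrow> H a b"
  shows "\<exists>x y. (\<lambda>n. (J \<alpha> \<beta> (t n + \<tau> n) (u n) - J \<alpha> \<beta> (t n) (u n)) / \<tau> n) \<longlonglongrightarrow> x / S a \<and>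
     (\<lambda>n. (J \<alpha> \<beta> (t n) (u n + \<upsilon> n) - J \<alpha> \<beta> (t n) (u n)) / \<upsilon> n) \<longlonglongrightarrow> y / S b \<and>
     x \<le> 1 - J \<alpha> \<beta> a b \<and> y \<le> 1 - J \<alpha> \<beta> a b \<and> 0 < H a b \<and> 0 < k * (1 - H a b) \<and>
     2 * k * (1 - (H a b)\<^sup>2) * B \<le> - (x\<^sup>2 + y\<^sup>2 + 2 * H a b * x * y)"
proof -
  have SS: "0 < S t" "0 < S u" if "0 < t" "t \<le> T" "0 < u" "u \<le> U" for t u
    using geod_S_pos[OF g(1)] geod_S_pos[OF g(2)] that by auto
  have bds: "t0 \<le> t n" "t n \<le> t1" "t0 \<le> t n + \<tau> n" "t n + \<tau> n \<le> t1" "u0 \<le> u n" "u n \<le> u1" "u0 \<le> u n + \<upsilon> n" "u n + \<upsilon> n \<le> u1" for n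
    using seq(1,2)[of n] seq(3)[of n] seq(4)[of n] seq(5)[of n] seq(6)[of n] by auto
  have bds': "0 \<le> t n" "t n + \<tau> n \<le> T" "0 \<le> u n" "u n + \<upsilon> n \<le> U" for n
    using bds[of n] rect by auto
  have pos1: "0 < d (\<alpha> (t n)) (\<beta> (u n))" "0 < d (\<alpha> (t n + \<tau> n)) (\<beta> (u n + \<upsilon> n))" for n
    using pos bds[of n] by auto
  have S4: "0 < S (t n)" "0 < S (u n)" "0 < S (t n + \<tau> n)" "0 < S (u n + \<upsilon> n)" for n
    using SS[of "t n" "u n"] SS[of "t n + \<tau> n" "u n + \<upsilon> n"] bds[of n] rect by auto
  have Sab: "0 < S a" "0 < S b" using SS[of a b] ab rect by auto
  have la: "(\<lambda>n. t n + \<tau> n) \<longlonglongrightarrow> a" "(\<lambda>n. u n + \<upsilon> n) \<longlonglongrightarrow> b"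
    using tendsto_add[OF lim(1,3)] tendsto_add[OF lim(2,4)] by auto
  have Hl: "(\<lambda>n. H (t n) (u n)) \<longlonglongrightarrow> H a b" "(\<lambda>n. H (t n + \<tau> n) (u n)) \<longlonglongrightarrow> H a b"
     "(\<lambda>n. H (t n) (u n + \<upsilon> n)) \<longlonglongrightarrow> H a b" "(\<lambda>n. H (t n + \<tau> n) (u n + \<upsilon> n)) \<longlonglongrightarrow> H a b"
    using bds by (auto intro!: Hlim lim la)
  have HJ: "H p q = C p * C q + k * S p * S q * J \<alpha> \<beta> p q" if "0 < S p" "0 < S q" for p q
    unfolding H using that by (intro J_eq) auto
  have X: "\<alpha> a \<in> X" "\<beta> b \<in> X" "\<And>n. \<alpha> (t n) \<in> X" "\<And>n. \<beta> (u n) \<in> X"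
    using geodD(2)[OF g(1)] geodD(2)[OF g(2)] rect ab bds order_trans less_imp_le by (meson less_le_trans)+
  have h0: "0 < H a b" using pos[of a b] ab by (simp add: H)
  have kh: "0 < k * (1 - H a b)"
  proof -
    have "k = 1 \<Longrightarrow> d (\<alpha> a) (\<beta> b) \<le> pi" using bnd[OF _ X(1,2)] pi_gt_zero by linarith
    then have "k * C (d (\<alpha> a) (\<beta> b)) < k * C 0"
      using pos[of a b] ab by (intro kC_strict) auto
    then show ?thesis by (simp add: H algebra_simps)
  qed
  have ineq: "(\<lambda>n. \<upsilon> n / \<tau> n) \<longlonglongrightarrow> S b / S a \<and> (\<forall>n. k * (H (t n) (u n) + C (\<upsilon> n)) * (H (t n + \<tau> n) (u n + \<upsilon> n) + C (\<tau> n))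
       \<le> k * (1 + H (t n + \<tau> n) (u n)) * (1 + H (t n) (u n + \<upsilon> n)) - k * (H (t n + \<tau> n) (u n + \<upsilon> n) - H (t n) (u n))\<^sup>2 / (2 * (1 - H (t n) (u n) * H (t n + \<tau> n) (u n + \<upsilon> n))) * (1 + H (t n) (u n + \<upsilon> n))) \<or>
     (\<lambda>n. \<upsilon> n / \<tau> n) \<longlonglongrightarrow> H a b * (S b / S a) \<and> (\<forall>n. k * ((C (\<upsilon> n) + 2 * H (t n) (u n) * H (t n + \<tau> n) (u n + \<upsilon> n) - 1 + (H (t n + \<tau> n) (u n + \<upsilon> n) - H (t n) (u n))\<^sup>2 / (2 * (1 - H (t n) (u n) * H (t n + \<tau> n) (u n + \<upsilon> n)))) * (1 + C (\<tau> n))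
       - (H (t n) (u n) + H (t n + \<tau> n) (u n)) * (H (t n + \<tau> n) (u n + \<upsilon> n) + H (t n) (u n + \<upsilon> n))) \<le> 0)"
    using sg
  proof
    assume "sg = 1"
    then show ?thesis using lim(5) corner(2)[OF g(1,2) bds'(1) seq(3) bds'(2) bds'(3) seq(4) bds'(4) pos1 H H H H] by simp
  next
    assume "sg = -1"
    then show ?thesis using lim(5) corner(1)[OF g(1,2) bds'(1) seq(3) bds'(2) bds'(3) seq(4) bds'(4) pos1 H H H H] by simp
  qed
  have "\<exists>x y. E = - k * S a * C b + k * C a * S b * J \<alpha> \<beta> a b + k * S b * x \<and>
     E' = - k * C a * S b + k * S a * C b * J \<alpha> \<beta> a b + k * S a * y \<and>
     (\<lambda>n. (J \<alpha> \<beta> (t n + \<tau> n) (u n) - J \<alpha> \<beta> (t n) (u n)) / \<tau> n) \<longlonglongrightarrow> x / S a \<and>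
     (\<lambda>n. (J \<alpha> \<beta> (t n) (u n + \<upsilon> n) - J \<alpha> \<beta> (t n) (u n)) / \<upsilon> n) \<longlonglongrightarrow> y / S b \<and>
     2 * k * (1 - (H a b)\<^sup>2) * B \<le> - (x\<^sup>2 + y\<^sup>2 + 2 * H a b * x * y)"
    by (rule corner_limit[OF lim(1,2) Sab lim(3) seq(3) lim(4) seq(4) S4 Hl kh h0 lE
        HJ[OF S4(1,2)] HJ[OF S4(3,2)] HJ[OF S4(1,4)] HJ[OF S4(3,4)] bad ineq HJ[OF Sab]])
  then obtain x y where xy: "E = - k * S a * C b + k * C a * S b * J \<alpha> \<beta> a b + k * S b * x"
     "E' = - k * C a * S b + k * S a * C b * J \<alpha> \<beta> a b + k * S a * y"
     "(\<lambda>n. (J \<alpha> \<beta> (t n + \<tau> n) (u n) - J \<alpha> \<beta> (t n) (u n)) / \<tau> n) \<longlonglongrightarrow> x / S a"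
     "(\<lambda>n. (J \<alpha> \<beta> (t n) (u n + \<upsilon> n) - J \<alpha> \<beta> (t n) (u n)) / \<upsilon> n) \<longlonglongrightarrow> y / S b"
     "2 * k * (1 - (H a b)\<^sup>2) * B \<le> - (x\<^sup>2 + y\<^sup>2 + 2 * H a b * x * y)"
    by (elim exE conjE)
  have d0: "d (\<alpha> 0) (\<beta> (u n)) = u n" "d (\<alpha> 0) (\<alpha> (t n)) = t n" "d (\<beta> 0) (\<alpha> (t n)) = t n" for n
    using geodD(3)[OF g(1), of 0 "t n"] geodD(3)[OF g(2), of 0 "u n"] bds[of n] rect unfolding g(3) by auto
  have H': "C (d (\<beta> u) (\<alpha> t)) = H t u" if "\<beta> u \<in> X" "\<alpha> t \<in> X" for t u using d_comm[OF that] by (simp add: H)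
  have C1: "0 < 1 + C a" "0 < 1 + C b"
    using geod_C_nn[OF g(1), of a] geod_C_nn[OF g(2), of b] rect ab by auto
  have X4: "\<alpha> (t n + \<tau> n) \<in> X" "\<beta> (u n + \<upsilon> n) \<in> X" for n
    using geodD(2)[OF g(1)] geodD(2)[OF g(2)] bds'[of n] seq(3)[of n] seq(4)[of n] by auto
  have x1: "x \<le> 1 - J \<alpha> \<beta> a b"
  proof (rule slope_limit[OF lim(1,2) Sab C1(1) lim(3) seq(3) Hl(1,2) lE(1) _ HJ[OF Sab] xy(1)])
    show "(\<forall>n. k * ((H (t n + \<tau> n) (u n) + C (u n) * C (\<tau> n)) * (1 + C (t n)) - (C (u n) + H (t n) (u n)) * (C (\<tau> n) + C (t n + \<tau> n)))
        \<le> S (u n) * S (\<tau> n) * (1 + C (t n))) \<or>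
      (\<forall>n. - k * ((H (t n) (u n) + C (u n) * C (\<tau> n)) * (1 + C (t n + \<tau> n)) - (C (u n) + H (t n + \<tau> n) (u n)) * (C (\<tau> n) + C (t n)))
        \<le> S (u n) * S (\<tau> n) * (1 + C (t n + \<tau> n)))"
      using sg
    proof
      assume "sg = 1"
      then show ?thesis using slope(1)[OF g(1) bds'(1) seq(3) bds'(2) X(4)] unfolding d0 H[symmetric] by blast
    next
      assume "sg = -1"
      then show ?thesis using slope(2)[OF g(1) bds'(1) seq(3) bds'(2) X(4)] unfolding d0 H[symmetric] by blast
    qed
  qed
  have hsym: "H a b = C b * C a + k * S b * S a * J \<alpha> \<beta> a b" using HJ[OF Sab] by (simp add: ac_simps)
  have xy2: "E' = - k * S b * C a + k * C b * S a * J \<alpha> \<beta> a b + k * S a * y" using xy(2) by (simp add: ac_simps)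
  have y1: "y \<le> 1 - J \<alpha> \<beta> a b"
  proof (rule slope_limit[OF lim(2,1) Sab(2,1) C1(2) lim(4) seq(4) Hl(1,3) lE(2) _ hsym xy2])
    show "(\<forall>n. k * ((H (t n) (u n + \<upsilon> n) + C (t n) * C (\<upsilon> n)) * (1 + C (u n)) - (C (t n) + H (t n) (u n)) * (C (\<upsilon> n) + C (u n + \<upsilon> n)))
        \<le> S (t n) * S (\<upsilon> n) * (1 + C (u n))) \<or>
      (\<forall>n. - k * ((H (t n) (u n) + C (t n) * C (\<upsilon> n)) * (1 + C (u n + \<upsilon> n)) - (C (t n) + H (t n) (u n + \<upsilon> n)) * (C (\<upsilon> n) + C (u n)))
        \<le> S (t n) * S (\<upsilon> n) * (1 + C (u n + \<upsilon> n)))"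
      using sg
    proof
      assume "sg = 1"
      then show ?thesis using slope(1)[OF g(2) bds'(3) seq(4) bds'(4) X(3)] unfolding d0 H'[OF X(4,3)] H'[OF X4(2) X(3)] by blast
    next
      assume "sg = -1"
      then show ?thesis using slope(2)[OF g(2) bds'(3) seq(4) bds'(4) X(3)] unfolding d0 H'[OF X(4,3)] H'[OF X4(2) X(3)] by blast
    qed
  qed
  show ?thesis using xy(3-5) x1 y1 h0 kh by blast
qed

text \<open>A rectangle on which the second difference of \<open>J\<close> exceeds \<open>B\<close>
  times the area yields a point where \<open>B\<close> obeys a quadratic inequality in the limiting
  slopes. The last two clauses are all that is kept of the limits: every uniform bound for the
  slopes of \<open>J\<close> on the rectangle passes to \<open>x\<close> and
  \<open>y\<close>.\<close>

lemma local_bound: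
  assumes g: "geod X d \<alpha> T" "geod X d \<beta> U" "\<alpha> 0 = \<beta> 0"
    and rect: "0 < t0" "t0 < t1" "t1 \<le> T" "0 < u0" "u0 < u1" "u1 \<le> U"
    and pos': "\<forall>t u. t0 \<le> t \<longrightarrow> t \<le> t1 \<longrightarrow> u0 \<le> u \<longrightarrow> u \<le> u1 \<longrightarrow> 0 < d (\<alpha> t) (\<beta> u) \<and> 0 < C (d (\<alpha> t) (\<beta> u))"
    and bad: "B * ((t1 - t0) * (u1 - u0)) < J \<alpha> \<beta> t1 u1 - J \<alpha> \<beta> t1 u0 - J \<alpha> \<beta> t0 u1 + J \<alpha> \<beta> t0 u0"
  shows "\<exists>a b x y h. t0 \<le> a \<and> a \<le> t1 \<and> u0 \<le> b \<and> b \<le> u1 \<and> 0 < h \<and> 0 < k * (1 - h) \<and>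
    x \<le> 1 - J \<alpha> \<beta> a b \<and> y \<le> 1 - J \<alpha> \<beta> a b \<and>
    2 * k * (1 - h\<^sup>2) * B \<le> - (x\<^sup>2 + y\<^sup>2 + 2 * h * x * y) \<and>
    (\<forall>P. (\<forall>t t' u. t0 \<le> t \<longrightarrow> t < t' \<longrightarrow> t' \<le> t1 \<longrightarrow> u0 \<le> u \<longrightarrow> u \<le> u1 \<longrightarrow> J \<alpha> \<beta> t' u - J \<alpha> \<beta> t u \<le> P * (t' - t)) \<longrightarrow> x \<le> S a * P) \<and>
    (\<forall>P. (\<forall>t u u'. t0 \<le> t \<longrightarrow> t \<le> t1 \<longrightarrow> u0 \<le> u \<longrightarrow> u < u' \<longrightarrow> u' \<le> u1 \<longrightarrow> J \<alpha> \<beta> t u' - J \<alpha> \<beta> t u \<le> P * (u' - u)) \<longrightarrow> y \<le> S b * P)"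
proof -
  note pos = pos'[rule_format]
  define H where "H t u = C (d (\<alpha> t) (\<beta> u))" for t u
  define \<rho> where "\<rho> a b = (if sg = 1 then H a b * (S b / S a) else S b / S a)" for a b
  have SS: "0 < S t" "0 < S u" if "0 < t" "t \<le> T" "0 < u" "u \<le> U" for t u
    using geod_S_pos[OF g(1)] geod_S_pos[OF g(2)] that by auto
  have \<rho>pos: "0 < \<rho> t u" if "t0 \<le> t" "t \<le> t1" "u0 \<le> u" "u \<le> u1" for t u
    using SS[of t u] pos[of t u] that rect unfolding \<rho>_def H_def by auto
  obtain t \<tau> u \<upsilon> a b where lim: "t \<longlonglongrightarrow> a" "u \<longlonglongrightarrow> b" "\<tau> \<longlonglongrightarrow> 0" "\<upsilon> \<longlonglongrightarrow> 0"
    "(\<lambda>n. \<upsilon> n / \<tau> n) \<longlonglongrightarrow> \<rho> a b" and ab: "t0 \<le> a" "a \<le> t1" "u0 \<le> b" "b \<le> u1"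
    and seq: "\<And>n::nat. t0 \<le> t n" "\<And>n. u0 \<le> u n" "\<And>n. 0 < \<tau> n" "\<And>n. 0 < \<upsilon> n" "\<And>n. t n + \<tau> n \<le> t1" "\<And>n. u n + \<upsilon> n \<le> u1"
    and bad': "\<And>n. B * (\<tau> n * \<upsilon> n) \<le> J \<alpha> \<beta> (t n + \<tau> n) (u n + \<upsilon> n) - J \<alpha> \<beta> (t n + \<tau> n) (u n) - J \<alpha> \<beta> (t n) (u n + \<upsilon> n) + J \<alpha> \<beta> (t n) (u n)"
    by (rule bad_rectangles[where f = "J \<alpha> \<beta>" and \<rho> = \<rho>, OF rect(2,5) bad \<rho>pos]) blast+
  define L where "L = cosh (T + U)"
  have Hlip: "\<bar>H t u - H t' u'\<bar> \<le> L * (\<bar>t - t'\<bar> + \<bar>u - u'\<bar>)"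
    if that: "t0 \<le> t" "t \<le> t1" "u0 \<le> u" "u \<le> u1" "t0 \<le> t'" "t' \<le> t1" "u0 \<le> u'" "u' \<le> u1" for t u t' u'
  proof -
    have X: "\<alpha> 0 \<in> X" "\<alpha> t \<in> X" "\<alpha> t' \<in> X" "\<beta> u \<in> X" "\<beta> u' \<in> X"
      using geodD(2)[OF g(1)] geodD(2)[OF g(2)] rect that by auto
    have "d (\<alpha> t) (\<alpha> 0) \<le> T" "d (\<alpha> t') (\<alpha> 0) \<le> T"
      using geodD(3)[OF g(1)] rect that by auto
    moreover have "d (\<beta> 0) (\<beta> u) \<le> U" "d (\<beta> 0) (\<beta> u') \<le> U"
      using geodD(3)[OF g(2)] rect that by auto
    ultimately have "d (\<alpha> t) (\<beta> u) \<le> T + U" "d (\<alpha> t') (\<beta> u') \<le> T + U"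
      using d_tri[of "\<alpha> t" "\<alpha> 0" "\<beta> u"] d_tri[of "\<alpha> t'" "\<alpha> 0" "\<beta> u'"] X unfolding g(3) by auto
    then have "\<bar>H t u - H t' u'\<bar> \<le> L * \<bar>d (\<alpha> t) (\<beta> u) - d (\<alpha> t') (\<beta> u')\<bar>"
      unfolding H_def L_def using d_nn X by (intro C_lipschitz) auto
    also have "\<dots> \<le> L * (\<bar>t - t'\<bar> + \<bar>u - u'\<bar>)"
      using dist_lip[OF g(1,2), of t t' u u'] that rect by (intro mult_left_mono) (auto simp: L_def)
    finally show ?thesis .
  qed
  have bds: "t0 \<le> t n" "t n \<le> t1" "t0 \<le> t n + \<tau> n" "t n + \<tau> n \<le> t1" "u0 \<le> u n" "u n \<le> u1" "u0 \<le> u n + \<upsilon> n" "u n + \<upsilon> n \<le> u1" for n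
    using seq(1,2)[of n] seq(3)[of n] seq(4)[of n] seq(5)[of n] seq(6)[of n] by auto
  define e where "e n = (H (t n + \<tau> n) (u n) - H (t n) (u n)) / \<tau> n" for n
  define e' where "e' n = (H (t n) (u n + \<upsilon> n) - H (t n) (u n)) / \<upsilon> n" for n
  have "e n \<in> {-L..L}" "e' n \<in> {-L..L}" for n
  proof -
    have "\<bar>H (t n + \<tau> n) (u n) - H (t n) (u n)\<bar> \<le> L * \<tau> n" "\<bar>H (t n) (u n + \<upsilon> n) - H (t n) (u n)\<bar> \<le> L * \<upsilon> n"
      using Hlip[of "t n + \<tau> n" "u n" "t n" "u n"] Hlip[of "t n" "u n + \<upsilon> n" "t n" "u n"] bds[of n] seq(3,4)[of n] by auto
    then have "\<bar>e n\<bar> \<le> L" "\<bar>e' n\<bar> \<le> L" unfolding e_def e'_def using seq(3)[of n] seq(4)[of n] by (auto simp: abs_divide pos_divide_le_eq)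
    then show "e n \<in> {-L..L}" "e' n \<in> {-L..L}" by auto
  qed
  \<comment> \<open>\<open>H\<close> is Lipschitz, so its difference quotients stay in a compact
    interval and converge along a subsequence; this replaces differentiability.\<close>
  then have inn: "\<forall>n. (e n, e' n) \<in> {-L..L} \<times> {-L..L}" by blast
  have sc: "seq_compact ({-L..L} \<times> {-L..L})"
    by (intro compact_imp_seq_compact compact_Times) auto
  from seq_compactE[OF sc inn] obtain z r where z: "strict_mono (r :: nat \<Rightarrow> nat)" "((\<lambda>n. (e n, e' n)) \<circ> r) \<longlonglongrightarrow> z"
    by blast
  obtain E E' where EE: "z = (E, E')" by force
  have lE: "(\<lambda>n. e (r n)) \<longlonglongrightarrow> E" "(\<lambda>n. e' (r n)) \<longlonglongrightarrow> E'"
    using tendsto_fst[OF z(2)] tendsto_snd[OF z(2)] EE by (auto simp: o_def)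
  have lr: "(\<lambda>n. t (r n)) \<longlonglongrightarrow> a" "(\<lambda>n. u (r n)) \<longlonglongrightarrow> b" "(\<lambda>n. \<tau> (r n)) \<longlonglongrightarrow> 0" "(\<lambda>n. \<upsilon> (r n)) \<longlonglongrightarrow> 0"
    "(\<lambda>n. \<upsilon> (r n) / \<tau> (r n)) \<longlonglongrightarrow> (if sg = 1 then H a b * (S b / S a) else S b / S a)"
    using lim[THEN LIMSEQ_subseq_LIMSEQ, OF z(1)] by (auto simp: o_def \<rho>_def)
  have H_lim: "(\<lambda>n. H (p n) (q n)) \<longlonglongrightarrow> H a b" if pq: "p \<longlonglongrightarrow> a" "q \<longlonglongrightarrow> b" "\<And>n. t0 \<le> p n \<and> p n \<le> t1 \<and> u0 \<le> q n \<and> q n \<le> u1" for p q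
  proof (rule LIM_zero_cancel, rule Lim_null_comparison)
    show "\<forall>\<^sub>F n in sequentially. norm (H (p n) (q n) - H a b) \<le> L * (\<bar>p n - a\<bar> + \<bar>q n - b\<bar>)"
      using Hlip pq(3) ab by auto
    have "(\<lambda>n. L * (\<bar>p n - a\<bar> + \<bar>q n - b\<bar>)) \<longlonglongrightarrow> L * (\<bar>a - a\<bar> + \<bar>b - b\<bar>)"
      by (intro tendsto_intros pq(1,2))
    then show "(\<lambda>n. L * (\<bar>p n - a\<bar> + \<bar>q n - b\<bar>)) \<longlonglongrightarrow> 0" by simp
  qed
  have "\<exists>x y. (\<lambda>n. (J \<alpha> \<beta> (t (r n) + \<tau> (r n)) (u (r n)) - J \<alpha> \<beta> (t (r n)) (u (r n))) / \<tau> (r n)) \<longlonglongrightarrow> x / S a \<and>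
     (\<lambda>n. (J \<alpha> \<beta> (t (r n)) (u (r n) + \<upsilon> (r n)) - J \<alpha> \<beta> (t (r n)) (u (r n))) / \<upsilon> (r n)) \<longlonglongrightarrow> y / S b \<and>
     x \<le> 1 - J \<alpha> \<beta> a b \<and> y \<le> 1 - J \<alpha> \<beta> a b \<and> 0 < H a b \<and> 0 < k * (1 - H a b) \<and>
     2 * k * (1 - (H a b)\<^sup>2) * B \<le> - (x\<^sup>2 + y\<^sup>2 + 2 * H a b * x * y)"
    by (rule local_seq[OF g rect(1,3,4,6) pos H_def lr ab seq bad' lE[unfolded e_def e'_def] H_lim])
  then obtain x y where xy: "(\<lambda>n. (J \<alpha> \<beta> (t (r n) + \<tau> (r n)) (u (r n)) - J \<alpha> \<beta> (t (r n)) (u (r n))) / \<tau> (r n)) \<longlonglongrightarrow> x / S a"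
     "(\<lambda>n. (J \<alpha> \<beta> (t (r n)) (u (r n) + \<upsilon> (r n)) - J \<alpha> \<beta> (t (r n)) (u (r n))) / \<upsilon> (r n)) \<longlonglongrightarrow> y / S b"
     "x \<le> 1 - J \<alpha> \<beta> a b" "y \<le> 1 - J \<alpha> \<beta> a b" "0 < H a b" "0 < k * (1 - H a b)"
     "2 * k * (1 - (H a b)\<^sup>2) * B \<le> - (x\<^sup>2 + y\<^sup>2 + 2 * H a b * x * y)"
    by (elim exE conjE)
  have Sab: "0 < S a" "0 < S b" using SS[of a b] ab rect by auto
  have P1: "(\<forall>P. (\<forall>t t' u. t0 \<le> t \<longrightarrow> t < t' \<longrightarrow> t' \<le> t1 \<longrightarrow> u0 \<le> u \<longrightarrow> u \<le> u1 \<longrightarrow> J \<alpha> \<beta> t' u - J \<alpha> \<beta> t u \<le> P * (t' - t)) \<longrightarrow> x \<le> S a * P)"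
  proof (intro allI impI)
    fix P assume *: "\<forall>t t' u. t0 \<le> t \<longrightarrow> t < t' \<longrightarrow> t' \<le> t1 \<longrightarrow> u0 \<le> u \<longrightarrow> u \<le> u1 \<longrightarrow> J \<alpha> \<beta> t' u - J \<alpha> \<beta> t u \<le> P * (t' - t)"
    have "(J \<alpha> \<beta> (t (r n) + \<tau> (r n)) (u (r n)) - J \<alpha> \<beta> (t (r n)) (u (r n))) / \<tau> (r n) \<le> P" for n
      using *[rule_format, of "t (r n)" "t (r n) + \<tau> (r n)" "u (r n)"] bds[of "r n"] seq(3)[of "r n"] by (simp add: pos_divide_le_eq)
    then have "x / S a \<le> P" by (intro LIMSEQ_le_const2[OF xy(1)]) blast
    then show "x \<le> S a * P" using Sab by (simp add: pos_divide_le_eq mult.commute)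
  qed
  have P2: "(\<forall>P. (\<forall>t u u'. t0 \<le> t \<longrightarrow> t \<le> t1 \<longrightarrow> u0 \<le> u \<longrightarrow> u < u' \<longrightarrow> u' \<le> u1 \<longrightarrow> J \<alpha> \<beta> t u' - J \<alpha> \<beta> t u \<le> P * (u' - u)) \<longrightarrow> y \<le> S b * P)"
  proof (intro allI impI)
    fix P assume *: "\<forall>t u u'. t0 \<le> t \<longrightarrow> t \<le> t1 \<longrightarrow> u0 \<le> u \<longrightarrow> u < u' \<longrightarrow> u' \<le> u1 \<longrightarrow> J \<alpha> \<beta> t u' - J \<alpha> \<beta> t u \<le> P * (u' - u)"
    have "(J \<alpha> \<beta> (t (r n)) (u (r n) + \<upsilon> (r n)) - J \<alpha> \<beta> (t (r n)) (u (r n))) / \<upsilon> (r n) \<le> P" for n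
      using *[rule_format, of "t (r n)" "u (r n)" "u (r n) + \<upsilon> (r n)"] bds[of "r n"] seq(4)[of "r n"] by (simp add: pos_divide_le_eq)
    then have "y / S b \<le> P" by (intro LIMSEQ_le_const2[OF xy(2)]) blast
    then show "y \<le> S b * P" using Sab by (simp add: pos_divide_le_eq mult.commute)
  qed
  show ?thesis
    by (intro exI[of _ a] exI[of _ b] exI[of _ x] exI[of _ y] exI[of _ "H a b"] conjI ab xy(5,6,3,4,7) P1 P2)
qed

text \<open>For \<open>k = 1\<close> one has \<open>0 < h < 1\<close>, the form
  \<open>x\<^sup>2 + y\<^sup>2 + 2 * h * x * y\<close> is positive semidefinite, and
  \<open>B \<le> 0\<close>. For \<open>k = -1\<close> one has \<open>h > 1\<close> and the form is
  indefinite; completing the square shows that its negative is at most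
  \<open>(h\<^sup>2 - 1) * M\<^sup>2\<close>, since it can be positive only if \<open>x\<close> or
  \<open>y\<close> is. The factor \<open>(1 - k) / 4\<close> is 0 in the former case and
  \<open>1 / 2\<close> in the latter.\<close>

lemma quadratic_bound:
  assumes h: "0 < h" "0 < k * (1 - h)" and xy: "x \<le> M" "y \<le> M" "0 \<le> M"
    and B: "2 * k * (1 - h\<^sup>2) * B \<le> - (x\<^sup>2 + y\<^sup>2 + 2 * h * x * y)"
  shows "B \<le> (1 - k) * M\<^sup>2 / 4"
  using k
proof
  assume k1: "k = 1"
  have "0 \<le> (1 - h) * (x\<^sup>2 + y\<^sup>2) + h * (x + y)\<^sup>2" using h k1 by (intro add_nonneg_nonneg mult_nonneg_nonneg) auto
  also have "\<dots> = x\<^sup>2 + y\<^sup>2 + 2 * h * x * y" by (simp add: power2_eq_square algebra_simps)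
  finally have "(2 * (1 - h\<^sup>2)) * B \<le> 0" using B k1 by simp
  moreover have "0 < 2 * (1 - h\<^sup>2)" using h k1 by (simp add: power_less_one_iff)
  ultimately have "B \<le> 0" by (simp add: mult_le_0_iff)
  then show ?thesis using k1 by simp
next
  assume k1: "k = -1"
  have h1: "1 < h" using h k1 by simp
  then have h2: "0 < h\<^sup>2 - 1" by (simp add: one_less_power)
  have "- (x\<^sup>2 + y\<^sup>2 + 2 * h * x * y) \<le> (h\<^sup>2 - 1) * M\<^sup>2"
  proof (cases "0 \<le> x")
    case True
    have "- (x\<^sup>2 + y\<^sup>2 + 2 * h * x * y) = (h\<^sup>2 - 1) * x\<^sup>2 - (y + h * x)\<^sup>2" by (simp add: power2_eq_square algebra_simps)
    also have "\<dots> \<le> (h\<^sup>2 - 1) * x\<^sup>2" by simp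
    also have "\<dots> \<le> (h\<^sup>2 - 1) * M\<^sup>2" using True xy h2 by (intro mult_left_mono power_mono) auto
    finally show ?thesis .
  next
    case x: False
    show ?thesis
    proof (cases "0 \<le> y")
      case True
      have "- (x\<^sup>2 + y\<^sup>2 + 2 * h * x * y) = (h\<^sup>2 - 1) * y\<^sup>2 - (x + h * y)\<^sup>2" by (simp add: power2_eq_square algebra_simps)
      also have "\<dots> \<le> (h\<^sup>2 - 1) * y\<^sup>2" by simp
      also have "\<dots> \<le> (h\<^sup>2 - 1) * M\<^sup>2" using True xy h2 by (intro mult_left_mono power_mono) auto
      finally show ?thesis .
    next
      case False
      then have "0 \<le> x * y" using x by (intro mult_nonpos_nonpos) auto
      then have "0 \<le> h * (x * y)" using h by simp
      moreover have "0 \<le> (h\<^sup>2 - 1) * M\<^sup>2" using h2 by simp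
      moreover have "0 \<le> x\<^sup>2" "0 \<le> y\<^sup>2" "2 * h * x * y = 2 * (h * (x * y))" by simp_all
      ultimately show ?thesis by linarith
    qed
  qed
  then have "(h\<^sup>2 - 1) * (2 * B) \<le> (h\<^sup>2 - 1) * M\<^sup>2" using B k1 by (simp add: algebra_simps)
  then have "2 * B \<le> M\<^sup>2" using h2 by (rule mult_left_le_imp_le)
  then show ?thesis using k1 by simp
qed

end

section \<open>Trigonometric inequalities for the first variation of the distance\<close>

context curv
begin

lemma C_sum: "C x + C y = 2 * C ((x + y) / 2) * C ((x - y) / 2)"
proof -
  have "x = (x + y) / 2 + (x - y) / 2" "y = (x + y) / 2 - (x - y) / 2" by (simp_all add: field_simps)
  then have "C x = C ((x + y) / 2) * C ((x - y) / 2) - k * S ((x + y) / 2) * S ((x - y) / 2)"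
    "C y = C ((x + y) / 2) * C ((x - y) / 2) + k * S ((x + y) / 2) * S ((x - y) / 2)"
    by (metis C_add, metis C_diff)
  then show ?thesis by simp
qed

lemma C_sum_eq: "x + y = 2 * a \<Longrightarrow> x - y = 2 * b \<Longrightarrow> C x + C y = 2 * C a * C b"
  using C_sum[of x y] by simp

lemma S_le: "0 \<le> x \<Longrightarrow> S x \<le> x * cosh x"
proof (cases "k = 1")
  case True
  assume "0 \<le> x"
  then have "sin x \<le> x * 1" using sin_x_le_x by simp
  also have "\<dots> \<le> x * cosh x" using \<open>0 \<le> x\<close> cosh_real_ge_1 by (intro mult_left_mono) auto
  finally show ?thesis using True by (simp add: sn_def)
next
  case False
  assume "0 \<le> x"
  have "(\<lambda>x. x * cosh x - sinh x) 0 \<le> (\<lambda>x. x * cosh x - sinh x) x"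
  proof (rule DERIV_nonneg_imp_nondecreasing[OF \<open>0 \<le> x\<close>])
    fix z :: real assume "0 \<le> z"
    have "((\<lambda>x. x * cosh x - sinh x) has_real_derivative z * sinh z) (at z)"
      by (rule derivative_eq_intros refl | simp)+
    then show "\<exists>y. ((\<lambda>x. x * cosh x - sinh x) has_real_derivative y) (at z) \<and> 0 \<le> y"
      using \<open>0 \<le> z\<close> by (intro exI[of _ "z * sinh z"]) simp
  qed
  then show ?thesis using False by (simp add: sn_def)
qed

text \<open>The quotient is the tangent, or hyperbolic tangent, of \<open>u / 2\<close>.\<close>

lemma half_tangent_limit: "((\<lambda>u. k * (1 - C u) / S u) \<longlongrightarrow> 0) (at_right 0)"
proof -
  have "((\<lambda>u. S (u / 2) / C (u / 2)) \<longlongrightarrow> S (0 / 2) / C (0 / 2)) (at_right 0)"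
    by (intro tendsto_intros) auto
  moreover have "\<forall>\<^sub>F u in at_right 0. S (u / 2) / C (u / 2) = k * (1 - C u) / S u"
  proof (rule eventually_at_rightI[of 0 1])
    show "S (u / 2) / C (u / 2) = k * (1 - C u) / S u" if "u \<in> {0<..<1}" for u
    proof -
      have "0 < S (u / 2)" using that pi_gt3 by (intro S_pos) auto
      then show ?thesis unfolding one_minus_C S_double[of u] by (simp add: power2_eq_square)
    qed
  qed simp
  ultimately show ?thesis by (simp add: Lim_transform_eventually)
qed

text \<open>Sum-to-product formulas turn the difference of the two sides into a nonnegative multiple
  of \<open>k * (1 - C (p + q - g))\<close>. Equality for \<open>g = p + q\<close> is what makes the
  first variation estimate sharp to first order.\<close>

lemma first_variation_plus:
  "k * ((C g + C (g - q)) * (C p + C (p + q))) \<le> k * ((1 + C (p + g)) * (1 + C q))"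
proof -
  have e1: "1 + C (p + g) = 2 * (C ((p + g) / 2))\<^sup>2" by (rule C_double')
  have e2: "1 + C q = 2 * (C (q / 2))\<^sup>2" by (rule C_double')
  have e3: "C p + C (p + q) = 2 * C (p + q / 2) * C (q / 2)"
    using C_sum_eq[of p "p + q" "p + q / 2" "- q / 2"] by simp
  have e4: "C g + C (g - q) = 2 * C (g - q / 2) * C (q / 2)"
    by (rule C_sum_eq) auto
  have e5: "2 * (C ((p + g) / 2))\<^sup>2 - 2 * (C (p + q / 2) * C (g - q / 2)) = 1 - C (p + q - g)"
    using C_sum_eq[of "p + g" "p + q - g" "p + q / 2" "g - q / 2"] C_double'[of "p + g"] by simp
  have "k * ((1 + C (p + g)) * (1 + C q)) - k * ((C g + C (g - q)) * (C p + C (p + q)))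
     = 2 * (C (q / 2))\<^sup>2 * (k * (1 - C (p + q - g)))"
    unfolding e1 e2 e3 e4 e5[symmetric] by (simp add: power2_eq_square algebra_simps)
  moreover have "0 \<le> 2 * (C (q / 2))\<^sup>2 * (k * (1 - C (p + q - g)))"
    by (intro mult_nonneg_nonneg one_minus_C_nonneg) auto
  ultimately show ?thesis by linarith
qed

text \<open>The analogue for the other sign, again with equality for \<open>g = p + q\<close>. The
  factor in front of \<open>k * (1 - C (g - (p + q)))\<close> is now a product of two different
  cosines, whence the assumptions on their signs.\<close>

lemma first_variation_minus:
  assumes "0 \<le> C ((p - q) / 2)" "0 \<le> C ((p + q) / 2)"
  shows "k * ((C (p - g) + C (g - q)) * (1 + C (p + q))) \<le> k * ((C p + C q) * (C g + 1))"
proof -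
  have f1: "1 + C (p + q) = 2 * (C ((p + q) / 2))\<^sup>2" by (rule C_double')
  have f2: "C p + C q = 2 * C ((p + q) / 2) * C ((p - q) / 2)" by (rule C_sum)
  have f3: "C (p - g) + C (g - q) = 2 * C ((p - q) / 2) * C (g - (p + q) / 2)"
    using C_sum_eq[of "p - g" "g - q" "(p - q) / 2" "- (g - (p + q) / 2)"] by (simp add: field_simps)
  have f4: "C g + 1 - 2 * (C ((p + q) / 2) * C (g - (p + q) / 2)) = 1 - C (g - (p + q))"
    using C_sum_eq[of g "(p + q) - g" "(p + q) / 2" "g - (p + q) / 2"] C_commute[of "p + q" g] by (simp add: field_simps)
  have "k * ((C p + C q) * (C g + 1)) - k * ((C (p - g) + C (g - q)) * (1 + C (p + q)))
     = 2 * (C ((p - q) / 2) * C ((p + q) / 2)) * (k * (1 - C (g - (p + q))))"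
    unfolding f1 f2 f3 f4[symmetric] by (simp add: power2_eq_square algebra_simps)
  moreover have "0 \<le> 2 * (C ((p - q) / 2) * C ((p + q) / 2)) * (k * (1 - C (g - (p + q))))"
    using assms by (intro mult_nonneg_nonneg one_minus_C_nonneg) auto
  ultimately show ?thesis by linarith
qed

end

section \<open>Comparison angles almost decrease along geodesics\<close>

context fourpt
begin

text \<open>\<open>M\<close> bounds the scaled slopes of \<open>J\<close>. Without further knowledge
  \<open>M = 2\<close> is admissible, because the slopes are at most \<open>1 - J\<close> and
  \<open>J\<close> is at least -1; known slope bounds \<open>P\<close> and \<open>Q\<close> allow a
  smaller \<open>M\<close>. The two alternatives are the two rounds of the bootstrap.\<close>

lemma rect_bound:
  assumes g: "geod X d \<alpha> T" "geod X d \<beta> U" "\<alpha> 0 = \<beta> 0"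
    and rect: "0 < t0" "t0 < t1" "t1 \<le> T" "0 < u0" "u0 < u1" "u1 \<le> U"
    and pos: "\<And>t u. t0 \<le> t \<Longrightarrow> t \<le> t1 \<Longrightarrow> u0 \<le> u \<Longrightarrow> u \<le> u1 \<Longrightarrow> 0 < d (\<alpha> t) (\<beta> u) \<and> 0 < C (d (\<alpha> t) (\<beta> u))"
    and M: "0 \<le> M" "M = 2 \<or> (\<exists>P Q.
       (\<forall>t t' u. t0 \<le> t \<longrightarrow> t < t' \<longrightarrow> t' \<le> t1 \<longrightarrow> u0 \<le> u \<longrightarrow> u \<le> u1 \<longrightarrow> J \<alpha> \<beta> t' u - J \<alpha> \<beta> t u \<le> P * (t' - t)) \<and>
       (\<forall>t u u'. t0 \<le> t \<longrightarrow> t \<le> t1 \<longrightarrow> u0 \<le> u \<longrightarrow> u < u' \<longrightarrow> u' \<le> u1 \<longrightarrow> J \<alpha> \<beta> t u' - J \<alpha> \<beta> t u \<le> Q * (u' - u)) \<and>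
       (\<forall>a b. t0 \<le> a \<longrightarrow> a \<le> t1 \<longrightarrow> u0 \<le> b \<longrightarrow> b \<le> u1 \<longrightarrow> S a * P \<le> M \<and> S b * Q \<le> M))"
  shows "J \<alpha> \<beta> t1 u1 - J \<alpha> \<beta> t1 u0 - J \<alpha> \<beta> t0 u1 + J \<alpha> \<beta> t0 u0 \<le> (1 - k) * M\<^sup>2 / 4 * ((t1 - t0) * (u1 - u0))"
proof (rule ccontr)
  define A where "A = (t1 - t0) * (u1 - u0)"
  define D where "D = J \<alpha> \<beta> t1 u1 - J \<alpha> \<beta> t1 u0 - J \<alpha> \<beta> t0 u1 + J \<alpha> \<beta> t0 u0"
  have A: "0 < A" using rect by (simp add: A_def)
  assume "\<not> ?thesis"
  then have "(1 - k) * M\<^sup>2 / 4 < D / A" using A by (simp add: A_def[symmetric] D_def[symmetric] pos_less_divide_eq)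
  then obtain B where B: "(1 - k) * M\<^sup>2 / 4 < B" "B < D / A" using dense by blast
  have bad: "B * ((t1 - t0) * (u1 - u0)) < J \<alpha> \<beta> t1 u1 - J \<alpha> \<beta> t1 u0 - J \<alpha> \<beta> t0 u1 + J \<alpha> \<beta> t0 u0"
    using B(2) A by (simp add: A_def[symmetric] D_def[symmetric] pos_less_divide_eq)
  have pos': "\<forall>t u. t0 \<le> t \<longrightarrow> t \<le> t1 \<longrightarrow> u0 \<le> u \<longrightarrow> u \<le> u1 \<longrightarrow> 0 < d (\<alpha> t) (\<beta> u) \<and> 0 < C (d (\<alpha> t) (\<beta> u))"
    using pos by simp
  from local_bound[OF g rect pos' bad]
  obtain a b x y h where ab: "t0 \<le> a" "a \<le> t1" "u0 \<le> b" "b \<le> u1" and h: "0 < h" "0 < k * (1 - h)"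
    and x: "x \<le> 1 - J \<alpha> \<beta> a b" "y \<le> 1 - J \<alpha> \<beta> a b"
    and q: "2 * k * (1 - h\<^sup>2) * B \<le> - (x\<^sup>2 + y\<^sup>2 + 2 * h * x * y)"
    and P: "\<forall>P. (\<forall>t t' u. t0 \<le> t \<longrightarrow> t < t' \<longrightarrow> t' \<le> t1 \<longrightarrow> u0 \<le> u \<longrightarrow> u \<le> u1 \<longrightarrow> J \<alpha> \<beta> t' u - J \<alpha> \<beta> t u \<le> P * (t' - t)) \<longrightarrow> x \<le> S a * P"
     "\<forall>P. (\<forall>t u u'. t0 \<le> t \<longrightarrow> t \<le> t1 \<longrightarrow> u0 \<le> u \<longrightarrow> u < u' \<longrightarrow> u' \<le> u1 \<longrightarrow> J \<alpha> \<beta> t u' - J \<alpha> \<beta> t u \<le> P * (u' - u)) \<longrightarrow> y \<le> S b * P"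
    by (elim exE conjE)
  have "x \<le> M \<and> y \<le> M" using M(2)
  proof
    assume "M = 2"
    moreover have "-1 \<le> J \<alpha> \<beta> a b" using rect ab by (intro J_bounds(1)[OF g]) auto
    ultimately show ?thesis using x by linarith
  next
    assume "\<exists>P Q.
       (\<forall>t t' u. t0 \<le> t \<longrightarrow> t < t' \<longrightarrow> t' \<le> t1 \<longrightarrow> u0 \<le> u \<longrightarrow> u \<le> u1 \<longrightarrow> J \<alpha> \<beta> t' u - J \<alpha> \<beta> t u \<le> P * (t' - t)) \<and>
       (\<forall>t u u'. t0 \<le> t \<longrightarrow> t \<le> t1 \<longrightarrow> u0 \<le> u \<longrightarrow> u < u' \<longrightarrow> u' \<le> u1 \<longrightarrow> J \<alpha> \<beta> t u' - J \<alpha> \<beta> t u \<le> Q * (u' - u)) \<and>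
       (\<forall>a b. t0 \<le> a \<longrightarrow> a \<le> t1 \<longrightarrow> u0 \<le> b \<longrightarrow> b \<le> u1 \<longrightarrow> S a * P \<le> M \<and> S b * Q \<le> M)"
    then obtain p q where pq: "\<forall>t t' u. t0 \<le> t \<longrightarrow> t < t' \<longrightarrow> t' \<le> t1 \<longrightarrow> u0 \<le> u \<longrightarrow> u \<le> u1 \<longrightarrow> J \<alpha> \<beta> t' u - J \<alpha> \<beta> t u \<le> p * (t' - t)"
       "\<forall>t u u'. t0 \<le> t \<longrightarrow> t \<le> t1 \<longrightarrow> u0 \<le> u \<longrightarrow> u < u' \<longrightarrow> u' \<le> u1 \<longrightarrow> J \<alpha> \<beta> t u' - J \<alpha> \<beta> t u \<le> q * (u' - u)"
       and pq': "\<forall>a b. t0 \<le> a \<longrightarrow> a \<le> t1 \<longrightarrow> u0 \<le> b \<longrightarrow> b \<le> u1 \<longrightarrow> S a * p \<le> M \<and> S b * q \<le> M" by (elim exE conjE)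
    have "S a * p \<le> M" "S b * q \<le> M" using pq' ab by simp_all
    then show ?thesis using P(1)[rule_format, OF pq(1)[rule_format]] P(2)[rule_format, OF pq(2)[rule_format]] by linarith
  qed
  then show False using quadratic_bound[OF h _ _ M(1) q] B(1) by auto
qed

text \<open>Seen from \<open>\<beta> u\<close> with small \<open>u\<close>, the distances to
  \<open>\<alpha> t\<close> and \<open>\<alpha> t'\<close> differ by \<open>t' - t\<close> up to an
  error of order \<open>1 - C u\<close>. The constant \<open>c\<close> may depend on
  \<open>t\<close> and \<open>t'\<close> but not on \<open>u\<close>; hence the increase of
  \<open>J\<close> from \<open>t\<close> to \<open>t'\<close> has a nonpositive upper limit as
  \<open>u\<close> tends to 0.\<close>

lemma first_variation:
  assumes g: "geod X d \<alpha> T" "geod X d \<beta> U" "\<alpha> 0 = \<beta> 0" and t: "0 < t" "t < t'" "t' \<le> T"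
  shows "\<exists>c\<ge>0. \<forall>u. 0 < u \<longrightarrow> u \<le> U \<longrightarrow> J \<alpha> \<beta> t' u - J \<alpha> \<beta> t u \<le> c * (k * (1 - C u) / S u)"
proof -
  define q where "q = t' - t"
  have q: "0 < q" "t' = t + q" "t \<le> T" using t by (auto simp: q_def)
  have St: "0 < S t" "0 < S t'" "0 < S q" using geod_S_pos[OF g(1)] t q by auto
  have Ct: "0 < C t" "0 \<le> C t'" "0 \<le> C q" "0 \<le> C ((t - q) / 2)" "0 \<le> C ((t + q) / 2)"
    using geod_bnd[OF g(1)] t q by (auto intro!: C_nonneg C_pos)
  define c0 where "c0 = (if sg = 1 then (1 + C q) / (C t + C t') else (C t + C q) / (1 + C t'))"
  have c0: "0 \<le> c0" using Ct by (auto simp: c0_def intro!: divide_nonneg_nonneg add_nonneg_nonneg)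
  have "J \<alpha> \<beta> t' u - J \<alpha> \<beta> t u \<le> c0 / S t * (k * (1 - C u) / S u)" if u: "0 < u" "u \<le> U" for u
  proof -
    define f where "f = d (\<alpha> t) (\<beta> u)"
    define e where "e = d (\<alpha> t') (\<beta> u)"
    have X: "\<alpha> 0 \<in> X" "\<alpha> t \<in> X" "\<alpha> t' \<in> X" "\<beta> u \<in> X"
      using geodD(2)[OF g(1)] geodD(2)[OF g(2)] t u by auto
    have dd: "d (\<alpha> 0) (\<alpha> t) = t" "d (\<alpha> t) (\<alpha> 0) = t" "d (\<alpha> 0) (\<alpha> t') = t'" "d (\<alpha> t) (\<alpha> t') = q" "d (\<alpha> 0) (\<beta> u) = u"
      "d (\<beta> u) (\<alpha> t') = e" "d (\<alpha> t) (\<beta> u) = f"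
      using geodD(3)[OF g(1), of 0 t] geodD(3)[OF g(1), of t 0] geodD(3)[OF g(1), of 0 t'] geodD(3)[OF g(1), of t t']
        geodD(3)[OF g(2), of 0 u] t u g(3) d_comm[OF X(3,4)] by (simp_all add: f_def e_def q_def)
    have Su: "0 < S u" using geod_S_pos[OF g(2) u] .
    \<comment> \<open>In terms of distances, \<open>f\<close> is at most \<open>e - q\<close> up to
      an error governed by \<open>1 - C u\<close>. The triangle inequality gives the reverse
      estimate without error.\<close>
    have FV: "k * C (e - q) - c0 * (k * (1 - C u)) \<le> k * C f"
      using sg
    proof
      assume s: "sg = 1"
      define N where "N = C t + C t'"
      have N: "0 < N" using Ct by (simp add: N_def)
      have "sg * k * ((C (d (\<alpha> 0) (\<beta> u)) + C (d (\<alpha> t) (\<alpha> 0)) * C (d (\<beta> u) (\<alpha> t'))) * (1 + C (d (\<alpha> t) (\<alpha> t')))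
        - (C (d (\<alpha> t) (\<alpha> 0)) + C (d (\<alpha> 0) (\<alpha> t'))) * (C (d (\<beta> u) (\<alpha> t')) + C (d (\<alpha> t) (\<beta> u))))
        \<le> S (d (\<alpha> t) (\<alpha> 0)) * S (d (\<beta> u) (\<alpha> t')) * (1 + C (d (\<alpha> t) (\<alpha> t')))"
        by (rule four[OF X(2,1,4,3)])
      then have "k * ((C u + C t * C e) * (1 + C q) - N * (C e + C f)) \<le> S t * S e * (1 + C q)"
        unfolding dd s N_def by simp
      moreover have "k * (C (t + e) * (1 + C q)) = k * (C t * C e * (1 + C q)) - S t * S e * (1 + C q)"
        unfolding C_add using k by (auto simp: algebra_simps)
      ultimately have "k * ((1 + C (t + e)) * (1 + C q)) - k * (1 - C u) * (1 + C q) - k * C e * N \<le> k * C f * N"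
        by (simp add: algebra_simps)
      moreover have "k * ((C e + C (e - q)) * N) \<le> k * ((1 + C (t + e)) * (1 + C q))"
        using first_variation_plus[of e q t] q by (simp add: N_def)
      ultimately have "k * C (e - q) * N - k * (1 - C u) * (1 + C q) \<le> k * C f * N"
        by (simp add: algebra_simps)
      moreover have cN: "c0 * N = 1 + C q" using N by (simp add: c0_def s N_def)
      have "(k * C (e - q) - c0 * (k * (1 - C u))) * N = k * C (e - q) * N - k * (1 - C u) * (1 + C q)"
        unfolding cN[symmetric] by (simp add: algebra_simps)
      ultimately have "(k * C (e - q) - c0 * (k * (1 - C u))) * N \<le> (k * C f) * N" by linarith
      then show ?thesis using N by (rule mult_right_le_imp_le)
    next
      assume s: "sg = -1"
      define N where "N = 1 + C t'"
      have N: "0 < N" using Ct by (simp add: N_def)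
      have "sg * k * ((C (d (\<alpha> t) (\<beta> u)) + C (d (\<alpha> 0) (\<alpha> t)) * C (d (\<beta> u) (\<alpha> t'))) * (1 + C (d (\<alpha> 0) (\<alpha> t')))
        - (C (d (\<alpha> 0) (\<alpha> t)) + C (d (\<alpha> t) (\<alpha> t'))) * (C (d (\<beta> u) (\<alpha> t')) + C (d (\<alpha> 0) (\<beta> u))))
        \<le> S (d (\<alpha> 0) (\<alpha> t)) * S (d (\<beta> u) (\<alpha> t')) * (1 + C (d (\<alpha> 0) (\<alpha> t')))"
        by (rule four[OF X(1,2,4,3)])
      then have "- k * ((C f + C t * C e) * N - (C t + C q) * (C e + C u)) \<le> S t * S e * N"
        unfolding dd s N_def by simp
      moreover have "k * (C (t - e) * N) = k * (C t * C e * N) + S t * S e * N"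
        unfolding C_diff using k by (auto simp: algebra_simps)
      ultimately have "k * ((C t + C q) * (C e + 1)) - k * (1 - C u) * (C t + C q) - k * C (t - e) * N \<le> k * C f * N"
        by (simp add: algebra_simps)
      moreover have "k * ((C (t - e) + C (e - q)) * N) \<le> k * ((C t + C q) * (C e + 1))"
        using first_variation_minus[OF Ct(4,5), of e] q by (simp add: N_def)
      ultimately have "k * C (e - q) * N - k * (1 - C u) * (C t + C q) \<le> k * C f * N"
        by (simp add: algebra_simps)
      moreover have cN: "c0 * N = C t + C q" using N by (simp add: c0_def s N_def)
      have "(k * C (e - q) - c0 * (k * (1 - C u))) * N = k * C (e - q) * N - k * (1 - C u) * (C t + C q)"
        unfolding cN[symmetric] by (simp add: algebra_simps)
      ultimately have "(k * C (e - q) - c0 * (k * (1 - C u))) * N \<le> (k * C f) * N" by linarith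
      then show ?thesis using N by (rule mult_right_le_imp_le)
    qed
    \<comment> \<open>Written through \<open>\<eta>\<close>, both values of \<open>J\<close> consist
      of the common term \<open>S \<eta> / S u\<close> and a nonnegative multiple of the cotangent
      \<open>C t / S t\<close> or \<open>C t' / S t'\<close>, up to the error in \<open>FV\<close>;
      the cotangent decreases.\<close>
    define \<eta> where "\<eta> = t' - e"
    have \<eta>: "\<bar>\<eta>\<bar> \<le> u"
      using d_tri[OF X(1,4,3)] d_tri[OF X(3,4,1)] d_tri[OF X(1,3,4)] d_tri[OF X(3,1,4)] d_comm[OF X(3,1)] d_comm[OF X(4,1)]
      unfolding \<eta>_def e_def by (simp add: dd abs_le_iff)
    have "k * C u \<le> k * C \<bar>\<eta>\<bar>" using \<eta> geod_bnd[OF g(2)] u pi_gt_zero by (intro kC_mono) auto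
    then have ku: "0 \<le> k * (C \<eta> - C u)" by (simp add: algebra_simps)
    have e1: "e - q = t - \<eta>" "e = t' - \<eta>" using q by (auto simp: \<eta>_def)
    have "k * C (e - q) = k * C t * C \<eta> + S t * S \<eta>" unfolding e1(1) C_diff using k by (auto simp: algebra_simps)
    then have "C t * (k * (C \<eta> - C u)) + S t * S \<eta> - c0 * (k * (1 - C u)) \<le> k * (C f - C t * C u)"
      using FV by (simp add: algebra_simps)
    then have "(C t * (k * (C \<eta> - C u)) + S t * S \<eta> - c0 * (k * (1 - C u))) / (S t * S u) \<le> J \<alpha> \<beta> t u"
      unfolding J_def f_def[symmetric] using St Su by (intro divide_right_mono) auto
    moreover have r1: "(c * y + s * z - c0 * w) / (s * v) = (c / s * y + z) / v - c0 / s * (w / v)" if "0 < s" "0 < v" for c y s z w v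
      using that by (simp add: field_simps)
    ultimately have J1: "(C t / S t * (k * (C \<eta> - C u)) + S \<eta>) / S u - c0 / S t * (k * (1 - C u) / S u) \<le> J \<alpha> \<beta> t u"
      by (simp only: r1[OF St(1) Su])
    have "k * C e = k * C t' * C \<eta> + S t' * S \<eta>" unfolding e1(2) C_diff using k by (auto simp: algebra_simps)
    then have "k * (C e - C t' * C u) = C t' * (k * (C \<eta> - C u)) + S t' * S \<eta>" by (simp add: algebra_simps)
    moreover have r2: "(c * y + s * z) / (s * v) = (c / s * y + z) / v" if "0 < s" "0 < v" for c y s z v :: real
      using that by (simp add: field_simps)
    ultimately have J2: "J \<alpha> \<beta> t' u = (C t' / S t' * (k * (C \<eta> - C u)) + S \<eta>) / S u"
      unfolding J_def e_def[symmetric] by (simp only: r2[OF St(2) Su])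
    have "C t / S t - C t' / S t' = S q / (S t * S t')"
      unfolding q_def S_diff using St by (simp add: field_simps)
    moreover have "0 \<le> S q / (S t * S t')" using St by simp
    ultimately have "C t' / S t' \<le> C t / S t" by linarith
    then have "(C t' / S t' * (k * (C \<eta> - C u)) + S \<eta>) / S u \<le> (C t / S t * (k * (C \<eta> - C u)) + S \<eta>) / S u"
      using Su ku by (intro divide_right_mono add_right_mono mult_right_mono) auto
    then show ?thesis using J1 J2 by linarith
  qed
  moreover have "0 \<le> c0 / S t" using c0 St by simp
  ultimately show ?thesis by blast
qed

lemma J_comm:
  assumes "geod X d \<alpha> T" "geod X d \<beta> U" "0 \<le> t" "t \<le> T" "0 \<le> u" "u \<le> U"
  shows "J \<beta> \<alpha> u t = J \<alpha> \<beta> t u"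
  unfolding J_def using d_comm[of "\<alpha> t" "\<beta> u"] geodD(2)[OF assms(1)] geodD(2)[OF assms(2)] assms by (simp add: ac_simps)

text \<open>The rectangle over \<open>{v..u}\<close> carries the slope from height \<open>u\<close>
  down to height \<open>v\<close>. As \<open>v\<close> tends to 0 the slope there is controlled by
  \<open>first_variation\<close>, so that only \<open>B\<close> times the height remains.\<close>

lemma slope_from_rect:
  assumes g: "geod X d \<alpha> T" "geod X d \<beta> U" "\<alpha> 0 = \<beta> 0"
    and V: "0 < V" "V \<le> U" and B: "0 \<le> B"
    and rect: "\<And>t0 t1 u0 u1. 0 < t0 \<Longrightarrow> t0 < t1 \<Longrightarrow> t1 \<le> T \<Longrightarrow> 0 < u0 \<Longrightarrow> u0 < u1 \<Longrightarrow> u1 \<le> V \<Longrightarrow>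
       J \<alpha> \<beta> t1 u1 - J \<alpha> \<beta> t1 u0 - J \<alpha> \<beta> t0 u1 + J \<alpha> \<beta> t0 u0 \<le> B * ((t1 - t0) * (u1 - u0))"
    and t: "0 < t" "t < t'" "t' \<le> T" "0 < u" "u \<le> V"
  shows "J \<alpha> \<beta> t' u - J \<alpha> \<beta> t u \<le> B * u * (t' - t)"
proof -
  obtain c where c: "\<And>u. 0 < u \<Longrightarrow> u \<le> U \<Longrightarrow> J \<alpha> \<beta> t' u - J \<alpha> \<beta> t u \<le> c * (k * (1 - C u) / S u)"
    using first_variation[OF g t(1-3)] by blast
  have "((\<lambda>v. c * (k * (1 - C v) / S v) + B * u * (t' - t)) \<longlongrightarrow> c * 0 + B * u * (t' - t)) (at_right 0)"
    by (intro tendsto_intros half_tangent_limit)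
  moreover have "\<forall>\<^sub>F v in at_right 0. J \<alpha> \<beta> t' u - J \<alpha> \<beta> t u \<le> c * (k * (1 - C v) / S v) + B * u * (t' - t)"
  proof (rule eventually_at_rightI[OF _ t(4)])
    fix v assume v: "v \<in> {0<..<u}"
    have "J \<alpha> \<beta> t' u - J \<alpha> \<beta> t' v - J \<alpha> \<beta> t u + J \<alpha> \<beta> t v \<le> B * ((t' - t) * (u - v))"
      using v t by (intro rect) auto
    also have "\<dots> \<le> B * ((t' - t) * u)" using v t B by (intro mult_left_mono) auto
    also have "\<dots> = B * u * (t' - t)" by (simp add: ac_simps)
    finally show "J \<alpha> \<beta> t' u - J \<alpha> \<beta> t u \<le> c * (k * (1 - C v) / S v) + B * u * (t' - t)"
      using c[of v] v V t by (auto simp: )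
  qed
  ultimately show ?thesis
    by (intro tendsto_lowerbound[of _ _ "at_right (0::real)"]) auto
qed

text \<open>The bootstrap. \<open>M = 2\<close> bounds second differences by twice the area, hence
  the slopes by \<open>2 * u\<close> in \<open>t\<close> and by \<open>2 * t\<close> in
  \<open>u\<close>. These permit \<open>M = V * K\<close> for parameters up to \<open>V\<close> on
  \<open>\<beta>\<close>, so second differences are of order \<open>V\<^sup>2\<close> and
  monotonicity at height \<open>V\<close> fails by at most a multiple of \<open>V ^ 3\<close>. For
  \<open>k = 1\<close> the constant \<open>Q\<close> is 0.\<close>

lemma J_almost_decreasing:
  assumes g: "geod X d \<alpha> T" "geod X d \<beta> U" "\<alpha> 0 = \<beta> 0"
    and TU: "0 < T" "0 < U"
    and pos: "\<And>t u. 0 < t \<Longrightarrow> t \<le> T \<Longrightarrow> 0 < u \<Longrightarrow> u \<le> U \<Longrightarrow> 0 < d (\<alpha> t) (\<beta> u) \<and> 0 < C (d (\<alpha> t) (\<beta> u))"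
  shows "\<exists>Q\<ge>0. \<forall>t u. 0 < t \<longrightarrow> t \<le> T \<longrightarrow> 0 < u \<longrightarrow> u \<le> U \<longrightarrow> J \<alpha> \<beta> T u - J \<alpha> \<beta> t u \<le> Q * u ^ 3"
proof -
  have k2: "0 \<le> 1 - k" "1 - k \<le> 2" using k by auto
  have r1: "J \<alpha> \<beta> t1 u1 - J \<alpha> \<beta> t1 u0 - J \<alpha> \<beta> t0 u1 + J \<alpha> \<beta> t0 u0 \<le> 2 * ((t1 - t0) * (u1 - u0))"
    if that: "0 < t0" "t0 < t1" "t1 \<le> T" "0 < u0" "u0 < u1" "u1 \<le> U" for t0 t1 u0 u1
  proof -
    have "J \<alpha> \<beta> t1 u1 - J \<alpha> \<beta> t1 u0 - J \<alpha> \<beta> t0 u1 + J \<alpha> \<beta> t0 u0 \<le> (1 - k) * 2\<^sup>2 / 4 * ((t1 - t0) * (u1 - u0))"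
      by (rule rect_bound[OF g that]) (rule pos, use that in auto)
    also have "\<dots> \<le> 2 * ((t1 - t0) * (u1 - u0))" using k2 that by (intro mult_right_mono) auto
    finally show ?thesis .
  qed
  have s1: "J \<alpha> \<beta> t' u - J \<alpha> \<beta> t u \<le> 2 * u * (t' - t)" if "0 < t" "t < t'" "t' \<le> T" "0 < u" "u \<le> U" for t t' u
    by (rule slope_from_rect[OF g TU(2) order_refl _ r1 that]) auto
  have r2: "J \<beta> \<alpha> t1 u1 - J \<beta> \<alpha> t1 u0 - J \<beta> \<alpha> t0 u1 + J \<beta> \<alpha> t0 u0 \<le> 2 * ((t1 - t0) * (u1 - u0))"
    if "0 < t0" "t0 < t1" "t1 \<le> U" "0 < u0" "u0 < u1" "u1 \<le> T" for t0 t1 u0 u1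
    using r1[of u0 u1 t0 t1] that by (simp add: J_comm[OF g(1,2)] ac_simps)
  have s2: "J \<alpha> \<beta> t u' - J \<alpha> \<beta> t u \<le> 2 * t * (u' - u)" if "0 < t" "t \<le> T" "0 < u" "u < u'" "u' \<le> U" for t u u'
    using slope_from_rect[OF g(2,1) g(3)[symmetric] TU(1) order_refl _ r2 that(3,4,5,1,2)] that by (simp add: J_comm[OF g(1,2)])
  define K where "K = 2 * T * (cosh T + cosh U)"
  define Q where "Q = (1 - k) * K\<^sup>2 / 4 * T"
  have K: "0 \<le> K" using TU by (simp add: K_def add_nonneg_nonneg)
  have "J \<alpha> \<beta> T V - J \<alpha> \<beta> t V \<le> Q * V ^ 3" if "0 < t" "t \<le> T" and V: "0 < V" "V \<le> U" for t V
  proof (cases "t = T")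
    case True
    have "0 \<le> Q * V ^ 3" using k2 TU V by (simp add: Q_def)
    then show ?thesis using True by simp
  next
    case False
    have SV: "S a * (2 * V) \<le> V * K" if "0 < a" "a \<le> T" for a
    proof -
      have "S a \<le> a * cosh a" using that by (intro S_le) auto
      also have "\<dots> \<le> T * cosh T" using that by (intro mult_mono) (auto simp: cosh_real_nonneg_le_iff)
      also have "\<dots> \<le> T * (cosh T + cosh U)" using TU by (intro mult_left_mono) auto
      finally have "S a * (2 * V) \<le> T * (cosh T + cosh U) * (2 * V)" using V by (intro mult_right_mono) auto
      then show ?thesis by (simp add: K_def ac_simps)
    qed
    \<comment> \<open>The slope in \<open>u\<close> is only bounded by \<open>2 * T\<close>, but it
      is scaled by \<open>S b\<close> with \<open>b \<le> V\<close>; so it gains a factor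
      \<open>V\<close> as well.\<close>
    have ST: "S b * (2 * T) \<le> V * K" if "0 < b" "b \<le> V" for b
    proof -
      have "S b \<le> b * cosh b" using that by (intro S_le) auto
      also have "\<dots> \<le> V * cosh U" using that V by (intro mult_mono) (auto simp: cosh_real_nonneg_le_iff)
      also have "\<dots> \<le> V * (cosh T + cosh U)" using V by (intro mult_left_mono) auto
      finally have "S b * (2 * T) \<le> V * (cosh T + cosh U) * (2 * T)" using TU by (intro mult_right_mono) auto
      then show ?thesis by (simp add: K_def ac_simps)
    qed
    have r3: "J \<alpha> \<beta> t1 u1 - J \<alpha> \<beta> t1 u0 - J \<alpha> \<beta> t0 u1 + J \<alpha> \<beta> t0 u0 \<le> (1 - k) * (V * K)\<^sup>2 / 4 * ((t1 - t0) * (u1 - u0))"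
      if that: "0 < t0" "t0 < t1" "t1 \<le> T" "0 < u0" "u0 < u1" "u1 \<le> V" for t0 t1 u0 u1
    proof (rule rect_bound[OF g that(1-5)])
      show "u1 \<le> U" using that V by simp
      show "0 \<le> V * K" using V K by simp
      show "0 < d (\<alpha> t) (\<beta> u) \<and> 0 < C (d (\<alpha> t) (\<beta> u))" if "t0 \<le> t" "t \<le> t1" "u0 \<le> u" "u \<le> u1" for t u
        using that \<open>0 < t0\<close> \<open>t1 \<le> T\<close> \<open>0 < u0\<close> \<open>u1 \<le> V\<close> V by (intro pos) auto
      have a: "J \<alpha> \<beta> t' u - J \<alpha> \<beta> t u \<le> (2 * V) * (t' - t)" if "t0 \<le> t" "t < t'" "t' \<le> t1" "u0 \<le> u" "u \<le> u1" for t t' u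
      proof -
        have "J \<alpha> \<beta> t' u - J \<alpha> \<beta> t u \<le> 2 * u * (t' - t)"
          using that \<open>0 < t0\<close> \<open>t1 \<le> T\<close> \<open>0 < u0\<close> \<open>u1 \<le> V\<close> V by (intro s1) auto
        also have "\<dots> \<le> (2 * V) * (t' - t)" using that \<open>u1 \<le> V\<close> by (intro mult_right_mono) auto
        finally show ?thesis .
      qed
      have b: "J \<alpha> \<beta> t u' - J \<alpha> \<beta> t u \<le> (2 * T) * (u' - u)" if "t0 \<le> t" "t \<le> t1" "u0 \<le> u" "u < u'" "u' \<le> u1" for t u u'
      proof -
        have "J \<alpha> \<beta> t u' - J \<alpha> \<beta> t u \<le> 2 * t * (u' - u)"
          using that \<open>0 < t0\<close> \<open>t1 \<le> T\<close> \<open>0 < u0\<close> \<open>u1 \<le> V\<close> V by (intro s2) auto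
        also have "\<dots> \<le> (2 * T) * (u' - u)" using that \<open>t1 \<le> T\<close> by (intro mult_right_mono) auto
        finally show ?thesis .
      qed
      show "V * K = 2 \<or> (\<exists>P Q.
       (\<forall>t t' u. t0 \<le> t \<longrightarrow> t < t' \<longrightarrow> t' \<le> t1 \<longrightarrow> u0 \<le> u \<longrightarrow> u \<le> u1 \<longrightarrow> J \<alpha> \<beta> t' u - J \<alpha> \<beta> t u \<le> P * (t' - t)) \<and>
       (\<forall>t u u'. t0 \<le> t \<longrightarrow> t \<le> t1 \<longrightarrow> u0 \<le> u \<longrightarrow> u < u' \<longrightarrow> u' \<le> u1 \<longrightarrow> J \<alpha> \<beta> t u' - J \<alpha> \<beta> t u \<le> Q * (u' - u)) \<and>
       (\<forall>a b. t0 \<le> a \<longrightarrow> a \<le> t1 \<longrightarrow> u0 \<le> b \<longrightarrow> b \<le> u1 \<longrightarrow> S a * P \<le> V * K \<and> S b * Q \<le> V * K))"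
        by (rule disjI2, rule exI[of _ "2 * V"], rule exI[of _ "2 * T"]) (use a b SV ST that in auto)
    qed
    have "J \<alpha> \<beta> T V - J \<alpha> \<beta> t V \<le> (1 - k) * (V * K)\<^sup>2 / 4 * V * (T - t)"
      by (rule slope_from_rect[OF g V _ r3]) (use that k2 V False in auto)
    also have "\<dots> \<le> (1 - k) * (V * K)\<^sup>2 / 4 * V * T"
      using that k2 V by (intro mult_left_mono) auto
    also have "\<dots> = Q * V ^ 3" by (simp add: Q_def power2_eq_square power3_eq_cube)
    finally show ?thesis .
  qed
  moreover have "0 \<le> Q" using k2 TU by (simp add: Q_def)
  ultimately show ?thesis by blast
qed

end

section \<open>Maximum principle and the concavity inequality\<close>

context curv
begin

lemma tendsto_ratio_zero: "((\<lambda>\<delta>. S \<delta> / \<delta>) \<longlongrightarrow> 1) (at_right 0)"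
  using DERIV_S[OF DERIV_ident, of 0 UNIV] by (auto simp: DERIV_def intro: filterlim_at_split[THEN iffD1, THEN conjunct2])

text \<open>\<open>l\<close> is the solution of \<open>f'' = - k * f\<close> with the boundary
  values of \<open>h\<close>. If \<open>k * (h - l)\<close> were negative somewhere, a shift by
  \<open>\<epsilon> * k\<close> and division by a positive solution \<open>w\<close> would leave an
  interior minimum. There the second difference of the shift, of exact order
  \<open>\<delta>\<^sup>2\<close>, outweighs the cubic error.\<close>

lemma concave_max_principle:
  fixes h :: "real \<Rightarrow> real"
  assumes ab: "a < b" "k = 1 \<Longrightarrow> b - a \<le> pi / 2"
    and cont: "continuous_on {a..b} h"
    and loc: "\<And>s. a < s \<Longrightarrow> s < b \<Longrightarrow> \<exists>Q \<delta>0. 0 < \<delta>0 \<and> (\<forall>\<delta>. 0 < \<delta> \<longrightarrow> \<delta> \<le> \<delta>0 \<longrightarrow> k * (h (s + \<delta>) + h (s - \<delta>) - 2 * C \<delta> * h s) \<le> Q * \<delta> ^ 3)"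
    and s1: "a \<le> s1" "s1 \<le> b"
  shows "0 \<le> k * (S (b - a) * h s1 - S (b - s1) * h a - S (s1 - a) * h b)"
proof (rule ccontr)
  assume neg: "\<not> ?thesis"
  have Sab: "0 < S (b - a)" using ab pi_gt_zero by (intro S_pos) (auto intro: order_le_less_trans)
  define l where "l s = (S (b - s) * h a + S (s - a) * h b) / S (b - a)" for s
  have la: "l a = h a" "l b = h b" using Sab by (auto simp: l_def)
  have l2: "l (s + \<delta>) + l (s - \<delta>) = 2 * C \<delta> * l s" for s \<delta>
  proof -
    have "S (x + \<delta>) + S (x - \<delta>) = 2 * C \<delta> * S x" for x by (simp add: S_add S_diff)
    from this[of "b - s"] this[of "s - a"]
    have 1: "S (b - (s - \<delta>)) + S (b - (s + \<delta>)) = 2 * C \<delta> * S (b - s)" "S (s + \<delta> - a) + S (s - \<delta> - a) = 2 * C \<delta> * S (s - a)"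
      by (simp_all add: algebra_simps)
    have "l (s + \<delta>) + l (s - \<delta>) = ((S (b - (s - \<delta>)) + S (b - (s + \<delta>))) * h a + (S (s + \<delta> - a) + S (s - \<delta> - a)) * h b) / S (b - a)"
      unfolding l_def add_divide_distrib[symmetric] by (simp add: algebra_simps)
    then show ?thesis unfolding 1 l_def by (simp add: algebra_simps)
  qed
  define g0 where "g0 s = k * (h s - l s)" for s
  have "k * (S (b - a) * h s1 - S (b - s1) * h a - S (s1 - a) * h b) = S (b - a) * g0 s1"
    unfolding g0_def l_def using Sab by (simp add: field_simps)
  then have g0: "g0 s1 < 0" using neg Sab by (simp add: not_le mult_less_0_iff)
  \<comment> \<open>The solution symmetric about the midpoint. It is positive on the interval, whose
    length is at most \<open>pi / 2\<close> if \<open>k = 1\<close>; division by it makes the second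
    difference at a minimum comparable with \<open>2 * C \<delta>\<close> times the value.\<close>
  define w where "w s = C (s - (a + b) / 2)" for s
  have w: "0 < w s" if "a \<le> s" "s \<le> b" for s
    unfolding w_def using that ab pi_gt_zero by (intro C_pos) (auto simp: abs_less_iff field_simps)
  have w2: "w (s + \<delta>) + w (s - \<delta>) = 2 * C \<delta> * w s" for s \<delta>
  proof -
    have "C (x + \<delta>) + C (x - \<delta>) = 2 * C \<delta> * C x" for x by (simp add: C_add C_diff)
    from this[of "s - (a + b) / 2"] show ?thesis unfolding w_def by (simp add: algebra_simps)
  qed
  have wab: "w a = w b"
  proof -
    have "a - (a + b) / 2 = - (b - (a + b) / 2)" by (simp add: field_simps)
    then show ?thesis unfolding w_def by (metis C_minus)
  qed
  \<comment> \<open>After the shift the quotient at \<open>s1\<close> has to stay below both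
    boundary values. For \<open>k = 1\<close> the shift lowers the latter, to one half of
    \<open>g0 s1\<close>; for \<open>k = -1\<close> it raises them above 0 while the value at
    \<open>s1\<close> remains negative.\<close>
  obtain \<epsilon> where \<epsilon>: "0 < \<epsilon>" "(g0 s1 - \<epsilon> * k) / w s1 < - \<epsilon> * k / w a" "(g0 s1 - \<epsilon> * k) / w s1 < 0"
  proof -
    have ws: "0 < w s1" "0 < w a" using w ab s1 by auto
    show thesis using k
    proof
      assume k1: "k = 1"
      define e where "e = - g0 s1 * w a / 2"
      have e: "0 < e" using g0 ws by (simp add: e_def mult_neg_pos)
      have w1: "w s1 \<le> 1" using k1 by (simp add: w_def cs_def)
      have "g0 s1 / w s1 \<le> g0 s1" using w1 ws g0 by (simp add: pos_divide_le_eq mult_le_cancel_left1)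
      moreover have "- e / w a = g0 s1 / 2" using ws by (simp add: e_def)
      moreover have "(g0 s1 - e * k) / w s1 = g0 s1 / w s1 - e / w s1" using k1 by (simp add: diff_divide_distrib)
      moreover have "0 < e / w s1" using e ws by simp
      ultimately show thesis using that[of e] e g0 k1 by simp
    next
      assume k1: "k = -1"
      define e where "e = - g0 s1 / 2"
      have "(g0 s1 - e * k) / w s1 < 0" using g0 ws k1 by (simp add: e_def divide_neg_pos)
      moreover have "0 < - e * k / w a" using g0 ws k1 by (simp add: e_def divide_neg_pos)
      moreover have "0 < e" using g0 by (simp add: e_def)
      ultimately show thesis using that[of e] by linarith
    qed
  qed
  define g where "g s = g0 s - \<epsilon> * k" for s
  have "continuous_on {a..b} (\<lambda>s. g s / w s)"
    unfolding g_def g0_def l_def w_def using Sab w[unfolded w_def]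
    by (intro continuous_intros cont) (force simp: )+
  then obtain s0 where s0: "s0 \<in> {a..b}" "\<And>s. s \<in> {a..b} \<Longrightarrow> g s0 / w s0 \<le> g s / w s"
    using continuous_attains_inf[of "{a..b}" "\<lambda>s. g s / w s"] ab by auto
  define m where "m = g s0 / w s0"
  have m1: "m \<le> g s1 / w s1" using s0(2)[of s1] s1 by (simp add: m_def)
  have ga: "g a / w a = - \<epsilon> * k / w a" "g b / w b = - \<epsilon> * k / w a" by (simp_all add: g_def g0_def la wab)
  have "s0 \<noteq> a" "s0 \<noteq> b" using m1 \<epsilon>(2) ga unfolding m_def g_def by auto
  then have s0i: "a < s0" "s0 < b" using s0(1) by auto
  have gm: "m * w s \<le> g s" if "a \<le> s" "s \<le> b" for s
    using s0(2)[of s] w[OF that] that by (simp add: m_def[symmetric] pos_le_divide_eq)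
  have gs0: "g s0 = m * w s0" using w[of s0] s0i by (simp add: m_def)
  obtain Q \<delta>0 where Q: "0 < \<delta>0" "\<And>\<delta>. 0 < \<delta> \<Longrightarrow> \<delta> \<le> \<delta>0 \<Longrightarrow> k * (h (s0 + \<delta>) + h (s0 - \<delta>) - 2 * C \<delta> * h s0) \<le> Q * \<delta> ^ 3"
    using loc[OF s0i] by blast
  define \<delta>1 where "\<delta>1 = min \<delta>0 (min (s0 - a) (b - s0))"
  have \<delta>1: "0 < \<delta>1" using Q s0i by (simp add: \<delta>1_def)
  have key: "k * (1 - C \<delta>) / \<delta>\<^sup>2 \<le> Q * \<delta> / (2 * \<epsilon>)" if d: "0 < \<delta>" "\<delta> < \<delta>1" for \<delta>
  proof -
    have "m * w (s0 + \<delta>) + m * w (s0 - \<delta>) \<le> g (s0 + \<delta>) + g (s0 - \<delta>)"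
      using d \<delta>1_def s0i by (intro add_mono gm) auto
    then have "2 * C \<delta> * g s0 \<le> g (s0 + \<delta>) + g (s0 - \<delta>)"
      unfolding gs0 using w2[of s0 \<delta>] by (metis distrib_left mult.left_commute)
    moreover have "g (s0 + \<delta>) + g (s0 - \<delta>) - 2 * C \<delta> * g s0 = k * (h (s0 + \<delta>) + h (s0 - \<delta>) - 2 * C \<delta> * h s0)
       - k * (l (s0 + \<delta>) + l (s0 - \<delta>) - 2 * C \<delta> * l s0) - 2 * \<epsilon> * (k * (1 - C \<delta>))"
      unfolding g_def g0_def by (simp add: algebra_simps)
    moreover have "k * (h (s0 + \<delta>) + h (s0 - \<delta>) - 2 * C \<delta> * h s0) \<le> Q * \<delta> ^ 3"
      using d by (intro Q) (auto simp: \<delta>1_def)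
    ultimately have "2 * \<epsilon> * (k * (1 - C \<delta>)) \<le> Q * \<delta> ^ 3" unfolding l2 by simp
    then have "k * (1 - C \<delta>) \<le> (Q * \<delta> / (2 * \<epsilon>)) * \<delta>\<^sup>2"
      using \<epsilon>(1) by (simp add: field_simps power2_eq_square power3_eq_cube)
    then show ?thesis using d by (simp add: pos_divide_le_eq)
  qed
  have "(1/2 :: real) \<le> Q * 0 / (2 * \<epsilon>)"
  proof (rule tendsto_le[of "at_right 0"])
    show "((\<lambda>\<delta>. k * (1 - C \<delta>) / \<delta>\<^sup>2) \<longlongrightarrow> 1/2) (at_right 0)"
      using LIM_C by (rule filterlim_mono) (auto simp: at_le)
    show "((\<lambda>\<delta>. Q * \<delta> / (2 * \<epsilon>)) \<longlongrightarrow> Q * 0 / (2 * \<epsilon>)) (at_right 0)"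
      using \<epsilon>(1) by (intro tendsto_intros) auto
    show "\<forall>\<^sub>F \<delta> in at_right 0. k * (1 - C \<delta>) / \<delta>\<^sup>2 \<le> Q * \<delta> / (2 * \<epsilon>)"
      using key by (intro eventually_at_rightI[OF _ \<delta>1]) auto
  qed auto
  then show False by simp
qed

end

context mspace
begin

text \<open>In the model plane the expression vanishes. It is multiplied out by \<open>S l\<close>,
  so that no division occurs and geodesics of length 0 are harmless.\<close>

definition CAT :: bool where
  "CAT \<longleftrightarrow> (\<forall>D\<in>X. \<forall>\<alpha> l s. geod X d \<alpha> l \<longrightarrow> 0 \<le> s \<longrightarrow> s \<le> l \<longrightarrow>
     0 \<le> k * (S l * C (d D (\<alpha> s)) - S (l - s) * C (d D (\<alpha> 0)) - S s * C (d D (\<alpha> l))))"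

definition connected :: bool where
  "connected \<longleftrightarrow> (\<forall>A\<in>X. \<forall>B\<in>X. \<exists>\<alpha>. geod X d \<alpha> (d A B) \<and> \<alpha> 0 = A \<and> \<alpha> (d A B) = B)"

lemma continuous_dist_geod:
  assumes g: "geod X d \<alpha> l" and D: "D \<in> X"
  shows "continuous_on {0..l} (\<lambda>s. d D (\<alpha> s))"
proof (rule continuous_onI)
  fix s and e :: real assume s: "s \<in> {0..l}" and e: "0 < e"
  have "dist (d D (\<alpha> t)) (d D (\<alpha> s)) \<le> e" if t: "t \<in> {0..l}" "dist t s < e" for t
  proof -
    have X: "\<alpha> s \<in> X" "\<alpha> t \<in> X" and "d (\<alpha> t) (\<alpha> s) = \<bar>t - s\<bar>" "d (\<alpha> s) (\<alpha> t) = \<bar>t - s\<bar>"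
      using geodD(2,3)[OF g] s t by auto
    then show ?thesis using d_tri[OF D X(1,2)] d_tri[OF D X(2,1)] t by (auto simp: dist_real_def)
  qed
  then show "\<exists>da>0. \<forall>x'\<in>{0..l}. dist x' s < da \<longrightarrow> dist (d D (\<alpha> x')) (d D (\<alpha> s)) \<le> e"
    using e by blast
qed

text \<open>Adjacent comparison angles sum to at least \<open>pi\<close> up to an error that
  vanishes as \<open>t\<close> tends to 0 for fixed \<open>u\<close>. By the triangle inequality
  \<open>x + y\<close> is at least \<open>2 * u\<close>, and \<open>k * (C x + C y)\<close> does not
  exceed its value for two equal arguments with the same sum.\<close>

lemma J_sum_small:
  assumes g: "geod X d \<sigma> r" "geod X d \<beta> U" "geod X d \<beta>' U" "\<sigma> 0 = \<beta> 0" "\<sigma> 0 = \<beta>' 0"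
    and opp: "d (\<beta> u) (\<beta>' u) = 2 * u" and b: "0 < t" "t \<le> r" "0 < u" "u \<le> U"
  shows "J \<sigma> \<beta> t u + J \<sigma> \<beta>' t u \<le> 2 * C u / S u * (k * (1 - C t) / S t)"
proof -
  have X: "\<sigma> t \<in> X" "\<beta> u \<in> X" "\<beta>' u \<in> X" using geodD(2)[OF g(1)] geodD(2)[OF g(2)] geodD(2)[OF g(3)] b by auto
  have S: "0 < S t" "0 < S u" using geod_S_pos[OF g(1)] geod_S_pos[OF g(2)] b by auto
  define x where "x = d (\<sigma> t) (\<beta> u)"
  define y where "y = d (\<sigma> t) (\<beta>' u)"
  have xy: "2 * u \<le> x + y" using d_tri[OF X(2,1,3)] d_comm[OF X(1,2)] opp by (simp add: x_def y_def)
  have b2: "k = 1 \<Longrightarrow> (x + y) / 2 \<le> pi / 2" using bnd[OF _ X(1,2)] bnd[OF _ X(1,3)] by (simp add: x_def y_def)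
  have ku: "k * C ((x + y) / 2) \<le> k * C u" using xy b b2 pi_gt_zero by (intro kC_mono) auto
  have nn: "0 \<le> x" "0 \<le> y" using d_nn X by (auto simp: x_def y_def)
  have "k * (C x + C y) \<le> k * (2 * C u)"
  proof -
    have 1: "C x + C y = 2 * C ((x + y) / 2) * C ((x - y) / 2)" by (rule C_sum)
    have nn2: "0 \<le> C ((x + y) / 2)" using b2 nn by (intro C_nonneg) auto
    have "k * C ((x + y) / 2) * C ((x - y) / 2) \<le> k * C ((x + y) / 2)"
    proof (rule disjE[OF k])
      assume "k = 1"
      then show ?thesis using nn2 mult_left_mono[of "cos ((x - y) / 2)" 1 "cos ((x + y) / 2)"] by (simp add: cs_def)
    next
      assume "k = -1"
      then show ?thesis using mult_left_mono[of 1 "cosh ((x - y) / 2)" "cosh ((x + y) / 2)"] cosh_real_ge_1 by (simp add: cs_def)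
    qed
    moreover have "k * (2 * C ((x + y) / 2) * C ((x - y) / 2)) = 2 * (k * C ((x + y) / 2) * C ((x - y) / 2))" "k * (2 * C u) = 2 * (k * C u)" by simp_all
    ultimately show ?thesis unfolding 1 using ku by linarith
  qed
  then have "k * (C x - C t * C u) + k * (C y - C t * C u) \<le> 2 * C u * (k * (1 - C t))"
    by (simp add: algebra_simps)
  then have "(k * (C x - C t * C u) + k * (C y - C t * C u)) / (S t * S u) \<le> 2 * C u * (k * (1 - C t)) / (S t * S u)"
    using S by (intro divide_right_mono) auto
  then show ?thesis unfolding J_def x_def[symmetric] y_def[symmetric] by (simp add: add_divide_distrib mult.commute)
qed

end

context fourpt
begin

text \<open>Uniqueness of geodesics. With the four points ordered according to the sign, the
  four-point inequality reduces to \<open>k \<le> k * C z\<close> for the distance \<open>z\<close>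
  of \<open>P\<close> and \<open>Q\<close>, which forces \<open>z\<close> to be 0.\<close>

lemma geod_unique:
  assumes X: "A \<in> X" "B \<in> X" "P \<in> X" "Q \<in> X" and x: "0 < x" "0 \<le> y"
    and dd: "d A P = x" "d P B = y" "d A Q = x" "d Q B = y" "d A B = x + y"
  shows "P = Q"
proof -
  define z where "z = d P Q"
  have z: "0 \<le> z" "k = 1 \<Longrightarrow> z \<le> pi" using d_nn[OF X(3,4)] bnd[OF _ X(3,4)] pi_gt_zero by (auto simp: z_def)
  have b: "k = 1 \<Longrightarrow> x + y \<le> pi / 2" using bnd[OF _ X(1,2)] dd by simp
  have Cx: "0 \<le> C x" "0 < C y" "0 \<le> C (x + y)" "0 < C ((x - y) / 2)" "0 < C ((x + y) / 2)"
    using b x pi_gt_zero by (auto intro!: C_nonneg C_pos)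
  have "k * 1 \<le> k * C z"
    using sg
  proof
    assume s: "sg = 1"
    have "sg * k * ((C (d P B) + C (d A P) * C (d B Q)) * (1 + C (d A Q))
        - (C (d A P) + C (d P Q)) * (C (d B Q) + C (d A B)))
      \<le> S (d A P) * S (d B Q) * (1 + C (d A Q))" by (rule four[OF X(1,3,2,4)])
    then have "k * ((C y + C x * C y) * (1 + C x) - (C x + C z) * (C y + C (x + y))) \<le> S x * S y * (1 + C x)"
      using dd d_comm[OF X(2,4)] s by (simp add: z_def)
    moreover have "k * C (x + y) = k * C x * C y - S x * S y" unfolding C_add using k by auto
    moreover have "k * ((C y + C x * C y) * (1 + C x) - (C x + C z) * (C y + C (x + y))) - S x * S y * (1 + C x)
        = k * C y * (1 + C x) + (k * C x * C y - S x * S y) * (1 + C x) - (C x + C z) * (k * C y + k * C (x + y))"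
      by (simp add: algebra_simps)
    moreover have "\<dots> = (k * 1 - k * C z) * (C y + C (x + y))"
      using \<open>k * C (x + y) = k * C x * C y - S x * S y\<close>[symmetric] by (simp add: algebra_simps)
    ultimately have "(k * 1 - k * C z) * (C y + C (x + y)) \<le> 0" by linarith
    moreover have "0 < C y + C (x + y)" using Cx by simp
    ultimately show ?thesis by (simp add: mult_le_0_iff)
  next
    assume s: "sg = -1"
    have "sg * k * ((C (d P Q) + C (d A P) * C (d Q B)) * (1 + C (d A B))
        - (C (d A P) + C (d P B)) * (C (d Q B) + C (d A Q)))
      \<le> S (d A P) * S (d Q B) * (1 + C (d A B))" by (rule four[OF X(1,3,4,2)])
    then have "- k * ((C z + C x * C y) * (1 + C (x + y)) - (C x + C y) * (C y + C x)) \<le> S x * S y * (1 + C (x + y))"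
      using dd s by (simp add: z_def)
    moreover have "k * C (x - y) = k * C x * C y + S x * S y" unfolding C_diff using k by auto
    moreover have "- k * ((C z + C x * C y) * (1 + C (x + y)) - (C x + C y) * (C y + C x)) - S x * S y * (1 + C (x + y))
       = k * (C x + C y)\<^sup>2 - (k * C z + (k * C x * C y + S x * S y)) * (1 + C (x + y))"
      by (simp add: algebra_simps power2_eq_square)
    ultimately have 1: "k * (C x + C y)\<^sup>2 \<le> (k * C z + k * C (x - y)) * (1 + C (x + y))" by simp
    have "(C x + C y)\<^sup>2 = (1 + C (x - y)) * (1 + C (x + y))"
      unfolding C_sum[of x y] C_double'[of "x - y"] C_double'[of "x + y"] by (simp add: power2_eq_square)
    then have "(k * 1 + k * C (x - y)) * (1 + C (x + y)) \<le> (k * C z + k * C (x - y)) * (1 + C (x + y))"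
      using 1 by (simp add: algebra_simps)
    moreover have "0 < 1 + C (x + y)" using Cx by simp
    ultimately have "k * 1 + k * C (x - y) \<le> k * C z + k * C (x - y)" by (rule mult_right_le_imp_le)
    then show ?thesis by simp
  qed
  then have "z \<le> 0" using kC_le_D[of 0 z] z by simp
  then show ?thesis using z d_zero[OF X(3,4)] by (simp add: z_def)
qed

text \<open>The limits behind \<open>J_almost_decreasing\<close> need positive distances between the
  two geodesics. If the geodesics meet again, they coincide up to that point by uniqueness, and near
  the start \<open>J\<close> has its maximal value 1.\<close>

lemma J_eventually_decreasing:
  assumes g: "geod X d \<sigma> r" "geod X d \<beta> U" "\<sigma> 0 = \<beta> 0" and pos: "0 < r" "0 < U" and small: "k = 1 \<Longrightarrow> r + U < pi / 2"
  shows "\<exists>Q\<ge>0. \<exists>\<delta>0>0. \<delta>0 \<le> U \<and> \<delta>0 \<le> r \<and> (\<forall>\<delta> t. 0 < \<delta> \<longrightarrow> \<delta> \<le> \<delta>0 \<longrightarrow> 0 < t \<longrightarrow> t \<le> \<delta>0 \<longrightarrow> J \<sigma> \<beta> r \<delta> - J \<sigma> \<beta> t \<delta> \<le> Q * \<delta> ^ 3)"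
proof (cases "\<exists>t u. 0 < t \<and> t \<le> r \<and> 0 < u \<and> u \<le> U \<and> \<sigma> t = \<beta> u")
  case True
  then obtain t u where tu: "0 < t" "t \<le> r" "0 < u" "u \<le> U" "\<sigma> t = \<beta> u" by blast
  have "t = u" using geodD(3)[OF g(1), of 0 t] geodD(3)[OF g(2), of 0 u] tu g(3) by auto
  have coin: "\<sigma> v = \<beta> v" if v: "0 < v" "v \<le> t" for v
  proof (rule geod_unique[of "\<sigma> 0" "\<sigma> t" _ _ v "t - v"])
    show "\<sigma> 0 \<in> X" "\<sigma> t \<in> X" "\<sigma> v \<in> X" "\<beta> v \<in> X" using geodD(2)[OF g(1)] geodD(2)[OF g(2)] tu v \<open>t = u\<close> by auto
    show "0 < v" "0 \<le> t - v" using v by auto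
    show "d (\<sigma> 0) (\<sigma> v) = v" "d (\<sigma> v) (\<sigma> t) = t - v" "d (\<sigma> 0) (\<sigma> t) = v + (t - v)"
      using geodD(3)[OF g(1), of 0 v] geodD(3)[OF g(1), of v t] geodD(3)[OF g(1), of 0 t] tu(1,2) v by auto
    show "d (\<sigma> 0) (\<beta> v) = v" unfolding g(3) using geodD(3)[OF g(2)] tu v \<open>t = u\<close> by auto
    show "d (\<beta> v) (\<sigma> t) = t - v" unfolding tu(5) using geodD(3)[OF g(2)] tu v \<open>t = u\<close> by auto
  qed
  have "J \<sigma> \<beta> r \<delta> - J \<sigma> \<beta> v \<delta> \<le> 0 * \<delta> ^ 3" if v: "0 < \<delta>" "\<delta> \<le> t" "0 < v" "v \<le> t" for \<delta> v
  proof -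
    have "d (\<sigma> v) (\<beta> \<delta>) = \<bar>v - \<delta>\<bar>" unfolding coin[OF v(3,4)] using geodD(3)[OF g(2)] v tu \<open>t = u\<close> by auto
    moreover have "0 < S v" "0 < S \<delta>" using geod_S_pos[OF g(1)] v tu by auto
    ultimately have "J \<sigma> \<beta> v \<delta> = 1" unfolding J_def by (simp add: C_diff mult.assoc)
    moreover have "J \<sigma> \<beta> r \<delta> \<le> 1" using J_bounds(2)[OF g, of r \<delta>] pos v tu \<open>t = u\<close> by auto
    ultimately show ?thesis by simp
  qed
  then show ?thesis using tu \<open>t = u\<close> by (intro exI[of _ 0]) (auto intro!: exI[of _ t])
next
  case False
  have "\<exists>Q\<ge>0. \<forall>t u. 0 < t \<longrightarrow> t \<le> r \<longrightarrow> 0 < u \<longrightarrow> u \<le> U \<longrightarrow> J \<sigma> \<beta> r u - J \<sigma> \<beta> t u \<le> Q * u ^ 3"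
  proof (rule J_almost_decreasing[OF g pos])
    fix t u assume tu: "0 < t" "t \<le> r" "0 < u" "u \<le> U"
    have X: "\<sigma> 0 \<in> X" "\<sigma> t \<in> X" "\<beta> u \<in> X" using geodD(2)[OF g(1)] geodD(2)[OF g(2)] tu by auto
    have "d (\<sigma> t) (\<sigma> 0) = t" "d (\<sigma> 0) (\<beta> u) = u" using geodD(3)[OF g(1), of t 0] geodD(3)[OF g(2), of 0 u] tu g(3) by auto
    then have "d (\<sigma> t) (\<beta> u) \<le> t + u" using d_tri[OF X(2,1,3)] by simp
    then show "0 < d (\<sigma> t) (\<beta> u) \<and> 0 < C (d (\<sigma> t) (\<beta> u))"
      using d_pos[OF X(2,3)] False tu small d_nn[OF X(2,3)] by (auto intro!: C_pos)
  qed
  then obtain Q where Q: "0 \<le> Q" "\<And>t u. 0 < t \<Longrightarrow> t \<le> r \<Longrightarrow> 0 < u \<Longrightarrow> u \<le> U \<Longrightarrow> J \<sigma> \<beta> r u - J \<sigma> \<beta> t u \<le> Q * u ^ 3"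
    by blast
  then show ?thesis using pos by (intro exI[of _ Q]) (auto intro!: exI[of _ "min r U"])
qed

text \<open>Along the geodesic \<open>\<sigma>\<close> from \<open>\<gamma> s\<close> to
  \<open>D\<close>, the value of \<open>J\<close> at the far end is compared with values near the
  start, where the cosines for the two directions of \<open>\<gamma>\<close> have a sum of at most 0
  in the limit. Strict positivity of the cosine leaves room for a piece of \<open>\<gamma>\<close>
  whose points all have distance less than \<open>pi / 2\<close> from those of
  \<open>\<sigma>\<close>.\<close>

lemma local_concavity:
  assumes con: connected and D: "D \<in> X" and g: "geod X d \<gamma> l" and s: "0 < s" "s < l" and h: "0 < C (d D (\<gamma> s))"
  shows "\<exists>Q \<delta>0. 0 < \<delta>0 \<and> \<delta>0 \<le> s \<and> \<delta>0 \<le> l - s \<and> (\<forall>\<delta>. 0 < \<delta> \<longrightarrow> \<delta> \<le> \<delta>0 \<longrightarrow> k * (C (d D (\<gamma> (s + \<delta>))) + C (d D (\<gamma> (s - \<delta>))) - 2 * C \<delta> * C (d D (\<gamma> s))) \<le> Q * \<delta> ^ 3)"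
proof (cases "D = \<gamma> s")
  case True
  have "d D (\<gamma> (s + \<delta>)) = \<delta>" "d D (\<gamma> (s - \<delta>)) = \<delta>" if "0 < \<delta>" "\<delta> \<le> min s (l - s)" for \<delta>
    using geodD(3)[OF g] s that True by auto
  then show ?thesis using s D unfolding True
    by (intro exI[of _ 0] exI[of _ "min s (l - s)"]) (auto simp: True)
next
  case False
  define M where "M = \<gamma> s"
  have M: "M \<in> X" using geodD(2)[OF g] s by (simp add: M_def)
  define r where "r = d M D"
  have r: "0 < r" using d_pos[OF M D] False by (auto simp: r_def M_def)
  have r': "d D (\<gamma> s) = r" using d_comm[OF D M] by (simp add: r_def M_def)
  have rs: "r < pi / 2" if "k = 1"
  proof (rule ccontr)
    assume "\<not> r < pi / 2"
    then have "r = pi / 2" using bnd[OF that M D] by (simp add: r_def)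
    have "C r = 0" unfolding \<open>r = pi / 2\<close> cs_def using that by simp
    then show False using h r' by simp
  qed
  obtain \<sigma> where \<sigma>: "geod X d \<sigma> r" "\<sigma> 0 = M" "\<sigma> r = D"
    using con M D unfolding connected_def r_def by blast
  \<comment> \<open>Half of the remaining room \<open>pi / 2 - r\<close> keeps \<open>r + U\<close>
    below \<open>pi / 2\<close>; for \<open>k = -1\<close> the bound 1 is an arbitrary positive
    number.\<close>
  define U where "U = min (min s (l - s)) (if k = 1 then (pi / 2 - r) / 2 else 1)"
  have U: "0 < U" "U \<le> s" "U \<le> l - s" "k = 1 \<Longrightarrow> r + U < pi / 2"
    using s rs by (auto simp: U_def min_def field_simps)
  define \<beta> where "\<beta> u = \<gamma> (s + u)" for u
  define \<beta>' where "\<beta>' u = \<gamma> (s - u)" for u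
  have gb: "geod X d \<beta> U" "geod X d \<beta>' U" "\<sigma> 0 = \<beta> 0" "\<sigma> 0 = \<beta>' 0"
    using geod_shift[OF g, of U s] geod_rev_sub[OF g, of U s] U s unfolding \<beta>_def \<beta>'_def by (auto simp: \<sigma>(2) M_def)
  obtain Q \<delta>0 where Q: "0 \<le> Q" "0 < \<delta>0" "\<delta>0 \<le> U" "\<delta>0 \<le> r" "\<And>\<delta> t. 0 < \<delta> \<Longrightarrow> \<delta> \<le> \<delta>0 \<Longrightarrow> 0 < t \<Longrightarrow> t \<le> \<delta>0 \<Longrightarrow> J \<sigma> \<beta> r \<delta> - J \<sigma> \<beta> t \<delta> \<le> Q * \<delta> ^ 3"
    using J_eventually_decreasing[OF \<sigma>(1) gb(1,3) r U(1,4)] by blast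
  obtain Q' \<delta>0' where Q': "0 \<le> Q'" "0 < \<delta>0'" "\<delta>0' \<le> U" "\<delta>0' \<le> r" "\<And>\<delta> t. 0 < \<delta> \<Longrightarrow> \<delta> \<le> \<delta>0' \<Longrightarrow> 0 < t \<Longrightarrow> t \<le> \<delta>0' \<Longrightarrow> J \<sigma> \<beta>' r \<delta> - J \<sigma> \<beta>' t \<delta> \<le> Q' * \<delta> ^ 3"
    using J_eventually_decreasing[OF \<sigma>(1) gb(2,4) r U(1,4)] by blast
  define \<delta>1 where "\<delta>1 = min \<delta>0 \<delta>0'"
  have Sr: "0 < S r" using geod_S_pos[OF \<sigma>(1) r] by simp
  have main: "k * (C (d D (\<gamma> (s + \<delta>))) + C (d D (\<gamma> (s - \<delta>))) - 2 * C \<delta> * C (d D (\<gamma> s))) \<le> (S r * (U * cosh U) * (Q + Q')) * \<delta> ^ 3"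
    if d: "0 < \<delta>" "\<delta> \<le> \<delta>1" for \<delta>
  proof -
    have dU: "\<delta> \<le> U" "\<delta> \<le> \<delta>0" "\<delta> \<le> \<delta>0'" using d Q(3) by (auto simp: \<delta>1_def)
    have S\<delta>: "0 < S \<delta>" using geod_S_pos[OF gb(1) d(1) dU(1)] .
    have X: "\<beta> \<delta> \<in> X" "\<beta>' \<delta> \<in> X" using geodD(2)[OF gb(1)] geodD(2)[OF gb(2)] d dU by auto
    have opp: "d (\<beta> \<delta>) (\<beta>' \<delta>) = 2 * \<delta>" unfolding \<beta>_def \<beta>'_def using geodD(3)[OF g] d dU U by auto
    define T where "T = J \<sigma> \<beta> r \<delta> + J \<sigma> \<beta>' r \<delta>"
    \<comment> \<open>\<open>\<delta>\<close> stays fixed while the parameter \<open>t\<close> on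
      \<open>\<sigma>\<close> tends to 0; in this limit the error in \<open>J_sum_small\<close>
      disappears.\<close>
    have "T \<le> 2 * C \<delta> / S \<delta> * 0 + (Q + Q') * \<delta> ^ 3"
    proof (rule tendsto_lowerbound[of _ _ "at_right 0"])
      show "((\<lambda>t. 2 * C \<delta> / S \<delta> * (k * (1 - C t) / S t) + (Q + Q') * \<delta> ^ 3) \<longlongrightarrow> 2 * C \<delta> / S \<delta> * 0 + (Q + Q') * \<delta> ^ 3) (at_right 0)"
        by (intro tendsto_add tendsto_mult tendsto_const half_tangent_limit)
      show "\<forall>\<^sub>F t in at_right 0. T \<le> 2 * C \<delta> / S \<delta> * (k * (1 - C t) / S t) + (Q + Q') * \<delta> ^ 3"
      proof (rule eventually_at_rightI[of 0 \<delta>1])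
        fix t assume t: "t \<in> {0<..<\<delta>1}"
        have "J \<sigma> \<beta> r \<delta> - J \<sigma> \<beta> t \<delta> \<le> Q * \<delta> ^ 3" using t dU d by (intro Q(5)) (auto simp: \<delta>1_def)
        moreover have "J \<sigma> \<beta>' r \<delta> - J \<sigma> \<beta>' t \<delta> \<le> Q' * \<delta> ^ 3" using t dU d by (intro Q'(5)) (auto simp: \<delta>1_def)
        moreover have "J \<sigma> \<beta> t \<delta> + J \<sigma> \<beta>' t \<delta> \<le> 2 * C \<delta> / S \<delta> * (k * (1 - C t) / S t)"
          using t Q(4) dU d by (intro J_sum_small[OF \<sigma>(1) gb opp]) (auto simp: \<delta>1_def)
        ultimately show "T \<le> 2 * C \<delta> / S \<delta> * (k * (1 - C t) / S t) + (Q + Q') * \<delta> ^ 3"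
          by (simp add: T_def distrib_right)
      qed (use Q(2) Q'(2) in \<open>simp add: \<delta>1_def\<close>)
    qed auto
    then have T: "T \<le> (Q + Q') * \<delta> ^ 3" by simp
    have e: "C (d D (\<gamma> (s + \<delta>))) = C r * C \<delta> + k * S r * S \<delta> * J \<sigma> \<beta> r \<delta>" "C (d D (\<gamma> (s - \<delta>))) = C r * C \<delta> + k * S r * S \<delta> * J \<sigma> \<beta>' r \<delta>"
      using J_eq[of r \<delta> \<sigma> \<beta>] J_eq[of r \<delta> \<sigma> \<beta>'] Sr S\<delta> unfolding \<sigma>(3) \<beta>_def[symmetric] \<beta>'_def[symmetric] by auto
    have "k * (C (d D (\<gamma> (s + \<delta>))) + C (d D (\<gamma> (s - \<delta>))) - 2 * C \<delta> * C (d D (\<gamma> s))) = S r * S \<delta> * T"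
      unfolding e r' T_def by (simp add: algebra_simps)
    also have "\<dots> \<le> S r * S \<delta> * ((Q + Q') * \<delta> ^ 3)" using T Sr S\<delta> by (intro mult_left_mono) auto
    also have "\<dots> \<le> S r * (U * cosh U) * ((Q + Q') * \<delta> ^ 3)"
    proof -
      have "S \<delta> \<le> \<delta> * cosh \<delta>" using d by (intro S_le) auto
      also have "\<dots> \<le> U * cosh U" using d dU by (intro mult_mono) (auto simp: cosh_real_nonneg_le_iff)
      finally show ?thesis using Sr Q(1) Q'(1) d by (intro mult_right_mono mult_left_mono) auto
    qed
    finally show ?thesis by (simp add: mult.assoc)
  qed
  have "0 < \<delta>1" "\<delta>1 \<le> s" "\<delta>1 \<le> l - s" using Q(2,3) Q'(2) U by (auto simp: \<delta>1_def)
  then show ?thesis using main by blast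
qed

text \<open>A point at distance \<open>pi / 2\<close> is out of reach of
  \<open>local_concavity\<close>. The midpoint \<open>x\<close> of the geodesic from
  \<open>\<gamma> s\<close> to \<open>D\<close> takes its place, and \<open>first_variation\<close>
  carries the estimate from \<open>x\<close> on to \<open>D\<close>. The resulting error is
  quadratic in \<open>\<delta>\<close>: too large for the maximum principle, but sufficient for
  \<open>zero_propagates\<close>.\<close>

lemma local_concavity_zero:
  assumes con: connected and D: "D \<in> X" and g: "geod X d \<gamma> l" and s: "0 < s" "s < l" and h: "C (d D (\<gamma> s)) = 0"
  shows "\<exists>Q \<delta>0. 0 < \<delta>0 \<and> \<delta>0 \<le> s \<and> \<delta>0 \<le> l - s \<and> (\<forall>\<delta>. 0 < \<delta> \<longrightarrow> \<delta> \<le> \<delta>0 \<longrightarrow> C (d D (\<gamma> (s + \<delta>))) + C (d D (\<gamma> (s - \<delta>))) \<le> Q * \<delta>\<^sup>2)"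
proof -
  have k1: "k = 1"
  proof (rule ccontr)
    assume "k \<noteq> 1"
    then show False using h cosh_real_pos[of "d D (\<gamma> s)"] by (simp add: cs_def)
  qed
  define M where "M = \<gamma> s"
  have M: "M \<in> X" using geodD(2)[OF g] s by (simp add: M_def)
  define r where "r = d M D"
  have r': "d D (\<gamma> s) = r" using d_comm[OF D M] by (simp add: r_def M_def)
  have r: "r = pi / 2"
  proof (rule ccontr)
    assume "r \<noteq> pi / 2"
    then have "0 < C r" using bnd[OF k1 M D] d_nn[OF M D] by (intro C_pos) (auto simp: r_def)
    then show False using h r' by simp
  qed
  obtain \<sigma> where \<sigma>: "geod X d \<sigma> r" "\<sigma> 0 = M" "\<sigma> r = D"
    using con M D unfolding connected_def r_def by blast
  define U where "U = min s (l - s)"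
  have U: "0 < U" "U \<le> s" "U \<le> l - s" using s by (auto simp: U_def)
  define \<beta> where "\<beta> u = \<gamma> (s + u)" for u
  define \<beta>' where "\<beta>' u = \<gamma> (s - u)" for u
  have gb: "geod X d \<beta> U" "geod X d \<beta>' U" "\<sigma> 0 = \<beta> 0" "\<sigma> 0 = \<beta>' 0"
    using geod_shift[OF g, of U s] geod_rev_sub[OF g, of U s] U s unfolding \<beta>_def \<beta>'_def by (auto simp: \<sigma>(2) M_def)
  define p where "p = pi / 4"
  have p: "0 < p" "p < r" using pi_gt_zero by (auto simp: p_def r)
  define x where "x = \<sigma> p"
  have x: "x \<in> X" "d x (\<gamma> s) = p"
    using geodD(2)[OF \<sigma>(1), of p] geodD(3)[OF \<sigma>(1), of p 0] p \<sigma>(2) by (auto simp: x_def M_def)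
  have Sp: "0 < S p" "S r = 1" "C r = 0" using geod_S_pos[OF \<sigma>(1), of p] p cos_pi_half sin_pi_half by (auto simp: r k1 sn_def cs_def simp del: cos_pi_half sin_pi_half)
  have "0 < C (d x (\<gamma> s))" unfolding x(2) using p r by (intro C_pos) auto
  from local_concavity[OF con x(1) g s this] obtain Q \<delta>1 where
    Q: "0 < \<delta>1" "\<delta>1 \<le> s" "\<delta>1 \<le> l - s" "\<And>\<delta>. 0 < \<delta> \<Longrightarrow> \<delta> \<le> \<delta>1 \<Longrightarrow> k * (C (d x (\<gamma> (s + \<delta>))) + C (d x (\<gamma> (s - \<delta>))) - 2 * C \<delta> * C (d x (\<gamma> s))) \<le> Q * \<delta> ^ 3"
    by blast
  obtain c where c: "0 \<le> c" "\<And>u. 0 < u \<Longrightarrow> u \<le> U \<Longrightarrow> J \<sigma> \<beta> r u - J \<sigma> \<beta> p u \<le> c * (k * (1 - C u) / S u)"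
    using first_variation[OF \<sigma>(1) gb(1,3) p order_refl] by blast
  obtain c' where c': "0 \<le> c'" "\<And>u. 0 < u \<Longrightarrow> u \<le> U \<Longrightarrow> J \<sigma> \<beta>' r u - J \<sigma> \<beta>' p u \<le> c' * (k * (1 - C u) / S u)"
    using first_variation[OF \<sigma>(1) gb(2,4) p order_refl] by blast
  have "C (d D (\<gamma> (s + \<delta>))) + C (d D (\<gamma> (s - \<delta>))) \<le> (\<bar>Q\<bar> / S p * \<delta>1 + (c + c')) * \<delta>\<^sup>2" if d: "0 < \<delta>" "\<delta> \<le> \<delta>1" for \<delta>
  proof -
    have dU: "\<delta> \<le> U" using d Q by (simp add: U_def)
    have S\<delta>: "0 < S \<delta>" using geod_S_pos[OF gb(1) d(1) dU] .
    have e: "C (d D (\<gamma> (s + \<delta>))) = S \<delta> * J \<sigma> \<beta> r \<delta>" "C (d D (\<gamma> (s - \<delta>))) = S \<delta> * J \<sigma> \<beta>' r \<delta>"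
      using J_eq[of r \<delta> \<sigma> \<beta>] J_eq[of r \<delta> \<sigma> \<beta>'] Sp S\<delta> k1 unfolding \<sigma>(3) \<beta>_def[symmetric] \<beta>'_def[symmetric] by auto
    have e': "C (d x (\<gamma> (s + \<delta>))) = C p * C \<delta> + k * S p * S \<delta> * J \<sigma> \<beta> p \<delta>" "C (d x (\<gamma> (s - \<delta>))) = C p * C \<delta> + k * S p * S \<delta> * J \<sigma> \<beta>' p \<delta>"
      using J_eq[of p \<delta> \<sigma> \<beta>] J_eq[of p \<delta> \<sigma> \<beta>'] Sp S\<delta> unfolding x_def \<beta>_def[symmetric] \<beta>'_def[symmetric] by auto
    have "S p * (S \<delta> * (J \<sigma> \<beta> p \<delta> + J \<sigma> \<beta>' p \<delta>)) \<le> Q * \<delta> ^ 3"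
      using Q(4)[OF d] unfolding e' x(2) using k1 by (simp add: algebra_simps)
    then have "S \<delta> * (J \<sigma> \<beta> p \<delta> + J \<sigma> \<beta>' p \<delta>) \<le> Q / S p * \<delta> ^ 3"
      using Sp by (simp add: pos_le_divide_eq mult.commute)
    also have "\<dots> \<le> \<bar>Q\<bar> / S p * \<delta> ^ 3" using Sp d by (intro mult_right_mono divide_right_mono) auto
    also have "\<dots> \<le> \<bar>Q\<bar> / S p * (\<delta>1 * \<delta>\<^sup>2)" using Sp d by (intro mult_left_mono) (auto simp: power3_eq_cube power2_eq_square)
    finally have 1: "S \<delta> * (J \<sigma> \<beta> p \<delta> + J \<sigma> \<beta>' p \<delta>) \<le> \<bar>Q\<bar> / S p * (\<delta>1 * \<delta>\<^sup>2)" .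
    have "J \<sigma> \<beta> r \<delta> + J \<sigma> \<beta>' r \<delta> \<le> (J \<sigma> \<beta> p \<delta> + J \<sigma> \<beta>' p \<delta>) + (c + c') * (k * (1 - C \<delta>) / S \<delta>)"
      using c(2)[OF d(1) dU] c'(2)[OF d(1) dU] unfolding distrib_right by linarith
    then have "S \<delta> * (J \<sigma> \<beta> r \<delta> + J \<sigma> \<beta>' r \<delta>) \<le> S \<delta> * ((J \<sigma> \<beta> p \<delta> + J \<sigma> \<beta>' p \<delta>) + (c + c') * (k * (1 - C \<delta>) / S \<delta>))"
      using S\<delta> by (intro mult_left_mono) auto
    also have "\<dots> = S \<delta> * (J \<sigma> \<beta> p \<delta> + J \<sigma> \<beta>' p \<delta>) + (c + c') * (k * (1 - C \<delta>))"
      using S\<delta> by (simp add: distrib_left)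
    also have "\<dots> \<le> S \<delta> * (J \<sigma> \<beta> p \<delta> + J \<sigma> \<beta>' p \<delta>) + (c + c') * \<delta>\<^sup>2"
    proof -
      have "\<bar>sin (\<delta> / 2)\<bar> \<le> \<bar>\<delta> / 2\<bar>" by (rule abs_sin_x_le_abs_x)
      then have "(sin (\<delta> / 2))\<^sup>2 \<le> (\<delta> / 2)\<^sup>2" by (simp only: abs_le_square_iff)
      then have "(sin (\<delta> / 2))\<^sup>2 \<le> \<delta>\<^sup>2 / 4" by (simp add: power_divide)
      then have "2 * (sin (\<delta> / 2))\<^sup>2 \<le> \<delta>\<^sup>2" using zero_le_power2[of \<delta>] by linarith
      then have "k * (1 - C \<delta>) \<le> \<delta>\<^sup>2" unfolding one_minus_C using k1 by (simp add: sn_def)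
      then show ?thesis using c(1) c'(1) by (intro add_left_mono mult_left_mono) auto
    qed
    finally have "S \<delta> * (J \<sigma> \<beta> r \<delta> + J \<sigma> \<beta>' r \<delta>) \<le> S \<delta> * (J \<sigma> \<beta> p \<delta> + J \<sigma> \<beta>' p \<delta>) + (c + c') * \<delta>\<^sup>2" .
    then show ?thesis using 1 unfolding e by (simp add: algebra_simps)
  qed
  then show ?thesis using Q(1-3) by blast
qed

lemma concave_on_positive:
  assumes con: connected and D: "D \<in> X" and g: "geod X d \<gamma> l" and ab: "0 \<le> a" "a < b" "b \<le> l"
    and pos: "\<And>s. a < s \<Longrightarrow> s < b \<Longrightarrow> 0 < C (d D (\<gamma> s))" and s: "a \<le> s" "s \<le> b"
  shows "0 \<le> k * (S (b - a) * C (d D (\<gamma> s)) - S (b - s) * C (d D (\<gamma> a)) - S (s - a) * C (d D (\<gamma> b)))"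
proof (rule concave_max_principle[of a b "\<lambda>s. C (d D (\<gamma> s))", OF ab(2) _ _ _ s])
  show "b - a \<le> pi / 2" if "k = 1" using geod_bnd[OF g that] ab by simp
  show "continuous_on {a..b} (\<lambda>s. C (d D (\<gamma> s)))"
    by (intro continuous_on_C continuous_on_subset[OF continuous_dist_geod[OF g D]]) (use ab in auto)
  show "\<exists>Q \<delta>0. 0 < \<delta>0 \<and> (\<forall>\<delta>. 0 < \<delta> \<longrightarrow> \<delta> \<le> \<delta>0 \<longrightarrow> k * (C (d D (\<gamma> (s + \<delta>))) + C (d D (\<gamma> (s - \<delta>))) - 2 * C \<delta> * C (d D (\<gamma> s))) \<le> Q * \<delta> ^ 3)"
    if "a < s" "s < b" for s
    using local_concavity[OF con D g _ _ pos[OF that]] that ab by (meson le_less_trans less_le_trans)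
qed

text \<open>Let \<open>a\<close> be the first zero after \<open>s\<close>. Concavity on
  \<open>{s..a}\<close> makes the cosine at \<open>a - \<delta>\<close> at least linear in
  \<open>\<delta>\<close>, with a slope proportional to \<open>h s\<close>, whereas
  \<open>local_concavity_zero\<close> bounds it by a multiple of
  \<open>\<delta>\<^sup>2\<close>.\<close>

lemma zero_propagates:
  assumes con: connected and D: "D \<in> X" and g: "geod X d \<gamma> l" and z: "0 < z" "z < l" "C (d D (\<gamma> z)) = 0"
    and s: "0 \<le> s" "s < z"
  shows "C (d D (\<gamma> s)) = 0"
proof (rule ccontr)
  define h where "h s = C (d D (\<gamma> s))" for s
  have hn: "0 \<le> h s" if "0 \<le> s" "s \<le> l" for s unfolding h_def using Cd_nn[OF D] geodD(2)[OF g] that by auto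
  assume "C (d D (\<gamma> s)) \<noteq> 0"
  then have hs: "0 < h s" using hn[of s] s z by (simp add: h_def)
  have cont: "continuous_on {0..l} h" unfolding h_def by (intro continuous_on_C continuous_dist_geod[OF g D])
  define Z where "Z = {t \<in> {s..z}. h t = 0}"
  have "closed Z" unfolding Z_def
    by (rule continuous_closed_preimage_constant) (use cont s z in \<open>auto intro: continuous_on_subset\<close>)
  moreover have "Z \<noteq> {}" "bdd_below Z" using z s by (auto simp: Z_def h_def)
  ultimately have "Inf Z \<in> Z" by (intro closed_contains_Inf)
  define a where "a = Inf Z"
  have a: "s \<le> a" "a \<le> z" "h a = 0" using \<open>Inf Z \<in> Z\<close> by (auto simp: Z_def a_def)
  have sa: "s < a" using a hs by (cases "s = a") auto
  have pos: "0 < h t" if "s < t" "t < a" for t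
  proof -
    have "t \<notin> Z" using cInf_lower[OF _ \<open>bdd_below Z\<close>, of t] that by (auto simp: a_def)
    then show ?thesis using hn[of t] that s a z by (auto simp: Z_def)
  qed
  have al: "0 < a" "a < l" using sa s a z by auto
  obtain Q \<delta>0 where Q: "0 < \<delta>0" "\<delta>0 \<le> a" "\<delta>0 \<le> l - a" "\<And>\<delta>. 0 < \<delta> \<Longrightarrow> \<delta> \<le> \<delta>0 \<Longrightarrow> h (a + \<delta>) + h (a - \<delta>) \<le> Q * \<delta>\<^sup>2"
    using local_concavity_zero[OF con D g al a(3)[unfolded h_def]] unfolding h_def by blast
  have k1: "k = 1"
  proof (rule ccontr)
    assume "k \<noteq> 1"
    then show False using z(3) cosh_real_pos[of "d D (\<gamma> z)"] by (simp add: cs_def)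
  qed
  define K where "K = S (a - s)"
  have "S \<delta> / \<delta> * h s \<le> K * Q * \<delta>" if d: "0 < \<delta>" "\<delta> < min \<delta>0 (a - s)" for \<delta>
  proof -
    have "0 \<le> k * (S (a - s) * h (a - \<delta>) - S (a - (a - \<delta>)) * h s - S (a - \<delta> - s) * h a)"
      unfolding h_def by (rule concave_on_positive[OF con D g]) (use s sa al d pos in \<open>auto simp: h_def\<close>)
    then have "S \<delta> * h s \<le> K * h (a - \<delta>)" using k1 a(3) by (simp add: K_def)
    moreover have "h (a - \<delta>) \<le> Q * \<delta>\<^sup>2" using Q(4)[of \<delta>] hn[of "a + \<delta>"] d Q(3) al by auto
    moreover have "0 \<le> K" unfolding K_def using geod_bnd[OF g k1] sa s al pi_gt_zero by (intro S_nonneg) auto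
    ultimately have "S \<delta> * h s \<le> K * (Q * \<delta>\<^sup>2)" by (meson mult_left_mono order_trans)
    then show ?thesis using d by (simp add: field_simps power2_eq_square)
  qed
  then have ev: "\<forall>\<^sub>F \<delta> in at_right 0. S \<delta> / \<delta> * h s \<le> K * Q * \<delta>"
    using Q(1) sa by (intro eventually_at_rightI[of 0 "min \<delta>0 (a - s)"]) auto
  have "1 * h s \<le> K * Q * 0"
    by (rule tendsto_le[OF _ _ _ ev]) (intro tendsto_intros tendsto_ratio_zero trivial_limit_at_right_real)+
  then show False using hs by simp
qed

text \<open>Without an interior zero of the cosine the maximum principle covers the whole geodesic.
  An interior zero spreads to the left and, after reversal of the geodesic, to the right; then all
  three cosines vanish.\<close>

theorem fourpt_CAT:
  assumes con: connected
  shows CAT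
  unfolding CAT_def
proof (intro ballI allI impI)
  fix D \<gamma> l s assume D: "D \<in> X" and g: "geod X d \<gamma> l" and s: "0 \<le> s" "s \<le> l"
  define h where "h s = C (d D (\<gamma> s))" for s
  have hn: "0 \<le> h s" if "0 \<le> s" "s \<le> l" for s unfolding h_def using Cd_nn[OF D] geodD(2)[OF g] that by auto
  show "0 \<le> k * (S l * C (d D (\<gamma> s)) - S (l - s) * C (d D (\<gamma> 0)) - S s * C (d D (\<gamma> l)))"
  proof (cases "\<exists>z. 0 < z \<and> z < l \<and> h z = 0")
    case False
    show ?thesis
    proof (cases "l = 0")
      case True
      then show ?thesis using s by simp
    next
      case l: False
      have "0 \<le> k * (S (l - 0) * C (d D (\<gamma> s)) - S (l - s) * C (d D (\<gamma> 0)) - S (s - 0) * C (d D (\<gamma> l)))"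
      proof (rule concave_on_positive[OF con D g])
        show "0 < C (d D (\<gamma> s))" if "0 < s" "s < l" for s
          using hn[of s] False that by (force simp: h_def)
      qed (use s l in auto)
      then show ?thesis by simp
    qed
  next
    case True
    then obtain z where z: "0 < z" "z < l" "C (d D (\<gamma> z)) = 0" by (auto simp: h_def)
    have lo: "C (d D (\<gamma> t)) = 0" if "0 \<le> t" "t < z" for t
      by (rule zero_propagates[OF con D g z that])
    have g': "geod X d (\<lambda>t. \<gamma> (l - t)) l" using geodD(1)[OF g] by (intro geod_rev_sub[OF g]) auto
    have up: "C (d D (\<gamma> t)) = 0" if "z < t" "t \<le> l" for t
      using zero_propagates[OF con D g', of "l - z" "l - t"] z that by simp
    have "C (d D (\<gamma> t)) = 0" if "0 \<le> t" "t \<le> l" for t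
      using lo[of t] up[of t] z(3) that by (cases t z rule: linorder_cases) auto
    then show ?thesis using s by simp
  qed
qed

end

section \<open>Shortest curves are unit-speed geodesics up to parametrization\<close>

lemma shortest_imp_geod:
  assumes met: "metric_on X d" and sh: "shortest X d L A B"
  obtains \<alpha> where "geod X d \<alpha> (d A B)" "\<alpha> 0 = A" "\<alpha> (d A B) = B" "L = \<alpha> ` {0..d A B}" "A \<in> X" "B \<in> X"
proof -
  have comm: "\<And>x y. x \<in> X \<Longrightarrow> y \<in> X \<Longrightarrow> d x y = d y x" and nn: "\<And>x y. x \<in> X \<Longrightarrow> y \<in> X \<Longrightarrow> 0 \<le> d x y"
    and zero: "\<And>x y. x \<in> X \<Longrightarrow> y \<in> X \<Longrightarrow> d x y = 0 \<longleftrightarrow> x = y"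
    and tri: "\<And>x y z. x \<in> X \<Longrightarrow> y \<in> X \<Longrightarrow> z \<in> X \<Longrightarrow> d x z \<le> d x y + d y z"
    using met unfolding metric_on_def semimetric_on_def by blast+
  obtain \<gamma> a b where c: "curve_in X d \<gamma> a b" and AB: "\<gamma> a = A" "\<gamma> b = B"
    and len: "curve_length d \<gamma> a b = ereal (d A B)" and L: "L = \<gamma> ` {a..b}"
    using sh unfolding shortest_def by blast
  have ab: "a \<le> b" and X: "\<And>s. s \<in> {a..b} \<Longrightarrow> \<gamma> s \<in> X"
    and cont: "\<And>t e. t \<in> {a..b} \<Longrightarrow> 0 < e \<Longrightarrow> \<exists>\<delta>>0. \<forall>s\<in>{a..b}. \<bar>s - t\<bar> < \<delta> \<longrightarrow> d (\<gamma> s) (\<gamma> t) < e"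
    using c unfolding curve_in_def by auto
  have AX: "A \<in> X" "B \<in> X" using X[of a] X[of b] ab AB by auto
  define f where "f s = d A (\<gamma> s)" for s
  have dist: "d (\<gamma> s) (\<gamma> t) = f t - f s" if st: "a \<le> s" "s \<le> t" "t \<le> b" for s t
  proof -
    \<comment> \<open>The partition with nodes \<open>a\<close>, \<open>s\<close>, \<open>t\<close>,
      \<open>b\<close> and three pieces: its inscribed length is at most \<open>d A B\<close>, which
      makes the distance from \<open>A\<close> additive along the curve.\<close>
    define p where "p i = (if i = 0 then a else if i = Suc 0 then s else if i = 2 then t else b)" for i :: nat
    have "(p, 3) \<in> {(t, n). t 0 = a \<and> t n = b \<and> (\<forall>i<n. t i \<le> t (Suc i))}"
      using st ab by (auto simp: p_def numeral_3_eq_3 less_Suc_eq)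
    then have "ereal (\<Sum>i<snd (p, 3::nat). d (\<gamma> (fst (p, 3::nat) i)) (\<gamma> (fst (p, 3::nat) (Suc i)))) \<le> curve_length d \<gamma> a b"
      unfolding curve_length_def by (rule SUP_upper)
    then have "d A (\<gamma> s) + d (\<gamma> s) (\<gamma> t) + d (\<gamma> t) B \<le> d A B"
      unfolding len by (simp add: p_def AB numeral_3_eq_3)
    moreover have "d A B \<le> d A (\<gamma> t) + d (\<gamma> t) B" "d A (\<gamma> t) \<le> d A (\<gamma> s) + d (\<gamma> s) (\<gamma> t)"
      using st AX by (auto intro!: tri X)
    ultimately show ?thesis unfolding f_def by linarith
  qed
  have dist': "d (\<gamma> s) (\<gamma> t) = \<bar>f s - f t\<bar>" if st: "s \<in> {a..b}" "t \<in> {a..b}" for s t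
    using dist[of s t] dist[of t s] nn[of "\<gamma> s" "\<gamma> t"] comm[of "\<gamma> s" "\<gamma> t"] X st by (cases "s \<le> t") (auto simp: abs_if)
  have "continuous_on {a..b} f"
  proof (rule continuous_onI)
    fix t and e :: real assume t: "t \<in> {a..b}" and e: "0 < e"
    from cont[OF t e] obtain \<delta> where "\<delta> > 0" "\<And>s. s \<in> {a..b} \<Longrightarrow> \<bar>s - t\<bar> < \<delta> \<Longrightarrow> d (\<gamma> s) (\<gamma> t) < e" by blast
    then show "\<exists>\<delta>>0. \<forall>s\<in>{a..b}. dist s t < \<delta> \<longrightarrow> dist (f s) (f t) \<le> e"
      using dist' t by (auto simp: dist_real_def intro!: exI[of _ \<delta>] less_imp_le)
  qed
  moreover have f0: "f a = 0" "f b = d A B" using AB AX zero by (auto simp: f_def)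
  ultimately have "\<exists>s. a \<le> s \<and> s \<le> b \<and> f s = r" if "0 \<le> r" "r \<le> d A B" for r
    using that ab by (intro IVT') auto
  then have "\<forall>r. \<exists>s. 0 \<le> r \<and> r \<le> d A B \<longrightarrow> s \<in> {a..b} \<and> f s = r" by auto
  \<comment> \<open>A curve may pause, so \<open>f\<close> need not be injective. \<open>q\<close>
    selects some preimage, and parameters with the same value of \<open>f\<close> give the same
    point because \<open>dist'\<close> makes their distance 0.\<close>
  from this[unfolded choice_iff] obtain q where q: "\<And>r. 0 \<le> r \<Longrightarrow> r \<le> d A B \<Longrightarrow> q r \<in> {a..b} \<and> f (q r) = r" by blast
  define \<alpha> where "\<alpha> r = \<gamma> (q r)" for r
  have eq: "\<gamma> s = \<alpha> (f s)" "0 \<le> f s" "f s \<le> d A B" if s: "s \<in> {a..b}" for s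
  proof -
    show b: "0 \<le> f s" "f s \<le> d A B" using nn[OF AX(1) X[OF s]] dist[of s b] nn[of "\<gamma> s" B] X[OF s] AX s AB f0 by (auto simp: f_def)
    have "d (\<gamma> s) (\<alpha> (f s)) = 0" unfolding \<alpha>_def using dist'[OF s, of "q (f s)"] q[OF b] by simp
    then show "\<gamma> s = \<alpha> (f s)" using zero[OF X[OF s], of "\<alpha> (f s)"] X q[OF b] by (auto simp: \<alpha>_def)
  qed
  show thesis
  proof (rule that[of \<alpha>])
    show "geod X d \<alpha> (d A B)"
      unfolding geod_def
    proof (intro conjI ballI)
      show "0 \<le> d A B" by (rule nn[OF AX])
      show "\<alpha> s \<in> X" if "s \<in> {0..d A B}" for s unfolding \<alpha>_def using q[of s] X that by simp
      show "d (\<alpha> s) (\<alpha> t) = \<bar>s - t\<bar>" if "s \<in> {0..d A B}" "t \<in> {0..d A B}" for s t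
        unfolding \<alpha>_def using q[of s] q[of t] dist'[of "q s" "q t"] that by simp
    qed
    show "\<alpha> 0 = A" using eq(1)[of a] ab f0 AB by simp
    show "\<alpha> (d A B) = B" using eq(1)[of b] ab f0 AB by simp
    show "L = \<alpha> ` {0..d A B}"
    proof (intro equalityI subsetI)
      fix x assume "x \<in> L"
      then obtain s where s: "s \<in> {a..b}" "x = \<gamma> s" unfolding L by blast
      then show "x \<in> \<alpha> ` {0..d A B}" using eq[OF s(1)] by (intro image_eqI[of _ _ "f s"]) auto
    next
      fix x assume "x \<in> \<alpha> ` {0..d A B}"
      then obtain r where r: "0 \<le> r" "r \<le> d A B" "x = \<alpha> r" by auto
      then show "x \<in> L" unfolding L \<alpha>_def using q[OF r(1,2)] by blast
    qed
  qed (use AX in auto)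
qed

lemma geod_imp_shortest:
  assumes g: "geod X d \<alpha> l"
  shows "shortest X d (\<alpha> ` {0..l}) (\<alpha> 0) (\<alpha> l)"
proof -
  have l: "0 \<le> l" and dl: "d (\<alpha> 0) (\<alpha> l) = l" using geodD(1)[OF g] geodD(3)[OF g, of 0 l] by auto
  have "curve_length d \<alpha> 0 l = ereal l"
    unfolding curve_length_def
  proof (rule SUP_eq_const)
    have "((\<lambda>i. if i = 0 then 0 else l), 1) \<in> {(t, n). t 0 = 0 \<and> t n = l \<and> (\<forall>i<n. t i \<le> t (Suc i))}"
      using l by auto
    then show "{(t :: nat \<Rightarrow> real, n). t 0 = 0 \<and> t n = l \<and> (\<forall>i<n. t i \<le> t (Suc i))} \<noteq> {}" by (rule ex_in_conv[THEN iffD1, OF exI])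
    fix p assume "p \<in> {(t :: nat \<Rightarrow> real, n). t 0 = 0 \<and> t n = l \<and> (\<forall>i<n. t i \<le> t (Suc i))}"
    then obtain t n where p: "p = (t, n)" "t 0 = 0" "t n = l" "\<And>i. i < n \<Longrightarrow> t i \<le> t (Suc i)" by auto
    have mono: "t i \<le> t j" if "i \<le> j" "j \<le> n" for i j
      using that
    proof (induction j rule: dec_induct)
      case (step m)
      then have "t i \<le> t m" "t m \<le> t (Suc m)" using p(4)[of m] by auto
      then show ?case by (rule order_trans)
    qed simp
    have "0 \<le> t i \<and> t i \<le> l" if "i \<le> n" for i using mono[of 0 i] mono[of i n] p(2,3) that by simp
    then have "d (\<alpha> (t i)) (\<alpha> (t (Suc i))) = t (Suc i) - t i" if "i < n" for i
      using geodD(3)[OF g, of "t i" "t (Suc i)"] p(4)[OF that] that by (auto simp: Suc_le_eq)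
    then have "(\<Sum>i<n. d (\<alpha> (t i)) (\<alpha> (t (Suc i)))) = (\<Sum>i<n. t (Suc i) - t i)" by simp
    also have "\<dots> = l" using p by (simp add: sum_lessThan_telescope)
    finally show "ereal (\<Sum>i<snd p. d (\<alpha> (fst p i)) (\<alpha> (fst p (Suc i)))) = ereal l" by (simp add: p(1))
  qed
  moreover have "curve_in X d \<alpha> 0 l"
    unfolding curve_in_def using l geodD(2,3)[OF g] by auto
  ultimately show ?thesis unfolding shortest_def using dl by (intro exI[of _ \<alpha>] exI[of _ 0] exI[of _ l]) auto
qed

section \<open>Upper angles and their bound under the concavity inequality\<close>

context mspace
begin

definition ua :: "(real \<Rightarrow> 'a) \<Rightarrow> (real \<Rightarrow> 'a) \<Rightarrow> real \<Rightarrow> real \<Rightarrow> real" where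
  "ua \<alpha> \<beta> T U = upper_angle d (\<alpha> 0) (\<alpha> ` {0..T}) (\<beta> ` {0..U})"

text \<open>The Euclidean counterpart of \<open>J\<close>; upper angles are defined through it,
  whatever the curvature.\<close>

definition J0 :: "(real \<Rightarrow> 'a) \<Rightarrow> (real \<Rightarrow> 'a) \<Rightarrow> real \<Rightarrow> real \<Rightarrow> real" where
  "J0 \<alpha> \<beta> t u = (t\<^sup>2 + u\<^sup>2 - (d (\<alpha> t) (\<beta> u))\<^sup>2) / (2 * t * u)"

lemma J0_bounds:
  assumes g: "geod X d \<alpha> T" "geod X d \<beta> U" "\<alpha> 0 = \<beta> 0" and t: "0 < t" "t \<le> T" "0 < u" "u \<le> U"
  shows "-1 \<le> J0 \<alpha> \<beta> t u" "J0 \<alpha> \<beta> t u \<le> 1"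
proof -
  define x where "x = d (\<alpha> t) (\<beta> u)"
  have X: "\<alpha> 0 \<in> X" "\<alpha> t \<in> X" "\<beta> u \<in> X" using geodD(2)[OF g(1)] geodD(2)[OF g(2)] t by auto
  have "d (\<alpha> 0) (\<alpha> t) = t" "d (\<alpha> 0) (\<beta> u) = u"
    using geodD(3)[OF g(1), of 0 t] geodD(3)[OF g(2), of 0 u] t g(3) by auto
  then have x: "x \<le> t + u" "\<bar>t - u\<bar> \<le> x" "0 \<le> x"
    using d_tri[OF X(2,1,3)] d_tri[OF X] d_tri[OF X(1,3,2)] d_comm[OF X(1,2)] d_comm[OF X(2,3)] d_nn[OF X(2,3)] by (auto simp: x_def)
  have "x\<^sup>2 \<le> (t + u)\<^sup>2" using x by (intro power_mono) auto
  moreover have "(t - u)\<^sup>2 \<le> x\<^sup>2" using x(2) power_mono[of "\<bar>t - u\<bar>" x 2] by simp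
  ultimately have "- (2 * t * u) \<le> t\<^sup>2 + u\<^sup>2 - x\<^sup>2" "t\<^sup>2 + u\<^sup>2 - x\<^sup>2 \<le> 2 * t * u"
    by (auto simp: power2_eq_square algebra_simps)
  then show "-1 \<le> J0 \<alpha> \<beta> t u" "J0 \<alpha> \<beta> t u \<le> 1"
    unfolding J0_def x_def[symmetric] using t by (auto simp: pos_le_divide_eq pos_divide_le_eq)
qed

lemma ua_eq:
  assumes g: "geod X d \<alpha> T" "geod X d \<beta> U" "\<alpha> 0 = \<beta> 0"
  shows "ua \<alpha> \<beta> T U = (INF e\<in>{e. 0 < e}. Sup {arccos (J0 \<alpha> \<beta> t u) |t u. 0 < t \<and> t \<le> T \<and> 0 < u \<and> u \<le> U \<and> t < e \<and> u < e})"
proof -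
  have a: "d (\<alpha> 0) (\<alpha> t) = t" if "0 \<le> t" "t \<le> T" for t using geodD(3)[OF g(1), of 0 t] that by auto
  have b: "d (\<alpha> 0) (\<beta> u) = u" if "0 \<le> u" "u \<le> U" for u using geodD(3)[OF g(2), of 0 u] that g(3) by auto
  have X: "\<alpha> 0 \<in> X" using geodD(1,2)[OF g(1)] by auto
  have a0: "\<alpha> t = \<alpha> 0 \<longleftrightarrow> t = 0" if "0 \<le> t" "t \<le> T" for t using a[OF that] X by auto
  have b0: "\<beta> u = \<alpha> 0 \<longleftrightarrow> u = 0" if "0 \<le> u" "u \<le> U" for u using b[OF that] X g(3) by auto
  have L: "x \<in> \<alpha> ` {0..T} - {\<alpha> 0} \<longleftrightarrow> (\<exists>t. 0 < t \<and> t \<le> T \<and> x = \<alpha> t)" for x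
  proof
    assume "x \<in> \<alpha> ` {0..T} - {\<alpha> 0}"
    then obtain t where "0 \<le> t" "t \<le> T" "x = \<alpha> t" "x \<noteq> \<alpha> 0" by auto
    then show "\<exists>t. 0 < t \<and> t \<le> T \<and> x = \<alpha> t" by (intro exI[of _ t]) (cases "t = 0", auto)
  next
    assume "\<exists>t. 0 < t \<and> t \<le> T \<and> x = \<alpha> t"
    then obtain t where t: "0 < t" "t \<le> T" "x = \<alpha> t" by auto
    then show "x \<in> \<alpha> ` {0..T} - {\<alpha> 0}" using a0[of t] by auto
  qed
  have N: "y \<in> \<beta> ` {0..U} - {\<alpha> 0} \<longleftrightarrow> (\<exists>u. 0 < u \<and> u \<le> U \<and> y = \<beta> u)" for y
  proof
    assume "y \<in> \<beta> ` {0..U} - {\<alpha> 0}"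
    then obtain u where "0 \<le> u" "u \<le> U" "y = \<beta> u" "y \<noteq> \<alpha> 0" by auto
    then show "\<exists>t. 0 < t \<and> t \<le> U \<and> y = \<beta> t" using g(3) by (intro exI[of _ u]) (cases "u = 0", auto)
  next
    assume "\<exists>t. 0 < t \<and> t \<le> U \<and> y = \<beta> t"
    then obtain t where t: "0 < t" "t \<le> U" "y = \<beta> t" by auto
    then show "y \<in> \<beta> ` {0..U} - {\<alpha> 0}" using b0[of t] by auto
  qed
  have "{angle0 d (\<alpha> 0) x y |x y. x \<in> \<alpha> ` {0..T} - {\<alpha> 0} \<and> y \<in> \<beta> ` {0..U} - {\<alpha> 0} \<and> d (\<alpha> 0) x < e \<and> d (\<alpha> 0) y < e}
     = {arccos (J0 \<alpha> \<beta> t u) |t u. 0 < t \<and> t \<le> T \<and> 0 < u \<and> u \<le> U \<and> t < e \<and> u < e}" (is "?A = ?B") for e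
  proof -
    have "angle0 d (\<alpha> 0) (\<alpha> t) (\<beta> u) = arccos (J0 \<alpha> \<beta> t u)" if "0 < t" "t \<le> T" "0 < u" "u \<le> U" for t u
      unfolding angle0_def J0_def using a[of t] b[of u] that by simp
    note ang = this
    show ?thesis
    proof (intro equalityI subsetI)
      fix z assume "z \<in> ?A"
      then obtain t u where "0 < t" "t \<le> T" "0 < u" "u \<le> U" "z = angle0 d (\<alpha> 0) (\<alpha> t) (\<beta> u)" "d (\<alpha> 0) (\<alpha> t) < e" "d (\<alpha> 0) (\<beta> u) < e"
        unfolding L N by blast
      then show "z \<in> ?B" using ang a[of t] b[of u] by auto
    next
      fix z assume "z \<in> ?B"
      then obtain t u where tu: "0 < t" "t \<le> T" "0 < u" "u \<le> U" "z = arccos (J0 \<alpha> \<beta> t u)" "t < e" "u < e" by blast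
      then have "\<alpha> t \<in> \<alpha> ` {0..T} - {\<alpha> 0}" "\<beta> u \<in> \<beta> ` {0..U} - {\<alpha> 0}" "d (\<alpha> 0) (\<alpha> t) < e" "d (\<alpha> 0) (\<beta> u) < e"
        unfolding L N using a[of t] b[of u] by auto
      moreover have "z = angle0 d (\<alpha> 0) (\<alpha> t) (\<beta> u)" using ang tu by simp
      ultimately show "z \<in> ?A" by blast
    qed
  qed
  then show ?thesis unfolding ua_def upper_angle_def by simp
qed

text \<open>Suprema and infima of reals are meaningful only for nonempty bounded sets. Here this
  holds because all values are arccosines in \<open>{0..pi}\<close> and both geodesics have positive
  length.\<close>

lemma ua_aux:
  assumes g: "geod X d \<alpha> T" "geod X d \<beta> U" "\<alpha> 0 = \<beta> 0" and TU: "0 < T" "0 < U"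
  defines "A \<equiv> \<lambda>e. {arccos (J0 \<alpha> \<beta> t u) |t u. 0 < t \<and> t \<le> T \<and> 0 < u \<and> u \<le> U \<and> t < e \<and> u < e}"
  shows "0 < e \<Longrightarrow> A e \<noteq> {}" "A e \<subseteq> {0..pi}" "bdd_above (A e)" "0 < e \<Longrightarrow> 0 \<le> Sup (A e)" "bdd_below ((\<lambda>e. Sup (A e)) ` {e. 0 < e})"
proof -
  show ne: "A e \<noteq> {}" if e: "0 < e" for e
  proof -
    define t where "t = min T (min U (e / 2))"
    have "arccos (J0 \<alpha> \<beta> t t) \<in> A e" unfolding A_def using TU e by (auto simp: t_def intro!: exI[of _ t])
    then show ?thesis by blast
  qed
  show sub: "A e \<subseteq> {0..pi}" for e
    unfolding A_def using J0_bounds[OF g] by (auto intro!: arccos_lbound arccos_ubound)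
  show bd: "bdd_above (A e)" for e using bdd_above_mono[OF _ sub[of e]] by auto
  show nn: "0 \<le> Sup (A e)" if e: "0 < e" for e
  proof -
    obtain x where "x \<in> A e" using ne[OF e] by blast
    then show ?thesis using cSup_upper[OF _ bd, of x e] sub[of e] by force
  qed
  show "bdd_below ((\<lambda>e. Sup (A e)) ` {e. 0 < e})"
    using nn by (intro bdd_belowI[of _ 0]) auto
qed

lemma ua_nonneg:
  assumes g: "geod X d \<alpha> T" "geod X d \<beta> U" "\<alpha> 0 = \<beta> 0" and TU: "0 < T" "0 < U"
  shows "0 \<le> ua \<alpha> \<beta> T U"
  unfolding ua_eq[OF g] by (rule cINF_greatest) (use ua_aux(4)[OF assms] in \<open>auto intro: exI[of _ 1]\<close>)

lemma ua_lessD: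
  assumes g: "geod X d \<alpha> T" "geod X d \<beta> U" "\<alpha> 0 = \<beta> 0" and TU: "0 < T" "0 < U" and c: "ua \<alpha> \<beta> T U < c"
  shows "\<exists>e>0. \<forall>t u. 0 < t \<longrightarrow> t \<le> T \<longrightarrow> t < e \<longrightarrow> 0 < u \<longrightarrow> u \<le> U \<longrightarrow> u < e \<longrightarrow> arccos (J0 \<alpha> \<beta> t u) < c"
proof -
  have "\<exists>x\<in>(\<lambda>e. Sup {arccos (J0 \<alpha> \<beta> t u) |t u. 0 < t \<and> t \<le> T \<and> 0 < u \<and> u \<le> U \<and> t < e \<and> u < e}) ` {e. 0 < e}. x < c"
    by (rule cInf_lessD) (use c in \<open>auto simp: ua_eq[OF g] intro: exI[of _ 1]\<close>)
  then obtain e where e: "0 < e" "Sup {arccos (J0 \<alpha> \<beta> t u) |t u. 0 < t \<and> t \<le> T \<and> 0 < u \<and> u \<le> U \<and> t < e \<and> u < e} < c" by auto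
  have "arccos (J0 \<alpha> \<beta> t u) < c" if "0 < t" "t \<le> T" "t < e" "0 < u" "u \<le> U" "u < e" for t u
  proof -
    have "arccos (J0 \<alpha> \<beta> t u) \<le> Sup {arccos (J0 \<alpha> \<beta> t u) |t u. 0 < t \<and> t \<le> T \<and> 0 < u \<and> u \<le> U \<and> t < e \<and> u < e}"
      by (rule cSup_upper[OF _ ua_aux(3)[OF g TU]]) (use that in blast)
    then show ?thesis using e by simp
  qed
  then show ?thesis using e(1) by blast
qed

lemma ua_leI:
  assumes g: "geod X d \<alpha> T" "geod X d \<beta> U" "\<alpha> 0 = \<beta> 0" and TU: "0 < T" "0 < U" and e: "0 < e"
    and le: "\<And>t u. 0 < t \<Longrightarrow> t \<le> T \<Longrightarrow> t < e \<Longrightarrow> 0 < u \<Longrightarrow> u \<le> U \<Longrightarrow> u < e \<Longrightarrow> arccos (J0 \<alpha> \<beta> t u) \<le> c"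
  shows "ua \<alpha> \<beta> T U \<le> c"
proof -
  have "ua \<alpha> \<beta> T U \<le> Sup {arccos (J0 \<alpha> \<beta> t u) |t u. 0 < t \<and> t \<le> T \<and> 0 < u \<and> u \<le> U \<and> t < e \<and> u < e}"
    unfolding ua_eq[OF g] by (rule cINF_lower[OF ua_aux(5)[OF g TU]]) (use e in auto)
  also have "\<dots> \<le> c" by (rule cSup_least[OF ua_aux(1)[OF g TU e]]) (use le in auto)
  finally show ?thesis .
qed

lemma ua_le_pi:
  assumes g: "geod X d \<alpha> T" "geod X d \<beta> U" "\<alpha> 0 = \<beta> 0" and TU: "0 < T" "0 < U"
  shows "ua \<alpha> \<beta> T U \<le> pi"
  by (rule ua_leI[OF assms zero_less_one]) (use J0_bounds[OF g] in \<open>auto intro: arccos_ubound\<close>)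

text \<open>After substitution of \<open>J_eq\<close>, the concavity inequality for the point
  \<open>\<beta> u\<close> and the geodesic \<open>\<alpha>\<close> is exactly the monotonicity of
  \<open>J\<close>, multiplied by \<open>S T * S t * S u\<close>.\<close>

lemma CAT_J_mono:
  assumes cat: CAT and g: "geod X d \<alpha> T" "geod X d \<beta> U" "\<alpha> 0 = \<beta> 0" and t: "0 < t" "t \<le> T" "0 < u" "u \<le> U"
  shows "J \<alpha> \<beta> T u \<le> J \<alpha> \<beta> t u"
proof -
  have X: "\<beta> u \<in> X" "\<alpha> t \<in> X" "\<alpha> T \<in> X" "\<alpha> 0 \<in> X" using geodD(2)[OF g(1)] geodD(2)[OF g(2)] t by auto
  have S: "0 < S t" "0 < S T" "0 < S u" using geod_S_pos[OF g(1)] geod_S_pos[OF g(2)] t by auto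
  have du: "d (\<beta> u) (\<alpha> 0) = u" using geodD(3)[OF g(2), of u 0] t g(3) by auto
  have "0 \<le> k * (S T * C (d (\<beta> u) (\<alpha> t)) - S (T - t) * C (d (\<beta> u) (\<alpha> 0)) - S t * C (d (\<beta> u) (\<alpha> T)))"
    using cat X(1) g(1) t unfolding CAT_def by auto
  then have "0 \<le> k * (S T * C (d (\<alpha> t) (\<beta> u)) - S (T - t) * C u - S t * C (d (\<alpha> T) (\<beta> u)))"
    unfolding du d_comm[OF X(1,2)] d_comm[OF X(1,3)] .
  also have "\<dots> = S T * S t * S u * (J \<alpha> \<beta> t u - J \<alpha> \<beta> T u)"
  proof -
    have e: "C (d (\<alpha> t) (\<beta> u)) = C t * C u + k * S t * S u * J \<alpha> \<beta> t u" "C (d (\<alpha> T) (\<beta> u)) = C T * C u + k * S T * S u * J \<alpha> \<beta> T u"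
      using S by (auto intro!: J_eq)
    show ?thesis unfolding e S_diff by (simp add: algebra_simps)
  qed
  finally have "S T * S t * S u * 0 \<le> S T * S t * S u * (J \<alpha> \<beta> t u - J \<alpha> \<beta> T u)" by simp
  moreover have "0 < S T * S t * S u" using S by simp
  ultimately have "0 \<le> J \<alpha> \<beta> t u - J \<alpha> \<beta> T u" by (rule mult_left_le_imp_le)
  then show ?thesis by simp
qed

lemma J_sym:
  assumes "geod X d \<alpha> T" "geod X d \<beta> U" "0 \<le> t" "t \<le> T" "0 \<le> u" "u \<le> U"
  shows "J \<beta> \<alpha> u t = J \<alpha> \<beta> t u"
  unfolding J_def using d_comm[of "\<alpha> t" "\<beta> u"] geodD(2)[OF assms(1)] geodD(2)[OF assms(2)] assms by (simp add: ac_simps)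

lemma CAT_J_mono2:
  assumes cat: CAT and g: "geod X d \<alpha> T" "geod X d \<beta> U" "\<alpha> 0 = \<beta> 0" and t: "0 < t" "t \<le> T" "0 < u" "u \<le> U"
  shows "J \<alpha> \<beta> T U \<le> J \<alpha> \<beta> t u"
proof -
  have "J \<alpha> \<beta> T U \<le> J \<alpha> \<beta> t U" using t by (intro CAT_J_mono[OF cat g]) auto
  also have "\<dots> = J \<beta> \<alpha> U t" using t by (intro J_sym[OF g(1,2), symmetric]) auto
  also have "\<dots> \<le> J \<beta> \<alpha> u t" using t by (intro CAT_J_mono[OF cat g(2,1) g(3)[symmetric]]) auto
  also have "\<dots> = J \<alpha> \<beta> t u" using t by (intro J_sym[OF g(1,2)]) auto
  finally show ?thesis .
qed

lemma S_near:
  assumes "0 < \<epsilon>"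
  shows "\<exists>e>0. \<forall>y. 0 \<le> y \<longrightarrow> y < e \<longrightarrow> (1 - \<epsilon>) * y \<le> S y \<and> S y \<le> (1 + \<epsilon>) * y"
proof -
  have "\<forall>\<^sub>F y in at_right 0. dist (S y / y) 1 < \<epsilon>" using tendsto_ratio_zero assms by (rule tendstoD)
  then obtain e where e: "0 < e" "\<And>y. 0 < y \<Longrightarrow> y < e \<Longrightarrow> dist (S y / y) 1 < \<epsilon>"
    unfolding eventually_at_right_field by blast
  have "(1 - \<epsilon>) * y \<le> S y \<and> S y \<le> (1 + \<epsilon>) * y" if "0 \<le> y" "y < e" for y
  proof (cases "y = 0")
    case False
    then have "dist (S y / y) 1 < \<epsilon>" using e that by auto
    then have "1 - \<epsilon> < S y / y" "S y / y < 1 + \<epsilon>" unfolding dist_real_def by linarith+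
    then show ?thesis using False that by (simp add: pos_less_divide_eq pos_divide_less_eq)
  qed simp
  then show ?thesis using e(1) by blast
qed

text \<open>Both defects factor. With \<open>x\<close> the distance and
  \<open>v = \<bar>t - u\<bar>\<close>, \<open>S t * S u * (1 - J)\<close> equals
  \<open>2 * S ((x + v) / 2) * S ((x - v) / 2)\<close>, and \<open>2 * t * u * (1 - J0)\<close>
  equals \<open>(x + v) * (x - v)\<close>. So \<open>S y\<close> being close to \<open>y\<close>
  compares them factor by factor, even when both defects are tiny.\<close>

lemma J_J0:
  assumes g: "geod X d \<alpha> T" "geod X d \<beta> U" "\<alpha> 0 = \<beta> 0" and \<epsilon>: "0 < \<epsilon>" "\<epsilon> < 1"
  shows "\<exists>e>0. \<forall>t u. 0 < t \<longrightarrow> t \<le> T \<longrightarrow> t < e \<longrightarrow> 0 < u \<longrightarrow> u \<le> U \<longrightarrow> u < e \<longrightarrow> (1 - \<epsilon>)\<^sup>2 * (1 - J0 \<alpha> \<beta> t u) \<le> (1 + \<epsilon>)\<^sup>2 * (1 - J \<alpha> \<beta> t u)"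
proof -
  obtain e where e: "0 < e" "\<And>y. 0 \<le> y \<Longrightarrow> y < e \<Longrightarrow> (1 - \<epsilon>) * y \<le> S y \<and> S y \<le> (1 + \<epsilon>) * y"
    using S_near[OF \<epsilon>(1)] by blast
  have "(1 - \<epsilon>)\<^sup>2 * (1 - J0 \<alpha> \<beta> t u) \<le> (1 + \<epsilon>)\<^sup>2 * (1 - J \<alpha> \<beta> t u)" if t: "0 < t" "t \<le> T" "t < e / 2" "0 < u" "u \<le> U" "u < e / 2" for t u
  proof -
    define x where "x = d (\<alpha> t) (\<beta> u)"
    define v where "v = \<bar>t - u\<bar>"
    have X: "\<alpha> 0 \<in> X" "\<alpha> t \<in> X" "\<beta> u \<in> X" using geodD(2)[OF g(1)] geodD(2)[OF g(2)] t by auto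
    have "d (\<alpha> 0) (\<alpha> t) = t" "d (\<alpha> 0) (\<beta> u) = u"
      using geodD(3)[OF g(1), of 0 t] geodD(3)[OF g(2), of 0 u] t g(3) by auto
    then have x: "x \<le> t + u" "v \<le> x" "0 \<le> v"
      using d_tri[OF X(2,1,3)] d_tri[OF X] d_tri[OF X(1,3,2)] d_comm[OF X(1,2)] d_comm[OF X(2,3)] d_nn[OF X(2,3)] by (auto simp: x_def v_def)
    have St: "0 < S t" "0 < S u" using geod_S_pos[OF g(1)] geod_S_pos[OF g(2)] t by auto
    have a: "(1 - \<epsilon>) * ((x + v) / 2) \<le> S ((x + v) / 2)" "(1 - \<epsilon>) * ((x - v) / 2) \<le> S ((x - v) / 2)"
      using e(2)[of "(x + v) / 2"] e(2)[of "(x - v) / 2"] x t by auto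
    have J: "2 * (S ((x + v) / 2) * S ((x - v) / 2)) = S t * S u * (1 - J \<alpha> \<beta> t u)"
    proof -
      have "C x = C t * C u + k * S t * S u * J \<alpha> \<beta> t u" unfolding x_def using St by (intro J_eq) auto
      moreover have "C v = C t * C u + k * S t * S u" unfolding v_def C_abs C_diff ..
      ultimately have "k * (C v - C x) = S t * S u * (1 - J \<alpha> \<beta> t u)" by (simp add: algebra_simps)
      moreover have "k * (C v - C x) = k * (1 - C x) - k * (1 - C v)" by (simp add: algebra_simps)
      ultimately have "2 * ((S (x / 2))\<^sup>2 - (S (v / 2))\<^sup>2) = S t * S u * (1 - J \<alpha> \<beta> t u)"
        unfolding one_minus_C by simp
      then show ?thesis unfolding S_diff_sq by (simp add: add_divide_distrib diff_divide_distrib)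
    qed
    have J0: "x\<^sup>2 - v\<^sup>2 = 2 * (t * u) * (1 - J0 \<alpha> \<beta> t u)"
      unfolding J0_def x_def[symmetric] v_def using t by (simp add: field_simps power2_eq_square)
    have "2 * (((1 - \<epsilon>) * ((x + v) / 2)) * ((1 - \<epsilon>) * ((x - v) / 2))) \<le> 2 * (S ((x + v) / 2) * S ((x - v) / 2))"
    proof -
      have nn: "0 \<le> (1 - \<epsilon>) * ((x + v) / 2)" "0 \<le> (1 - \<epsilon>) * ((x - v) / 2)" using \<epsilon> x by simp_all
      show ?thesis by (intro mult_left_mono mult_mono a nn order_trans[OF nn(1) a(1)]) simp
    qed
    also have "\<dots> = S t * S u * (1 - J \<alpha> \<beta> t u)" by (rule J)
    also have "\<dots> \<le> ((1 + \<epsilon>) * t) * ((1 + \<epsilon>) * u) * (1 - J \<alpha> \<beta> t u)"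
      using e(2)[of t] e(2)[of u] t \<epsilon> St J_bounds(2)[OF g t(1,2,4,5)] by (intro mult_right_mono mult_mono) auto
    also have "\<dots> = (t * u) * ((1 + \<epsilon>)\<^sup>2 * (1 - J \<alpha> \<beta> t u))" by (simp only: power2_eq_square ac_simps)
    also have "2 * (((1 - \<epsilon>) * ((x + v) / 2)) * ((1 - \<epsilon>) * ((x - v) / 2))) = (1 - \<epsilon>)\<^sup>2 * ((x + v) * (x - v)) / 2"
      by (simp add: power2_eq_square)
    finally have "(1 - \<epsilon>)\<^sup>2 * (x\<^sup>2 - v\<^sup>2) \<le> 2 * (t * u) * ((1 + \<epsilon>)\<^sup>2 * (1 - J \<alpha> \<beta> t u))"
      unfolding power2_eq_square[of x] power2_eq_square[of v] square_diff_square_factored by linarith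
    then have "(2 * (t * u)) * ((1 - \<epsilon>)\<^sup>2 * (1 - J0 \<alpha> \<beta> t u)) \<le> (2 * (t * u)) * ((1 + \<epsilon>)\<^sup>2 * (1 - J \<alpha> \<beta> t u))"
      unfolding J0 by (simp only: mult.assoc mult.left_commute mult.commute)
    moreover have "0 < 2 * (t * u)" using t by simp
    ultimately show ?thesis by (rule mult_left_le_imp_le)
  qed
  then show ?thesis using e(1) by (intro exI[of _ "e / 2"]) auto
qed

text \<open>By monotonicity \<open>J\<close> is at least its value \<open>j\<close> at the far ends.
  Near the start \<open>1 - J0\<close> exceeds \<open>1 - J\<close> at most by the factor
  \<open>(1 + \<epsilon>)\<^sup>2 / (1 - \<epsilon>)\<^sup>2\<close>, and \<open>\<epsilon>\<close>
  is so small that this factor does not use up the gap between \<open>j\<close> and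
  \<open>cos c\<close>.\<close>

lemma CAT_angle:
  assumes cat: CAT and g: "geod X d \<alpha> T" "geod X d \<beta> U" "\<alpha> 0 = \<beta> 0" and TU: "0 < T" "0 < U"
  shows "ua \<alpha> \<beta> T U \<le> arccos (J \<alpha> \<beta> T U)"
proof (rule dense_ge)
  define j where "j = J \<alpha> \<beta> T U"
  have j: "-1 \<le> j" "j \<le> 1" using J_bounds[OF g TU(1) order_refl TU(2) order_refl] by (auto simp: j_def)
  fix c assume c: "arccos (J \<alpha> \<beta> T U) < c"
  show "ua \<alpha> \<beta> T U \<le> c"
  proof (cases "c \<le> pi")
    case False
    then show ?thesis using ua_le_pi[OF g TU] by simp
  next
    case True
    have c0: "0 \<le> c" using c arccos_lbound[OF j] by (simp add: j_def)
    have cj: "cos c < j" using cos_monotone_0_pi[OF arccos_lbound[OF j] c[folded j_def] True] cos_arccos[OF j] by simp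
    have "((\<lambda>\<epsilon>. (1 - \<epsilon>)\<^sup>2 * (1 - cos c) - (1 + \<epsilon>)\<^sup>2 * (1 - j)) \<longlongrightarrow> (1 - 0)\<^sup>2 * (1 - cos c) - (1 + 0)\<^sup>2 * (1 - j)) (at_right 0)"
      by (intro tendsto_intros)
    then have "\<forall>\<^sub>F \<epsilon> in at_right 0. 0 < (1 - \<epsilon>)\<^sup>2 * (1 - cos c) - (1 + \<epsilon>)\<^sup>2 * (1 - j)"
      using cj by (intro order_tendstoD(1)) auto
    then obtain b where b: "0 < b" "\<And>\<epsilon>. 0 < \<epsilon> \<Longrightarrow> \<epsilon> < b \<Longrightarrow> (1 + \<epsilon>)\<^sup>2 * (1 - j) < (1 - \<epsilon>)\<^sup>2 * (1 - cos c)"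
      unfolding eventually_at_right_field by auto
    define \<epsilon> where "\<epsilon> = min (b / 2) (1 / 2)"
    have \<epsilon>: "0 < \<epsilon>" "\<epsilon> < 1" "\<epsilon> < b" using b(1) by (auto simp: \<epsilon>_def)
    obtain e where e: "0 < e" "\<And>t u. 0 < t \<Longrightarrow> t \<le> T \<Longrightarrow> t < e \<Longrightarrow> 0 < u \<Longrightarrow> u \<le> U \<Longrightarrow> u < e \<Longrightarrow> (1 - \<epsilon>)\<^sup>2 * (1 - J0 \<alpha> \<beta> t u) \<le> (1 + \<epsilon>)\<^sup>2 * (1 - J \<alpha> \<beta> t u)"
      using J_J0[OF g \<epsilon>(1,2)] by blast
    show ?thesis
    proof (rule ua_leI[OF g TU e(1)])
      fix t u assume t: "0 < t" "t \<le> T" "t < e" "0 < u" "u \<le> U" "u < e"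
      have "(1 - \<epsilon>)\<^sup>2 * (1 - J0 \<alpha> \<beta> t u) \<le> (1 + \<epsilon>)\<^sup>2 * (1 - J \<alpha> \<beta> t u)" by (rule e(2)[OF t])
      also have "\<dots> \<le> (1 + \<epsilon>)\<^sup>2 * (1 - j)"
        using CAT_J_mono2[OF cat g t(1,2,4,5)] by (intro mult_left_mono) (auto simp: j_def)
      also have "\<dots> < (1 - \<epsilon>)\<^sup>2 * (1 - cos c)" by (rule b(2)[OF \<epsilon>(1,3)])
      finally have "cos c \<le> J0 \<alpha> \<beta> t u" using \<epsilon> by (simp add: mult_less_cancel_left)
      then have "arccos (J0 \<alpha> \<beta> t u) \<le> arccos (cos c)"
        using J0_bounds[OF g t(1,2,4,5)] by (intro arccos_le_arccos) auto
      then show "arccos (J0 \<alpha> \<beta> t u) \<le> c" using arccos_cos[OF c0 True] by simp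
    qed
  qed
qed

end

text \<open>\<open>cos x - cos (x + a)\<close> is \<open>2 * sin (x + a / 2) * sin (a / 2)\<close>,
  and \<open>x + a / 2\<close> lies between \<open>a / 2\<close> and \<open>pi - a / 2\<close>,
  where the sine is at least \<open>sin (a / 2)\<close>. A gap between angles thus becomes a gap
  between cosines whose size does not depend on their position.\<close>

lemma cos_gap:
  assumes "0 \<le> x" "0 \<le> a" "x + a \<le> y" "y \<le> pi"
  shows "1 - cos a \<le> cos x - cos y"
proof -
  have "cos y \<le> cos (x + a)" using assms by (intro cos_monotone_0_pi_le) auto
  moreover have "cos x - cos (x + a) = 2 * sin (x + a / 2) * sin (a / 2)"
    using cos_diff_cos[of x "x + a"] by (simp add: field_simps)
  moreover have "1 - cos a = 2 * sin (a / 2) * sin (a / 2)"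
    using cos_double_sin[of "a / 2"] by (simp add: power2_eq_square)
  moreover have "2 * sin (a / 2) * sin (a / 2) \<le> 2 * sin (x + a / 2) * sin (a / 2)"
  proof (intro mult_right_mono mult_left_mono)
    show "0 \<le> sin (a / 2)" using assms by (intro sin_ge_zero) auto
    show "sin (a / 2) \<le> sin (x + a / 2)"
    proof (cases "x + a / 2 \<le> pi / 2")
      case True
      then show ?thesis using assms by (intro sin_monotone_2pi_le) auto
    next
      case False
      have "sin (a / 2) \<le> sin (pi - (x + a / 2))" using assms False by (intro sin_monotone_2pi_le) auto
      then show ?thesis by simp
    qed
  qed simp
  ultimately show ?thesis by linarith
qed

section \<open>From bounds for angle sums to the concavity inequality\<close>

context mspace
begin

definition mang :: "real \<Rightarrow> real \<Rightarrow> real \<Rightarrow> real" where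
  "mang a b c = arccos (k * (C c - C a * C b) / (S a * S b))"

definition angsum :: bool where
  "angsum \<longleftrightarrow> (\<forall>\<alpha> \<beta> \<gamma> T U V. geod X d \<alpha> T \<longrightarrow> geod X d \<beta> U \<longrightarrow> geod X d \<gamma> V \<longrightarrow> 0 < T \<longrightarrow> 0 < U \<longrightarrow> 0 < V \<longrightarrow>
     \<alpha> 0 = \<beta> 0 \<longrightarrow> \<alpha> T = \<gamma> 0 \<longrightarrow> \<beta> U = \<gamma> V \<longrightarrow>
     ua \<alpha> \<beta> T U + ua (\<lambda>s. \<alpha> (T - s)) \<gamma> T V + ua (\<lambda>s. \<beta> (U - s)) (\<lambda>s. \<gamma> (V - s)) U V
       \<le> mang T U V + mang T V U + mang U V T)"

lemma ua_local:
  assumes g: "geod X d \<alpha> T" "geod X d \<beta> U" "\<alpha> 0 = \<beta> 0" and t: "0 < t" "t \<le> T" "0 < u" "u \<le> U"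
  shows "ua \<alpha> \<beta> T U \<le> ua \<alpha> \<beta> t u"
proof (rule dense_ge)
  fix c assume c: "ua \<alpha> \<beta> t u < c"
  have g': "geod X d \<alpha> t" "geod X d \<beta> u" using g t by (auto simp: geod_def)
  obtain e where e: "0 < e" "\<And>s v. 0 < s \<Longrightarrow> s \<le> t \<Longrightarrow> s < e \<Longrightarrow> 0 < v \<Longrightarrow> v \<le> u \<Longrightarrow> v < e \<Longrightarrow> arccos (J0 \<alpha> \<beta> s v) < c"
    using ua_lessD[OF g' g(3) t(1,3) c] by blast
  show "ua \<alpha> \<beta> T U \<le> c"
    by (rule ua_leI[OF g, of "min e (min t u)"]) (use t e in \<open>auto intro: less_imp_le\<close>)
qed

text \<open>Points at equal parameters on the two sides have the Euclidean comparison angle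
  \<open>pi\<close>, arbitrarily close to the vertex.\<close>

lemma ua_opposite:
  assumes g: "geod X d \<alpha> l" and s: "0 < m" "m \<le> s" "0 < n" "s + n \<le> l"
  shows "pi \<le> ua (\<lambda>t. \<alpha> (s - t)) (\<lambda>t. \<alpha> (s + t)) m n"
proof (rule ccontr)
  assume "\<not> ?thesis"
  then have c: "ua (\<lambda>t. \<alpha> (s - t)) (\<lambda>t. \<alpha> (s + t)) m n < pi" by simp
  have g': "geod X d (\<lambda>t. \<alpha> (s - t)) m" "geod X d (\<lambda>t. \<alpha> (s + t)) n"
    using s by (auto intro!: geod_rev_sub[OF g] geod_shift[OF g])
  obtain e where e: "0 < e" "\<And>t u. 0 < t \<Longrightarrow> t \<le> m \<Longrightarrow> t < e \<Longrightarrow> 0 < u \<Longrightarrow> u \<le> n \<Longrightarrow> u < e \<Longrightarrow> arccos (J0 (\<lambda>t. \<alpha> (s - t)) (\<lambda>t. \<alpha> (s + t)) t u) < pi"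
    using ua_lessD[OF g' _ s(1,3) c] by auto
  define t where "t = min (e / 2) (min m n)"
  have t: "0 < t" "t \<le> m" "t < e" "t \<le> n" using e(1) s by (auto simp: t_def)
  have "d (\<alpha> (s - t)) (\<alpha> (s + t)) = 2 * t" using geodD(3)[OF g, of "s - t" "s + t"] t s by auto
  then have "J0 (\<lambda>t. \<alpha> (s - t)) (\<lambda>t. \<alpha> (s + t)) t t = -1" unfolding J0_def using t by (simp add: power2_eq_square)
  then show False using e(2)[of t t] t by simp
qed

text \<open>The upper angle controls, through the Euclidean law of cosines, the triangle with sides
  \<open>\<delta>\<close> and a small but fixed \<open>v\<close> on \<open>\<sigma>\<close>; the
  triangle inequality covers the rest of \<open>\<sigma>\<close>. Fixing \<open>v\<close> is what
  leaves an error quadratic in \<open>\<delta>\<close>.\<close>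

lemma first_variation_inequality:
  assumes g: "geod X d \<alpha> x" "geod X d \<sigma> y" "\<alpha> x = \<sigma> 0" and xy: "0 < x" "0 < y" and \<epsilon>: "0 < \<epsilon>"
  shows "\<exists>v>0. \<exists>\<delta>0>0. \<forall>\<delta>. 0 < \<delta> \<longrightarrow> \<delta> < \<delta>0 \<longrightarrow> d (\<alpha> (x - \<delta>)) (\<sigma> y) \<le> y - \<delta> * (cos (ua (\<lambda>s. \<alpha> (x - s)) \<sigma> x y) - \<epsilon>) + \<delta>\<^sup>2 / (2 * v)"
proof -
  define \<alpha>' where "\<alpha>' s = \<alpha> (x - s)" for s
  have g': "geod X d \<alpha>' x" "\<alpha>' 0 = \<sigma> 0" using geod_rev_sub[OF g(1), of x x] xy g(3) by (auto simp: \<alpha>'_def[abs_def])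
  define \<xi> where "\<xi> = ua \<alpha>' \<sigma> x y"
  have \<xi>: "0 \<le> \<xi>" "\<xi> \<le> pi" using ua_nonneg[OF g'(1) g(2) g'(2) xy] ua_le_pi[OF g'(1) g(2) g'(2) xy] by (auto simp: \<xi>_def)
  define c where "c = cos \<xi> - \<epsilon>"
  have "ua \<alpha>' \<sigma> x y < \<xi> + \<epsilon>" using \<epsilon> by (simp add: \<xi>_def)
  from ua_lessD[OF g'(1) g(2) g'(2) xy this] obtain e where
    e: "0 < e" "\<And>t u. 0 < t \<Longrightarrow> t \<le> x \<Longrightarrow> t < e \<Longrightarrow> 0 < u \<Longrightarrow> u \<le> y \<Longrightarrow> u < e \<Longrightarrow> arccos (J0 \<alpha>' \<sigma> t u) < \<xi> + \<epsilon>" by blast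
  define v where "v = min (e / 2) y"
  have v: "0 < v" "v \<le> y" "v < e" using e xy by (auto simp: v_def)
  have "d (\<alpha> (x - \<delta>)) (\<sigma> y) \<le> y - \<delta> * c + \<delta>\<^sup>2 / (2 * v)" if \<delta>: "0 < \<delta>" "\<delta> < min e x" for \<delta>
  proof -
    have jb: "-1 \<le> J0 \<alpha>' \<sigma> \<delta> v" "J0 \<alpha>' \<sigma> \<delta> v \<le> 1" using J0_bounds[OF g'(1) g(2) g'(2), of \<delta> v] \<delta> v by auto
    have a: "arccos (J0 \<alpha>' \<sigma> \<delta> v) < \<xi> + \<epsilon>" using \<delta> v by (intro e(2)) auto
    have "c \<le> J0 \<alpha>' \<sigma> \<delta> v"
    proof (cases "arccos (J0 \<alpha>' \<sigma> \<delta> v) \<le> \<xi>")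
      case True
      have "cos \<xi> \<le> cos (arccos (J0 \<alpha>' \<sigma> \<delta> v))" using arccos_lbound[OF jb] True \<xi> by (intro cos_monotone_0_pi_le) auto
      then show ?thesis using cos_arccos[OF jb] \<epsilon> by (simp add: c_def)
    next
      case False
      have "\<bar>cos \<xi> - cos (arccos (J0 \<alpha>' \<sigma> \<delta> v))\<bar> \<le> \<bar>\<xi> - arccos (J0 \<alpha>' \<sigma> \<delta> v)\<bar>"
      proof -
        have "norm (cos \<xi> - cos (arccos (J0 \<alpha>' \<sigma> \<delta> v))) \<le> 1 * norm (\<xi> - arccos (J0 \<alpha>' \<sigma> \<delta> v))"
          by (rule field_differentiable_bound[of UNIV cos "\<lambda>z. - sin z"]) (auto intro: DERIV_cos)
        then show ?thesis by simp
      qed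
      then show ?thesis using a False cos_arccos[OF jb] by (simp add: c_def)
    qed
    then have "\<delta>\<^sup>2 + v\<^sup>2 - (d (\<alpha>' \<delta>) (\<sigma> v))\<^sup>2 \<ge> c * (2 * \<delta> * v)"
      unfolding J0_def using \<delta> v by (simp add: pos_le_divide_eq)
    \<comment> \<open>\<open>v + z\<close> is the tangent estimate for the square root of
      \<open>v\<^sup>2 + 2 * v * z\<close>: its square is larger by
      \<open>z\<^sup>2\<close>.\<close>
    moreover define z where "z = \<delta>\<^sup>2 / (2 * v) - \<delta> * c"
    moreover have vz: "2 * v * z = \<delta>\<^sup>2 - c * (2 * \<delta> * v)" unfolding z_def using v by (simp add: field_simps)
    ultimately have dz: "(d (\<alpha>' \<delta>) (\<sigma> v))\<^sup>2 \<le> v\<^sup>2 + 2 * v * z" by simp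
    have "0 \<le> v\<^sup>2 + 2 * v * z" using order_trans[OF zero_le_power2 dz] .
    then have "v * 0 \<le> v * (v + 2 * z)" by (simp add: power2_eq_square algebra_simps)
    then have "0 \<le> v + 2 * z" using v(1) by (rule mult_left_le_imp_le)
    then have vz0: "0 \<le> v + z" using v by linarith
    have "(d (\<alpha>' \<delta>) (\<sigma> v))\<^sup>2 \<le> (v + z)\<^sup>2"
    proof -
      have "(v + z)\<^sup>2 = v\<^sup>2 + 2 * v * z + z\<^sup>2" "0 \<le> z\<^sup>2" by (simp_all add: power2_sum)
      then show ?thesis using dz by linarith
    qed
    then have "d (\<alpha>' \<delta>) (\<sigma> v) \<le> v + z" using vz0 by (rule power2_le_imp_le)
    moreover have X: "\<alpha>' \<delta> \<in> X" "\<sigma> v \<in> X" "\<sigma> y \<in> X" using geodD(2)[OF g'(1)] geodD(2)[OF g(2)] \<delta> v by auto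
    moreover have "d (\<sigma> v) (\<sigma> y) = y - v" using geodD(3)[OF g(2), of v y] v by auto
    ultimately have "d (\<alpha>' \<delta>) (\<sigma> y) \<le> y + z" using d_tri[OF X] by linarith
    then show ?thesis by (simp add: \<alpha>'_def z_def)
  qed
  moreover have "0 < min e x" using e xy by simp
  ultimately show ?thesis using v(1) unfolding c_def \<xi>_def \<alpha>'_def[abs_def] by blast
qed

text \<open>By minimality, shortening \<open>x\<close> by \<open>\<delta>\<close> leaves a
  comparison angle of at least the old one plus \<open>c2 * ln (1 - \<delta> / x)\<close>, which
  bounds the new third side from below. The first variation bounds it from above through the upper
  angle at \<open>\<alpha> x\<close>. To first order in \<open>\<delta>\<close> the two bounds are
  compatible only if the cosine of this upper angle exceeds that of the model angle by
  little.\<close>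

lemma angle_step:
  assumes g: "geod X d \<alpha> T" "geod X d \<beta> U" "\<alpha> 0 = \<beta> 0" and x: "0 < x" "x \<le> T" "0 < y" "y \<le> U"
    and \<sigma>: "geod X d \<sigma> z" "\<sigma> 0 = \<alpha> x" "\<sigma> z = \<beta> y" and z: "0 < z" and c2: "0 < c2"
    and min: "0 < \<delta>1" "\<And>\<delta>. 0 < \<delta> \<Longrightarrow> \<delta> < \<delta>1 \<Longrightarrow> arccos (J \<alpha> \<beta> x y) - c2 * ln (x * y) \<le> arccos (J \<alpha> \<beta> (x - \<delta>) y) - c2 * ln ((x - \<delta>) * y)"
  shows "cos (ua (\<lambda>s. \<alpha> (x - s)) \<sigma> x z) - cos (mang x z y) \<le> c2 * (S x / x)"
proof -
  define j where "j = J \<alpha> \<beta> x y"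
  have jb: "-1 \<le> j" "j \<le> 1" using J_bounds[OF g x] by (auto simp: j_def)
  define G where "G = arccos j"
  have G: "0 \<le> G" "G \<le> pi" "cos G = j" using arccos_lbound[OF jb] arccos_ubound[OF jb] cos_arccos[OF jb] by (auto simp: G_def)
  have ga: "geod X d \<alpha> x" using g(1) x by (auto simp: geod_def)
  have Sx: "0 < S x" "0 < S y" "0 < S z" using geod_S_pos[OF g(1)] geod_S_pos[OF g(2)] geod_S_pos[OF \<sigma>(1)] x z by auto
  have dz: "d (\<alpha> x) (\<beta> y) = z" using geodD(3)[OF \<sigma>(1), of 0 z] \<sigma>(2,3) z by simp
  have X: "\<alpha> 0 \<in> X" "\<alpha> x \<in> X" "\<beta> y \<in> X" using geodD(2)[OF g(1)] geodD(2)[OF g(2)] x by auto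
  have Cz: "C z = C x * C y + k * S x * S y * j" unfolding j_def dz[symmetric] using Sx by (intro J_eq) auto
  define q where "q = k * (C y - C x * C z) / (S x * S z)"
  have qb: "-1 \<le> q" "q \<le> 1"
  proof -
    have "d (\<alpha> x) (\<alpha> 0) = x" "d (\<alpha> 0) (\<beta> y) = y"
      using geodD(3)[OF g(1), of x 0] geodD(3)[OF g(2), of 0 y] x g(3) by auto
    then show "-1 \<le> q" "q \<le> 1" using cosine_bounds[OF X(2,1,3)] Sx dz unfolding q_def by auto
  qed
  have cq: "cos (mang x z y) = q" unfolding mang_def q_def[symmetric] using cos_arccos[OF qb] .
  have Sq: "S z * q = S x * C y - C x * S y * j"
  proof -
    have "S x * (S z * q) = k * (C y - C x * C z)" unfolding q_def using Sx by simp
    also have "\<dots> = k * (C y * (1 - (C x)\<^sup>2)) - C x * S x * S y * j"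
      unfolding Cz using k by (auto simp: power2_eq_square algebra_simps)
    also have "k * (C y * (1 - (C x)\<^sup>2)) = C y * (S x)\<^sup>2" unfolding S_sq by simp
    finally have "S x * (S z * q) = S x * (S x * C y - C x * S y * j)" by (simp add: power2_eq_square algebra_simps)
    then show ?thesis using Sx by simp
  qed
  \<comment> \<open>The law of sines in the model triangle, with the sine of the angle at
    \<open>\<alpha> x\<close> estimated by 1.\<close>
  have sinq: "S y * sin G \<le> S z"
  proof -
    have "(S z)\<^sup>2 - (S z * q)\<^sup>2 = (S y)\<^sup>2 * (1 - j\<^sup>2)"
    proof -
      have "(S z)\<^sup>2 = k * (1 - (C x * C y + k * S x * S y * j)\<^sup>2)" unfolding S_sq Cz ..
      then have "(S z)\<^sup>2 - (S z * q)\<^sup>2 = k - (C y)\<^sup>2 * (k * (C x)\<^sup>2 + (S x)\<^sup>2) - (S y)\<^sup>2 * j\<^sup>2 * ((C x)\<^sup>2 + k * (S x)\<^sup>2)"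
        unfolding Sq using k by (auto simp: power2_eq_square algebra_simps)
      also have "k * (C x)\<^sup>2 + (S x)\<^sup>2 = k" unfolding S_sq using k by auto
      also have "(C x)\<^sup>2 + k * (S x)\<^sup>2 = 1" unfolding S_sq using k by auto
      also have "k - (C y)\<^sup>2 * k - (S y)\<^sup>2 * j\<^sup>2 * 1 = (S y)\<^sup>2 * (1 - j\<^sup>2)" unfolding S_sq by (simp add: algebra_simps)
      finally show ?thesis .
    qed
    moreover have "(sin G)\<^sup>2 = 1 - j\<^sup>2" using G by (simp add: sin_squared_eq)
    then have "(S y * sin G)\<^sup>2 = (S y)\<^sup>2 * (1 - j\<^sup>2)" by (simp add: power_mult_distrib)
    ultimately have "(S y * sin G)\<^sup>2 = (S z)\<^sup>2 - (S z * q)\<^sup>2" by (simp only:)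
    then have "(S y * sin G)\<^sup>2 \<le> (S z)\<^sup>2" using zero_le_power2[of "S z * q"] by linarith
    then show ?thesis using less_imp_le[OF Sx(3)] by (rule power2_le_imp_le)
  qed
  have main: "S z * (cos (ua (\<lambda>s. \<alpha> (x - s)) \<sigma> x z) - \<epsilon> - q) \<le> c2 * (S x / x) * S z" if \<epsilon>: "0 < \<epsilon>" for \<epsilon>
  proof -
    define c where "c = cos (ua (\<lambda>s. \<alpha> (x - s)) \<sigma> x z) - \<epsilon>"
    from first_variation_inequality[OF ga \<sigma>(1) \<sigma>(2)[symmetric] x(1) z \<epsilon>] obtain v \<delta>0 where
      v0: "0 < v" "0 < \<delta>0" "\<forall>\<delta>. 0 < \<delta> \<longrightarrow> \<delta> < \<delta>0 \<longrightarrow> d (\<alpha> (x - \<delta>)) (\<sigma> z) \<le> z - \<delta> * c + \<delta>\<^sup>2 / (2 * v)"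
      unfolding c_def[symmetric] by (elim exE conjE)
    note v = v0(1,2) v0(3)[rule_format]
    \<comment> \<open>The upper bound for \<open>J\<close> that minimality provides. For
      \<open>G = 0\<close> the shifted angle would be negative and its cosine no bound, so the
      trivial bound 1 is taken; in both cases the derivative at 0 is
      \<open>c2 / x * sin G\<close>.\<close>
    define F where "F \<delta> = (if 0 < G then cos (G + c2 * ln (1 - \<delta> / x)) else 1)" for \<delta>
    have F0: "F 0 = j" using G by (auto simp: F_def)
    have F': "(F has_real_derivative c2 / x * sin G) (at 0)"
    proof (cases "0 < G")
      case True
      have "((\<lambda>\<delta>. cos (G + c2 * ln (1 - \<delta> / x))) has_real_derivative c2 / x * sin G) (at 0)"
      proof -
        have l: "((\<lambda>\<delta>. ln (1 - \<delta> / x)) has_real_derivative - (1 / x)) (at 0)"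
          using x by (auto intro!: derivative_eq_intros)
        have "((\<lambda>\<delta>. cos (G + c2 * ln (1 - \<delta> / x))) has_real_derivative - sin (G + c2 * ln (1 - 0 / x)) * (0 + c2 * (- (1 / x)))) (at 0)"
          by (intro DERIV_fun_cos DERIV_add DERIV_const DERIV_cmult l)
        then show ?thesis by (simp add: mult.commute)
      qed
      then show ?thesis using True by (simp add: F_def[abs_def])
    next
      case False
      then have "G = 0" using G by simp
      then show ?thesis by (simp add: F_def[abs_def])
    qed
    \<comment> \<open>The difference of \<open>k * C\<close> for the two bounds on the new third
      side. It is nonpositive for small positive \<open>\<delta>\<close> and 0 at 0, so its
      derivative at 0 cannot be positive.\<close>
    define p where "p \<delta> = k * C (z - \<delta> * c + \<delta>\<^sup>2 / (2 * v)) - k * C (x - \<delta>) * C y - S (x - \<delta>) * S y * F \<delta>" for \<delta>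
    have p0: "p 0 = 0" unfolding p_def using F0 Cz by (simp add: algebra_simps)
    have p': "(p has_real_derivative S z * c - S x * C y + C x * S y * j - c2 * (S x / x) * S y * sin G) (at 0)"
    proof -
      have h: "((\<lambda>\<delta>. z - \<delta> * c + \<delta>\<^sup>2 / (2 * v)) has_real_derivative - c) (at 0)"
        using v(1) by (auto intro!: derivative_eq_intros)
      have h2: "((\<lambda>\<delta>. x - \<delta>) has_real_derivative - 1) (at 0)"
        by (auto intro!: derivative_eq_intros)
      have "((\<lambda>\<delta>. k * C (z - \<delta> * c + \<delta>\<^sup>2 / (2 * v)) - k * C (x - \<delta>) * C y - S (x - \<delta>) * S y * F \<delta>) has_real_derivative
          k * (- k * S (z - 0 * c + 0\<^sup>2 / (2 * v)) * (- c)) - k * (- k * S (x - 0) * (- 1)) * C y - (C (x - 0) * (- 1) * S y * F 0 + c2 / x * sin G * (S (x - 0) * S y))) (at 0)"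
        by (intro DERIV_diff DERIV_cmult DERIV_cmult_right DERIV_mult DERIV_C DERIV_S h h2 F')
      then show ?thesis unfolding p_def[abs_def] by (simp add: F0 mult.assoc mult.commute mult.left_commute diff_diff_eq2 diff_add_eq)
    qed
    have "\<forall>\<^sub>F \<delta> in at_right 0. p \<delta> \<le> 0"
    proof -
      have "((\<lambda>\<delta>. z - \<delta> * c + \<delta>\<^sup>2 / (2 * v)) \<longlongrightarrow> z - 0 * c + 0\<^sup>2 / (2 * v)) (at_right 0)"
        using v by (intro tendsto_intros) auto
      then have 1: "\<forall>\<^sub>F \<delta> in at_right 0. z - \<delta> * c + \<delta>\<^sup>2 / (2 * v) < 2 * z"
        using z by (intro order_tendstoD) auto
      have 2: "\<forall>\<^sub>F \<delta> in at_right 0. 0 < \<delta> \<and> \<delta> < min x (min \<delta>0 \<delta>1)"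
        using x v min by (intro eventually_at_rightI[of 0 "min x (min \<delta>0 \<delta>1)"]) auto
      have "((\<lambda>\<delta>. G + c2 * ln (1 - \<delta> / x)) \<longlongrightarrow> G + c2 * ln (1 - 0 / x)) (at_right 0)"
        using x by (intro tendsto_intros) auto
      then have 3: "\<forall>\<^sub>F \<delta> in at_right 0. 0 < G \<longrightarrow> 0 < G + c2 * ln (1 - \<delta> / x)"
        by (cases "0 < G") (auto intro!: order_tendstoD)
      show ?thesis
        using 1 2 3
      proof eventually_elim
        case (elim \<delta>)
        then have \<delta>: "0 < \<delta>" "\<delta> < x" "\<delta> < \<delta>0" "\<delta> < \<delta>1" by auto
        have X': "\<alpha> (x - \<delta>) \<in> X" using geodD(2)[OF g(1)] x \<delta> by auto
        have S': "0 < S (x - \<delta>)" using geod_S_pos[OF g(1)] x \<delta> by auto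
        have jd: "-1 \<le> J \<alpha> \<beta> (x - \<delta>) y" "J \<alpha> \<beta> (x - \<delta>) y \<le> 1" using J_bounds[OF g, of "x - \<delta>" y] x \<delta> by auto
        have "J \<alpha> \<beta> (x - \<delta>) y \<le> F \<delta>"
        proof (cases "0 < G")
          case True
          have "ln ((x - \<delta>) * y) = ln (x * y) + ln (1 - \<delta> / x)"
          proof -
            have "(x - \<delta>) * y = (x * y) * (1 - \<delta> / x)" using x by (simp add: field_simps)
            moreover have "0 < 1 - \<delta> / x" using \<delta> x by simp
            ultimately show ?thesis using x by (simp add: ln_mult)
          qed
          then have "G + c2 * ln (1 - \<delta> / x) \<le> arccos (J \<alpha> \<beta> (x - \<delta>) y)"
            using min(2)[OF \<delta>(1,4)] by (simp add: G_def j_def algebra_simps)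
          then have "cos (arccos (J \<alpha> \<beta> (x - \<delta>) y)) \<le> cos (G + c2 * ln (1 - \<delta> / x))"
            using elim(3) True arccos_ubound[OF jd] by (intro cos_monotone_0_pi_le) auto
          then show ?thesis using cos_arccos[OF jd] True by (simp add: F_def)
        next
          case False
          then show ?thesis using jd by (simp add: F_def)
        qed
        moreover have "C (d (\<alpha> (x - \<delta>)) (\<beta> y)) = C (x - \<delta>) * C y + k * S (x - \<delta>) * S y * J \<alpha> \<beta> (x - \<delta>) y"
          using S' Sx by (intro J_eq) auto
        then have "k * C (d (\<alpha> (x - \<delta>)) (\<beta> y)) = k * C (x - \<delta>) * C y + S (x - \<delta>) * S y * J \<alpha> \<beta> (x - \<delta>) y"
          using k by (auto simp: algebra_simps)
        moreover have "k * C (z - \<delta> * c + \<delta>\<^sup>2 / (2 * v)) \<le> k * C (d (\<alpha> (x - \<delta>)) (\<beta> y))"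
        proof (rule kC_mono)
          show "0 \<le> d (\<alpha> (x - \<delta>)) (\<beta> y)" using d_nn X' X by auto
          show "d (\<alpha> (x - \<delta>)) (\<beta> y) \<le> z - \<delta> * c + \<delta>\<^sup>2 / (2 * v)" using v(3)[OF \<delta>(1,3)] \<sigma>(3) by simp
          show "z - \<delta> * c + \<delta>\<^sup>2 / (2 * v) \<le> pi" if "k = 1" using elim(1) geod_bnd[OF \<sigma>(1) that] by simp
        qed
        moreover have "S (x - \<delta>) * S y * J \<alpha> \<beta> (x - \<delta>) y \<le> S (x - \<delta>) * S y * F \<delta>"
          using calculation(1) S' Sx by (intro mult_left_mono) auto
        ultimately show "p \<delta> \<le> 0" unfolding p_def by linarith
      qed
    qed
    then have "S z * c - S x * C y + C x * S y * j - c2 * (S x / x) * S y * sin G \<le> 0"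
    proof -
      assume ev: "\<forall>\<^sub>F \<delta> in at_right 0. p \<delta> \<le> 0"
      show ?thesis
      proof (rule ccontr)
        assume "\<not> ?thesis"
        then have "0 < S z * c - S x * C y + C x * S y * j - c2 * (S x / x) * S y * sin G" by simp
        from DERIV_pos_inc_right[OF p' this] obtain h where h: "0 < h" "\<And>t. 0 < t \<Longrightarrow> t < h \<Longrightarrow> 0 < p t"
          using p0 by auto
        have "\<forall>\<^sub>F \<delta> in at_right 0. 0 < p \<delta>" using h by (intro eventually_at_rightI[of 0 h]) auto
        with ev have "\<forall>\<^sub>F \<delta> in at_right (0::real). False" by eventually_elim auto
        then show False by (simp add: trivial_limit_at_right_real)
      qed
    qed
    then have "S z * (c - q) \<le> c2 * (S x / x) * (S y * sin G)" using Sq by (simp add: algebra_simps)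
    also have "\<dots> \<le> c2 * (S x / x) * S z" using sinq c2 Sx x by (intro mult_left_mono) auto
    finally show ?thesis by (simp add: c_def)
  qed
  have "cos (ua (\<lambda>s. \<alpha> (x - s)) \<sigma> x z) - q \<le> c2 * (S x / x)"
  proof (rule field_le_epsilon)
    fix \<epsilon> :: real assume "0 < \<epsilon>"
    then have "S z * (cos (ua (\<lambda>s. \<alpha> (x - s)) \<sigma> x z) - \<epsilon> - q) \<le> S z * (c2 * (S x / x))" using main by (simp add: mult.commute)
    then have "cos (ua (\<lambda>s. \<alpha> (x - s)) \<sigma> x z) - \<epsilon> - q \<le> c2 * (S x / x)" using Sx(3) by (rule mult_left_le_imp_le)
    then show "cos (ua (\<lambda>s. \<alpha> (x - s)) \<sigma> x z) - q \<le> c2 * (S x / x) + \<epsilon>" by simp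
  qed
  then show ?thesis by (simp add: cq)
qed

lemma angsum_angle:
  assumes con: connected and sum: angsum
    and g: "geod X d \<alpha> T" "geod X d \<beta> U" "\<alpha> 0 = \<beta> 0" and TU: "0 < T" "0 < U"
  shows "ua \<alpha> \<beta> T U \<le> arccos (J \<alpha> \<beta> T U)"
proof (rule ccontr)
  define \<gamma>0 where "\<gamma>0 = arccos (J \<alpha> \<beta> T U)"
  define c where "c = ua \<alpha> \<beta> T U - \<gamma>0"
  assume "\<not> ?thesis"
  then have c: "0 < c" by (simp add: c_def \<gamma>0_def)
  have Jb: "-1 \<le> J \<alpha> \<beta> x y" "J \<alpha> \<beta> x y \<le> 1" if "0 < x" "x \<le> T" "0 < y" "y \<le> U" for x y
    using J_bounds[OF g that] by auto
  have \<gamma>0: "0 \<le> \<gamma>0" unfolding \<gamma>0_def using Jb TU by (intro arccos_lbound) auto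
  have "c \<le> pi" using ua_le_pi[OF g TU] \<gamma>0 by (simp add: c_def)
  then have cpi: "c / 2 < pi" "c \<le> pi" using c by auto
  define c1 where "c1 = 1 - cos (c / 2)"
  have c1: "0 < c1" using cos_monotone_0_pi[of 0 "c / 2"] c cpi by (simp add: c1_def)
  define K where "K = cosh (T + U)"
  have K: "0 < K" by (simp add: K_def)
  have SK: "S x / x \<le> K" if "0 < x" "x \<le> T + U" for x
  proof -
    have "S x \<le> x * cosh x" using that by (intro S_le) auto
    also have "\<dots> \<le> x * K" unfolding K_def using that by (intro mult_left_mono) (auto simp: cosh_real_nonneg_le_iff)
    finally show ?thesis using that by (simp add: pos_divide_le_eq mult.commute)
  qed
  \<comment> \<open>\<open>c1\<close> is the gap between cosines caused by an angle defect of
    \<open>c / 2\<close>, and \<open>K\<close> bounds \<open>S x / x\<close>; hence the tolerance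
    \<open>c2 * (S x / x)\<close> of \<open>angle_step\<close> stays below
    \<open>c1\<close>.\<close>
  define c2 where "c2 = c1 / (2 * K)"
  have c2: "0 < c2" "c2 * K < c1" using c1 K by (auto simp: c2_def)
  \<comment> \<open>On the curve \<open>x * y = m\<close> the logarithmic term alone makes
    \<open>G\<close> exceed its value at \<open>(T, U)\<close> by at least 1. So the minimum lies
    off this curve, and either side can still be shortened a little within \<open>R\<close>.\<close>
  define m where "m = T * U * exp (- ((\<gamma>0 + 1) / c2))"
  have m: "0 < m" "m \<le> T * U" using TU \<gamma>0 c2 by (auto simp: m_def mult_le_cancel_left1)
  have lnm: "c2 * ln m = c2 * ln (T * U) - (\<gamma>0 + 1)"
  proof -
    have "ln m = ln (T * U) + - ((\<gamma>0 + 1) / c2)"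
      unfolding m_def using TU by (subst ln_mult) auto
    moreover have "c2 * ((\<gamma>0 + 1) / c2) = \<gamma>0 + 1" using c2 by simp
    ultimately show ?thesis by (simp only: distrib_left mult_minus_right)
  qed
  define G where "G p = arccos (J \<alpha> \<beta> (fst p) (snd p)) - c2 * ln (fst p * snd p)" for p
  define R where "R = {p \<in> {0..T} \<times> {0..U}. m \<le> fst p * snd p}"
  have Rpos: "0 < fst p" "0 < snd p" "fst p \<le> T" "snd p \<le> U" "m \<le> fst p * snd p" if "p \<in> R" for p
  proof -
    have p: "0 \<le> fst p" "fst p \<le> T" "0 \<le> snd p" "snd p \<le> U" "m \<le> fst p * snd p" using that by (auto simp: R_def)
    then have "fst p * snd p \<noteq> 0" using m by linarith
    then show "0 < fst p" "0 < snd p" "fst p \<le> T" "snd p \<le> U" "m \<le> fst p * snd p" using p by (auto simp: less_le)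
  qed
  have "compact R"
  proof -
    have "R = ({0..T} \<times> {0..U}) \<inter> {p. m \<le> fst p * snd p}" by (auto simp: R_def)
    moreover have "closed {p :: real \<times> real. m \<le> fst p * snd p}"
      by (intro closed_Collect_le continuous_intros)
    ultimately show ?thesis by (simp add: compact_Int_closed compact_Times)
  qed
  moreover have "(T, U) \<in> R" using TU m by (auto simp: R_def)
  moreover have "continuous_on R G"
  proof -
    have "continuous_on R (\<lambda>p. d (\<alpha> (fst p)) (\<beta> (snd p)))"
    proof (rule continuous_onI)
      fix p and e :: real assume p: "p \<in> R" and e: "0 < e"
      have "dist (d (\<alpha> (fst q)) (\<beta> (snd q))) (d (\<alpha> (fst p)) (\<beta> (snd p))) \<le> e" if q: "q \<in> R" "dist q p < e / 2" for q
      proof -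
        have "\<bar>d (\<alpha> (fst q)) (\<beta> (snd q)) - d (\<alpha> (fst p)) (\<beta> (snd p))\<bar> \<le> \<bar>fst q - fst p\<bar> + \<bar>snd q - snd p\<bar>"
          using Rpos[OF p] Rpos[OF q(1)] by (intro dist_lip[OF g(1,2)]) auto
        moreover have "\<bar>fst q - fst p\<bar> \<le> dist q p" "\<bar>snd q - snd p\<bar> \<le> dist q p"
          using dist_fst_le[of q p] dist_snd_le[of q p] by (auto simp: dist_real_def)
        ultimately show ?thesis using q(2) by (simp add: dist_real_def)
      qed
      then show "\<exists>\<delta>>0. \<forall>q\<in>R. dist q p < \<delta> \<longrightarrow> dist (d (\<alpha> (fst q)) (\<beta> (snd q))) (d (\<alpha> (fst p)) (\<beta> (snd p))) \<le> e"
        using e by (intro exI[of _ "e / 2"]) auto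
    qed
    moreover have "S (fst p) * S (snd p) \<noteq> 0" if "p \<in> R" for p
      using geod_S_pos[OF g(1), of "fst p"] geod_S_pos[OF g(2), of "snd p"] Rpos[OF that] by auto
    ultimately have "continuous_on R (\<lambda>p. J \<alpha> \<beta> (fst p) (snd p))"
      unfolding J_def by (intro continuous_intros) auto
    then have "continuous_on R (\<lambda>p. arccos (J \<alpha> \<beta> (fst p) (snd p)))"
      using Jb Rpos by (intro continuous_on_arccos) auto
    moreover have "continuous_on R (\<lambda>p. ln (fst p * snd p))"
      using Rpos by (intro continuous_on_ln continuous_intros) fastforce+
    ultimately show ?thesis unfolding G_def by (intro continuous_on_diff continuous_on_mult_left)
  qed
  ultimately obtain p where p: "p \<in> R" "\<And>q. q \<in> R \<Longrightarrow> G p \<le> G q"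
    using continuous_attains_inf[of R G] by blast
  define x where "x = fst p"
  define y where "y = snd p"
  have xy: "0 < x" "x \<le> T" "0 < y" "y \<le> U" "m \<le> x * y" using Rpos[OF p(1)] by (auto simp: x_def y_def)
  define \<gamma> where "\<gamma> = arccos (J \<alpha> \<beta> x y)"
  have \<gamma>: "0 \<le> \<gamma>" unfolding \<gamma>_def using Jb xy by (intro arccos_lbound) auto
  have Gmin: "\<gamma> - c2 * ln (x * y) \<le> arccos (J \<alpha> \<beta> x' y') - c2 * ln (x' * y')" if "0 < x'" "x' \<le> T" "0 < y'" "y' \<le> U" "m \<le> x' * y'" for x' y'
    using p(2)[of "(x', y')"] that by (auto simp: G_def R_def \<gamma>_def x_def y_def)
  have G1: "\<gamma> - c2 * ln (x * y) \<le> \<gamma>0 - c2 * ln (T * U)"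
    using Gmin[OF TU(1) order_refl TU(2) order_refl m(2)] by (simp add: \<gamma>0_def)
  have "m \<noteq> x * y"
  proof
    assume "m = x * y"
    then have "\<gamma> - (c2 * ln (T * U) - (\<gamma>0 + 1)) \<le> \<gamma>0 - c2 * ln (T * U)" using G1 lnm by simp
    then show False using \<gamma> by linarith
  qed
  then have mxy: "m < x * y" using xy by simp
  have "ln (x * y) \<le> ln (T * U)" using xy TU by (intro ln_mono mult_mono mult_pos_pos) auto
  then have "c2 * ln (x * y) \<le> c2 * ln (T * U)" using c2 by (intro mult_left_mono) auto
  then have \<gamma>le: "\<gamma> \<le> \<gamma>0" using G1 by linarith
  have ga: "geod X d \<alpha> x" "geod X d \<beta> y" using g xy by (auto simp: geod_def)
  have loc: "ua \<alpha> \<beta> T U \<le> ua \<alpha> \<beta> x y" by (rule ua_local[OF g xy(1-4)])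
  have X: "\<alpha> x \<in> X" "\<beta> y \<in> X" "\<alpha> 0 \<in> X" using geodD(2)[OF g(1)] geodD(2)[OF g(2)] xy by auto
  define z where "z = d (\<alpha> x) (\<beta> y)"
  show False
  proof (cases "\<alpha> x = \<beta> y")
    case True
    \<comment> \<open>The third side has shrunk to a point. Halving \<open>\<alpha>\<close> gives a
      triangle to which \<open>angsum\<close> applies: its model angles are 0, \<open>pi\<close>, 0,
      and its upper angle at the midpoint of \<open>\<alpha>\<close> is already at least
      \<open>pi\<close>, so nothing is left for the angle at the start.\<close>
    have "x = y" using geodD(3)[OF g(1), of 0 x] geodD(3)[OF g(2), of 0 y] xy g(3) True by auto
    define h where "h = x / 2"
    have h: "0 < h" "x = h + h" using xy by (auto simp: h_def)
    define \<eta> where "\<eta> s = \<alpha> (h + s)" for s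
    have gs: "geod X d \<alpha> h" "geod X d \<eta> h"
      using geod_shift[OF g(1), of h h] geod_shift[OF g(1), of h 0] xy h unfolding \<eta>_def by auto
    have "ua \<alpha> \<beta> h y + ua (\<lambda>s. \<alpha> (h - s)) \<eta> h h + ua (\<lambda>s. \<beta> (y - s)) (\<lambda>s. \<eta> (h - s)) y h \<le> mang h y h + mang h h y + mang y h h"
      using g(3) True by (intro sum[unfolded angsum_def, rule_format] gs ga(2) h(1) xy(3)) (simp_all add: \<eta>_def h(2)[symmetric])
    moreover have "ua \<alpha> \<beta> T U \<le> ua \<alpha> \<beta> h y" using xy h by (intro ua_local[OF g]) auto
    moreover have "pi \<le> ua (\<lambda>s. \<alpha> (h - s)) \<eta> h h"
      unfolding \<eta>_def by (rule ua_opposite[OF g(1)]) (use h xy in auto)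
    moreover have "0 \<le> ua (\<lambda>s. \<beta> (y - s)) (\<lambda>s. \<eta> (h - s)) y h"
      by (rule ua_nonneg[OF geod_rev_sub[OF ga(2)] geod_rev_sub[OF gs(2)]]) (use h xy \<open>x = y\<close> True in \<open>auto simp: \<eta>_def\<close>)
    moreover have "mang h y h = 0" "mang y h h = 0" "mang h h y = pi"
    proof -
      have Sh: "0 < S h" "0 < S y" using geod_S_pos[OF gs(1)] geod_S_pos[OF ga(2)] h xy by auto
      have y: "y = h + h" using h \<open>x = y\<close> by simp
      have "k * (C h - C h * C y) = S h * S y"
      proof -
        have "C (y - h) = C y * C h + k * S y * S h" by (rule C_diff)
        then have "C h = C y * C h + k * S y * S h" using y by simp
        then have "C h - C h * C y = k * (S h * S y)" by (simp add: algebra_simps)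
        then show ?thesis by simp
      qed
      then show "mang h y h = 0" "mang y h h = 0" unfolding mang_def using Sh by (simp_all add: mult.commute)
      have "k * (C y - C h * C h) = - (S h * S h)" unfolding y C_add by (simp add: mult.assoc)
      then show "mang h h y = pi" unfolding mang_def using Sh by simp
    qed
    ultimately show False using c \<gamma>0 unfolding c_def by linarith
  next
    case False
    have z: "0 < z" using d_pos[OF X(1,2) False] by (simp add: z_def)
    obtain \<sigma> where \<sigma>: "geod X d \<sigma> z" "\<sigma> 0 = \<alpha> x" "\<sigma> z = \<beta> y"
      using con X unfolding connected_def z_def by blast
    define \<sigma>' where "\<sigma>' s = \<sigma> (z - s)" for s
    have \<sigma>': "geod X d \<sigma>' z" "\<sigma>' 0 = \<beta> y" "\<sigma>' z = \<alpha> x"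
      using geod_rev_sub[OF \<sigma>(1), of z z] z \<sigma> by (auto simp: \<sigma>'_def[abs_def])
    define \<xi> where "\<xi> = ua (\<lambda>s. \<alpha> (x - s)) \<sigma> x z"
    define \<eta> where "\<eta> = ua (\<lambda>s. \<beta> (y - s)) \<sigma>' y z"
    have "ua \<alpha> \<beta> x y + \<xi> + \<eta> \<le> mang x y z + mang x z y + mang y z x"
      using sum ga \<sigma>(1) \<sigma>(2,3)[symmetric] xy z g(3) unfolding angsum_def \<xi>_def \<eta>_def \<sigma>'_def[abs_def] by auto
    moreover have "mang x y z = \<gamma>" unfolding mang_def \<gamma>_def J_def z_def ..
    ultimately have small: "\<xi> + \<eta> + c \<le> mang x z y + mang y z x" using loc \<gamma>le unfolding c_def by linarith
    have gr: "geod X d (\<lambda>s. \<alpha> (x - s)) x" "geod X d (\<lambda>s. \<beta> (y - s)) y"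
      using geod_rev_sub[OF ga(1), of x x] geod_rev_sub[OF ga(2), of y y] xy by auto
    have nn: "0 \<le> \<xi>" "0 \<le> \<eta>" unfolding \<xi>_def \<eta>_def
      using \<sigma>(2) \<sigma>'(2) by (auto intro!: ua_nonneg gr \<sigma>(1) \<sigma>'(1) xy z)
    have Sxyz: "0 < S x" "0 < S y" "0 < S z" using geod_S_pos[OF ga(1)] geod_S_pos[OF ga(2)] geod_S_pos[OF \<sigma>(1)] xy z by auto
    have dd: "d (\<alpha> x) (\<alpha> 0) = x" "d (\<alpha> 0) (\<beta> y) = y" "d (\<beta> y) (\<alpha> 0) = y" "d (\<alpha> 0) (\<alpha> x) = x" "d (\<beta> y) (\<alpha> x) = z" "d (\<alpha> x) (\<beta> y) = z"
      using geodD(3)[OF g(1), of x 0] geodD(3)[OF g(1), of 0 x] geodD(3)[OF g(2), of 0 y] geodD(3)[OF g(2), of y 0] xy g(3) d_comm[OF X(1,2)] by (auto simp: z_def)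
    have mpi: "mang x z y \<le> pi" "mang y z x \<le> pi"
      using cosine_bounds[OF X(1,3,2)] cosine_bounds[OF X(2,3,1)] Sxyz unfolding mang_def dd by (auto intro!: arccos_ubound)
    have m1: "0 < x - m / y" "0 < y - m / x" using mxy xy by (auto simp: pos_divide_less_eq mult.commute)
    show False
    proof (cases "\<xi> + c / 2 \<le> mang x z y")
      case True
      have "c1 \<le> cos \<xi> - cos (mang x z y)" unfolding c1_def using nn c True mpi by (intro cos_gap) auto
      also have "\<dots> \<le> c2 * (S x / x)" unfolding \<xi>_def
      proof (rule angle_step[OF g xy(1-4) \<sigma> z c2(1), of "min x (x - m / y)"])
        show "0 < min x (x - m / y)" using m1 xy by simp
        fix \<delta> assume \<delta>: "0 < \<delta>" "\<delta> < min x (x - m / y)"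
        then have "m / y \<le> x - \<delta>" by simp
        then have "m \<le> (x - \<delta>) * y" using xy by (simp add: pos_divide_le_eq)
        then show "arccos (J \<alpha> \<beta> x y) - c2 * ln (x * y) \<le> arccos (J \<alpha> \<beta> (x - \<delta>) y) - c2 * ln ((x - \<delta>) * y)"
          using Gmin[of "x - \<delta>" y] \<delta> xy by (simp add: \<gamma>_def)
      qed
      also have "\<dots> \<le> c2 * K" using SK[of x] xy c2 TU by (intro mult_left_mono) auto
      finally show False using c2 by simp
    next
      case F: False
      then have T': "\<eta> + c / 2 \<le> mang y z x" using small by linarith
      have "c1 \<le> cos \<eta> - cos (mang y z x)" unfolding c1_def using nn c T' mpi by (intro cos_gap) auto
      also have "\<dots> \<le> c2 * (S y / y)" unfolding \<eta>_def
      proof (rule angle_step[OF g(2,1) g(3)[symmetric] xy(3,4,1,2) \<sigma>' z c2(1), of "min y (y - m / x)"])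
        show "0 < min y (y - m / x)" using m1 xy by simp
        fix \<delta> assume \<delta>: "0 < \<delta>" "\<delta> < min y (y - m / x)"
        then have "m / x \<le> y - \<delta>" by simp
        then have "m \<le> (y - \<delta>) * x" using xy by (simp add: pos_divide_le_eq)
        moreover have "J \<beta> \<alpha> y x = J \<alpha> \<beta> x y" "J \<beta> \<alpha> (y - \<delta>) x = J \<alpha> \<beta> x (y - \<delta>)"
          using \<delta> xy by (auto intro!: J_sym[OF g(1,2)])
        ultimately show "arccos (J \<beta> \<alpha> y x) - c2 * ln (y * x) \<le> arccos (J \<beta> \<alpha> (y - \<delta>) x) - c2 * ln ((y - \<delta>) * x)"
          using Gmin[of x "y - \<delta>"] \<delta> xy by (simp add: \<gamma>_def mult.commute)
      qed
      also have "\<dots> \<le> c2 * K" using SK[of y] xy c2 TU by (intro mult_left_mono) auto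
      finally show False using c2 by simp
    qed
  qed
qed

text \<open>If \<open>3 * a\<close> were missing from \<open>pi\<close>, then near the vertex the
  two Euclidean comparison angles together would fall short of \<open>pi\<close> by more than
  \<open>a\<close>, and their cosines would add up to at least \<open>b = 1 - cos a\<close>. By the
  triangle inequality, however, the cosines add up to at most \<open>t / u\<close>, and
  \<open>t\<close> may be chosen small compared with \<open>u\<close>.\<close>

lemma adjacent_angles:
  assumes g: "geod X d \<sigma> r" "geod X d \<beta> U" "geod X d \<beta>' V" "\<sigma> 0 = \<beta> 0" "\<sigma> 0 = \<beta>' 0" and pos: "0 < r" "0 < U" "0 < V"
    and opp: "\<And>u. 0 < u \<Longrightarrow> u \<le> U \<Longrightarrow> u \<le> V \<Longrightarrow> d (\<beta> u) (\<beta>' u) = 2 * u"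
  shows "pi \<le> ua \<sigma> \<beta> r U + ua \<sigma> \<beta>' r V"
proof (rule ccontr)
  assume neg: "\<not> ?thesis"
  define a where "a = (pi - (ua \<sigma> \<beta> r U + ua \<sigma> \<beta>' r V)) / 3"
  have a: "0 < a" using neg by (simp add: a_def)
  have "3 * a \<le> pi" using ua_nonneg[OF g(1,2,4) pos(1,2)] ua_nonneg[OF g(1,3,5) pos(1,3)] by (simp add: a_def)
  then have api: "a < pi" using a by auto
  have "ua \<sigma> \<beta> r U < ua \<sigma> \<beta> r U + a" "ua \<sigma> \<beta>' r V < ua \<sigma> \<beta>' r V + a" using a by auto
  from ua_lessD[OF g(1,2,4) pos(1,2) this(1)] ua_lessD[OF g(1,3,5) pos(1,3) this(2)]
  obtain e e' where e: "0 < e" "\<And>t u. 0 < t \<Longrightarrow> t \<le> r \<Longrightarrow> t < e \<Longrightarrow> 0 < u \<Longrightarrow> u \<le> U \<Longrightarrow> u < e \<Longrightarrow> arccos (J0 \<sigma> \<beta> t u) < ua \<sigma> \<beta> r U + a"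
    and e': "0 < e'" "\<And>t u. 0 < t \<Longrightarrow> t \<le> r \<Longrightarrow> t < e' \<Longrightarrow> 0 < u \<Longrightarrow> u \<le> V \<Longrightarrow> u < e' \<Longrightarrow> arccos (J0 \<sigma> \<beta>' t u) < ua \<sigma> \<beta>' r V + a"
    by blast
  define b where "b = 1 - cos a"
  have b: "0 < b" using cos_monotone_0_pi[of 0 a] a api by (simp add: b_def)
  define u where "u = min (min U V) (min e e') / 2"
  have u: "0 < u" "u \<le> U" "u \<le> V" "u < e" "u < e'" using pos e(1) e'(1) by (auto simp: u_def)
  define t where "t = min (min r u) (u * b / 2)"
  have t: "0 < t" "t \<le> r" "t < e" "t < e'" "t < u * b"
  proof -
    have "0 < u * b" using u b by simp
    then show "0 < t" "t < u * b" using u pos by (auto simp: t_def)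
    show "t \<le> r" "t < e" "t < e'" using u by (auto simp: t_def)
  qed
  define x where "x = d (\<sigma> t) (\<beta> u)"
  define y where "y = d (\<sigma> t) (\<beta>' u)"
  have X: "\<sigma> t \<in> X" "\<beta> u \<in> X" "\<beta>' u \<in> X" using geodD(2)[OF g(1)] geodD(2)[OF g(2)] geodD(2)[OF g(3)] t u by auto
  have xy: "2 * u \<le> x + y" using d_tri[OF X(2,1,3)] d_comm[OF X(1,2)] opp[OF u(1-3)] by (simp add: x_def y_def)
  have "(2 * u)\<^sup>2 \<le> (x + y)\<^sup>2" using xy u by (intro power_mono) auto
  moreover have "(x + y)\<^sup>2 \<le> 2 * (x\<^sup>2 + y\<^sup>2)" using zero_le_power2[of "x - y"] by (simp add: power2_eq_square algebra_simps)
  ultimately have "2 * u\<^sup>2 \<le> x\<^sup>2 + y\<^sup>2" by (simp add: power2_eq_square)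
  then have "(t\<^sup>2 + u\<^sup>2 - x\<^sup>2) + (t\<^sup>2 + u\<^sup>2 - y\<^sup>2) \<le> 2 * t\<^sup>2" by simp
  then have "((t\<^sup>2 + u\<^sup>2 - x\<^sup>2) + (t\<^sup>2 + u\<^sup>2 - y\<^sup>2)) / (2 * t * u) \<le> 2 * t\<^sup>2 / (2 * t * u)"
    using t u by (intro divide_right_mono) auto
  also have "\<dots> = t / u" using t by (simp add: power2_eq_square)
  also have "\<dots> < b" using t u by (simp add: pos_divide_less_eq mult.commute)
  finally have sum: "J0 \<sigma> \<beta> t u + J0 \<sigma> \<beta>' t u < b"
    unfolding J0_def x_def y_def by (simp only: add_divide_distrib)
  define p where "p = arccos (J0 \<sigma> \<beta> t u)"
  define p' where "p' = arccos (J0 \<sigma> \<beta>' t u)"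
  have jb: "-1 \<le> J0 \<sigma> \<beta> t u" "J0 \<sigma> \<beta> t u \<le> 1" "-1 \<le> J0 \<sigma> \<beta>' t u" "J0 \<sigma> \<beta>' t u \<le> 1"
    using J0_bounds[OF g(1,2,4)] J0_bounds[OF g(1,3,5)] t u by auto
  have p: "0 \<le> p" "p' \<le> pi" "0 \<le> p'" "cos p = J0 \<sigma> \<beta> t u" "cos p' = J0 \<sigma> \<beta>' t u"
    unfolding p_def p'_def using jb by (auto intro: arccos_lbound arccos_ubound)
  have "p < ua \<sigma> \<beta> r U + a" "p' < ua \<sigma> \<beta>' r V + a"
    unfolding p_def p'_def using t u by (auto intro!: e e')
  moreover have "3 * a = pi - (ua \<sigma> \<beta> r U + ua \<sigma> \<beta>' r V)" by (simp add: a_def)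
  ultimately have "p + a \<le> pi - p'" by linarith
  then have "1 - cos a \<le> cos p - cos (pi - p')" using p a by (intro cos_gap) auto
  then show False using sum p by (simp add: b_def)
qed

text \<open>The comparison angles at \<open>\<gamma> s\<close> towards the two ends of
  \<open>\<gamma>\<close> sum to at least \<open>pi\<close>, so their cosines have a sum of at most
  0; the expression in \<open>CAT\<close> is this sum times a nonpositive factor. If
  \<open>s\<close> is an endpoint or \<open>D\<close> one of the three points of
  \<open>\<gamma>\<close>, no angles are available, but the expression is 0.\<close>

lemma angle_CAT:
  assumes con: connected
    and ang: "\<And>\<alpha> \<beta> T U. geod X d \<alpha> T \<Longrightarrow> geod X d \<beta> U \<Longrightarrow> \<alpha> 0 = \<beta> 0 \<Longrightarrow> 0 < T \<Longrightarrow> 0 < U \<Longrightarrow> \<alpha> T \<noteq> \<beta> U \<Longrightarrow> ua \<alpha> \<beta> T U \<le> arccos (J \<alpha> \<beta> T U)"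
  shows CAT
  unfolding CAT_def
proof (intro ballI allI impI)
  fix D \<gamma> l s assume D: "D \<in> X" and g: "geod X d \<gamma> l" and s: "0 \<le> s" "s \<le> l"
  have X: "\<gamma> 0 \<in> X" "\<gamma> s \<in> X" "\<gamma> l \<in> X" using geodD(2)[OF g] s by auto
  show "0 \<le> k * (S l * C (d D (\<gamma> s)) - S (l - s) * C (d D (\<gamma> 0)) - S s * C (d D (\<gamma> l)))"
  proof (cases "s = 0 \<or> s = l \<or> D = \<gamma> 0 \<or> D = \<gamma> l \<or> D = \<gamma> s")
    case True
    have eq: "S l * C s - S s * C l = S (l - s)" by (simp add: S_diff)
    have eq2: "S l * C (l - s) - S (l - s) * C l = S s" using S_diff[of l "l - s"] by (simp add: mult.commute)
    have dd: "d (\<gamma> u) (\<gamma> v) = \<bar>u - v\<bar>" if "0 \<le> u" "u \<le> l" "0 \<le> v" "v \<le> l" for u v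
      by (rule geodD(3)[OF g that])
    have d0: "d (\<gamma> 0) (\<gamma> s) = s" "d (\<gamma> 0) (\<gamma> l) = l" "d (\<gamma> l) (\<gamma> s) = l - s" "d (\<gamma> l) (\<gamma> 0) = l" "d (\<gamma> s) (\<gamma> 0) = s" "d (\<gamma> s) (\<gamma> l) = l - s"
      using s by (simp_all add: dd)
    consider "s = 0" | "s = l" | "D = \<gamma> 0" | "D = \<gamma> l" | "D = \<gamma> s" using True by blast
    then show ?thesis
    proof cases
      case 3
      have "S l * C s - S (l - s) * 1 - S s * C l = 0" using eq by simp
      then show ?thesis unfolding 3 d0 using X by simp
    next
      case 4
      have "S l * C (l - s) - S (l - s) * C l - S s * 1 = 0" using eq2 by simp
      then show ?thesis unfolding 4 d0 using X by simp
    next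
      case 5
      have "S l = S (l - s) * C s + C (l - s) * S s" using S_add[of "l - s" s] by simp
      then have "S l * 1 - S (l - s) * C s - S s * C (l - s) = 0" by (simp add: mult.commute)
      then show ?thesis unfolding 5 d0 using X by simp
    next
      case 1
      then show ?thesis by simp
    next
      case 2
      then show ?thesis by simp
    qed
  next
    case False
    then have s': "0 < s" "s < l" using s by auto
    define r where "r = d (\<gamma> s) D"
    have r: "0 < r" using d_pos[OF X(2) D] False by (auto simp: r_def)
    obtain \<sigma> where \<sigma>: "geod X d \<sigma> r" "\<sigma> 0 = \<gamma> s" "\<sigma> r = D"
      using con X D unfolding connected_def r_def by blast
    define \<beta> where "\<beta> u = \<gamma> (s + u)" for u
    define \<beta>' where "\<beta>' u = \<gamma> (s - u)" for u
    have gb: "geod X d \<beta> (l - s)" "geod X d \<beta>' s" "\<sigma> 0 = \<beta> 0" "\<sigma> 0 = \<beta>' 0"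
      using geod_shift[OF g, of "l - s" s] geod_rev_sub[OF g, of s s] s unfolding \<beta>_def \<beta>'_def by (auto simp: \<sigma>(2))
    have "pi \<le> ua \<sigma> \<beta> r (l - s) + ua \<sigma> \<beta>' r s"
    proof (rule adjacent_angles[OF \<sigma>(1) gb r])
      show "d (\<beta> u) (\<beta>' u) = 2 * u" if "0 < u" "u \<le> l - s" "u \<le> s" for u
        unfolding \<beta>_def \<beta>'_def using geodD(3)[OF g, of "s + u" "s - u"] that s by auto
    qed (use s' in auto)
    also have "\<dots> \<le> arccos (J \<sigma> \<beta> r (l - s)) + arccos (J \<sigma> \<beta>' r s)"
    proof (intro add_mono)
      show "ua \<sigma> \<beta> r (l - s) \<le> arccos (J \<sigma> \<beta> r (l - s))"
        using False by (intro ang \<sigma>(1) gb r) (auto simp: \<sigma>(3) \<beta>_def s')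
      show "ua \<sigma> \<beta>' r s \<le> arccos (J \<sigma> \<beta>' r s)"
        using False by (intro ang \<sigma>(1) gb r) (auto simp: \<sigma>(3) \<beta>'_def s')
    qed
    finally have sum: "pi \<le> arccos (J \<sigma> \<beta> r (l - s)) + arccos (J \<sigma> \<beta>' r s)" .
    have jb: "-1 \<le> J \<sigma> \<beta> r (l - s)" "J \<sigma> \<beta> r (l - s) \<le> 1" "-1 \<le> J \<sigma> \<beta>' r s" "J \<sigma> \<beta>' r s \<le> 1"
      using J_bounds[OF \<sigma>(1) gb(1,3) r order_refl _ order_refl] J_bounds[OF \<sigma>(1) gb(2,4) r order_refl _ order_refl] s' by auto
    have "cos (arccos (J \<sigma> \<beta> r (l - s))) \<le> cos (pi - arccos (J \<sigma> \<beta>' r s))"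
      using sum arccos_ubound[OF jb(1,2)] arccos_ubound[OF jb(3,4)] by (intro cos_monotone_0_pi_le) auto
    then have JJ: "J \<sigma> \<beta> r (l - s) + J \<sigma> \<beta>' r s \<le> 0" using jb by simp
    have Sp: "0 < S r" "0 < S (l - s)" "0 < S s" using geod_S_pos[OF \<sigma>(1)] geod_S_pos[OF gb(1)] geod_S_pos[OF gb(2)] r s' by auto
    have e: "C (d D (\<gamma> l)) = C r * C (l - s) + k * S r * S (l - s) * J \<sigma> \<beta> r (l - s)" "C (d D (\<gamma> 0)) = C r * C s + k * S r * S s * J \<sigma> \<beta>' r s"
      using J_eq[of r "l - s" \<sigma> \<beta>] J_eq[of r s \<sigma> \<beta>'] Sp unfolding \<sigma>(3) by (auto simp: \<beta>_def \<beta>'_def)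
    have dr: "d D (\<gamma> s) = r" using d_comm[OF D X(2)] by (simp add: r_def)
    have Sl: "S l = S (l - s) * C s + C (l - s) * S s" using S_add[of "l - s" s] by simp
    have "k * (S l * C (d D (\<gamma> s)) - S (l - s) * C (d D (\<gamma> 0)) - S s * C (d D (\<gamma> l)))
       = - (S r * S s * S (l - s)) * (J \<sigma> \<beta> r (l - s) + J \<sigma> \<beta>' r s)"
      unfolding e dr Sl by (simp add: algebra_simps)
    moreover have "0 \<le> S r * S s * S (l - s)" using Sp by simp
    ultimately show ?thesis using JJ by (simp add: mult_nonneg_nonpos)
  qed
qed

end

section \<open>The model plane as a quadric in three-dimensional space\<close>

definition form :: "real \<Rightarrow> real \<times> real \<times> real \<Rightarrow> real \<times> real \<times> real \<Rightarrow> real" where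
  "form k x y = fst x * fst y + k * (fst (snd x) * fst (snd y) + snd (snd x) * snd (snd y))"

lemma form_sym: "form k x y = form k y x"
  by (simp add: form_def mult.commute)

lemma form_linear:
  "form k (x + y) z = form k x z + form k y z" "form k z (x + y) = form k z x + form k z y"
  "form k (x - y) z = form k x z - form k y z" "form k z (x - y) = form k z x - form k z y"
  "form k (r *\<^sub>R x) z = r * form k x z" "form k z (r *\<^sub>R x) = r * form k z x"
  by (simp_all add: form_def algebra_simps)

text \<open>Let \<open>\<phi>\<close> and \<open>\<psi>\<close> in \<open>[0, pi]\<close> be the
  polar angles of \<open>(p1, p2)\<close> and \<open>(q1, q2)\<close>. The last hypothesis says
  \<open>a * b * sin (\<phi> + \<psi>) < 0\<close>; so \<open>\<phi> + \<psi>\<close> exceeds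
  \<open>pi\<close> and \<open>cos \<phi> \<le> - cos \<psi>\<close>. The proof squares instead of
  using angles, and the case distinction provides the signs for this.\<close>

lemma opposite_sector:
  fixes p1 p2 q1 q2 a b :: real
  assumes nn: "0 \<le> p2" "0 \<le> q2" "0 \<le> a" "0 \<le> b" and sq: "p1\<^sup>2 + p2\<^sup>2 = a\<^sup>2" "q1\<^sup>2 + q2\<^sup>2 = b\<^sup>2"
    and neg: "q2 * p1 + p2 * q1 < 0"
  shows "p1 * b \<le> - (q1 * a)"
proof -
  have key: "x1 * b \<le> - y1 * a" if "0 < x1" "y1 \<le> 0" "0 \<le> x2" "0 \<le> y2" "0 \<le> a" "0 \<le> b" "x1\<^sup>2 + x2\<^sup>2 = a\<^sup>2" "y1\<^sup>2 + y2\<^sup>2 = b\<^sup>2" "y2 * x1 \<le> - (x2 * y1)"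
    for x1 x2 y1 y2 a b :: real
  proof -
    have "y2 * x1 \<le> x2 * (- y1)" "0 \<le> y2 * x1" using that(1,4,9) by simp_all
    then have "(y2 * x1)\<^sup>2 \<le> (x2 * (- y1))\<^sup>2" by (rule power_mono)
    then have "y2\<^sup>2 * x1\<^sup>2 \<le> x2\<^sup>2 * y1\<^sup>2" by (simp add: power_mult_distrib)
    moreover have "(x1 * b)\<^sup>2 = x1\<^sup>2 * y1\<^sup>2 + y2\<^sup>2 * x1\<^sup>2" "(- y1 * a)\<^sup>2 = x1\<^sup>2 * y1\<^sup>2 + x2\<^sup>2 * y1\<^sup>2"
      unfolding power_mult_distrib that(7,8)[symmetric] by (simp_all add: algebra_simps)
    ultimately have "(x1 * b)\<^sup>2 \<le> (- y1 * a)\<^sup>2" by linarith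
    then show ?thesis by (rule power2_le_imp_le) (use that(2,5) in \<open>simp add: mult_nonpos_nonneg\<close>)
  qed
  show ?thesis
  proof (cases "p1 \<le> 0")
    case p: True
    show ?thesis
    proof (cases "q1 \<le> 0")
      case True
      then have "p1 * b \<le> 0" "q1 * a \<le> 0" using nn p by (auto intro: mult_nonpos_nonneg)
      then show ?thesis by linarith
    next
      case False
      have "q1 * a \<le> - p1 * b" by (rule key[of q1 p1 q2 p2 b a]) (use nn sq neg p False in auto)
      then show ?thesis by simp
    qed
  next
    case p: False
    show ?thesis
    proof (cases "q1 \<le> 0")
      case True
      have "p1 * b \<le> - q1 * a" by (rule key[of p1 q1 p2 q2 a b]) (use nn sq neg p True in auto)
      then show ?thesis by simp
    next
      case False
      then have "0 \<le> q2 * p1" "0 \<le> p2 * q1" using nn p by auto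
      then show ?thesis using neg by linarith
    qed
  qed
qed

context curv
begin

text \<open>For \<open>k = 1\<close> the scalar product, with the unit sphere as model plane; for
  \<open>k = -1\<close> a Lorentz form, with a sheet of the hyperboloid. On points of the model
  plane the form is \<open>C\<close> of their distance.\<close>

abbreviation F :: "real \<times> real \<times> real \<Rightarrow> real \<times> real \<times> real \<Rightarrow> real" where "F \<equiv> form k"

text \<open>The left-hand side is the Gram determinant of \<open>v\<close>, \<open>x\<close>,
  \<open>y\<close>. The form itself has determinant \<open>k\<^sup>2 = 1\<close>, so the Gram
  determinant is the square of the ordinary determinant for both signs.\<close>

lemma form_gram:
  "F v v * (F x x * F y y - (F x y)\<^sup>2) - F v x * (F v x * F y y - F x y * F v y) + F v y * (F v x * F x y - F x x * F v y)
   = (fst v * (fst (snd x) * snd (snd y) - snd (snd x) * fst (snd y))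
     - fst (snd v) * (fst x * snd (snd y) - snd (snd x) * fst y)
     + snd (snd v) * (fst x * fst (snd y) - fst (snd x) * fst y))\<^sup>2"
  using k unfolding form_def power2_eq_square by (auto simp: algebra_simps)

lemma form_Cauchy_Schwarz:
  assumes "F v v = 1" "F v x = 0" "F v y = 0"
  shows "(F x y)\<^sup>2 \<le> F x x * F y y"
proof -
  have "0 \<le> F v v * (F x x * F y y - (F x y)\<^sup>2) - F v x * (F v x * F y y - F x y * F v y) + F v y * (F v x * F x y - F x x * F v y)"
    unfolding form_gram by simp
  then show ?thesis unfolding assms by simp
qed

text \<open>Cauchy--Schwarz for the tangent vector from \<open>v1\<close> towards \<open>v2\<close> and the parallel
  transport, along the segment from \<open>v4\<close> to \<open>v1\<close>, of the one from \<open>v4\<close> towards \<open>v3\<close>.\<close>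

lemma model_inequality:
  assumes u: "F v1 v1 = 1" "F v2 v2 = 1" "F v3 v3 = 1" "F v4 v4 = 1"
  shows "((F v2 v3 + F v1 v2 * F v3 v4) * (1 + F v1 v4) - (F v1 v2 + F v2 v4) * (F v3 v4 + F v1 v3))\<^sup>2
    \<le> (1 - (F v1 v2)\<^sup>2) * (1 - (F v3 v4)\<^sup>2) * (1 + F v1 v4)\<^sup>2"
proof -
  define x where "x = v2 - F v1 v2 *\<^sub>R v1"
  define w where "w = v3 - F v3 v4 *\<^sub>R v4"
  define b where "b = F v1 v3 - F v3 v4 * F v1 v4"
  \<comment> \<open>Parallel transport from \<open>v4\<close> to \<open>v1\<close> subtracts from
    \<open>w\<close> the multiple \<open>b / (1 + F v1 v4)\<close> of \<open>v1 + v4\<close>;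
    \<open>y\<close> is the result multiplied by the denominator.\<close>
  define y where "y = (1 + F v1 v4) *\<^sub>R w - b *\<^sub>R (v1 + v4)"
  have s: "F v2 v1 = F v1 v2" "F v3 v1 = F v1 v3" "F v4 v1 = F v1 v4" "F v3 v2 = F v2 v3" "F v4 v2 = F v2 v4" "F v4 v3 = F v3 v4"
    by (simp_all add: form_sym)
  have w: "F v1 w = b" "F v4 w = 0" "F w w = 1 - (F v3 v4)\<^sup>2" "F v2 w = F v2 v3 - F v3 v4 * F v2 v4"
    unfolding w_def b_def by (simp_all add: form_linear u s power2_eq_square algebra_simps)
  then have ws: "F w v1 = b" "F w v4 = 0" "F w v2 = F v2 v3 - F v3 v4 * F v2 v4" by (simp_all add: form_sym)
  have "F v1 x = 0" "F x x = 1 - (F v1 v2)\<^sup>2"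
    unfolding x_def by (simp_all add: form_linear u s power2_eq_square algebra_simps)
  moreover have "F v1 y = 0" "F y y = (1 - (F v3 v4)\<^sup>2) * (1 + F v1 v4)\<^sup>2"
    unfolding y_def by (simp_all add: form_linear u s w ws power2_eq_square algebra_simps)
  moreover have "F x y = (F v2 v3 + F v1 v2 * F v3 v4) * (1 + F v1 v4) - (F v1 v2 + F v2 v4) * (F v3 v4 + F v1 v3)"
    unfolding y_def x_def by (simp add: form_linear u s w ws b_def algebra_simps)
  ultimately show ?thesis using form_Cauchy_Schwarz[of v1 x y] u by (simp add: mult.assoc)
qed

end

section \<open>Gluing comparison triangles along a diagonal\<close>

context mspace
begin

text \<open>\<open>A\<close> is placed at the origin of the model plane and \<open>B\<close> in the
  first direction: \<open>p1\<close> and \<open>p2\<close> are \<open>S (d A P)\<close> times the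
  cosine and the sine of the comparison angle at \<open>A\<close>, and
  \<open>(C (d A P), p1, p2)\<close> represents \<open>P\<close>. The triangle inequality provides
  \<open>\<bar>p1\<bar> \<le> S (d A P)\<close>, so that a real \<open>p2\<close> exists.\<close>

lemma triangle_coordinates:
  assumes X: "A \<in> X" "B \<in> X" "P \<in> X" and ne: "A \<noteq> B"
  shows "\<exists>p1 p2. 0 \<le> p2 \<and> p1\<^sup>2 + p2\<^sup>2 = (S (d A P))\<^sup>2 \<and> C (d B P) = C (d A B) * C (d A P) + k * S (d A B) * p1"
proof -
  have dp: "0 < d A B" using d_pos X ne by auto
  have sp: "0 < S (d A B)" using dp bnd[of A B] X by (intro S_pos) (auto intro: order_le_less_trans[of _ "pi/2"])
  define p1 where "p1 = k * (C (d B P) - C (d A B) * C (d A P)) / S (d A B)"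
  have eq: "C (d B P) = C (d A B) * C (d A P) + k * S (d A B) * p1"
    unfolding p1_def using sp by simp
  have "\<bar>p1\<bar> \<le> S (d A P)"
  proof (cases "A = P")
    case True
    then show ?thesis unfolding p1_def using X d_comm[of A B] by simp
  next
    case False
    have sq: "0 < S (d A P)" using d_pos[of A P] False bnd[of A P] X by (intro S_pos) (auto intro: order_le_less_trans[of _ "pi/2"])
    have "p1 / S (d A P) = k * (C (d B P) - C (d A B) * C (d A P)) / (S (d A B) * S (d A P))" by (simp add: p1_def)
    then have "-1 \<le> p1 / S (d A P)" "p1 / S (d A P) \<le> 1" using cosine_bounds[OF X sp sq] by auto
    then show ?thesis using sq by (simp add: pos_le_divide_eq pos_divide_le_eq abs_le_iff)
  qed
  then have "p1\<^sup>2 \<le> (S (d A P))\<^sup>2" using abs_le_square_iff[of p1 "S (d A P)"] by simp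
  then show ?thesis using eq by (intro exI[of _ p1] exI[of _ "sqrt ((S (d A P))\<^sup>2 - p1\<^sup>2)"]) auto
qed

text \<open>\<open>A, B, P, Q\<close> are represented in the model plane so that the diagonal \<open>AB\<close> and the
  opposite sides \<open>AP\<close> and \<open>BQ\<close> keep their lengths, the diagonal \<open>PQ\<close> does not get shorter,
  and of the remaining sides \<open>BP\<close> and \<open>AQ\<close> at most one changes, and does not get longer.\<close>

definition glued :: "'a \<Rightarrow> 'a \<Rightarrow> 'a \<Rightarrow> 'a \<Rightarrow> bool" where
  "glued A B P Q \<longleftrightarrow> (\<exists>vA vB vP vQ. F vA vA = 1 \<and> F vB vB = 1 \<and> F vP vP = 1 \<and> F vQ vQ = 1 \<and>
     F vA vB = C (d A B) \<and> F vA vP = C (d A P) \<and> F vB vQ = C (d B Q) \<and> k * F vP vQ \<le> k * C (d P Q) \<and>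
     k * C (d B P) \<le> k * F vB vP \<and> k * C (d A Q) \<le> k * F vA vQ \<and>
     (F vB vP = C (d B P) \<or> F vA vQ = C (d A Q)) \<and> 0 \<le> 1 + F vB vP \<and> 0 \<le> 1 + F vA vQ)"

lemma glued_swap:
  assumes X: "A \<in> X" "B \<in> X" "P \<in> X" "Q \<in> X" and gl: "glued B A Q P"
  shows "glued A B P Q"
proof -
  from gl[unfolded glued_def] obtain vA vB vP vQ where "F vB vB = 1 \<and> F vA vA = 1 \<and> F vQ vQ = 1 \<and> F vP vP = 1 \<and>
     F vB vA = C (d B A) \<and> F vB vQ = C (d B Q) \<and> F vA vP = C (d A P) \<and> k * F vQ vP \<le> k * C (d Q P) \<and>
     k * C (d A Q) \<le> k * F vA vQ \<and> k * C (d B P) \<le> k * F vB vP \<and>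
     (F vA vQ = C (d A Q) \<or> F vB vP = C (d B P)) \<and> 0 \<le> 1 + F vA vQ \<and> 0 \<le> 1 + F vB vP"
    by (elim exE)
  then show ?thesis unfolding glued_def
    by (intro exI[of _ vA] exI[of _ vB] exI[of _ vP] exI[of _ vQ]) (auto simp: form_sym[of k vB vA] form_sym[of k vQ vP] d_comm[OF X(2,1)] d_comm[OF X(4,3)])
qed

lemma unit_vector:
  assumes "p1\<^sup>2 + p2\<^sup>2 = (S x)\<^sup>2"
  shows "F (C x, p1, p2) (C x, p1, p2) = 1" "F (C x, p1, - p2) (C x, p1, - p2) = 1"
proof -
  have "(C x)\<^sup>2 + k * (p1\<^sup>2 + p2\<^sup>2) = 1" unfolding assms C_sq by simp
  then show "F (C x, p1, p2) (C x, p1, p2) = 1" "F (C x, p1, - p2) (C x, p1, - p2) = 1"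
    by (simp_all add: form_def power2_eq_square)
qed

lemma unit_vector': "F (1, 0, 0) (1, 0, 0) = 1" "F (C x, S x, 0) (C x, S x, 0) = 1"
  using C_sq[of x] by (simp_all add: form_def power2_eq_square mult.assoc)

text \<open>Both comparison triangles over \<open>A B\<close> are kept unchanged, on opposite sides
  of \<open>A B\<close>; hence the sign of \<open>q2\<close>. All five lengths are exact, and only
  the condition on the diagonal \<open>P Q\<close> remains as a hypothesis.\<close>

lemma glued_exact:
  assumes X: "A \<in> X" "B \<in> X" "P \<in> X" "Q \<in> X"
    and p: "p1\<^sup>2 + p2\<^sup>2 = (S (d A P))\<^sup>2" "C (d B P) = C (d A B) * C (d A P) + k * S (d A B) * p1"
    and q: "q1\<^sup>2 + q2\<^sup>2 = (S (d A Q))\<^sup>2" "C (d B Q) = C (d A B) * C (d A Q) + k * S (d A B) * q1"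
    and pq: "k * (C (d A P) * C (d A Q) + k * (p1 * q1 - p2 * q2)) \<le> k * C (d P Q)"
  shows "glued A B P Q"
  unfolding glued_def
proof (rule exI[of _ "(1, 0, 0)"], rule exI[of _ "(C (d A B), S (d A B), 0)"], rule exI[of _ "(C (d A P), p1, p2)"],
    rule exI[of _ "(C (d A Q), q1, - q2)"], intro conjI unit_vector'(1) unit_vector'(2)[of "d A B"] unit_vector(1)[OF p(1)] unit_vector(2)[OF q(1)])
  have e: "F (C (d A B), S (d A B), 0) (C (d A P), p1, p2) = C (d B P)" "F (1, 0, 0) (C (d A Q), q1, - q2) = C (d A Q)"
    unfolding p(2) by (simp_all add: form_def)
  show "k * C (d B P) \<le> k * F (C (d A B), S (d A B), 0) (C (d A P), p1, p2)" "k * C (d A Q) \<le> k * F (1, 0, 0) (C (d A Q), q1, - q2)"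
    "F (C (d A B), S (d A B), 0) (C (d A P), p1, p2) = C (d B P) \<or> F (1, 0, 0) (C (d A Q), q1, - q2) = C (d A Q)"
    "0 \<le> 1 + F (C (d A B), S (d A B), 0) (C (d A P), p1, p2)" "0 \<le> 1 + F (1, 0, 0) (C (d A Q), q1, - q2)"
    unfolding e using Cd_nn X by auto
  show "F (1, 0, 0) (C (d A B), S (d A B), 0) = C (d A B)" "F (1, 0, 0) (C (d A P), p1, p2) = C (d A P)" by (simp_all add: form_def)
  show "F (C (d A B), S (d A B), 0) (C (d A Q), q1, - q2) = C (d B Q)" unfolding q(2) by (simp add: form_def)
  show "k * F (C (d A P), p1, p2) (C (d A Q), q1, - q2) \<le> k * C (d P Q)" using pq by (simp add: form_def)
qed

lemma C_triangle:
  assumes X: "A \<in> X" "P \<in> X" "Q \<in> X"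
  shows "k * C (d A P + d A Q) \<le> k * C (d P Q)"
  using d_tri[of P A Q] d_comm[of A P] bnd[of A P] bnd[of A Q] d_nn[of P Q] X by (intro kC_mono) auto

text \<open>The angles at \<open>A\<close> add up to at least \<open>pi\<close>, and gluing the
  unchanged triangles could make \<open>P Q\<close> too short. Instead \<open>P\<close> is turned
  about \<open>A\<close> onto the prolongation of \<open>Q A\<close> beyond \<open>A\<close>: then
  \<open>P Q\<close> gets the length \<open>d A P + d A Q\<close>, which is large enough, and only
  \<open>B P\<close> changes, not getting longer.\<close>

lemma glued_obtuse:
  assumes X: "A \<in> X" "B \<in> X" "P \<in> X" "Q \<in> X" and pos: "0 < S (d A Q)"
    and p: "C (d B P) = C (d A B) * C (d A P) + k * S (d A B) * p1"
    and q: "q1\<^sup>2 + q2\<^sup>2 = (S (d A Q))\<^sup>2" "C (d B Q) = C (d A B) * C (d A Q) + k * S (d A B) * q1"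
    and obt: "p1 * S (d A Q) \<le> - (q1 * S (d A P))"
  shows "glued A B P Q"
proof -
  define m where "m = S (d A P) / S (d A Q)"
  have m: "m * S (d A Q) = S (d A P)" "0 \<le> m" using pos Sd_nn X by (auto simp: m_def)
  \<comment> \<open>\<open>(r1, r2)\<close> is the negative of \<open>(q1, - q2)\<close>, rescaled
    to the length \<open>S (d A P)\<close>.\<close>
  define r1 where "r1 = - q1 * m"
  define r2 where "r2 = q2 * m"
  have r: "r1\<^sup>2 + r2\<^sup>2 = (S (d A P))\<^sup>2"
  proof -
    have "r1\<^sup>2 + r2\<^sup>2 = (q1\<^sup>2 + q2\<^sup>2) * m\<^sup>2" by (simp add: r1_def r2_def power_mult_distrib algebra_simps)
    also have "\<dots> = (m * S (d A Q))\<^sup>2" unfolding q by (simp add: power_mult_distrib)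
    finally show ?thesis unfolding m .
  qed
  have pr: "p1 \<le> r1"
  proof -
    have "p1 * S (d A Q) \<le> r1 * S (d A Q)" using obt m by (simp add: r1_def mult.assoc)
    then show ?thesis using pos by simp
  qed
  have s: "0 \<le> S (d A B)" using Sd_nn X by auto
  have le: "k * C (d B P) \<le> k * (C (d A B) * C (d A P) + k * S (d A B) * r1)"
    unfolding p using mult_left_mono[OF pr s] by (simp add: distrib_left mult.assoc)
  have rb: "r1 \<le> S (d A P)"
  proof (rule power2_le_imp_le)
    show "r1\<^sup>2 \<le> (S (d A P))\<^sup>2" using r zero_le_power2[of r2] by linarith
    show "0 \<le> S (d A P)" using Sd_nn X by auto
  qed
  \<comment> \<open>For \<open>k = 1\<close> the cosine of the changed side can only grow. For
    \<open>k = -1\<close> it may fall, but not below \<open>C\<close> of the difference of the two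
    other sides.\<close>
  have nn: "0 \<le> 1 + (C (d A B) * C (d A P) + k * S (d A B) * r1)"
    using k
  proof (rule disjE)
    assume k1: "k = 1"
    then show ?thesis using le Cd_nn[OF X(2,3)] by simp
  next
    assume k1: "k = -1"
    have "S (d A B) * r1 \<le> S (d A B) * S (d A P)" by (rule mult_left_mono[OF rb s])
    then have "C (d A B - d A P) \<le> C (d A B) * C (d A P) + k * S (d A B) * r1" unfolding C_diff using k1 by simp
    moreover have "0 < C (d A B - d A P)" using k1 by (intro C_pos) auto
    ultimately show ?thesis by linarith
  qed
  show ?thesis
    unfolding glued_def
  proof (rule exI[of _ "(1, 0, 0)"], rule exI[of _ "(C (d A B), S (d A B), 0)"], rule exI[of _ "(C (d A P), r1, r2)"],
      rule exI[of _ "(C (d A Q), q1, - q2)"], intro conjI unit_vector'(1) unit_vector'(2)[of "d A B"] unit_vector(1)[OF r] unit_vector(2)[OF q(1)])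
    have e: "F (C (d A B), S (d A B), 0) (C (d A P), r1, r2) = C (d A B) * C (d A P) + k * S (d A B) * r1" "F (1, 0, 0) (C (d A Q), q1, - q2) = C (d A Q)"
      by (simp_all add: form_def)
    show "k * C (d B P) \<le> k * F (C (d A B), S (d A B), 0) (C (d A P), r1, r2)" "k * C (d A Q) \<le> k * F (1, 0, 0) (C (d A Q), q1, - q2)"
      "F (C (d A B), S (d A B), 0) (C (d A P), r1, r2) = C (d B P) \<or> F (1, 0, 0) (C (d A Q), q1, - q2) = C (d A Q)"
      "0 \<le> 1 + F (C (d A B), S (d A B), 0) (C (d A P), r1, r2)" "0 \<le> 1 + F (1, 0, 0) (C (d A Q), q1, - q2)"
      unfolding e using Cd_nn[OF X(1,4)] le nn by auto
    show "F (1, 0, 0) (C (d A B), S (d A B), 0) = C (d A B)" "F (1, 0, 0) (C (d A P), r1, r2) = C (d A P)" by (simp_all add: form_def)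
    show "F (C (d A B), S (d A B), 0) (C (d A Q), q1, - q2) = C (d B Q)" unfolding q(2) by (simp add: form_def)
    have "F (C (d A P), r1, r2) (C (d A Q), q1, - q2) = C (d A P) * C (d A Q) - k * m * (q1\<^sup>2 + q2\<^sup>2)"
      by (simp add: form_def r1_def r2_def power2_eq_square algebra_simps)
    also have "\<dots> = C (d A P) * C (d A Q) - k * (m * S (d A Q)) * S (d A Q)" unfolding q by (simp add: power2_eq_square)
    also have "\<dots> = C (d A P + d A Q)" unfolding m C_add ..
    finally show "k * F (C (d A P), r1, r2) (C (d A Q), q1, - q2) \<le> k * C (d P Q)" using C_triangle[OF X(1,3,4)] by simp
  qed
qed

text \<open>In the model plane the segment \<open>P Q\<close> crosses \<open>A B\<close> at
  parameter \<open>x\<close>: \<open>line\<close> says that the directions from there to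
  \<open>P\<close> and to \<open>Q\<close> are parallel, and \<open>opp\<close>, with the signs of
  \<open>p2\<close> and \<open>q2\<close>, that they are opposite. The concavity inequality bounds
  the distances of \<open>P\<close> and \<open>Q\<close> from \<open>\<gamma> x\<close> by those in
  the model, and the triangle inequality through \<open>\<gamma> x\<close> yields the claim.\<close>

lemma CAT_crossing:
  assumes cat: CAT and con: connected and X: "A \<in> X" "B \<in> X" "P \<in> X" "Q \<in> X" and pos: "0 < S (d A B)"
    and p: "p1\<^sup>2 + p2\<^sup>2 = (S (d A P))\<^sup>2" "C (d B P) = C (d A B) * C (d A P) + k * S (d A B) * p1"
    and q: "q1\<^sup>2 + q2\<^sup>2 = (S (d A Q))\<^sup>2" "C (d B Q) = C (d A B) * C (d A Q) + k * S (d A B) * q1"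
    and nn: "0 \<le> p2" "0 \<le> q2" and x: "0 \<le> x" "x \<le> d A B"
    and line: "q2 * (p1 * C x - C (d A P) * S x) + p2 * (q1 * C x - C (d A Q) * S x) = 0"
    and opp: "(p1 * C x - C (d A P) * S x) * (q1 * C x - C (d A Q) * S x) \<le> 0"
  shows "k * (C (d A P) * C (d A Q) + k * (p1 * q1 - p2 * q2)) \<le> k * C (d P Q)"
proof -
  obtain \<gamma> where \<gamma>: "geod X d \<gamma> (d A B)" "\<gamma> 0 = A" "\<gamma> (d A B) = B" using con X unfolding connected_def by blast
  have M: "\<gamma> x \<in> X" using geodD(2)[OF \<gamma>(1)] x by auto
  have CS: "C x * C x + k * (S x * S x) = 1" using C_sq[of x] by (simp add: power2_eq_square)
  have Sx: "0 \<le> S x" "0 \<le> S (d A B - x)" using x bnd[of A B] X by (auto intro!: S_nonneg intro: order_trans[of _ "pi/2"])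
  \<comment> \<open>\<open>C (d A Z) * C x + k * z1 * S x\<close> is the cosine of the model
    distance from \<open>Z\<close> to the point of \<open>A B\<close> at parameter \<open>x\<close>.
    It is nonnegative, is compared with the true distance by concavity, and its squared sine splits
    into a normal part \<open>z2\<close> and a part tangent to \<open>A B\<close>.\<close>
  have step: "0 \<le> C (d A Z) * C x + k * z1 * S x \<and> k * (C (d A Z) * C x + k * z1 * S x) \<le> k * C (d Z (\<gamma> x))
      \<and> k * (1 - (C (d A Z) * C x + k * z1 * S x)\<^sup>2) = z2\<^sup>2 + (z1 * C x - C (d A Z) * S x)\<^sup>2"
    if Z: "Z \<in> X" and z: "z1\<^sup>2 + z2\<^sup>2 = (S (d A Z))\<^sup>2" "C (d B Z) = C (d A B) * C (d A Z) + k * S (d A B) * z1" for Z z1 z2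
  proof (intro conjI)
    have e: "S (d A B - x) * C (d A Z) + S x * C (d B Z) = S (d A B) * (C (d A Z) * C x + k * z1 * S x)"
      unfolding z(2) S_diff by (simp add: algebra_simps)
    have "S (d A B) * 0 \<le> S (d A B) * (C (d A Z) * C x + k * z1 * S x)"
      unfolding e[symmetric] using Sx Cd_nn[OF X(1) Z] Cd_nn[OF X(2) Z] by simp
    then show "0 \<le> C (d A Z) * C x + k * z1 * S x" using pos by (rule mult_left_le_imp_le)
    have "0 \<le> k * (S (d A B) * C (d Z (\<gamma> x)) - S (d A B - x) * C (d Z (\<gamma> 0)) - S x * C (d Z (\<gamma> (d A B))))"
      using cat \<gamma>(1) x Z unfolding CAT_def by blast
    then have "0 \<le> k * (S (d A B) * C (d Z (\<gamma> x)) - (S (d A B - x) * C (d A Z) + S x * C (d B Z)))"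
      unfolding \<gamma> d_comm[OF Z X(1)] d_comm[OF Z X(2)] by (simp add: diff_diff_eq)
    then have "S (d A B) * (k * (C (d A Z) * C x + k * z1 * S x)) \<le> S (d A B) * (k * C (d Z (\<gamma> x)))"
      unfolding e by (simp add: right_diff_distrib mult.left_commute)
    then show "k * (C (d A Z) * C x + k * z1 * S x) \<le> k * C (d Z (\<gamma> x))" using pos by (rule mult_left_le_imp_le)
    have zz: "z2\<^sup>2 = k * (1 - (C (d A Z))\<^sup>2) - z1\<^sup>2" using z(1) S_sq[of "d A Z"] by simp
    have "z2\<^sup>2 + (z1 * C x - C (d A Z) * S x)\<^sup>2 + k * (C (d A Z) * C x + k * z1 * S x)\<^sup>2
      = z2\<^sup>2 + z1\<^sup>2 * (C x * C x + k * (S x * S x)) + k * (C (d A Z))\<^sup>2 * (C x * C x + k * (S x * S x))"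
      using k by (auto simp: power2_eq_square algebra_simps)
    also have "\<dots> = k" unfolding CS zz by (simp add: right_diff_distrib)
    finally show "k * (1 - (C (d A Z) * C x + k * z1 * S x)\<^sup>2) = z2\<^sup>2 + (z1 * C x - C (d A Z) * S x)\<^sup>2"
      by (simp add: right_diff_distrib)
  qed
  define f where "f = C (d A P) * C x + k * p1 * S x"
  define g where "g = C (d A Q) * C x + k * q1 * S x"
  define h where "h = p1 * C x - C (d A P) * S x"
  define h' where "h' = q1 * C x - C (d A Q) * S x"
  define u where "u = d P (\<gamma> x)"
  define v where "v = d Q (\<gamma> x)"
  have f: "0 \<le> f" "k * f \<le> k * C u" "k * (1 - f\<^sup>2) = p2\<^sup>2 + h\<^sup>2" using step[OF X(3) p] by (auto simp: f_def h_def u_def)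
  have g: "0 \<le> g" "k * g \<le> k * C v" "k * (1 - g\<^sup>2) = q2\<^sup>2 + h'\<^sup>2" using step[OF X(4) q] by (auto simp: g_def h'_def v_def)
  have l: "q2 * h + p2 * h' = 0" "h * h' \<le> 0" using line opp by (auto simp: h_def h'_def)
  have uv: "0 \<le> C u" "0 \<le> C v" "0 \<le> S u" "0 \<le> S v" unfolding u_def v_def using Cd_nn Sd_nn X M by auto
  have prod: "k * (f * g) \<le> k * (C u * C v)"
    using k
  proof
    assume "k = 1"
    then show ?thesis using mult_mono[of f "C u" g "C v"] f g uv by simp
  next
    assume "k = -1"
    then show ?thesis using mult_mono[of "C u" f "C v" g] f g uv by simp
  qed
  have sqb: "(S z)\<^sup>2 \<le> k * (1 - y\<^sup>2)" if "0 \<le> y" "0 \<le> C z" "k * y \<le> k * C z" for y z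
  proof -
    have "k * y\<^sup>2 \<le> k * (C z)\<^sup>2" using k that by (auto intro!: power_mono)
    then show ?thesis unfolding S_sq by (simp add: right_diff_distrib)
  qed
  have "(S u * S v)\<^sup>2 \<le> (p2 * q2 - h * h')\<^sup>2"
  proof -
    have "(S u * S v)\<^sup>2 \<le> (p2\<^sup>2 + h\<^sup>2) * (q2\<^sup>2 + h'\<^sup>2)"
      unfolding power_mult_distrib using sqb[OF f(1) uv(1) f(2)] sqb[OF g(1) uv(2) g(2)] unfolding f(3) g(3)
      by (intro mult_mono) auto
    \<comment> \<open>Lagrange's identity; the second square is 0 by \<open>line\<close>.\<close>
    also have "\<dots> = (p2 * q2 - h * h')\<^sup>2 + (q2 * h + p2 * h')\<^sup>2" by (simp add: power2_eq_square algebra_simps)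
    finally show ?thesis unfolding l by simp
  qed
  then have SS: "S u * S v \<le> p2 * q2 - h * h'"
    by (rule power2_le_imp_le) (use mult_nonneg_nonneg[OF nn] l in linarith)
  have "C (d A P) * C (d A Q) + k * (p1 * q1) = f * g + k * (h * h')"
  proof -
    have "f * g + k * (h * h') = C (d A P) * C (d A Q) * (C x * C x + k * (S x * S x)) + k * (p1 * q1) * (C x * C x + k * (S x * S x))"
      unfolding f_def g_def h_def h'_def using k by (auto simp: algebra_simps)
    then show ?thesis unfolding CS by simp
  qed
  then have "k * (C (d A P) * C (d A Q) + k * (p1 * q1)) = k * (f * g + k * (h * h'))" by (simp only:)
  then have "k * (C (d A P) * C (d A Q) + k * (p1 * q1 - p2 * q2)) = k * (f * g) - (p2 * q2 - h * h')"
    by (simp add: distrib_left right_diff_distrib)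
  also have "\<dots> \<le> k * (C u * C v) - S u * S v" using prod SS by linarith
  also have "\<dots> = k * C (d (\<gamma> x) P + d (\<gamma> x) Q)"
    unfolding C_add u_def v_def d_comm[OF X(3) M] d_comm[OF X(4) M] by (simp add: right_diff_distrib mult.assoc)
  also have "\<dots> \<le> k * C (d P Q)" by (rule C_triangle[OF M X(3,4)])
  finally show ?thesis .
qed

text \<open>The model segment \<open>P Q\<close> may pass \<open>A B\<close> beyond
  \<open>A\<close>, beyond \<open>B\<close>, or cross it. The sign of
  \<open>q2 * p1 + p2 * q1\<close> tells whether the angles at \<open>A\<close> add up to more than
  \<open>pi\<close>, and the analogous expression in coordinates at \<open>B\<close> does the same
  there; if neither is negative, the segment crosses.\<close>

lemma CAT_glued:
  assumes cat: CAT and con: connected and X: "A \<in> X" "B \<in> X" "P \<in> X" "Q \<in> X"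
  shows "glued A B P Q"
proof (cases "A = B \<or> A = Q \<or> B = P")
  case True
  show ?thesis
  proof (cases "A = B")
    case True
    have "k * (C (d A P) * C (d A Q) + k * (S (d A P) * (- S (d A Q)) - 0 * 0)) \<le> k * C (d P Q)"
      using C_triangle[OF X(1,3,4)] by (simp add: C_add mult.assoc)
    then show ?thesis using True X by (intro glued_exact[OF X, of "S (d A P)" 0 "- S (d A Q)" 0]) auto
  next
    case ne: False
    obtain p1 p2 where p: "0 \<le> p2 \<and> p1\<^sup>2 + p2\<^sup>2 = (S (d A P))\<^sup>2 \<and> C (d B P) = C (d A B) * C (d A P) + k * S (d A B) * p1"
      using triangle_coordinates[OF X(1-3) ne] by (elim exE)
    obtain q1 q2 where q: "0 \<le> q2 \<and> q1\<^sup>2 + q2\<^sup>2 = (S (d A Q))\<^sup>2 \<and> C (d B Q) = C (d A B) * C (d A Q) + k * S (d A B) * q1"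
      using triangle_coordinates[OF X(1,2,4) ne] by (elim exE)
    show ?thesis
    proof (cases "A = Q")
      case True
      then have "q1 = 0" "q2 = 0" using q X by (auto simp: sum_power2_eq_zero_iff)
      moreover have "d A Q = 0" "d P Q = d A P" using True X d_comm by auto
      ultimately show ?thesis using p q by (intro glued_exact[OF X, of p1 p2 q1 q2]) auto
    next
      case False
      then have "B = P" using True ne by auto
      have "k * (C (d A P) * C (d A Q) + k * (S (d A P) * q1 - 0 * q2)) \<le> k * C (d P Q)"
        using q \<open>B = P\<close> by (simp add: mult.assoc)
      moreover have "C (d B P) = C (d A B) * C (d A P) + k * S (d A B) * S (d A P)"
        using \<open>B = P\<close> X C_sq[of "d A B"] by (simp add: power2_eq_square mult.assoc)
      ultimately show ?thesis using q by (intro glued_exact[OF X, of "S (d A P)" 0 q1 q2]) auto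
    qed
  qed
next
  case False
  then have ne: "A \<noteq> B" "A \<noteq> Q" "B \<noteq> P" by auto
  have Sp: "0 < S (d Y Z)" if "Y \<in> X" "Z \<in> X" "Y \<noteq> Z" for Y Z
    using d_pos[OF that] bnd[OF _ that(1,2)] by (intro S_pos) (auto intro: order_le_less_trans[of _ "pi/2"])
  define a where "a = C (d A B)"
  define s where "s = S (d A B)"
  have s: "0 < s" using Sp X ne by (simp add: s_def)
  have as: "k * (s * s) = 1 - a * a" using C_sq[of "d A B"] by (simp add: s_def a_def power2_eq_square mult.assoc)
  obtain p1 p2 where p: "0 \<le> p2" "p1\<^sup>2 + p2\<^sup>2 = (S (d A P))\<^sup>2" "C (d B P) = C (d A B) * C (d A P) + k * S (d A B) * p1"
    using triangle_coordinates[OF X(1-3) ne(1)] by (elim exE conjE)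
  obtain q1 q2 where q: "0 \<le> q2" "q1\<^sup>2 + q2\<^sup>2 = (S (d A Q))\<^sup>2" "C (d B Q) = C (d A B) * C (d A Q) + k * S (d A B) * q1"
    using triangle_coordinates[OF X(1,2,4) ne(1)] by (elim exE conjE)
  \<comment> \<open>The change of coordinates to the base point \<open>B\<close> with
    \<open>A\<close> in the first direction; the second coordinate is unaffected.\<close>
  have swap: "(s * C (d A Z) - a * z1)\<^sup>2 + z2\<^sup>2 = (S (d B Z))\<^sup>2 \<and> C (d A Z) = C (d B A) * C (d B Z) + k * S (d B A) * (s * C (d A Z) - a * z1)"
    if z: "z1\<^sup>2 + z2\<^sup>2 = (S (d A Z))\<^sup>2" "C (d B Z) = C (d A B) * C (d A Z) + k * S (d A B) * z1" for Z z1 z2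
  proof
    have zz: "z2\<^sup>2 = k * (1 - (C (d A Z))\<^sup>2) - z1\<^sup>2" using z(1) S_sq[of "d A Z"] by simp
    have "(S (d B Z))\<^sup>2 = k * (1 - (a * C (d A Z) + k * s * z1)\<^sup>2)" unfolding S_sq z(2) a_def s_def ..
    also have "\<dots> = k - k * (C (d A Z))\<^sup>2 * (a * a) - 2 * a * s * z1 * C (d A Z) - z1\<^sup>2 * (k * (s * s))"
      using k by (auto simp: power2_eq_square algebra_simps)
    also have "\<dots> = k - k * (C (d A Z))\<^sup>2 * (1 - k * (s * s)) - 2 * a * s * z1 * C (d A Z) - z1\<^sup>2 * (1 - a * a)"
      unfolding as by simp
    also have "\<dots> = (s * C (d A Z) - a * z1)\<^sup>2 + z2\<^sup>2"
      unfolding zz using k by (auto simp: power2_eq_square algebra_simps)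
    finally show "(s * C (d A Z) - a * z1)\<^sup>2 + z2\<^sup>2 = (S (d B Z))\<^sup>2" ..
    have "C (d B A) * C (d B Z) + k * S (d B A) * (s * C (d A Z) - a * z1) = a * (a * C (d A Z) + k * s * z1) + k * s * (s * C (d A Z) - a * z1)"
      unfolding z(2) a_def s_def d_comm[OF X(2,1)] ..
    also have "\<dots> = C (d A Z) * (a * a + k * (s * s))" by (simp add: algebra_simps)
    finally show "C (d A Z) = C (d B A) * C (d B Z) + k * S (d B A) * (s * C (d A Z) - a * z1)" unfolding as by simp
  qed
  define p1' where "p1' = s * C (d A P) - a * p1"
  define q1' where "q1' = s * C (d A Q) - a * q1"
  have p': "p1'\<^sup>2 + p2\<^sup>2 = (S (d B P))\<^sup>2" "C (d A P) = C (d B A) * C (d B P) + k * S (d B A) * p1'"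
    unfolding p1'_def using swap[OF p(2,3)] by auto
  have q': "q1'\<^sup>2 + q2\<^sup>2 = (S (d B Q))\<^sup>2" "C (d A Q) = C (d B A) * C (d B Q) + k * S (d B A) * q1'"
    unfolding q1'_def using swap[OF q(2,3)] by auto
  have Snn: "0 \<le> S (d A P)" "0 \<le> S (d A Q)" "0 \<le> S (d B P)" "0 \<le> S (d B Q)" using Sd_nn X by auto
  have A: "glued A B P Q" if "p1 * S (d A Q) \<le> - (q1 * S (d A P))"
    by (rule glued_obtuse[OF X Sp[OF X(1,4) ne(2)] p(3) q(2,3) that])
  have B: "glued A B P Q" if "q1' * S (d B P) \<le> - (p1' * S (d B Q))"
    by (rule glued_swap[OF X glued_obtuse[OF X(2,1,4,3) Sp[OF X(2,3) ne(3)] q'(2) p' that]])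
  have cr: "glued A B P Q" if "0 \<le> x" "x \<le> d A B" "q2 * (p1 * C x - C (d A P) * S x) + p2 * (q1 * C x - C (d A Q) * S x) = 0"
    "(p1 * C x - C (d A P) * S x) * (q1 * C x - C (d A Q) * S x) \<le> 0" for x
    by (rule glued_exact[OF X p(2,3) q(2,3) CAT_crossing[OF cat con X Sp[OF X(1,2) ne(1)] p(2,3) q(2,3) p(1) q(1) that]])
  show ?thesis
  proof (cases "q2 * p1 + p2 * q1 < 0")
    case True
    show ?thesis by (rule A[OF opposite_sector[OF p(1) q(1) Snn(1,2) p(2) q(2) True]])
  next
    case n1: False
    show ?thesis
    proof (cases "p2 * q1' + q2 * p1' < 0")
      case True
      show ?thesis by (rule B[OF opposite_sector[OF q(1) p(1) Snn(4,3) q'(1) p'(1) True]])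
    next
      case n2: False
      show ?thesis
      proof (cases "p2 = 0 \<and> q2 = 0")
        case True
        \<comment> \<open>All four model points lie on one line, where the intermediate value
          argument below gives no information. Either one of the obtuse cases applies, or
          \<open>P\<close> lies on \<open>A B\<close> and serves as the crossing point
          itself.\<close>
        have bd: "\<bar>z\<bar> = b" if "z\<^sup>2 + y\<^sup>2 = b\<^sup>2" "y = 0" "0 \<le> b" for z y b :: real
        proof -
          have "sqrt (z\<^sup>2) = sqrt (b\<^sup>2)" using that by simp
          then show ?thesis using that by (simp only: real_sqrt_abs)
        qed
        have ab: "\<bar>p1\<bar> = S (d A P)" "\<bar>q1\<bar> = S (d A Q)" "\<bar>p1'\<bar> = S (d B P)" "\<bar>q1'\<bar> = S (d B Q)"
          using bd p(2) q(2) p'(1) q'(1) True Snn by auto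
        have ob: "x * \<bar>y\<bar> \<le> - (y * \<bar>x\<bar>)" if "x \<le> 0 \<or> y \<le> 0" for x y :: real
          using that mult_nonpos_nonpos[of x y] mult_nonneg_nonpos[of x y] mult_nonpos_nonneg[of x y] by (auto simp: abs_if mult.commute)
        show ?thesis
        proof (cases "p1 \<le> 0 \<or> q1 \<le> 0")
          case True
          show ?thesis by (rule A) (use ob[OF True] ab in simp)
        next
          case pos: False
          show ?thesis
          proof (cases "q1' \<le> 0 \<or> p1' \<le> 0")
            case T: True
            show ?thesis by (rule B) (use ob[OF T] ab in simp)
          next
            case F: False
            have p1: "p1 = S (d A P)" using pos ab by simp
            have le: "d A P \<le> d A B"
            proof (rule ccontr)
              assume "\<not> ?thesis"
              then have "0 \<le> S (d A P - d A B)" using bnd[of A P] d_nn[of A B] X by (intro S_nonneg) (auto intro: order_trans[of _ "pi/2"])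
              moreover have "S (d A B - d A P) = p1'" unfolding S_diff p1'_def p1 s_def a_def ..
              then have "S (d A P - d A B) = - p1'" using S_minus[of "d A B - d A P"] by simp
              ultimately show False using F by simp
            qed
            show ?thesis by (rule cr[OF d_nn[OF X(1,3)] le]) (use True p1 in auto)
          qed
        qed
      next
        case nz: False
        \<comment> \<open>The failure of the collinearity condition at parameter \<open>x\<close>.
          Its values at the ends are, up to sign, the two expressions that were tested before, so it
          changes sign along \<open>A B\<close>.\<close>
        define h where "h x = (q2 * p1 + p2 * q1) * C x - (q2 * C (d A P) + p2 * C (d A Q)) * S x" for x
        have h: "h x = q2 * (p1 * C x - C (d A P) * S x) + p2 * (q1 * C x - C (d A Q) * S x)" for x
          unfolding h_def by (simp add: algebra_simps)
        have "0 \<le> h 0" using n1 by (simp add: h_def)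
        moreover have "h (d A B) = - (p2 * q1' + q2 * p1')" unfolding h_def p1'_def q1'_def a_def s_def by (simp add: algebra_simps)
        then have "h (d A B) \<le> 0" using n2 by simp
        moreover have "continuous_on {0..d A B} h" unfolding h_def by (intro continuous_intros)
        ultimately obtain x where x: "0 \<le> x" "x \<le> d A B" "h x = 0"
          using IVT2'[of h "d A B" 0 0] d_nn[OF X(1,2)] by auto
        define y where "y = p1 * C x - C (d A P) * S x"
        define z where "z = q1 * C x - C (d A Q) * S x"
        have l: "q2 * y + p2 * z = 0" using x(3) unfolding h y_def z_def .
        have "y * z \<le> 0"
        proof (rule ccontr)
          assume "\<not> ?thesis"
          then have yz: "0 < y * z" by simp
          have "0 < q2 \<or> 0 < p2" using nz p(1) q(1) by auto
          then have "0 < q2 * y\<^sup>2 + p2 * (y * z)"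
          proof
            assume "0 < q2"
            moreover have "y \<noteq> 0" using yz by auto
            ultimately show ?thesis using yz p(1) by (intro add_pos_nonneg) auto
          next
            assume "0 < p2"
            then show ?thesis using yz q(1) by (intro add_nonneg_pos) auto
          qed
          also have "q2 * y\<^sup>2 + p2 * (y * z) = y * (q2 * y + p2 * z)" by (simp add: power2_eq_square algebra_simps)
          finally show False unfolding l by simp
        qed
        then show ?thesis using cr[OF x(1,2)] l unfolding y_def z_def by simp
      qed
    qed
  qed
qed

text \<open>The diagonal to glue along is the one for which the permitted changes of length act in
  the right direction: the distance that may have grown is that of \<open>P2\<close>,
  \<open>P3\<close> for \<open>sg = -1\<close> and that of \<open>P1\<close>, \<open>P3\<close> for
  \<open>sg = 1\<close>, and the one that may have shrunk is opposite to the sense in which its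
  cosine enters.\<close>

theorem CAT_four_point:
  assumes cat: CAT and con: connected and sg: "sg = 1 \<or> sg = -1"
    and X: "P1 \<in> X" "P2 \<in> X" "P3 \<in> X" "P4 \<in> X"
  shows "sg * k * ((C (d P2 P3) + C (d P1 P2) * C (d P3 P4)) * (1 + C (d P1 P4))
        - (C (d P1 P2) + C (d P2 P4)) * (C (d P3 P4) + C (d P1 P3)))
      \<le> S (d P1 P2) * S (d P3 P4) * (1 + C (d P1 P4))"
proof -
  have nn: "0 \<le> C (d P1 P2)" "0 \<le> C (d P1 P3)" "0 \<le> C (d P1 P4)" "0 \<le> C (d P2 P3)" "0 \<le> C (d P2 P4)" "0 \<le> C (d P3 P4)"
    using Cd_nn X by auto
  have Sn: "0 \<le> S (d P1 P2)" "0 \<le> S (d P3 P4)" using Sd_nn X by auto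
  have model: "\<bar>(F v2 v3 + F v1 v2 * F v3 v4) * (1 + F v1 v4) - (F v1 v2 + F v2 v4) * (F v3 v4 + F v1 v3)\<bar> \<le> S (d P1 P2) * S (d P3 P4) * (1 + F v1 v4)"
    if "F v1 v1 = 1" "F v2 v2 = 1" "F v3 v3 = 1" "F v4 v4 = 1" "F v1 v2 = C (d P1 P2)" "F v3 v4 = C (d P3 P4)" "0 \<le> 1 + F v1 v4" for v1 v2 v3 v4
  proof -
    have "(1 - (C (d P1 P2))\<^sup>2) * (1 - (C (d P3 P4))\<^sup>2) = (S (d P1 P2))\<^sup>2 * (S (d P3 P4))\<^sup>2" unfolding C_sq by simp
    then have "\<bar>(F v2 v3 + F v1 v2 * F v3 v4) * (1 + F v1 v4) - (F v1 v2 + F v2 v4) * (F v3 v4 + F v1 v3)\<bar>\<^sup>2 \<le> (S (d P1 P2) * S (d P3 P4) * (1 + F v1 v4))\<^sup>2"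
      using model_inequality[OF that(1-4)] unfolding that(5,6) power2_abs power_mult_distrib by simp
    then show ?thesis by (rule power2_le_imp_le) (use Sn that(7) in auto)
  qed
  have kab: "k * x \<le> \<bar>x\<bar>" "- (k * x) \<le> \<bar>x\<bar>" for x using k by auto
  from sg show ?thesis
  proof
    assume sg: "sg = -1"
    from CAT_glued[OF cat con X(1,4,2,3), unfolded glued_def] obtain v1 v4 v2 v3 where
      v: "F v1 v1 = 1" "F v4 v4 = 1" "F v2 v2 = 1" "F v3 v3 = 1" "F v1 v4 = C (d P1 P4)" "F v1 v2 = C (d P1 P2)" "F v4 v3 = C (d P4 P3)"
        "k * F v2 v3 \<le> k * C (d P2 P3)" "k * C (d P4 P2) \<le> k * F v4 v2" "k * C (d P1 P3) \<le> k * F v1 v3"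
        "F v4 v2 = C (d P4 P2) \<or> F v1 v3 = C (d P1 P3)"
      by (elim exE conjE)
    define y where "y = F v2 v4"
    define z where "z = F v1 v3"
    have yz: "k * C (d P2 P4) \<le> k * y" "k * C (d P1 P3) \<le> k * z" "y = C (d P2 P4) \<or> z = C (d P1 P3)"
      using v(9-11) unfolding y_def z_def form_sym[of k v4 v2] d_comm[OF X(4,2)] by auto
    have v34: "F v3 v4 = C (d P3 P4)" using v(7) unfolding form_sym[of k v4 v3] d_comm[OF X(4,3)] .
    have "- k * ((F v2 v3 + C (d P1 P2) * C (d P3 P4)) * (1 + C (d P1 P4)) - (C (d P1 P2) + y) * (C (d P3 P4) + z)) \<le> S (d P1 P2) * S (d P3 P4) * (1 + C (d P1 P4))"
      using order_trans[OF kab(2) model[OF v(1,3,4,2,6) v34]] nn(3) unfolding v(5,6) v34 y_def[symmetric] z_def[symmetric] by simp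
    moreover have "(k * F v2 v3) * (1 + C (d P1 P4)) \<le> (k * C (d P2 P3)) * (1 + C (d P1 P4))"
      using v(8) nn(3) by (intro mult_right_mono) auto
    moreover have "k * ((C (d P1 P2) + C (d P2 P4)) * (C (d P3 P4) + C (d P1 P3))) \<le> k * ((C (d P1 P2) + y) * (C (d P3 P4) + z))"
    proof (rule disjE[OF yz(3)])
      assume "y = C (d P2 P4)"
      moreover have "(k * C (d P1 P3)) * (C (d P1 P2) + C (d P2 P4)) \<le> (k * z) * (C (d P1 P2) + C (d P2 P4))"
        using yz nn by (intro mult_right_mono) auto
      ultimately show ?thesis by (simp add: algebra_simps)
    next
      assume "z = C (d P1 P3)"
      moreover have "(k * C (d P2 P4)) * (C (d P3 P4) + C (d P1 P3)) \<le> (k * y) * (C (d P3 P4) + C (d P1 P3))"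
        using yz nn by (intro mult_right_mono) auto
      ultimately show ?thesis by (simp add: algebra_simps)
    qed
    ultimately show ?thesis unfolding sg by (simp add: algebra_simps)
  next
    assume sg: "sg = 1"
    from CAT_glued[OF cat con X(2,4,1,3), unfolded glued_def] obtain v2 v4 v1 v3 where
      v: "F v2 v2 = 1" "F v4 v4 = 1" "F v1 v1 = 1" "F v3 v3 = 1" "F v2 v4 = C (d P2 P4)" "F v2 v1 = C (d P2 P1)" "F v4 v3 = C (d P4 P3)"
        "k * F v1 v3 \<le> k * C (d P1 P3)" "k * C (d P4 P1) \<le> k * F v4 v1" "k * C (d P2 P3) \<le> k * F v2 v3"
        "F v4 v1 = C (d P4 P1) \<or> F v2 v3 = C (d P2 P3)" "0 \<le> 1 + F v4 v1"
      by (elim exE conjE)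
    define y where "y = F v1 v4"
    define z where "z = F v2 v3"
    have yz: "k * C (d P1 P4) \<le> k * y" "k * C (d P2 P3) \<le> k * z" "y = C (d P1 P4) \<or> z = C (d P2 P3)" "0 \<le> 1 + y"
      using v(9-12) unfolding y_def z_def form_sym[of k v4 v1] d_comm[OF X(4,1)] by auto
    have v34: "F v3 v4 = C (d P3 P4)" using v(7) unfolding form_sym[of k v4 v3] d_comm[OF X(4,3)] .
    have v12: "F v1 v2 = C (d P1 P2)" using v(6) unfolding form_sym[of k v2 v1] d_comm[OF X(2,1)] .
    have m0: "k * ((z + C (d P1 P2) * C (d P3 P4)) * (1 + y) - (C (d P1 P2) + C (d P2 P4)) * (C (d P3 P4) + F v1 v3)) \<le> S (d P1 P2) * S (d P3 P4) * (1 + y)"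
      using order_trans[OF kab(1) model[OF v(3,1,4,2) v12 v34]] v(12) unfolding v(5) v12 v34 y_def z_def form_sym[of k v4 v1] by simp
    have "(k * F v1 v3) * (C (d P1 P2) + C (d P2 P4)) \<le> (k * C (d P1 P3)) * (C (d P1 P2) + C (d P2 P4))"
      using v(8) nn by (intro mult_right_mono) auto
    then have m: "k * ((z + C (d P1 P2) * C (d P3 P4)) * (1 + y) - (C (d P1 P2) + C (d P2 P4)) * (C (d P3 P4) + C (d P1 P3))) \<le> S (d P1 P2) * S (d P3 P4) * (1 + y)"
      using m0 by (simp add: algebra_simps)
    show ?thesis
    proof (rule disjE[OF yz(3)])
      assume y: "y = C (d P1 P4)"
      have "(k * C (d P2 P3)) * (1 + C (d P1 P4)) \<le> (k * z) * (1 + C (d P1 P4))" using yz nn by (intro mult_right_mono) auto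
      then show ?thesis using m unfolding sg y by (simp add: algebra_simps)
    next
      assume z: "z = C (d P2 P3)"
      \<comment> \<open>The changed cosine \<open>y\<close> occurs in a factor on both sides.
        Collected, the inequality reads \<open>k * w * (1 + y) \<le> k * c\<close>. For
        \<open>w \<ge> 0\<close> the true cosine may replace \<open>y\<close> by monotonicity;
        \<open>w < 0\<close> is possible only for \<open>k = 1\<close>, and then the left-hand side
        is nonpositive while \<open>c\<close> is nonnegative.\<close>
      define w where "w = C (d P2 P3) + C (d P1 P2 + d P3 P4)"
      have w: "k * w = k * (C (d P2 P3) + C (d P1 P2) * C (d P3 P4)) - S (d P1 P2) * S (d P3 P4)"
        unfolding w_def C_add by (simp add: distrib_left right_diff_distrib mult.assoc)
      define c where "c = (C (d P1 P2) + C (d P2 P4)) * (C (d P3 P4) + C (d P1 P3))"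
      have c: "0 \<le> c" unfolding c_def using nn by simp
      have goal: "?thesis \<longleftrightarrow> k * w * (1 + C (d P1 P4)) \<le> k * c"
        unfolding sg w c_def by (simp add: algebra_simps)
      have m': "k * w * (1 + y) \<le> k * c"
        using m unfolding z w c_def by (simp add: algebra_simps)
      show ?thesis
      proof (cases "0 \<le> w")
        case True
        have "(k * C (d P1 P4)) * w \<le> (k * y) * w" using yz True by (intro mult_right_mono) auto
        then have "k * w * (1 + C (d P1 P4)) \<le> k * w * (1 + y)" by (simp add: algebra_simps)
        then show ?thesis using m' unfolding goal by linarith
      next
        case False
        have "k = 1"
        proof (rule ccontr)
          assume "k \<noteq> 1"
          then have "0 < C (d P1 P2 + d P3 P4)" by (intro C_pos) auto
          then show False using False nn(4) by (simp add: w_def)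
        qed
        moreover have "w * (1 + C (d P1 P4)) \<le> 0" using False nn(3) by (intro mult_nonpos_nonneg) auto
        ultimately show ?thesis unfolding goal using c by simp
      qed
    qed
  qed
qed

end

section \<open>Semimetric spaces: triangle inequality, intermediate points and geodesics\<close>

lemma (in curv) four_point_imp_metric:
  fixes X :: "'a set"
  assumes semi: "semimetric_on X d" and bnd: "\<And>x y. k = 1 \<Longrightarrow> x \<in> X \<Longrightarrow> y \<in> X \<Longrightarrow> d x y \<le> pi / 2"
    and sg: "sg = 1 \<or> sg = -1"
    and four: "\<And>P1 P2 P3 P4. P1 \<in> X \<Longrightarrow> P2 \<in> X \<Longrightarrow> P3 \<in> X \<Longrightarrow> P4 \<in> X \<Longrightarrow>
      sg * k * ((C (d P2 P3) + C (d P1 P2) * C (d P3 P4)) * (1 + C (d P1 P4))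
        - (C (d P1 P2) + C (d P2 P4)) * (C (d P3 P4) + C (d P1 P3)))
      \<le> S (d P1 P2) * S (d P3 P4) * (1 + C (d P1 P4))"
  shows "metric_on X d"
proof -
  have com: "d x y = d y x" and nn: "0 \<le> d x y" and self: "d x x = 0" if "x \<in> X" "y \<in> X" for x y
    using semi that unfolding semimetric_on_def by auto
  \<comment> \<open>For \<open>sg = 1\<close> the right-hand side is \<open>k * C\<close> of the
    difference of two sides, for \<open>sg = -1\<close> it is, after a change of sign,
    \<open>k * C\<close> of their sum; so each sign yields one of the two forms of the triangle
    inequality.\<close>
  have tri: "sg * (k * C (d y z)) \<le> sg * (k * (C (d x y) * C (d x z))) + S (d x y) * S (d x z)" if X: "x \<in> X" "y \<in> X" "z \<in> X" for x y z
  proof -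
    have "sg * k * ((C (d y z) + C (d x y) * C (d x z)) * (1 + C 0) - (C (d x y) + C (d x y)) * (C (d x z) + C (d x z)))
      \<le> S (d x y) * S (d x z) * (1 + C 0)"
      using four[OF X X(1)] unfolding self[OF X(1,1)] com[OF X(2,1)] com[OF X(3,1)] .
    then show ?thesis by (simp add: algebra_simps)
  qed
  have "d x z \<le> d x y + d y z" if X: "x \<in> X" "y \<in> X" "z \<in> X" for x y z
    using sg
  proof
    assume sg: "sg = 1"
    have "k * C (d y z) \<le> k * C \<bar>d x y - d x z\<bar>"
      using tri[OF X] unfolding sg C_abs C_diff by (simp add: distrib_left mult.assoc)
    then have "\<bar>d x y - d x z\<bar> \<le> d y z"
    proof (rule kC_le_D[OF _ nn[OF X(2,3)]])
      assume "k = 1"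
      then show "\<bar>d x y - d x z\<bar> \<le> pi"
        using nn[OF X(1,2)] nn[OF X(1,3)] bnd[OF _ X(1,2)] bnd[OF _ X(1,3)] pi_gt_zero unfolding abs_le_iff by linarith
    qed
    then show ?thesis by linarith
  next
    assume sg: "sg = -1"
    have "k * C (d y x + d y z) \<le> k * C (d x z)"
      using tri[OF X(2,1,3)] unfolding sg C_add by (simp add: right_diff_distrib mult.assoc)
    then have "d x z \<le> d y x + d y z"
    proof (rule kC_le_D)
      show "0 \<le> d y x + d y z" using nn[OF X(2,1)] nn[OF X(2,3)] by simp
      assume "k = 1"
      then show "d x z \<le> pi" using bnd[OF _ X(1,3)] pi_gt_zero by linarith
    qed
    then show ?thesis unfolding com[OF X(2,1)] .
  qed
  then show ?thesis using semi unfolding metric_on_def by blast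
qed

context fourpt
begin

text \<open>A stable version of \<open>geod_unique\<close>. In the limit the four-point inequality
  for \<open>A\<close>, \<open>B\<close>, \<open>P n\<close>, \<open>Q n\<close> holds with equality
  except for the contribution of \<open>k * (1 - C e)\<close>, which is positive and would have to
  be nonpositive.\<close>

lemma between_unique_limit:
  assumes X: "A \<in> X" "B \<in> X" "\<And>n. P n \<in> X" "\<And>n. Q n \<in> X"
    and P: "(\<lambda>n::nat. d A (P n)) \<longlonglongrightarrow> t" "(\<lambda>n. d B (P n)) \<longlonglongrightarrow> u"
    and Q: "(\<lambda>n. d A (Q n)) \<longlonglongrightarrow> t" "(\<lambda>n. d B (Q n)) \<longlonglongrightarrow> u"
    and tu: "0 < t" "0 < u" "d A B = t + u" and e: "0 < e" "\<And>n. e \<le> d (P n) (Q n)"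
  shows False
proof -
  have dpi: "d x y \<le> pi" if "k = 1" "x \<in> X" "y \<in> X" for x y
    using bnd[OF that] pi_gt_zero by linarith
  have kk1: "k * (1 - C e) \<le> k * (1 - C (d (P n) (Q n)))" for n
  proof -
    have "k * C (d (P n) (Q n)) \<le> k * C e"
      by (rule kC_mono[OF less_imp_le[OF e(1)] e(2)]) (rule dpi[OF _ X(3) X(4)])
    then show ?thesis by (simp add: right_diff_distrib)
  qed
  have ke: "0 < k * (1 - C e)"
  proof -
    have "k * C e < k * C 0"
      by (rule kC_strict[OF order_refl e(1)]) (rule order_trans[OF e(2)[of 0] dpi[OF _ X(3) X(4)]])
    then show ?thesis by (simp add: right_diff_distrib)
  qed
  have CD: "C (t + u) = C t * C u - k * S t * S u" by (rule C_add)
  have D2: "k = 1 \<Longrightarrow> t + u \<le> pi / 2" using bnd[OF _ X(1,2)] tu by simp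
  show False
    using sg
  proof
    assume sg: "sg = 1"
    have le: "k * (1 - C e) * (C (d B (Q n)) + C (d A B))
      \<le> k * (C (d A (P n)) + 1) * (C (d B (Q n)) + C (d A B)) + S (d A (P n)) * S (d B (Q n)) * (1 + C (d A (Q n)))
        - k * (C (d B (P n)) + C (d A (P n)) * C (d B (Q n))) * (1 + C (d A (Q n)))" for n
    proof -
      have "k * (1 - C e) * (C (d B (Q n)) + C (d A B)) \<le> k * (1 - C (d (P n) (Q n))) * (C (d B (Q n)) + C (d A B))"
        by (rule mult_right_mono[OF kk1]) (use Cd_nn X in simp)
      moreover have "k * ((C (d B (P n)) + C (d A (P n)) * C (d B (Q n))) * (1 + C (d A (Q n)))
        - (C (d A (P n)) + C (d (P n) (Q n))) * (C (d B (Q n)) + C (d A B))) \<le> S (d A (P n)) * S (d B (Q n)) * (1 + C (d A (Q n)))"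
        using four[OF X(1) X(3)[of n] X(2) X(4)[of n]] unfolding sg d_comm[OF X(3)[of n] X(2)] by simp
      ultimately show ?thesis by (simp add: algebra_simps)
    qed
    have l1: "(\<lambda>n. k * (1 - C e) * (C (d B (Q n)) + C (d A B))) \<longlonglongrightarrow> k * (1 - C e) * (C u + C (d A B))" by (intro tendsto_intros P Q)
    have l2: "(\<lambda>n. k * (C (d A (P n)) + 1) * (C (d B (Q n)) + C (d A B)) + S (d A (P n)) * S (d B (Q n)) * (1 + C (d A (Q n))) - k * (C (d B (P n)) + C (d A (P n)) * C (d B (Q n))) * (1 + C (d A (Q n)))) \<longlonglongrightarrow> k * (C t + 1) * (C u + C (d A B)) + S t * S u * (1 + C t) - k * (C u + C t * C u) * (1 + C t)" by (intro tendsto_intros P Q)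
    have "k * (1 - C e) * (C u + C (d A B)) \<le> k * (C t + 1) * (C u + C (d A B)) + S t * S u * (1 + C t) - k * (C u + C t * C u) * (1 + C t)"
      by (rule LIMSEQ_le[OF l1 l2]) (intro exI[of _ 0] allI impI le)
    also have "\<dots> = 0" unfolding tu(3) CD using k by (auto simp: algebra_simps)
    finally have neg: "k * (1 - C e) * (C u + C (d A B)) \<le> 0" .
    have "0 < C u" by (rule C_pos) (use tu D2 in auto)
    then have "0 < C u + C (d A B)" using Cd_nn[OF X(1,2)] by linarith
    from mult_pos_pos[OF ke this] neg show False by linarith
  next
    assume sg: "sg = -1"
    have le: "k * (1 - C e) * (1 + C (d A B))
      \<le> k * (1 + C (d A (P n)) * C (d B (Q n))) * (1 + C (d A B)) - k * (C (d A (P n)) + C (d B (P n))) * (C (d B (Q n)) + C (d A (Q n)))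
        + S (d A (P n)) * S (d B (Q n)) * (1 + C (d A B))" for n
    proof -
      have "k * (1 - C e) * (1 + C (d A B)) \<le> k * (1 - C (d (P n) (Q n))) * (1 + C (d A B))"
        by (rule mult_right_mono[OF kk1]) (use Cd_nn X in simp)
      moreover have "- k * ((C (d (P n) (Q n)) + C (d A (P n)) * C (d B (Q n))) * (1 + C (d A B))
        - (C (d A (P n)) + C (d B (P n))) * (C (d B (Q n)) + C (d A (Q n)))) \<le> S (d A (P n)) * S (d B (Q n)) * (1 + C (d A B))"
        using four[OF X(1) X(3)[of n] X(4)[of n] X(2)] unfolding sg d_comm[OF X(3)[of n] X(2)] d_comm[OF X(4)[of n] X(2)] by simp
      ultimately show ?thesis by (simp add: algebra_simps)
    qed
    have l1: "(\<lambda>n. k * (1 - C e) * (1 + C (d A B))) \<longlonglongrightarrow> k * (1 - C e) * (1 + C (d A B))" by (intro tendsto_intros P Q)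
    have l2: "(\<lambda>n. k * (1 + C (d A (P n)) * C (d B (Q n))) * (1 + C (d A B)) - k * (C (d A (P n)) + C (d B (P n))) * (C (d B (Q n)) + C (d A (Q n))) + S (d A (P n)) * S (d B (Q n)) * (1 + C (d A B))) \<longlonglongrightarrow> k * (1 + C t * C u) * (1 + C (d A B)) - k * (C t + C u) * (C u + C t) + S t * S u * (1 + C (d A B))" by (intro tendsto_intros P Q)
    have "k * (1 - C e) * (1 + C (d A B)) \<le> k * (1 + C t * C u) * (1 + C (d A B)) - k * (C t + C u) * (C u + C t) + S t * S u * (1 + C (d A B))"
      by (rule LIMSEQ_le[OF l1 l2]) (intro exI[of _ 0] allI impI le)
    also have "\<dots> = k * (1 - (C t)\<^sup>2 - (C u)\<^sup>2 + (C t)\<^sup>2 * (C u)\<^sup>2) - k * (S t)\<^sup>2 * (S u)\<^sup>2"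
      unfolding tu(3) CD using k by (auto simp: power2_eq_square algebra_simps)
    also have "\<dots> = 0" unfolding S_sq using k by (auto simp: power2_eq_square algebra_simps)
    finally have neg: "k * (1 - C e) * (1 + C (d A B)) \<le> 0" .
    have "0 < 1 + C (d A B)" using Cd_nn[OF X(1,2)] by linarith
    from mult_pos_pos[OF ke this] neg show False by linarith
  qed
qed

lemma between_exists:
  assumes wc: "weakly_convex X d" and cc: "cauchy_complete X d" and X: "A \<in> X" "B \<in> X" and ne: "A \<noteq> B"
  shows "\<exists>M\<in>X. M \<noteq> A \<and> M \<noteq> B \<and> d A M + d M B = d A B"
proof -
  from wc X obtain l where l: "0 < l \<and> l < 1 \<and> (\<forall>e>0. \<exists>M\<in>X. \<bar>d A M - l * d A B\<bar> < e \<and> \<bar>d B M - (1 - l) * d A B\<bar> < e)"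
    unfolding weakly_convex_def by blast
  define t where "t = l * d A B"
  define u where "u = (1 - l) * d A B"
  have D: "0 < d A B" using d_pos X ne by simp
  have tu: "0 < t" "0 < u" "d A B = t + u" using l D by (auto simp: t_def u_def algebra_simps)
  have "\<forall>n::nat. \<exists>M. M \<in> X \<and> \<bar>d A M - t\<bar> < 1 / Suc n \<and> \<bar>d B M - u\<bar> < 1 / Suc n"
  proof
    fix n :: nat
    have "0 < 1 / real (Suc n)" by simp
    then show "\<exists>M. M \<in> X \<and> \<bar>d A M - t\<bar> < 1 / Suc n \<and> \<bar>d B M - u\<bar> < 1 / Suc n"
      using l unfolding t_def u_def by blast
  qed
  then obtain P where P: "\<And>n. P n \<in> X" "\<And>n. \<bar>d A (P n) - t\<bar> < 1 / Suc n" "\<And>n. \<bar>d B (P n) - u\<bar> < 1 / Suc n"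
    unfolding choice_iff by blast
  have lim: "(\<lambda>n. d A (P n)) \<longlonglongrightarrow> t" "(\<lambda>n. d B (P n)) \<longlonglongrightarrow> u"
  proof -
    have z: "(\<lambda>n. 1 / real (Suc n)) \<longlonglongrightarrow> 0" using LIMSEQ_inverse_real_of_nat by (simp add: inverse_eq_divide)
    have "(\<lambda>n. d A (P n) - t) \<longlonglongrightarrow> 0"
      by (rule Lim_null_comparison[OF always_eventually z]) (use P(2) in \<open>simp only: real_norm_def less_imp_le simp_thms\<close>)
    then show "(\<lambda>n. d A (P n)) \<longlonglongrightarrow> t" by (rule LIM_zero_cancel)
    have "(\<lambda>n. d B (P n) - u) \<longlonglongrightarrow> 0"
      by (rule Lim_null_comparison[OF always_eventually z]) (use P(3) in \<open>simp only: real_norm_def less_imp_le simp_thms\<close>)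
    then show "(\<lambda>n. d B (P n)) \<longlonglongrightarrow> u" by (rule LIM_zero_cancel)
  qed
  have "\<forall>e>0. \<exists>N. \<forall>m\<ge>N. \<forall>n\<ge>N. d (P m) (P n) < e"
  proof (rule ccontr)
    assume "\<not> ?thesis"
    then obtain e where e: "0 < e" "\<forall>N. \<exists>m n. N \<le> m \<and> N \<le> n \<and> e \<le> d (P m) (P n)"
      unfolding not_all not_ex not_imp not_less by blast
    \<comment> \<open>\<open>m\<close> and \<open>n\<close> need not be increasing; it suffices that
      they tend to infinity.\<close>
    from e(2) obtain m n where mn: "\<And>N. N \<le> m N" "\<And>N. N \<le> n N" "\<And>N. e \<le> d (P (m N)) (P (n N))"
      unfolding choice_iff by blast
    have f: "filterlim m sequentially sequentially" "filterlim n sequentially sequentially"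
      using mn by (auto intro!: filterlim_at_top_mono[OF filterlim_ident] always_eventually)
    show False
      by (rule between_unique_limit[OF X P(1) P(1) filterlim_compose[OF lim(1) f(1)] filterlim_compose[OF lim(2) f(1)]
            filterlim_compose[OF lim(1) f(2)] filterlim_compose[OF lim(2) f(2)] tu e(1) mn(3)])
  qed
  then obtain M where M: "M \<in> X" "(\<lambda>n. d (P n) M) \<longlonglongrightarrow> 0" using cc P(1) unfolding cauchy_complete_def by blast
  have conv: "(\<lambda>n. d Z (P n)) \<longlonglongrightarrow> d Z M" if Z: "Z \<in> X" for Z
  proof -
    have "\<bar>d Z (P n) - d Z M\<bar> \<le> d (P n) M" for n
      using d_tri[OF Z P(1)[of n] M(1)] d_tri[OF Z M(1) P(1)[of n]] d_comm[OF M(1) P(1)[of n]] by linarith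
    then have "(\<lambda>n. d Z (P n) - d Z M) \<longlonglongrightarrow> 0"
      by (intro Lim_null_comparison[OF always_eventually M(2)] allI) (simp only: real_norm_def)
    then show ?thesis by (rule LIM_zero_cancel)
  qed
  have eq: "d A M = t" "d B M = u"
    using LIMSEQ_unique[OF conv[OF X(1)] lim(1)] LIMSEQ_unique[OF conv[OF X(2)] lim(2)] by auto
  show ?thesis
  proof (intro bexI[OF _ M(1)] conjI)
    show "M \<noteq> A" using eq(1) tu X by auto
    show "M \<noteq> B" using eq(2) tu X by auto
    show "d A M + d M B = d A B" using eq tu(3) d_comm[OF M(1) X(2)] by simp
  qed
qed

end

context mspace
begin

text \<open>Menger's theorem: a maximal subset isometric to a subset of \<open>[0, d A B]\<close> is a geodesic.\<close>

lemma Menger: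
  assumes cc: "cauchy_complete X d"
    and btw: "\<And>A B. A \<in> X \<Longrightarrow> B \<in> X \<Longrightarrow> A \<noteq> B \<Longrightarrow> \<exists>M\<in>X. M \<noteq> A \<and> M \<noteq> B \<and> d A M + d M B = d A B"
  shows connected
  unfolding connected_def
proof (intro ballI)
  fix A B assume X: "A \<in> X" "B \<in> X"
  define D where "D = d A B"
  \<comment> \<open>The metric itself records the parameter: on each member of \<open>L\<close> the
    function \<open>d A\<close> is an isometry into \<open>{0..D}\<close>.\<close>
  define L where "L = {S. S \<subseteq> X \<and> A \<in> S \<and> B \<in> S \<and> (\<forall>x\<in>S. d A x \<le> D) \<and> (\<forall>x\<in>S. \<forall>y\<in>S. d x y = \<bar>d A x - d A y\<bar>)}"
  have D: "0 \<le> D" using d_nn X by (simp add: D_def)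
  have AB: "{A, B} \<in> L" using X d_comm[OF X] d_nn[OF X] by (auto simp: L_def D_def)
  have un: "\<Union>\<C> \<in> L" if ne: "\<C> \<noteq> {}" and ch: "subset.chain L \<C>" for \<C>
  proof -
    have sub: "\<C> \<subseteq> L" and lin: "\<And>Y Z. Y \<in> \<C> \<Longrightarrow> Z \<in> \<C> \<Longrightarrow> Y \<subseteq> Z \<or> Z \<subseteq> Y"
      using ch unfolding subset_chain_def by blast+
    have LD: "Y \<subseteq> X \<and> A \<in> Y \<and> B \<in> Y \<and> (\<forall>x\<in>Y. d A x \<le> D) \<and> (\<forall>x\<in>Y. \<forall>y\<in>Y. d x y = \<bar>d A x - d A y\<bar>)" if "Y \<in> \<C>" for Y
      using subsetD[OF sub that] unfolding L_def mem_Collect_eq .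
    have iso: "d x y = \<bar>d A x - d A y\<bar>" if xy: "x \<in> \<Union>\<C>" "y \<in> \<Union>\<C>" for x y
    proof -
      from xy obtain Y Z where YZ: "Y \<in> \<C>" "x \<in> Y" "Z \<in> \<C>" "y \<in> Z" by blast
      obtain W where W: "W \<in> \<C>" "x \<in> W" "y \<in> W"
      proof (cases "Y \<subseteq> Z")
        case True
        then show ?thesis using that[of Z] YZ by blast
      next
        case False
        then show ?thesis using that[of Y] lin[OF YZ(1,3)] YZ by blast
      qed
      show ?thesis using LD[OF W(1)] W(2,3) by blast
    qed
    have "\<Union>\<C> \<subseteq> X" using LD by blast
    moreover have "\<forall>x\<in>\<Union>\<C>. d A x \<le> D" using LD by blast
    moreover have "\<forall>x\<in>\<Union>\<C>. \<forall>y\<in>\<Union>\<C>. d x y = \<bar>d A x - d A y\<bar>" by (intro ballI iso)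
    moreover obtain Y where "Y \<in> \<C>" using ne by blast
    then have "A \<in> \<Union>\<C>" "B \<in> \<Union>\<C>" using LD[of Y] by blast+
    ultimately show ?thesis unfolding L_def mem_Collect_eq by (intro conjI)
  qed
  have "\<exists>M\<in>L. \<forall>Y\<in>L. M \<subseteq> Y \<longrightarrow> Y = M"
  proof (rule subset_Zorn_nonempty)
    show "L \<noteq> {}" using AB by blast
  qed (rule un)
  then obtain S where S: "S \<in> L" and max: "\<And>T. T \<in> L \<Longrightarrow> S \<subseteq> T \<Longrightarrow> T = S" by blast
  define f where "f = d A"
  have S': "S \<subseteq> X \<and> A \<in> S \<and> B \<in> S \<and> (\<forall>x\<in>S. d A x \<le> D) \<and> (\<forall>x\<in>S. \<forall>y\<in>S. d x y = \<bar>d A x - d A y\<bar>)"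
    using S unfolding L_def mem_Collect_eq .
  have SX: "\<And>x. x \<in> S \<Longrightarrow> x \<in> X" and AS: "A \<in> S" and BS: "B \<in> S" and fD: "\<And>x. x \<in> S \<Longrightarrow> f x \<le> D"
    and iso: "\<And>x y. x \<in> S \<Longrightarrow> y \<in> S \<Longrightarrow> d x y = \<bar>f x - f y\<bar>"
    using S' unfolding f_def by blast+
  have fA: "f A = 0" "f B = D" using X by (auto simp: f_def D_def)
  have f0: "0 \<le> f x" if "x \<in> S" for x using d_nn[OF X(1) SX[OF that]] by (simp add: f_def)
  \<comment> \<open>Maximality of \<open>S\<close> in the form used below: a point whose distances
    fit those of \<open>S\<close> already belongs to \<open>S\<close>.\<close>
  have ext: "x \<in> S" if x: "x \<in> X" "f x \<le> D" "\<And>y. y \<in> S \<Longrightarrow> d x y = \<bar>f x - f y\<bar>" for x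
  proof -
    have "d y x = \<bar>f y - f x\<bar>" if "y \<in> S" for y
      using x(3)[OF that] unfolding d_comm[OF x(1) SX[OF that]] abs_minus_commute[of "f x"] .
    note yx = this
    have "insert x S \<subseteq> X" using x(1) SX by blast
    moreover have "\<forall>z\<in>insert x S. d A z \<le> D" using x(2) fD unfolding f_def by blast
    moreover have "\<forall>y\<in>insert x S. \<forall>z\<in>insert x S. d y z = \<bar>d A y - d A z\<bar>"
    proof (intro ballI)
      fix y z assume yz: "y \<in> insert x S" "z \<in> insert x S"
      have "d y z = \<bar>f y - f z\<bar>"
      proof (cases "y = x")
        case y: True
        show ?thesis
        proof (cases "z = x")
          case True
          then show ?thesis using y x(1) by simp
        next
          case False
          then have "z \<in> S" using yz by blast
          then show ?thesis unfolding y by (rule x(3))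
        qed
      next
        case False
        then have y: "y \<in> S" using yz by blast
        show ?thesis
        proof (cases "z = x")
          case True
          show ?thesis unfolding True by (rule yx[OF y])
        next
          case False
          then have "z \<in> S" using yz by blast
          with y show ?thesis by (rule iso)
        qed
      qed
      then show "d y z = \<bar>d A y - d A z\<bar>" unfolding f_def .
    qed
    ultimately have "insert x S \<in> L" unfolding L_def mem_Collect_eq using AS BS by (intro conjI insertI2)
    then show ?thesis using max[of "insert x S"] by blast
  qed
  have closed: "\<exists>x\<in>S. f x = r" if s: "\<And>n. s n \<in> S" and lim: "(\<lambda>n::nat. f (s n)) \<longlonglongrightarrow> r" for s r
  proof -
    have "\<forall>e>0. \<exists>N. \<forall>m\<ge>N. \<forall>n\<ge>N. d (s m) (s n) < e"
    proof (intro allI impI)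
      fix e :: real assume "0 < e"
      then have "\<exists>N. \<forall>m\<ge>N. \<forall>n\<ge>N. norm (f (s m) - f (s n)) < e"
        using LIMSEQ_imp_Cauchy[OF lim] unfolding Cauchy_iff by blast
      then show "\<exists>N. \<forall>m\<ge>N. \<forall>n\<ge>N. d (s m) (s n) < e" using iso[OF s s] by simp
    qed
    then obtain x where x: "x \<in> X" "(\<lambda>n. d (s n) x) \<longlonglongrightarrow> 0" using cc s SX unfolding cauchy_complete_def by blast
    have xy: "d x y = \<bar>r - f y\<bar>" if y: "y \<in> S" for y
    proof -
      have "\<bar>d (s n) y - d x y\<bar> \<le> d (s n) x" for n
        using d_tri[OF SX[OF s] x(1) SX[OF y], of n] d_tri[OF x(1) SX[OF s] SX[OF y], of n] d_comm[OF x(1) SX[OF s], of n] by linarith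
      then have "(\<lambda>n. d (s n) y - d x y) \<longlonglongrightarrow> 0"
        by (intro Lim_null_comparison[OF always_eventually x(2)] allI) (simp only: real_norm_def)
      then have "(\<lambda>n. d (s n) y) \<longlonglongrightarrow> d x y" by (rule LIM_zero_cancel)
      moreover have "(\<lambda>n. d (s n) y) \<longlonglongrightarrow> \<bar>r - f y\<bar>" unfolding iso[OF s y] by (intro tendsto_intros lim)
      ultimately show ?thesis by (rule LIMSEQ_unique)
    qed
    have "0 \<le> r" using LIMSEQ_le_const[OF lim, of 0] f0[OF s] by blast
    then have fx: "f x = r" using xy[OF AS] d_comm[OF X(1) x(1)] fA by (simp add: f_def)
    moreover have "r \<le> D" using LIMSEQ_le_const2[OF lim, of D] fD[OF s] by blast
    ultimately have "x \<in> S" using ext x(1) xy by simp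
    then show ?thesis using fx by blast
  qed
  have full: "\<exists>x\<in>S. f x = r" if r: "0 \<le> r" "r \<le> D" for r
  proof (rule ccontr)
    assume no: "\<not> ?thesis"
    \<comment> \<open>If \<open>r\<close> is not a value of \<open>f\<close>, then \<open>p\<close>
      and \<open>q\<close> at \<open>Sup U\<close> and \<open>Inf V\<close> bound a gap of
      \<open>S\<close> around \<open>r\<close>. A point between \<open>p\<close> and
      \<open>q\<close> fits all distances, since every point of \<open>S\<close> lies on one side of
      the gap; so it would belong to \<open>S\<close>.\<close>
    define U where "U = {f x |x. x \<in> S \<and> f x \<le> r}"
    define V where "V = {f x |x. x \<in> S \<and> r \<le> f x}"
    have U: "0 \<in> U" "bdd_above U" unfolding U_def using AS fA r by (auto intro!: bdd_aboveI[of _ r] exI[of _ A])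
    have V: "D \<in> V" "bdd_below V" unfolding V_def using BS fA r by (auto intro!: bdd_belowI[of _ r] exI[of _ B])
    have "\<exists>x\<in>S. f x = Sup U"
    proof -
      have "\<forall>n::nat. \<exists>x. x \<in> S \<and> Sup U - 1 / Suc n < f x \<and> f x \<le> Sup U"
      proof
        fix n :: nat
        have "Sup U - 1 / Suc n < Sup U" by simp
        then obtain z where "z \<in> U" "Sup U - 1 / Suc n < z" using less_cSup_iff[of U] U by blast
        then show "\<exists>x. x \<in> S \<and> Sup U - 1 / Suc n < f x \<and> f x \<le> Sup U" using cSup_upper[OF _ U(2)] unfolding U_def by blast
      qed
      then obtain s where s: "\<And>n. s n \<in> S" "\<And>n. Sup U - 1 / Suc n < f (s n)" "\<And>n. f (s n) \<le> Sup U" unfolding choice_iff by blast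
      have "(\<lambda>n. 1 / real (Suc n)) \<longlonglongrightarrow> 0" using LIMSEQ_inverse_real_of_nat by (simp add: inverse_eq_divide)
      then have "(\<lambda>n. f (s n) - Sup U) \<longlonglongrightarrow> 0"
      proof (rule Lim_null_comparison[rotated], intro always_eventually allI)
        show "norm (f (s n) - Sup U) \<le> 1 / real (Suc n)" for n using s(2,3)[of n] by (simp only: real_norm_def abs_le_iff) linarith
      qed
      then show ?thesis by (rule closed[OF s(1) LIM_zero_cancel])
    qed
    then obtain p where p: "p \<in> S" "f p = Sup U" by blast
    have "\<exists>x\<in>S. f x = Inf V"
    proof -
      have "\<forall>n::nat. \<exists>x. x \<in> S \<and> f x < Inf V + 1 / Suc n \<and> Inf V \<le> f x"
      proof
        fix n :: nat
        have "Inf V < Inf V + 1 / Suc n" by simp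
        then obtain z where "z \<in> V" "z < Inf V + 1 / Suc n" using cInf_less_iff[of V] V by blast
        then show "\<exists>x. x \<in> S \<and> f x < Inf V + 1 / Suc n \<and> Inf V \<le> f x" using cInf_lower[OF _ V(2)] unfolding V_def by blast
      qed
      then obtain s where s: "\<And>n. s n \<in> S" "\<And>n. f (s n) < Inf V + 1 / Suc n" "\<And>n. Inf V \<le> f (s n)" unfolding choice_iff by blast
      have "(\<lambda>n. 1 / real (Suc n)) \<longlonglongrightarrow> 0" using LIMSEQ_inverse_real_of_nat by (simp add: inverse_eq_divide)
      then have "(\<lambda>n. f (s n) - Inf V) \<longlonglongrightarrow> 0"
      proof (rule Lim_null_comparison[rotated], intro always_eventually allI)
        show "norm (f (s n) - Inf V) \<le> 1 / real (Suc n)" for n using s(2,3)[of n] by (simp only: real_norm_def abs_le_iff) linarith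
      qed
      then show ?thesis by (rule closed[OF s(1) LIM_zero_cancel])
    qed
    then obtain q where q: "q \<in> S" "f q = Inf V" by blast
    have gap: "f y \<le> f p \<or> f q \<le> f y" if "y \<in> S" for y
    proof (cases "f y \<le> r")
      case True
      then have "f y \<in> U" using that unfolding U_def by blast
      then show ?thesis using cSup_upper[OF _ U(2)] p(2) by simp
    next
      case False
      then have "r \<le> f y" by simp
      then have "f y \<in> V" using that unfolding V_def by blast
      then show ?thesis using cInf_lower[OF _ V(2)] q(2) by simp
    qed
    have "Sup U \<le> r" using U(1) by (intro cSup_least) (auto simp: U_def)
    moreover have "r \<le> Inf V" using V(1) by (intro cInf_greatest) (auto simp: V_def)
    moreover have "f p \<noteq> r" "f q \<noteq> r" using no p(1) q(1) by auto
    ultimately have pq: "f p < r" "r < f q" using p(2) q(2) by auto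
    then have "p \<noteq> q" by auto
    then obtain M where M: "M \<in> X" "M \<noteq> p" "M \<noteq> q" "d p M + d M q = d p q" using btw[OF SX[OF p(1)] SX[OF q(1)]] by blast
    have dpq: "d p q = f q - f p" using iso[OF p(1) q(1)] pq by simp
    have pos: "0 < d p M" "0 < d M q" using d_pos SX p(1) q(1) M(1-3) by auto
    have fM: "f M = f p + d p M"
      using d_tri[OF X(1) SX[OF p(1)] M(1)] d_tri[OF X(1) M(1) SX[OF q(1)]] M(4) dpq unfolding f_def by linarith
    have "M \<in> S"
    proof (rule ext[OF M(1)])
      show "f M \<le> D" using fM M(4) dpq pos fD[OF q(1)] by linarith
      fix y assume y: "y \<in> S"
      note Y = SX[OF y]
      have "d M y \<le> d p M + d p y" "d p y \<le> d p M + d M y" "d M y \<le> d M q + d q y" "d q y \<le> d M q + d M y"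
        using d_tri[OF M(1) SX[OF p(1)] Y] d_tri[OF SX[OF p(1)] M(1) Y] d_tri[OF M(1) SX[OF q(1)] Y] d_tri[OF SX[OF q(1)] M(1) Y]
          d_comm[OF M(1) SX[OF p(1)]] d_comm[OF M(1) SX[OF q(1)]] by linarith+
      note t = this
      have e: "d p y = \<bar>f p - f y\<bar>" "d q y = \<bar>f q - f y\<bar>" using iso p(1) q(1) y by auto
      show "d M y = \<bar>f M - f y\<bar>"
      proof (rule disjE[OF gap[OF y]])
        assume le: "f y \<le> f p"
        then have "d p y = f p - f y" "d q y = f q - f y" using e pq by auto
        then have "d M y = f M - f y" using t fM M(4) dpq by linarith
        then show ?thesis using le fM pos by simp
      next
        assume le: "f q \<le> f y"
        then have "d p y = f y - f p" "d q y = f y - f q" using e pq by auto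
        then have "d M y = f y - f M" using t fM M(4) dpq by linarith
        then show ?thesis using le fM pos M(4) dpq by simp
      qed
    qed
    then have "f M \<le> f p \<or> f q \<le> f M" by (rule gap)
    moreover have "f p < f M" "f M < f q" using fM M(4) dpq pos by linarith+
    ultimately show False by linarith
  qed
  have "\<forall>r. \<exists>x. 0 \<le> r \<longrightarrow> r \<le> D \<longrightarrow> x \<in> S \<and> f x = r" using full by blast
  then obtain \<alpha> where \<alpha>: "\<And>r. 0 \<le> r \<Longrightarrow> r \<le> D \<Longrightarrow> \<alpha> r \<in> S \<and> f (\<alpha> r) = r" unfolding choice_iff by blast
  have "geod X d \<alpha> D" unfolding geod_def using D \<alpha> SX iso by auto
  moreover have "\<alpha> 0 = A"
  proof -
    have "\<alpha> 0 \<in> S" "f (\<alpha> 0) = 0" using \<alpha>[of 0] D by auto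
    then show ?thesis using d_zero[OF X(1) SX] unfolding f_def by blast
  qed
  moreover have "\<alpha> D = B"
  proof -
    have S': "\<alpha> D \<in> S" "f (\<alpha> D) = D" using \<alpha>[of D] D by auto
    then have "d (\<alpha> D) B = 0" using iso[OF S'(1) BS] fA by simp
    then show ?thesis using d_zero[OF SX[OF S'(1)] X(2)] by simp
  qed
  ultimately show "\<exists>\<alpha>. geod X d \<alpha> (d A B) \<and> \<alpha> 0 = A \<and> \<alpha> (d A B) = B" unfolding D_def by blast
qed

end

section \<open>Rescaling of the metric\<close>

lemma metric_on_scale:
  assumes "metric_on X \<rho>" "0 < c"
  shows "metric_on X (\<lambda>x y. c * \<rho> x y)"
  using assms by (auto simp: metric_on_def semimetric_on_def simp flip: distrib_left)

lemma geod_scale: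
  assumes "geod X \<rho> \<alpha> l" "0 < c"
  shows "geod X (\<lambda>x y. c * \<rho> x y) (\<lambda>t. \<alpha> (t / c)) (c * l)"
  unfolding geod_def
proof (intro conjI ballI)
  have b: "0 \<le> s / c" "s / c \<le> l" if "s \<in> {0..c * l}" for s
    using that assms(2) by (auto simp: pos_divide_le_eq mult.commute)
  show "0 \<le> c * l" using geodD(1)[OF assms(1)] assms(2) by simp
  show "\<alpha> (s / c) \<in> X" if "s \<in> {0..c * l}" for s using geodD(2)[OF assms(1)] b[OF that] by auto
  show "c * \<rho> (\<alpha> (s / c)) (\<alpha> (t / c)) = \<bar>s - t\<bar>" if "s \<in> {0..c * l}" "t \<in> {0..c * l}" for s t
  proof -
    have "c * \<bar>s / c - t / c\<bar> = \<bar>c * (s / c - t / c)\<bar>" using assms(2) by (simp add: abs_mult)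
    also have "c * (s / c - t / c) = s - t" using assms(2) by (simp add: right_diff_distrib)
    finally show ?thesis using geodD(3)[OF assms(1) b[OF that(1)] b[OF that(2)]] by simp
  qed
qed

lemma shortest_scale_imp:
  assumes "metric_on X \<rho>" "0 < c" "shortest X \<rho> L A B"
  shows "shortest X (\<lambda>x y. c * \<rho> x y) L A B"
proof (rule shortest_imp_geod[OF assms(1,3)])
  fix \<alpha> assume g: "geod X \<rho> \<alpha> (\<rho> A B)" "\<alpha> 0 = A" "\<alpha> (\<rho> A B) = B" "L = \<alpha> ` {0..\<rho> A B}"
  have "(\<lambda>t. \<alpha> (t / c)) ` {0..c * \<rho> A B} = L"
  proof -
    have "(\<lambda>t. t / c) ` {0..c * \<rho> A B} = {0..\<rho> A B}"
    proof (intro equalityI subsetI)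
      fix x assume "x \<in> {0..\<rho> A B}"
      then show "x \<in> (\<lambda>t. t / c) ` {0..c * \<rho> A B}" using assms(2) by (intro image_eqI[of _ _ "c * x"]) auto
    qed (use assms(2) in \<open>auto simp: pos_divide_le_eq mult.commute\<close>)
    then show ?thesis unfolding g(4) by (metis image_image)
  qed
  then show ?thesis using geod_imp_shortest[OF geod_scale[OF g(1) assms(2)]] g(2,3) assms(2) by simp
qed

lemma shortest_scale:
  assumes "metric_on X \<rho>" "0 < c"
  shows "shortest X (\<lambda>x y. c * \<rho> x y) L A B \<longleftrightarrow> shortest X \<rho> L A B"
proof
  assume "shortest X (\<lambda>x y. c * \<rho> x y) L A B"
  then have "shortest X (\<lambda>x y. (1 / c) * (c * \<rho> x y)) L A B"
    using shortest_scale_imp[OF metric_on_scale[OF assms], of "1 / c" L A B] assms(2) by simp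
  then show "shortest X \<rho> L A B" using assms(2) by simp
qed (rule shortest_scale_imp[OF assms])

lemma image_reverse: "(\<lambda>s. \<eta> (l - s)) ` {0..l} = \<eta> ` {0..l::real}"
proof -
  have "(\<lambda>s. \<eta> (l - s)) ` {0..l} = \<eta> ` ((-) l ` {0..l})" by (simp only: image_image)
  then show ?thesis by simp
qed

lemma shortest_sym:
  assumes "metric_on X \<rho>" "shortest X \<rho> L A B"
  shows "shortest X \<rho> L B A"
proof (rule shortest_imp_geod[OF assms])
  fix \<alpha> assume g: "geod X \<rho> \<alpha> (\<rho> A B)" "\<alpha> 0 = A" "\<alpha> (\<rho> A B) = B" "L = \<alpha> ` {0..\<rho> A B}"
  have "(\<lambda>t. \<alpha> (\<rho> A B - t)) ` {0..\<rho> A B} = L"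
    unfolding g(4) by (rule image_reverse)
  moreover have "geod X \<rho> (\<lambda>t. \<alpha> (\<rho> A B - t)) (\<rho> A B)"
    by (rule geod_rev_sub[OF g(1)]) (use geodD(1)[OF g(1)] in auto)
  ultimately show ?thesis using geod_imp_shortest[of X \<rho> "\<lambda>t. \<alpha> (\<rho> A B - t)" "\<rho> A B"] g(2,3) by simp
qed

text \<open>Euclidean comparison angles do not change under scaling; only the radius
  \<open>e\<close> does, which amounts to a reindexing of the infimum.\<close>

lemma upper_angle_scale:
  assumes "0 < c"
  shows "upper_angle (\<lambda>x y. c * \<rho> x y) P L N = upper_angle \<rho> P L N"
proof -
  have a: "angle0 (\<lambda>x y. c * \<rho> x y) P x y = angle0 \<rho> P x y" for x y
  proof -
    have e1: "(c * \<rho> P x)\<^sup>2 + (c * \<rho> P y)\<^sup>2 - (c * \<rho> x y)\<^sup>2 = c\<^sup>2 * ((\<rho> P x)\<^sup>2 + (\<rho> P y)\<^sup>2 - (\<rho> x y)\<^sup>2)"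
      by (simp add: power_mult_distrib right_diff_distrib distrib_left)
    have e2: "2 * (c * \<rho> P x) * (c * \<rho> P y) = c\<^sup>2 * (2 * \<rho> P x * \<rho> P y)" by (simp add: power2_eq_square)
    show ?thesis unfolding angle0_def e1 e2 using assms by simp
  qed
  define G where "G e = Sup {angle0 \<rho> P x y |x y. x \<in> L - {P} \<and> y \<in> N - {P} \<and> \<rho> P x < e \<and> \<rho> P y < e}" for e
  have "(\<lambda>e. e / c) ` {e. 0 < e} = {e. 0 < e}"
  proof (intro equalityI subsetI)
    fix x :: real assume "x \<in> {e. 0 < e}"
    then show "x \<in> (\<lambda>e. e / c) ` {e. 0 < e}" using assms by (intro image_eqI[of _ _ "c * x"]) auto
  qed (use assms in auto)
  then have im: "G ` {e. 0 < e} = (\<lambda>e. G (e / c)) ` {e. 0 < e}" by (metis image_image)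
  have "upper_angle (\<lambda>x y. c * \<rho> x y) P L N = (INF e\<in>{e. 0 < e}. G (e / c))"
    unfolding upper_angle_def a G_def using assms by (simp add: pos_less_divide_eq mult.commute)
  also have "\<dots> = (INF e\<in>{e. 0 < e}. G e)" by (simp only: im)
  also have "\<dots> = upper_angle \<rho> P L N" unfolding upper_angle_def G_def by simp
  finally show ?thesis .
qed

lemma weakly_convex_scale:
  assumes "weakly_convex X \<rho>" "0 < c"
  shows "weakly_convex X (\<lambda>x y. c * \<rho> x y)"
  unfolding weakly_convex_def
proof (intro ballI)
  fix A B assume X: "A \<in> X" "B \<in> X"
  from assms(1) X obtain l where l: "0 < l" "l < 1"
    and l': "\<And>e. 0 < e \<Longrightarrow> \<exists>M\<in>X. \<bar>\<rho> A M - l * \<rho> A B\<bar> < e \<and> \<bar>\<rho> B M - (1 - l) * \<rho> A B\<bar> < e"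
    unfolding weakly_convex_def by blast
  have "\<exists>M\<in>X. \<bar>c * \<rho> A M - l * (c * \<rho> A B)\<bar> < e \<and> \<bar>c * \<rho> B M - (1 - l) * (c * \<rho> A B)\<bar> < e" if "0 < e" for e
  proof -
    have "0 < e / c" using that assms(2) by simp
    from l'[OF this] obtain M where M: "M \<in> X" "\<bar>\<rho> A M - l * \<rho> A B\<bar> < e / c" "\<bar>\<rho> B M - (1 - l) * \<rho> A B\<bar> < e / c" by blast
    have s: "\<bar>c * x - m * (c * y)\<bar> < e" if "\<bar>x - m * y\<bar> < e / c" for x y m
    proof -
      have "\<bar>c * x - m * (c * y)\<bar> = \<bar>c * (x - m * y)\<bar>" by (simp add: right_diff_distrib mult.left_commute)
      also have "\<dots> = c * \<bar>x - m * y\<bar>" using assms(2) by (simp add: abs_mult)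
      also have "\<dots> < e" using that assms(2) by (simp add: pos_less_divide_eq mult.commute)
      finally show ?thesis .
    qed
    show ?thesis using M(1) s[OF M(2)] s[OF M(3)] by blast
  qed
  then show "\<exists>l>0. l < 1 \<and> (\<forall>e>0. \<exists>M\<in>X. \<bar>c * \<rho> A M - l * (c * \<rho> A B)\<bar> < e \<and> \<bar>c * \<rho> B M - (1 - l) * (c * \<rho> A B)\<bar> < e)"
    using l by blast
qed

lemma cauchy_complete_scale:
  assumes "cauchy_complete X \<rho>" "0 < c"
  shows "cauchy_complete X (\<lambda>x y. c * \<rho> x y)"
  unfolding cauchy_complete_def
proof (intro allI impI)
  fix s :: "nat \<Rightarrow> 'a" assume s: "\<forall>n. s n \<in> X" and ca: "\<forall>e>0. \<exists>N. \<forall>m\<ge>N. \<forall>n\<ge>N. c * \<rho> (s m) (s n) < e"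
  have "\<forall>e>0. \<exists>N. \<forall>m\<ge>N. \<forall>n\<ge>N. \<rho> (s m) (s n) < e"
  proof (intro allI impI)
    fix e :: real assume "0 < e"
    then have "0 < c * e" using assms(2) by simp
    then obtain N where "\<forall>m\<ge>N. \<forall>n\<ge>N. c * \<rho> (s m) (s n) < c * e" using ca by blast
    then show "\<exists>N. \<forall>m\<ge>N. \<forall>n\<ge>N. \<rho> (s m) (s n) < e" using assms(2) by auto
  qed
  then obtain x where x: "x \<in> X" "(\<lambda>n. \<rho> (s n) x) \<longlonglongrightarrow> 0" using assms(1) s unfolding cauchy_complete_def by blast
  then show "\<exists>x\<in>X. (\<lambda>n. c * \<rho> (s n) x) \<longlonglongrightarrow> 0" using tendsto_mult_right_zero by blast
qed

section \<open>Equivalence of the four-point condition with the bound for angle sums\<close>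

context mspace
begin

lemma geodesically_connected_iff: "geodesically_connected X d \<longleftrightarrow> connected"
proof
  assume gc: "geodesically_connected X d"
  show connected
    unfolding connected_def
  proof (intro ballI)
    fix A B assume "A \<in> X" "B \<in> X"
    then obtain L where L: "shortest X d L A B" using gc unfolding geodesically_connected_def by blast
    show "\<exists>\<alpha>. geod X d \<alpha> (d A B) \<and> \<alpha> 0 = A \<and> \<alpha> (d A B) = B" by (rule shortest_imp_geod[OF met L]) blast
  qed
next
  assume con: connected
  show "geodesically_connected X d"
    unfolding geodesically_connected_def
  proof (intro conjI met ballI)
    fix A B assume "A \<in> X" "B \<in> X"
    then obtain \<alpha> where "geod X d \<alpha> (d A B)" "\<alpha> 0 = A" "\<alpha> (d A B) = B" using con unfolding connected_def by blast
    then show "\<exists>L. shortest X d L A B" using geod_imp_shortest by metis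
  qed
qed

lemma CAT_upper_angle:
  assumes cat: CAT and L: "shortest X d L A B" and N: "shortest X d N A D" and ne: "A \<noteq> B" "A \<noteq> D"
  shows "upper_angle d A L N \<le> mang (d A B) (d A D) (d B D)"
proof (rule shortest_imp_geod[OF met L], rule shortest_imp_geod[OF met N])
  fix \<alpha> \<beta> assume a: "geod X d \<alpha> (d A B)" "\<alpha> 0 = A" "\<alpha> (d A B) = B" "L = \<alpha> ` {0..d A B}" "A \<in> X" "B \<in> X"
    and b: "geod X d \<beta> (d A D)" "\<beta> 0 = A" "\<beta> (d A D) = D" "N = \<beta> ` {0..d A D}" "D \<in> X"
  have "ua \<alpha> \<beta> (d A B) (d A D) \<le> arccos (J \<alpha> \<beta> (d A B) (d A D))"
    using a b ne d_pos by (intro CAT_angle[OF cat a(1) b(1)]) auto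
  then show ?thesis unfolding ua_def J_def mang_def a(2-4) b(3,4) .
qed

text \<open>The angle condition in the definition of the domains, for the normalized curvature
  \<open>k\<close> and with model angles expressed by \<open>mang\<close>.\<close>

definition angle_sums :: bool where
  "angle_sums \<longleftrightarrow> (\<forall>A\<in>X. \<forall>B\<in>X. \<forall>D\<in>X. \<forall>L M N. A \<noteq> B \<and> B \<noteq> D \<and> D \<noteq> A \<and>
     shortest X d L A B \<and> shortest X d M B D \<and> shortest X d N D A \<longrightarrow>
     upper_angle d A L N + upper_angle d B L M + upper_angle d D N M
       \<le> mang (d A B) (d A D) (d B D) + mang (d A B) (d B D) (d A D) + mang (d A D) (d B D) (d A B))"

lemma CAT_angle_sums:
  assumes cat: CAT
  shows angle_sums
  unfolding angle_sums_def
proof (intro ballI allI impI, elim conjE)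
  fix A B D L M N assume X: "A \<in> X" "B \<in> X" "D \<in> X" and ne: "A \<noteq> B" "B \<noteq> D" "D \<noteq> A"
    and sh: "shortest X d L A B" "shortest X d M B D" "shortest X d N D A"
  note sy = shortest_sym[OF met sh(1)] shortest_sym[OF met sh(2)] shortest_sym[OF met sh(3)]
  have "upper_angle d A L N \<le> mang (d A B) (d A D) (d B D)"
    by (rule CAT_upper_angle[OF cat sh(1) sy(3) ne(1) ne(3)[symmetric]])
  moreover have "upper_angle d B L M \<le> mang (d A B) (d B D) (d A D)"
    using CAT_upper_angle[OF cat sy(1) sh(2) ne(1)[symmetric] ne(2)] unfolding d_comm[OF X(2,1)] .
  moreover have "upper_angle d D N M \<le> mang (d A D) (d B D) (d A B)"
    using CAT_upper_angle[OF cat sh(3) sy(2) ne(3) ne(2)[symmetric]] unfolding d_comm[OF X(3,1)] d_comm[OF X(3,2)] .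
  ultimately show "upper_angle d A L N + upper_angle d B L M + upper_angle d D N M
      \<le> mang (d A B) (d A D) (d B D) + mang (d A B) (d B D) (d A D) + mang (d A D) (d B D) (d A B)"
    by linarith
qed

lemma angle_sums_angsum:
  assumes as: angle_sums
  shows angsum
  unfolding angsum_def
proof (intro allI impI)
  fix \<alpha> \<beta> \<gamma> T U V
  assume g: "geod X d \<alpha> T" "geod X d \<beta> U" "geod X d \<gamma> V" and pos: "0 < T" "0 < U" "0 < V"
    and eq: "\<alpha> 0 = \<beta> 0" "\<alpha> T = \<gamma> 0" "\<beta> U = \<gamma> V"
  have X: "\<alpha> 0 \<in> X" "\<alpha> T \<in> X" "\<beta> U \<in> X" using geodD(2)[OF g(1)] geodD(2)[OF g(2)] pos by auto
  have dd: "d (\<alpha> 0) (\<alpha> T) = T" "d (\<alpha> 0) (\<beta> U) = U" "d (\<alpha> T) (\<beta> U) = V"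
    using geodD(3)[OF g(1), of 0 T] geodD(3)[OF g(2), of 0 U] geodD(3)[OF g(3), of 0 V] pos unfolding eq by auto
  have ne: "\<alpha> 0 \<noteq> \<alpha> T" "\<alpha> T \<noteq> \<beta> U" "\<beta> U \<noteq> \<alpha> 0" using dd pos d_self[OF X(1)] d_self[OF X(2)] by force+
  have sh: "shortest X d (\<alpha> ` {0..T}) (\<alpha> 0) (\<alpha> T)" "shortest X d (\<gamma> ` {0..V}) (\<alpha> T) (\<beta> U)" "shortest X d (\<beta> ` {0..U}) (\<beta> U) (\<alpha> 0)"
    using geod_imp_shortest[OF g(1)] geod_imp_shortest[OF g(3)] shortest_sym[OF met geod_imp_shortest[OF g(2)]] unfolding eq by auto
  have "upper_angle d (\<alpha> 0) (\<alpha> ` {0..T}) (\<beta> ` {0..U}) + upper_angle d (\<alpha> T) (\<alpha> ` {0..T}) (\<gamma> ` {0..V}) + upper_angle d (\<beta> U) (\<beta> ` {0..U}) (\<gamma> ` {0..V})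
    \<le> mang T U V + mang T V U + mang U V T"
    using as[unfolded angle_sums_def, rule_format, OF X, of "\<alpha> ` {0..T}" "\<gamma> ` {0..V}" "\<beta> ` {0..U}"] ne sh unfolding dd by simp
  then show "ua \<alpha> \<beta> T U + ua (\<lambda>s. \<alpha> (T - s)) \<gamma> T V + ua (\<lambda>s. \<beta> (U - s)) (\<lambda>s. \<gamma> (V - s)) U V
       \<le> mang T U V + mang T V U + mang U V T"
    unfolding ua_def image_reverse by simp
qed

definition four_point :: "real \<Rightarrow> bool" where
  "four_point sg \<longleftrightarrow> (\<forall>P1\<in>X. \<forall>P2\<in>X. \<forall>P3\<in>X. \<forall>P4\<in>X.
     sg * k * ((C (d P2 P3) + C (d P1 P2) * C (d P3 P4)) * (1 + C (d P1 P4))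
        - (C (d P1 P2) + C (d P2 P4)) * (C (d P3 P4) + C (d P1 P3)))
      \<le> S (d P1 P2) * S (d P3 P4) * (1 + C (d P1 P4)))"

text \<open>Both implications pass through \<open>CAT\<close>, which does not mention
  \<open>sg\<close>; this is where the two signs become equivalent.\<close>

lemma four_point_iff_angle_sums:
  assumes con: connected and sg: "sg = 1 \<or> sg = -1"
  shows "four_point sg \<longleftrightarrow> angle_sums"
proof
  assume fp: "four_point sg"
  interpret fourpt k X d sg
  proof
    show "sg = 1 \<or> sg = -1" by (rule sg)
  qed (use fp in \<open>simp add: four_point_def\<close>)
  show angle_sums by (rule CAT_angle_sums[OF fourpt_CAT[OF con]])
next
  assume as: angle_sums
  have CAT
    by (rule angle_CAT[OF con angsum_angle[OF con angle_sums_angsum[OF as]]])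
  then show "four_point sg" unfolding four_point_def using CAT_four_point[OF _ con sg] by blast
qed

end

section \<open>Distance matrices and the curvature classes\<close>

definition scaled_four_point :: "real \<Rightarrow> real \<Rightarrow> real \<Rightarrow> 'a set \<Rightarrow> ('a \<Rightarrow> 'a \<Rightarrow> real) \<Rightarrow> bool" where
  "scaled_four_point k sg \<kappa> X \<rho> \<longleftrightarrow> (\<forall>P1\<in>X. \<forall>P2\<in>X. \<forall>P3\<in>X. \<forall>P4\<in>X.
     sg * k * ((cs k (\<kappa> * \<rho> P2 P3) + cs k (\<kappa> * \<rho> P1 P2) * cs k (\<kappa> * \<rho> P3 P4)) * (1 + cs k (\<kappa> * \<rho> P1 P4))
        - (cs k (\<kappa> * \<rho> P1 P2) + cs k (\<kappa> * \<rho> P2 P4)) * (cs k (\<kappa> * \<rho> P3 P4) + cs k (\<kappa> * \<rho> P1 P3)))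
      \<le> sn k (\<kappa> * \<rho> P1 P2) * sn k (\<kappa> * \<rho> P3 P4) * (1 + cs k (\<kappa> * \<rho> P1 P4)))"

lemma pt4_simps: "pt4 P1 P2 P3 P4 1 = P1" "pt4 P1 P2 P3 P4 2 = P2" "pt4 P1 P2 P3 P4 3 = P3" "pt4 P1 P2 P3 P4 4 = P4"
  by (simp_all add: pt4_def)

lemma dist_mat4_M4:
  assumes "semimetric_on X \<rho>" "P1 \<in> X" "P2 \<in> X" "P3 \<in> X" "P4 \<in> X"
  shows "dist_mat4 \<rho> P1 P2 P3 P4 \<in> M4"
proof -
  have "pt4 P1 P2 P3 P4 i \<in> X" for i using assms by (simp add: pt4_def)
  then show ?thesis using assms(1) unfolding M4_def dist_mat4_def semimetric_on_def by auto
qed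

lemma global_class_iff:
  "global_class X \<rho> K \<longleftrightarrow> (\<forall>P1\<in>X. \<forall>P2\<in>X. \<forall>P3\<in>X. \<forall>P4\<in>X. dist_mat4 \<rho> P1 P2 P3 P4 \<in> K)"
  unfolding global_class_def K4_def by blast

lemma global_class_Ksph:
  assumes "semimetric_on X \<rho>"
  shows "global_class X \<rho> (Ksph \<sigma> \<kappa>) \<longleftrightarrow> diam_le X \<rho> (pi / (2 * \<kappa>)) \<and> scaled_four_point 1 (if \<sigma> then 1 else -1) \<kappa> X \<rho>"
    (is "?G \<longleftrightarrow> ?D \<and> ?F")
proof
  assume G: ?G
  have D: ?D unfolding diam_le_def
  proof (intro ballI)
    fix A B assume "A \<in> X" "B \<in> X"
    \<comment> \<open>Every distance occurs as an entry of some matrix, so the bound on entries is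
      the diameter bound.\<close>
    then have "dist_mat4 \<rho> A B A B \<in> Ksph \<sigma> \<kappa>" using G unfolding global_class_iff by blast
    then have "dist_mat4 \<rho> A B A B 1 2 \<le> pi / (2 * \<kappa>)" unfolding Ksph_def by simp
    then show "\<rho> A B \<le> pi / (2 * \<kappa>)" unfolding dist_mat4_def pt4_simps .
  qed
  have ?F unfolding scaled_four_point_def
  proof (intro ballI)
    fix P1 P2 P3 P4 assume "P1 \<in> X" "P2 \<in> X" "P3 \<in> X" "P4 \<in> X"
    then have "dist_mat4 \<rho> P1 P2 P3 P4 \<in> Ksph \<sigma> \<kappa>" using G unfolding global_class_iff by blast
    then show "(if \<sigma> then 1 else -1) * 1 * ((cs 1 (\<kappa> * \<rho> P2 P3) + cs 1 (\<kappa> * \<rho> P1 P2) * cs 1 (\<kappa> * \<rho> P3 P4)) * (1 + cs 1 (\<kappa> * \<rho> P1 P4))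
        - (cs 1 (\<kappa> * \<rho> P1 P2) + cs 1 (\<kappa> * \<rho> P2 P4)) * (cs 1 (\<kappa> * \<rho> P3 P4) + cs 1 (\<kappa> * \<rho> P1 P3)))
      \<le> sn 1 (\<kappa> * \<rho> P1 P2) * sn 1 (\<kappa> * \<rho> P3 P4) * (1 + cs 1 (\<kappa> * \<rho> P1 P4))"
      unfolding Ksph_def dist_mat4_def mem_Collect_eq pt4_simps cs_def sn_def by simp
  qed
  with D show "?D \<and> ?F" by blast
next
  assume DF: "?D \<and> ?F"
  show ?G unfolding global_class_iff
  proof (intro ballI)
    fix P1 P2 P3 P4 assume P: "P1 \<in> X" "P2 \<in> X" "P3 \<in> X" "P4 \<in> X"
    then have "pt4 P1 P2 P3 P4 i \<in> X" for i by (simp add: pt4_def)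
    then have b: "\<forall>i\<in>{1..4}. \<forall>j\<in>{1..4}. dist_mat4 \<rho> P1 P2 P3 P4 i j \<le> pi / (2 * \<kappa>)"
      using DF unfolding diam_le_def dist_mat4_def by blast
    have f: "(if \<sigma> then 1 else -1) * 1 * ((cs 1 (\<kappa> * \<rho> P2 P3) + cs 1 (\<kappa> * \<rho> P1 P2) * cs 1 (\<kappa> * \<rho> P3 P4)) * (1 + cs 1 (\<kappa> * \<rho> P1 P4))
        - (cs 1 (\<kappa> * \<rho> P1 P2) + cs 1 (\<kappa> * \<rho> P2 P4)) * (cs 1 (\<kappa> * \<rho> P3 P4) + cs 1 (\<kappa> * \<rho> P1 P3)))
      \<le> sn 1 (\<kappa> * \<rho> P1 P2) * sn 1 (\<kappa> * \<rho> P3 P4) * (1 + cs 1 (\<kappa> * \<rho> P1 P4))"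
      using DF P unfolding scaled_four_point_def by blast
    show "dist_mat4 \<rho> P1 P2 P3 P4 \<in> Ksph \<sigma> \<kappa>"
      unfolding Ksph_def mem_Collect_eq
    proof (intro conjI)
      show "dist_mat4 \<rho> P1 P2 P3 P4 \<in> M4" by (rule dist_mat4_M4[OF assms P])
    qed (rule b, use f in \<open>unfold dist_mat4_def pt4_simps cs_def sn_def, simp\<close>)
  qed
qed

lemma global_class_Khyp:
  assumes "semimetric_on X \<rho>"
  shows "global_class X \<rho> (Khyp \<sigma> \<kappa>) \<longleftrightarrow> scaled_four_point (-1) (if \<sigma> then 1 else -1) \<kappa> X \<rho>"
  unfolding global_class_iff scaled_four_point_def
proof (intro ball_cong refl)
  fix P1 P2 P3 P4 assume P: "P1 \<in> X" "P2 \<in> X" "P3 \<in> X" "P4 \<in> X"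
  \<comment> \<open>The hyperbolic condition has the two products in the opposite order; the factor
    \<open>k = -1\<close> accounts for this.\<close>
  have e: "s * (-1) * (u - v) = s * (v - u)" for s u v :: real by (simp add: algebra_simps)
  show "dist_mat4 \<rho> P1 P2 P3 P4 \<in> Khyp \<sigma> \<kappa> \<longleftrightarrow>
     (if \<sigma> then 1 else -1) * (-1) * ((cs (-1) (\<kappa> * \<rho> P2 P3) + cs (-1) (\<kappa> * \<rho> P1 P2) * cs (-1) (\<kappa> * \<rho> P3 P4)) * (1 + cs (-1) (\<kappa> * \<rho> P1 P4))
        - (cs (-1) (\<kappa> * \<rho> P1 P2) + cs (-1) (\<kappa> * \<rho> P2 P4)) * (cs (-1) (\<kappa> * \<rho> P3 P4) + cs (-1) (\<kappa> * \<rho> P1 P3)))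
      \<le> sn (-1) (\<kappa> * \<rho> P1 P2) * sn (-1) (\<kappa> * \<rho> P3 P4) * (1 + cs (-1) (\<kappa> * \<rho> P1 P4))"
    using dist_mat4_M4[OF assms P] unfolding e Khyp_def mem_Collect_eq dist_mat4_def pt4_simps cs_def sn_def
    by simp
qed

lemma model_angle_scale:
  assumes "0 < \<kappa>" "k = 1 \<or> k = -1"
  shows "model_angle (k * \<kappa>\<^sup>2) a b c = arccos (k * (cs k (\<kappa> * c) - cs k (\<kappa> * a) * cs k (\<kappa> * b)) / (sn k (\<kappa> * a) * sn k (\<kappa> * b)))"
  using assms(2)
proof
  assume "k = 1"
  then show ?thesis using assms(1) by (simp add: model_angle_def cs_def sn_def)
next
  assume "k = -1"
  then show ?thesis using assms(1) by (simp add: model_angle_def cs_def sn_def)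
qed

lemma four_point_iff_ReK_domain:
  fixes X :: "'a set"
  assumes \<kappa>: "0 < \<kappa>" and k: "k = 1 \<or> k = -1" and sg: "sg = 1 \<or> sg = -1"
    and gc: "geodesically_connected X \<rho>" and diam: "k = 1 \<Longrightarrow> diam_le X \<rho> (pi / (2 * \<kappa>))"
  shows "scaled_four_point k sg \<kappa> X \<rho> \<longleftrightarrow> ReK_domain X \<rho> (k * \<kappa>\<^sup>2)"
proof -
  define d where "d = (\<lambda>x y. \<kappa> * \<rho> x y)"
  have met: "metric_on X \<rho>" using gc by (simp add: geodesically_connected_def)
  have bnd: "\<kappa> * \<rho> x y \<le> pi / 2" if "k = 1" "x \<in> X" "y \<in> X" for x y
  proof -
    have "\<rho> x y \<le> pi / (2 * \<kappa>)" using diam that unfolding diam_le_def by blast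
    then have "\<kappa> * \<rho> x y \<le> \<kappa> * (pi / (2 * \<kappa>))" using \<kappa> by (intro mult_left_mono) auto
    then show ?thesis using \<kappa> by simp
  qed
  interpret M: mspace k X d
  proof
    show "metric_on X d" unfolding d_def by (rule metric_on_scale[OF met \<kappa>])
  qed (use k bnd in \<open>auto simp: d_def\<close>)
  have sh: "shortest X d L A B \<longleftrightarrow> shortest X \<rho> L A B" for L A B unfolding d_def by (rule shortest_scale[OF met \<kappa>])
  have ua: "upper_angle d P L N = upper_angle \<rho> P L N" for P L N unfolding d_def by (rule upper_angle_scale[OF \<kappa>])
  have mang: "M.mang (d x y) (d z w) (d u v) = model_angle (k * \<kappa>\<^sup>2) (\<rho> x y) (\<rho> z w) (\<rho> u v)" for x y z w u v
    unfolding M.mang_def model_angle_scale[OF \<kappa> k] d_def ..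
  have con: M.connected
    unfolding M.geodesically_connected_iff[symmetric] using gc M.met by (simp add: geodesically_connected_def sh)
  have "scaled_four_point k sg \<kappa> X \<rho> \<longleftrightarrow> M.four_point sg" unfolding scaled_four_point_def M.four_point_def unfolding d_def ..
  also have "\<dots> \<longleftrightarrow> M.angle_sums" by (rule M.four_point_iff_angle_sums[OF con sg])
  also have "\<dots> \<longleftrightarrow> ReK_domain X \<rho> (k * \<kappa>\<^sup>2)"
  proof -
    \<comment> \<open>Three sides of at most \<open>pi / (2 * \<kappa>)\<close> add up to less than
      \<open>2 * pi / \<kappa>\<close>, so the diameter bound entails the perimeter
      condition.\<close>
    have per: "\<rho> A B + \<rho> B D + \<rho> D A < 2 * pi / sqrt (k * \<kappa>\<^sup>2)" if "0 < k * \<kappa>\<^sup>2" "A \<in> X" "B \<in> X" "D \<in> X" for A B D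
    proof -
      have k1: "k = 1" using that(1) k by auto
      have "\<kappa> * (\<rho> A B + \<rho> B D + \<rho> D A) \<le> 3 * (pi / 2)"
        using bnd[OF k1 that(2,3)] bnd[OF k1 that(3,4)] bnd[OF k1 that(4,2)] by (simp add: distrib_left)
      also have "\<dots> < 2 * pi" using pi_gt_zero by linarith
      finally show ?thesis using k1 \<kappa> by (simp add: pos_less_divide_eq mult.commute)
    qed
    show ?thesis
    proof
      assume as: "M.angle_sums"
      show "ReK_domain X \<rho> (k * \<kappa>\<^sup>2)"
        unfolding ReK_domain_def
        by (intro conjI gc as[unfolded M.angle_sums_def sh ua mang] impI ballI allI per)
    next
      assume R: "ReK_domain X \<rho> (k * \<kappa>\<^sup>2)"
      show "M.angle_sums"
        unfolding M.angle_sums_def sh ua mang by (rule R[unfolded ReK_domain_def, THEN conjunct2, THEN conjunct2])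
    qed
  qed
  finally show ?thesis .
qed

lemma four_point_geodesically_connected:
  fixes X :: "'a set"
  assumes \<kappa>: "0 < \<kappa>" and k: "k = 1 \<or> k = -1" and sg: "sg = 1 \<or> sg = -1"
    and ms: "in_MS X \<rho>" and diam: "k = 1 \<Longrightarrow> diam_le X \<rho> (pi / (2 * \<kappa>))"
    and fp: "scaled_four_point k sg \<kappa> X \<rho>"
  shows "geodesically_connected X \<rho>"
proof -
  define d where "d = (\<lambda>x y. \<kappa> * \<rho> x y)"
  have rho: "\<rho> = (\<lambda>x y. (1 / \<kappa>) * d x y)" using \<kappa> by (simp add: d_def)
  have bnd: "d x y \<le> pi / 2" if "k = 1" "x \<in> X" "y \<in> X" for x y
  proof -
    have "\<rho> x y \<le> pi / (2 * \<kappa>)" using diam that unfolding diam_le_def by blast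
    then have "\<kappa> * \<rho> x y \<le> \<kappa> * (pi / (2 * \<kappa>))" using \<kappa> by (intro mult_left_mono) auto
    then show ?thesis using \<kappa> by (simp add: d_def)
  qed
  have semi: "semimetric_on X d" using ms \<kappa> by (auto simp: in_MS_def semimetric_on_def d_def)
  have four: "sg * k * ((cs k (d P2 P3) + cs k (d P1 P2) * cs k (d P3 P4)) * (1 + cs k (d P1 P4))
        - (cs k (d P1 P2) + cs k (d P2 P4)) * (cs k (d P3 P4) + cs k (d P1 P3)))
      \<le> sn k (d P1 P2) * sn k (d P3 P4) * (1 + cs k (d P1 P4))"
    if "P1 \<in> X" "P2 \<in> X" "P3 \<in> X" "P4 \<in> X" for P1 P2 P3 P4
    using fp that unfolding scaled_four_point_def d_def by blast
  interpret curv k by unfold_locales (rule k)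
  have met: "metric_on X d" by (rule four_point_imp_metric[OF semi bnd sg four])
  interpret M: fourpt k X d sg by unfold_locales (use met bnd sg four in auto)
  have cc: "cauchy_complete X d" and wc: "weakly_convex X d"
    using ms \<kappa> unfolding in_MS_def d_def by (auto intro: cauchy_complete_scale weakly_convex_scale)
  have "geodesically_connected X d"
    unfolding M.geodesically_connected_iff by (rule M.Menger[OF cc M.between_exists[OF wc cc]])
  moreover have "metric_on X \<rho>" unfolding rho by (rule metric_on_scale[OF met]) (use \<kappa> in simp)
  ultimately show ?thesis
    unfolding geodesically_connected_def using shortest_scale[OF \<open>metric_on X \<rho>\<close> \<kappa>] unfolding d_def by blast
qed

theorem theorem4:
  fixes X :: "'a set" and rho :: "'a \<Rightarrow> 'a \<Rightarrow> real" and \<kappa> :: real and \<sigma> :: bool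
  assumes "\<kappa> > 0"
  shows
    "(in_MG X rho \<longrightarrow>
        (global_class X rho (Ksph \<sigma> \<kappa>) \<longleftrightarrow>
           ReK_domain X rho (\<kappa>^2) \<and> diam_le X rho (pi / (2 * \<kappa>)))) \<and>
     (in_MS X rho \<longrightarrow>
        (global_class X rho (Ksph \<sigma> \<kappa>) \<longleftrightarrow>
           ReK_domain X rho (\<kappa>^2) \<and> cauchy_complete X rho \<and> diam_le X rho (pi / (2 * \<kappa>)))) \<and>
     (in_MG X rho \<longrightarrow>
        (global_class X rho (Khyp \<sigma> \<kappa>) \<longleftrightarrow> ReK_domain X rho (- (\<kappa>^2)))) \<and>
     (in_MS X rho \<longrightarrow>
        (global_class X rho (Khyp \<sigma> \<kappa>) \<longleftrightarrow> ReK_domain X rho (- (\<kappa>^2)) \<and> cauchy_complete X rho))"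
proof -
  define sg :: real where "sg = (if \<sigma> then 1 else -1)"
  have sg: "sg = 1 \<or> sg = -1" by (simp add: sg_def)
  have semi: "semimetric_on X rho" if "in_MG X rho \<or> in_MS X rho"
    using that by (auto simp: in_MG_def in_MS_def geodesically_connected_def metric_on_def)
  have sph: "scaled_four_point 1 sg \<kappa> X rho \<longleftrightarrow> ReK_domain X rho (\<kappa>^2)"
    if "geodesically_connected X rho" "diam_le X rho (pi / (2 * \<kappa>))"
    using four_point_iff_ReK_domain[OF assms _ sg that(1), of 1] that(2) by simp
  have hyp: "scaled_four_point (-1) sg \<kappa> X rho \<longleftrightarrow> ReK_domain X rho (- (\<kappa>^2))"
    if "geodesically_connected X rho"
    using four_point_iff_ReK_domain[OF assms _ sg that, of "-1"] by simp
  have gc: "geodesically_connected X rho" if "ReK_domain X rho K" for K using that by (simp add: ReK_domain_def)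
  have msp: "geodesically_connected X rho" if "in_MS X rho" "diam_le X rho (pi / (2 * \<kappa>))" "scaled_four_point 1 sg \<kappa> X rho"
    using four_point_geodesically_connected[OF assms _ sg that(1) _ that(3)] that(2) by simp
  have mhy: "geodesically_connected X rho" if "in_MS X rho" "scaled_four_point (-1) sg \<kappa> X rho"
    using four_point_geodesically_connected[OF assms _ sg that(1) _ that(2)] by simp
  have cc: "cauchy_complete X rho" if "in_MS X rho" using that by (simp add: in_MS_def)
  show ?thesis
  proof (intro conjI impI)
    assume MG: "in_MG X rho"
    then have g: "geodesically_connected X rho" by (simp add: in_MG_def)
    show "global_class X rho (Ksph \<sigma> \<kappa>) \<longleftrightarrow> ReK_domain X rho (\<kappa>^2) \<and> diam_le X rho (pi / (2 * \<kappa>))"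
      unfolding global_class_Ksph[OF semi[OF disjI1[OF MG]]] sg_def[symmetric] using sph[OF g] by blast
    show "global_class X rho (Khyp \<sigma> \<kappa>) \<longleftrightarrow> ReK_domain X rho (- (\<kappa>^2))"
      unfolding global_class_Khyp[OF semi[OF disjI1[OF MG]]] sg_def[symmetric] by (rule hyp[OF g])
  next
    assume MS: "in_MS X rho"
    show "global_class X rho (Ksph \<sigma> \<kappa>) \<longleftrightarrow> ReK_domain X rho (\<kappa>^2) \<and> cauchy_complete X rho \<and> diam_le X rho (pi / (2 * \<kappa>))"
      unfolding global_class_Ksph[OF semi[OF disjI2[OF MS]]] sg_def[symmetric] using sph msp[OF MS] gc cc[OF MS] by blast
    show "global_class X rho (Khyp \<sigma> \<kappa>) \<longleftrightarrow> ReK_domain X rho (- (\<kappa>^2)) \<and> cauchy_complete X rho"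
      unfolding global_class_Khyp[OF semi[OF disjI2[OF MS]]] sg_def[symmetric] using hyp mhy[OF MS] gc cc[OF MS] by blast
  qed
qed

end
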